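(* In the setting described in the context, let $\hat u\in L^\infty(\Omega)$ be a weak solution of the balance law, with Helmholtz decomposition $\boldsymbol f(\hat u)=\nabla q+\nabla^\perp\psi$, $q\in H^1_{0,\Gamma_C}(\Omega)$, $\psi\in H^1_{0,\Gamma_I}(\Omega)$. (i) For any $v^h\in\mathcal U^h$, $$\tfrac12\|\nabla_{\mathfrak d}\cdot\boldsymbol f(v^h)-\ell_d\|_{-1,\Gamma_C}^2\le\mathcal G^h(v^h;q).$$ (ii) Assume that there are constants $C_0>0$ and $\beta_q,\beta_\psi>0$, independent of $h$, such that for every $h$ there exist $\hat q^h\in\mathcal V^h_{\Gamma_C}$ and $\hat\psi^h\in\mathcal V^h_{\Gamma_I}$ with $\|\nabla(\hat q^h-q)\|\le C_0h^{\beta_q}\|q\|_{\beta_q+1}$ and $\|\nabla(\hat\psi^h-\psi)\|\le C_0h^{\beta_\psi}\|\psi\|_{\beta_\psi+1}$. For $v^h\in\mathcal U^h$ write the Helmholtz decomposition $\boldsymbol f(v^h)=\nabla q_{v^h}+\nabla^\perp\psi_{v^h}$, $q_{v^h}\in H^1_{0,\Gamma_C}(\Omega)$, $\psi_{v^h}\in H^1_{0,\Gamma_I}(\Omega)$. Then there is a constant $C>0$, independent of $h$ and $v^h$, such that $$\mathcal G^h(v^h;q)\le2\|\nabla_{\mathfrak d}\cdot\boldsymbol f(v^h)-\ell_d\|_{-1,\Gamma_C}^2+Ch^{2\beta_q}\|q\|_{\beta_q+1}^2+\min_{\mu^h\in\mathcal V^h_{\Gamma_I}}\|\nabla(\mu^h-\psi_{v^h})\|^2,$$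 $$\mathcal G^h(v^h;q)\le2\|\nabla_{\mathfrak d}\cdot\boldsymbol f(v^h)-\ell_d\|_{-1,\Gamma_C}^2+Ch^{2\beta_q}\|q\|_{\beta_q+1}^2+Ch^{2\beta_{\psi_h}}\|\psi_{v^h}\|_{\beta_{\psi_h}+1}^2,$$ $$\mathcal G^h(v^h;q)\le2\|\boldsymbol f(v^h)-\boldsymbol f(\hat u)\|^2+Ch^{2\beta_q}\|q\|_{\beta_q+1}^2+Ch^{2\beta_\psi}\|\psi\|_{\beta_\psi+1}^2,$$ where for the second estimate one additionally considers an approximation bound for $\psi_{v^h}$, namely that there is an order $\beta_{\psi_h}>0$ (which may depend on $v^h$) and some $\mu^h\in\mathcal V^h_{\Gamma_I}$ with $\|\nabla(\mu^h-\psi_{v^h})\|\le C_0h^{\beta_{\psi_h}}\|\psi_{v^h}\|_{\beta_{\psi_h}+1}$.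
   Context: **Domain and spaces.** $\Omega\subset\mathbb R^2$ (coordinates $(t,x)$) is open, bounded, simply connected with Lipschitz boundary $\Gamma$ and unit outward normal $\boldsymbol n$. $\nabla v=[\partial_t v,\partial_x v]$, $\nabla^\perp v=[\partial_x v,-\partial_t v]$. $\|\cdot\|$ and $(\cdot,\cdot)$ are the norm and inner product in $L^2(\Omega)$ and $[L^2(\Omega)]^2$; $\|\cdot\|_s$ is the norm of the Sobolev space $H^s(\Omega)$ (a bound involving $\|w\|_s$ implicitly presumes $w\in H^s(\Omega)$). $\Gamma=\overline{\Gamma_I}\cup\overline{\Gamma_C}$, where $\Gamma_I$ (the inflow part of the boundary, regarded as given) and $\Gamma_C$ are disjoint relatively open subcurves of nonzero measure with finitely many connected components. For $\Gamma_S\subset\Gamma$, $H^1_{0,\Gamma_S}(\Omega)=\{\phi\in H^1(\Omega):\phi=0\text{ on }\Gamma_S\}$ with norm $|\phi|_1=\|\nabla\phi\|$; its dual is $H^{-1}_{\Gamma_S}(\Omega)$ with norm $\|\ell\|_{-1,\Gamma_S}=\sup_{0\ne\phi\in H^1_{0,\Gamma_S}(\Omega)}|\ell(\phi)|/|\phi|_1$. **Duality divergence.** For $\boldsymbol v\in[L^2(\Omega)]^2$, $\nabla_{\mathfrak d}\cdot\boldsymbol v\in H^{-1}_{\Gamma_C}(\Omega)$ is the functional $\phi\mapsto-(\boldsymbol v,\nabla\phi)$, $\phi\in H^1_{0,\Gamma_C}(\Omega)$. **Helmholtz decomposition.** Every $\boldsymbol v\in[L^2(\Omega)]^2$ has a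 unique $L^2$-orthogonal decomposition $\boldsymbol v=\nabla q_{\boldsymbol v}+\nabla^\perp\psi_{\boldsymbol v}$ with $q_{\boldsymbol v}\in H^1_{0,\Gamma_C}(\Omega)$ and $\psi_{\boldsymbol v}\in H^1_{0,\Gamma_I}(\Omega)$, where $(\nabla q_{\boldsymbol v},\nabla\phi)=(\boldsymbol v,\nabla\phi)$ for all $\phi\in H^1_{0,\Gamma_C}(\Omega)$ and $(\nabla^\perp\psi_{\boldsymbol v},\nabla^\perp\nu)=(\boldsymbol v,\nabla^\perp\nu)$ for all $\nu\in H^1_{0,\Gamma_I}(\Omega)$. **Balance law.** $\nabla\cdot\boldsymbol f(u)=r$ in $\Omega$, $u=g$ on $\Gamma_I$, with $r\in L^2(\Omega)$, $g\in L^\infty(\Gamma_I)$, and $\boldsymbol f=[f_1,f_2]:\mathbb R\to\mathbb R^2$ locally Lipschitz (for every compact $J\subset\mathbb R$ there is $K_{\boldsymbol f,J}>0$ with $|f_i(a)-f_i(b)|\le K_{\boldsymbol f,J}|a-b|$ for $a,b\in J$, $i=1,2$). The data functional $\ell_d\in H^{-1}_{\Gamma_C}(\Omega)$ is $\ell_d(\phi)=(r,\phi)-\langle\boldsymbol f(g)\cdot\boldsymbol n,\phi\rangle_\Gamma$, where $\langle\boldsymbol f(g)\cdot\boldsymbol n,\phi\rangle_\Gamma=\int_{\Gamma_I}\boldsymbol f(g)\cdot\boldsymbol n\,\phi\,d\sigma$. A function $\hat u\in L^\infty(\Omega)$ is a weak solution if $-(\boldsymbol f(\hat u),\nabla\phi)=\ell_d(\phi)$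 for all $\phi\in H^1_{0,\Gamma_C}(\Omega)$. **Functionals.** $h$ ranges over a sequence of positive mesh parameters tending to $0$; for each $h$, $\mathcal U^h\subset L^\infty(\Omega)$, $\mathcal V^h_{\Gamma_C}\subset H^1_{0,\Gamma_C}(\Omega)$, $\mathcal V^h_{\Gamma_I}\subset H^1_{0,\Gamma_I}(\Omega)$ are (finite-dimensional) finite element spaces. For $v\in L^\infty(\Omega)$, $p\in H^1_{0,\Gamma_C}(\Omega)$, $\mu\in H^1_{0,\Gamma_I}(\Omega)$, $$\mathcal F(v,p,\mu;q)=\|\boldsymbol f(v)-\nabla p-\nabla^\perp\mu\|^2+\|\nabla p-\nabla q\|^2,\qquad \mathcal G^h(v;q)=\min_{p^h\in\mathcal V^h_{\Gamma_C},\,\mu^h\in\mathcal V^h_{\Gamma_I}}\mathcal F(v,p^h,\mu^h;q).$$ *)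

theory Defs
  imports "HOL-Analysis.Analysis"
begin

text \<open>
  Points of the plane are pairs \<open>(t, x)\<close>. Elements of function spaces are represented by
  functions on the whole plane; their values outside the domain are irrelevant, and all
  notions below are invariant under changes on null sets.
\<close>

type_synonym pt = "real \<times> real"

definition e_t :: pt where "e_t = (1, 0)"
definition e_x :: pt where "e_x = (0, 1)"


section \<open>Lebesgue spaces\<close>

definition L2 :: "'a measure \<Rightarrow> ('a \<Rightarrow> real) set" where
  "L2 M = {u \<in> borel_measurable M. integrable M (\<lambda>p. (u p)\<^sup>2)}"

definition Linf :: "'a measure \<Rightarrow> ('a \<Rightarrow> real) set" where
  "Linf M = {u \<in> borel_measurable M. \<exists>B. AE p in M. \<bar>u p\<bar> \<le> B}"

definition l2ip :: "pt set \<Rightarrow> (pt \<Rightarrow> 'b::real_inner) \<Rightarrow> (pt \<Rightarrow> 'b) \<Rightarrow> real" where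
  "l2ip \<Omega> v w = (LINT p|lebesgue_on \<Omega>. v p \<bullet> w p)"

definition l2norm :: "pt set \<Rightarrow> (pt \<Rightarrow> 'b::real_inner) \<Rightarrow> real" where
  "l2norm \<Omega> v = sqrt (l2ip \<Omega> v v)"


section \<open>Weak derivatives and Sobolev spaces\<close>

definition pd :: "pt \<Rightarrow> (pt \<Rightarrow> real) \<Rightarrow> pt \<Rightarrow> real" where
  "pd e \<eta> p = deriv (\<lambda>\<tau>. \<eta> (p + \<tau> *\<^sub>R e)) 0"

definition smooth :: "(pt \<Rightarrow> real) \<Rightarrow> bool" where
  "smooth \<eta> \<longleftrightarrow> (\<forall>es. set es \<subseteq> {e_t, e_x} \<longrightarrow> (\<forall>p. foldr pd es \<eta> differentiable (at p)))"

definition test_functions :: "pt set \<Rightarrow> (pt \<Rightarrow> real) set" where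
  "test_functions \<Omega> =
     {\<eta>. smooth \<eta> \<and> compact (closure {p. \<eta> p \<noteq> 0}) \<and> closure {p. \<eta> p \<noteq> 0} \<subseteq> \<Omega>}"

definition locally_integrable :: "pt set \<Rightarrow> (pt \<Rightarrow> real) \<Rightarrow> bool" where
  "locally_integrable \<Omega> u \<longleftrightarrow> (\<forall>K. compact K \<and> K \<subseteq> \<Omega> \<longrightarrow> set_integrable lebesgue K u)"

definition weak_deriv :: "pt set \<Rightarrow> nat \<Rightarrow> nat \<Rightarrow> (pt \<Rightarrow> real) \<Rightarrow> (pt \<Rightarrow> real) \<Rightarrow> bool" where
  "weak_deriv \<Omega> i j u w \<longleftrightarrow>
     locally_integrable \<Omega> u \<and> locally_integrable \<Omega> w \<and>
     (\<forall>\<eta> \<in> test_functions \<Omega>.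
        l2ip \<Omega> u ((pd e_t ^^ i) ((pd e_x ^^ j) \<eta>)) = (-1) ^ (i + j) * l2ip \<Omega> w \<eta>)"

text \<open>A representative of the weak derivative, which is unique almost everywhere if it exists.\<close>

definition wD :: "pt set \<Rightarrow> nat \<Rightarrow> nat \<Rightarrow> (pt \<Rightarrow> real) \<Rightarrow> pt \<Rightarrow> real" where
  "wD \<Omega> i j u = (SOME w. weak_deriv \<Omega> i j u w)"

definition grad :: "pt set \<Rightarrow> (pt \<Rightarrow> real) \<Rightarrow> pt \<Rightarrow> pt" where
  "grad \<Omega> u p = (wD \<Omega> 1 0 u p, wD \<Omega> 0 1 u p)"

definition grad_perp :: "pt set \<Rightarrow> (pt \<Rightarrow> real) \<Rightarrow> pt \<Rightarrow> pt" where
  "grad_perp \<Omega> u p = (wD \<Omega> 0 1 u p, - wD \<Omega> 1 0 u p)"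

text \<open>
  Sobolev--Slobodeckij spaces of real order \<open>s \<ge> 0\<close>; the exponent \<open>2 + 2 * \<theta>\<close> is
  \<open>n + 2 * \<theta>\<close> in dimension \<open>n = 2\<close>.
\<close>

definition gagliardo :: "pt set \<Rightarrow> real \<Rightarrow> (pt \<Rightarrow> real) \<Rightarrow> ennreal" where
  "gagliardo \<Omega> \<theta> w =
     (\<integral>\<^sup>+ p. (\<integral>\<^sup>+ p'. ennreal ((w p - w p')\<^sup>2 / dist p p' powr (2 + 2 * \<theta>))
        \<partial>lebesgue_on \<Omega>) \<partial>lebesgue_on \<Omega>)"

definition sobolev :: "pt set \<Rightarrow> real \<Rightarrow> (pt \<Rightarrow> real) set" where
  "sobolev \<Omega> s =
     {u \<in> L2 (lebesgue_on \<Omega>).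
        (\<forall>i j. i + j \<le> nat \<lfloor>s\<rfloor> \<longrightarrow> (\<exists>w \<in> L2 (lebesgue_on \<Omega>). weak_deriv \<Omega> i j u w)) \<and>
        (frac s > 0 \<longrightarrow>
           (\<forall>i j. i + j = nat \<lfloor>s\<rfloor> \<longrightarrow> gagliardo \<Omega> (frac s) (wD \<Omega> i j u) < \<infinity>))}"

definition sobolev_norm :: "pt set \<Rightarrow> real \<Rightarrow> (pt \<Rightarrow> real) \<Rightarrow> real" where
  "sobolev_norm \<Omega> s u =
     sqrt ((\<Sum>(i, j) \<in> {(i, j). i + j \<le> nat \<lfloor>s\<rfloor>}. (l2norm \<Omega> (wD \<Omega> i j u))\<^sup>2) +
           (if frac s > 0
            then (\<Sum>(i, j) \<in> {(i, j). i + j = nat \<lfloor>s\<rfloor>}.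
                    enn2real (gagliardo \<Omega> (frac s) (wD \<Omega> i j u)))
            else 0))"


section \<open>Domain, boundary measure and outward normal\<close>

text \<open>
  Near each boundary point \<open>p\<close> the domain is, in the orthonormal frame \<open>((-b, a), (a, b))\<close> centred
  at \<open>p\<close>, the part of a rectangle below the graph of a Lipschitz function \<open>\<gamma>\<close>.
\<close>

definition lipschitz_boundary :: "pt set \<Rightarrow> bool" where
  "lipschitz_boundary \<Omega> \<longleftrightarrow>
     (\<forall>p \<in> frontier \<Omega>. \<exists>a b r d L. \<exists>\<gamma> :: real \<Rightarrow> real.
        a\<^sup>2 + b\<^sup>2 = 1 \<and> r > 0 \<and> d > 0 \<and> L-lipschitz_on {-r<..<r} \<gamma> \<and>
        (\<forall>s. \<bar>s\<bar> < r \<longrightarrow> \<bar>\<gamma> s\<bar> < d) \<and>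
        (\<forall>s \<tau>. \<bar>s\<bar> < r \<longrightarrow> \<bar>\<tau>\<bar> < d \<longrightarrow>
           (p + s *\<^sub>R (-b, a) + \<tau> *\<^sub>R (a, b) \<in> \<Omega> \<longleftrightarrow> \<tau> < \<gamma> s)))"

text \<open>Arc length is the one-dimensional Hausdorff measure.\<close>

definition hausdorff1_outer :: "pt set \<Rightarrow> ennreal" where
  "hausdorff1_outer A =
     (SUP \<delta> \<in> {0<..}. INF B \<in> {B :: nat \<Rightarrow> pt set.
          A \<subseteq> (\<Union>n. B n) \<and> (\<forall>n. bounded (B n) \<and> diameter (B n) \<le> (\<delta>::real))}.
        (\<Sum>n. ennreal (diameter (B n))))"

definition hausdorff1 :: "pt measure" where
  "hausdorff1 = measure_of UNIV (sets borel) hausdorff1_outer"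

definition surface :: "pt set \<Rightarrow> pt measure" where
  "surface S = restrict_space hausdorff1 S"

text \<open>
  \<open>\<nu>\<close> is the unit outward normal at \<open>p\<close>: up to cones of arbitrarily small aperture about the
  tangent line, \<open>\<Omega>\<close> coincides near \<open>p\<close> with the half-plane \<open>(y - p) \<bullet> \<nu> < 0\<close>. For a Lipschitz boundary
  this is the usual normal where the local graph function is differentiable, hence
  almost everywhere.
\<close>

definition is_outward_normal :: "pt set \<Rightarrow> pt \<Rightarrow> pt \<Rightarrow> bool" where
  "is_outward_normal \<Omega> p \<nu> \<longleftrightarrow>
     norm \<nu> = 1 \<and>
     (\<forall>\<epsilon>>0. \<exists>\<delta>>0. \<forall>y. dist y p < \<delta> \<longrightarrow>
        ((y - p) \<bullet> \<nu> < - \<epsilon> * dist y p \<longrightarrow> y \<in> \<Omega>) \<and>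
        ((y - p) \<bullet> \<nu> > \<epsilon> * dist y p \<longrightarrow> y \<notin> \<Omega>))"

definition outward_normal :: "pt set \<Rightarrow> pt \<Rightarrow> pt" where
  "outward_normal \<Omega> p = (THE \<nu>. is_outward_normal \<Omega> p \<nu>)"


section \<open>Traces\<close>

text \<open>
  \<open>\<gamma>\<close> is the \<open>L\<^sup>2\<close> boundary trace of \<open>\<phi>\<close>: the limit of the boundary values of smooth functions that
  converge to \<open>\<phi>\<close> in \<open>H\<^sup>1(\<Omega>)\<close>. By the trace theorem it exists and is unique almost everywhere on
  the boundary.
\<close>

definition has_trace :: "pt set \<Rightarrow> (pt \<Rightarrow> real) \<Rightarrow> (pt \<Rightarrow> real) \<Rightarrow> bool" where
  "has_trace \<Omega> \<phi> \<gamma> \<longleftrightarrow>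
     \<gamma> \<in> L2 (surface (frontier \<Omega>)) \<and>
     (\<exists>\<Phi> :: nat \<Rightarrow> pt \<Rightarrow> real.
        (\<forall>n. smooth (\<Phi> n)) \<and>
        (\<lambda>n. sobolev_norm \<Omega> 1 (\<lambda>p. \<phi> p - \<Phi> n p)) \<longlonglongrightarrow> 0 \<and>
        (\<lambda>n. \<integral>\<^sup>+ p. ennreal ((\<gamma> p - \<Phi> n p)\<^sup>2) \<partial>surface (frontier \<Omega>)) \<longlonglongrightarrow> 0)"

definition trace :: "pt set \<Rightarrow> (pt \<Rightarrow> real) \<Rightarrow> pt \<Rightarrow> real" where
  "trace \<Omega> \<phi> = (SOME \<gamma>. has_trace \<Omega> \<phi> \<gamma>)"

definition H1_0 :: "pt set \<Rightarrow> pt set \<Rightarrow> (pt \<Rightarrow> real) set" where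
  "H1_0 \<Omega> S =
     {\<phi> \<in> sobolev \<Omega> 1. \<exists>\<gamma>. has_trace \<Omega> \<phi> \<gamma> \<and> (AE p in surface S. \<gamma> p = 0)}"

definition dual_norm :: "pt set \<Rightarrow> pt set \<Rightarrow> ((pt \<Rightarrow> real) \<Rightarrow> real) \<Rightarrow> real" where
  "dual_norm \<Omega> S l =
     Sup {\<bar>l \<phi>\<bar> / l2norm \<Omega> (grad \<Omega> \<phi>) |\<phi>.
            \<phi> \<in> H1_0 \<Omega> S \<and> \<not> (AE p in lebesgue_on \<Omega>. \<phi> p = 0)}"

definition dual_div :: "pt set \<Rightarrow> (pt \<Rightarrow> pt) \<Rightarrow> (pt \<Rightarrow> real) \<Rightarrow> real" where
  "dual_div \<Omega> v \<phi> = - l2ip \<Omega> v (grad \<Omega> \<phi>)"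

text \<open>
  The two components of the decomposition are automatically \<open>L\<^sup>2\<close>-orthogonal, so orthogonality
  and the variational characterisations of \<open>q\<close> and \<open>\<psi>\<close> are not imposed separately.
\<close>

definition helmholtz ::
  "pt set \<Rightarrow> pt set \<Rightarrow> pt set \<Rightarrow> (pt \<Rightarrow> pt) \<Rightarrow> (pt \<Rightarrow> real) \<Rightarrow> (pt \<Rightarrow> real) \<Rightarrow> bool" where
  "helmholtz \<Omega> \<Gamma>I \<Gamma>C v q \<psi> \<longleftrightarrow>
     q \<in> H1_0 \<Omega> \<Gamma>C \<and> \<psi> \<in> H1_0 \<Omega> \<Gamma>I \<and>
     (AE p in lebesgue_on \<Omega>. v p = grad \<Omega> q p + grad_perp \<Omega> \<psi> p)"


section \<open>Balance law and least-squares functionals\<close>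

definition locally_lipschitz_flux :: "(real \<Rightarrow> pt) \<Rightarrow> bool" where
  "locally_lipschitz_flux f \<longleftrightarrow>
     (\<forall>J. compact J \<longrightarrow> (\<exists>K>0. \<forall>a\<in>J. \<forall>b\<in>J.
        \<bar>fst (f a) - fst (f b)\<bar> \<le> K * \<bar>a - b\<bar> \<and> \<bar>snd (f a) - snd (f b)\<bar> \<le> K * \<bar>a - b\<bar>))"

definition data_functional ::
  "pt set \<Rightarrow> pt set \<Rightarrow> (real \<Rightarrow> pt) \<Rightarrow> (pt \<Rightarrow> real) \<Rightarrow> (pt \<Rightarrow> real) \<Rightarrow> (pt \<Rightarrow> real) \<Rightarrow> real" where
  "data_functional \<Omega> \<Gamma>I f r g \<phi> =
     l2ip \<Omega> r \<phi> - (LINT p|surface \<Gamma>I. (f (g p) \<bullet> outward_normal \<Omega> p) * trace \<Omega> \<phi> p)"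

definition weak_solution ::
  "pt set \<Rightarrow> pt set \<Rightarrow> pt set \<Rightarrow> (real \<Rightarrow> pt) \<Rightarrow> (pt \<Rightarrow> real) \<Rightarrow> (pt \<Rightarrow> real) \<Rightarrow> (pt \<Rightarrow> real) \<Rightarrow> bool"
  where
  "weak_solution \<Omega> \<Gamma>I \<Gamma>C f r g u \<longleftrightarrow>
     u \<in> Linf (lebesgue_on \<Omega>) \<and>
     (\<forall>\<phi> \<in> H1_0 \<Omega> \<Gamma>C. - l2ip \<Omega> (\<lambda>p. f (u p)) (grad \<Omega> \<phi>) = data_functional \<Omega> \<Gamma>I f r g \<phi>)"

definition residual_norm ::
  "pt set \<Rightarrow> pt set \<Rightarrow> pt set \<Rightarrow> (real \<Rightarrow> pt) \<Rightarrow> (pt \<Rightarrow> real) \<Rightarrow> (pt \<Rightarrow> real) \<Rightarrow> (pt \<Rightarrow> real) \<Rightarrow> real"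
  where
  "residual_norm \<Omega> \<Gamma>I \<Gamma>C f r g v =
     dual_norm \<Omega> \<Gamma>C (\<lambda>\<phi>. dual_div \<Omega> (\<lambda>p. f (v p)) \<phi> - data_functional \<Omega> \<Gamma>I f r g \<phi>)"

text \<open>Finite-dimensional spaces of functions: linear spans of finitely many functions.\<close>

definition fin_dim_space :: "(pt \<Rightarrow> real) set \<Rightarrow> bool" where
  "fin_dim_space V \<longleftrightarrow> (\<exists>B. finite B \<and> V = {(\<lambda>p. \<Sum>b\<in>B. c b * b p) |c. True})"

definition F_functional ::
  "pt set \<Rightarrow> (real \<Rightarrow> pt) \<Rightarrow> (pt \<Rightarrow> real) \<Rightarrow> (pt \<Rightarrow> real) \<Rightarrow> (pt \<Rightarrow> real) \<Rightarrow> (pt \<Rightarrow> real) \<Rightarrow> real" where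
  "F_functional \<Omega> f v p \<mu> q =
     (l2norm \<Omega> (\<lambda>y. f (v y) - grad \<Omega> p y - grad_perp \<Omega> \<mu> y))\<^sup>2 +
     (l2norm \<Omega> (\<lambda>y. grad \<Omega> p y - grad \<Omega> q y))\<^sup>2"

text \<open>The infimum is a minimum for finite-dimensional \<open>VC\<close> and \<open>VI\<close>.\<close>

definition G_functional ::
  "pt set \<Rightarrow> (real \<Rightarrow> pt) \<Rightarrow> (pt \<Rightarrow> real) set \<Rightarrow> (pt \<Rightarrow> real) set \<Rightarrow> (pt \<Rightarrow> real) \<Rightarrow> (pt \<Rightarrow> real) \<Rightarrow> real"
  where
  "G_functional \<Omega> f VC VI v q = (INF (p, \<mu>) \<in> VC \<times> VI. F_functional \<Omega> f v p \<mu> q)"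

end

theory Submission
  imports Defs "HOL-Computational_Algebra.Polynomial"
begin

text \<open>
  The estimates are Hilbert space geometry once gradients of functions in \<open>H1_0 \<Omega> \<Gamma>C\<close> are known to be
  orthogonal to rotated gradients of functions in \<open>H1_0 \<Omega> \<Gamma>I\<close>: the residual functional is
  \<open>\<phi> \<mapsto> - (f(v) - \<nabla>q, \<nabla>\<phi>)\<close>, its dual norm is the norm of the gradient part of \<open>f(v) - \<nabla>q\<close>, and
  everything follows from Cauchy-Schwarz, Pythagoras and \<open>(x + y)\<^sup>2 \<le> 2 x\<^sup>2 + 2 y\<^sup>2\<close>.

  For the orthogonality consider \<open>\<zeta> \<mapsto> \<integral> d(\<zeta> \<phi>) \<and> d\<mu>\<close> for smooth \<open>\<zeta>\<close>; it suffices that it vanishes locally.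
  In a Lipschitz chart the integral of a derivative of a smooth function is bounded by the
  integral of its absolute value over the boundary graph, and approximation by smooth functions,
  first of \<open>\<phi>\<close> and then of \<open>\<mu>\<close>, gives the claim where \<open>\<phi>\<close> has zero trace. Where \<open>\<mu>\<close> has zero trace,
  exchange the roles of \<open>\<phi>\<close> and \<open>\<mu>\<close>: the form is antisymmetric because \<open>\<phi> \<mu>\<close> vanishes on the boundary.
  At a point where the boundary condition changes, one of the two functions vanishes on one side, so it
  satisfies a Poincare inequality on small boxes about the point, and these contribute nothing in the limit.
\<close>

section \<open>Smooth functions and cutoffs\<close>

text \<open>The obstacle is the trace. Membership in \<open>H1_0 \<Omega> S\<close> only provides
  smooth functions that converge in the Sobolev norm and whose boundary values are small in the mean
  on \<open>S\<close>; they need not vanish there. Every boundary argument is therefore an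
  inequality for smooth functions that survives the limit. The derivatives of the approximants of
  \<open>\<mu>\<close> are not controlled on the boundary, so the limit in \<open>\<phi>\<close> is
  taken first, with the approximant of \<open>\<mu>\<close> held fixed.

  The weight \<open>\<zeta>\<close> is part of the form so that the form is linear in it: vanishing
  near each point of the closed domain then adds up over a finite cover, and
  \<open>\<zeta> = 1\<close> returns the inner product of the two gradient fields.

  Arc length enters through a single inequality, \<open>nn_integral_graph_le\<close>. As
  \<open>hausdorff1\<close> is built by \<open>measure_of\<close>, it is the zero measure unless
  \<open>hausdorff1_outer\<close> is a measure on the Borel sets; the nonzero measure of
  \<open>\<Gamma>C\<close> secures that it is one, and it is passed along as the fact
  \<open>nt\<close>.\<close>

lemma smooth_coinduct:
  assumes "\<eta> \<in> X" and "\<And>\<eta> p. \<eta> \<in> X \<Longrightarrow> \<eta> differentiable (at p)"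
    and "\<And>\<eta> e. \<eta> \<in> X \<Longrightarrow> e \<in> {e_t, e_x} \<Longrightarrow> pd e \<eta> \<in> X"
  shows "smooth \<eta>"
proof -
  have "foldr pd es \<eta> \<in> X" if "set es \<subseteq> {e_t, e_x}" for es
    using that by (induction es) (use assms(1,3) in auto)
  then show ?thesis unfolding smooth_def using assms(2) by blast
qed

lemma smooth_pd: "smooth \<eta> \<Longrightarrow> e \<in> {e_t, e_x} \<Longrightarrow> smooth (pd e \<eta>)"
  unfolding smooth_def
proof (intro allI impI)
  fix es p assume "\<forall>es. set es \<subseteq> {e_t, e_x} \<longrightarrow> (\<forall>p. foldr pd es \<eta> differentiable at p)"
    "e \<in> {e_t, e_x}" "set es \<subseteq> {e_t, e_x}"
  then have "foldr pd (es @ [e]) \<eta> differentiable at p" by (metis Un_subset_iff empty_subsetI insert_subset list.set(1) list.simps(15) set_append)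
  then show "foldr pd es (pd e \<eta>) differentiable at p" by simp
qed

lemma smooth_pd_t: "smooth \<eta> \<Longrightarrow> smooth (pd e_t \<eta>)"
  and smooth_pd_x: "smooth \<eta> \<Longrightarrow> smooth (pd e_x \<eta>)"
  by (simp_all add: smooth_pd)

lemma smooth_differentiable: "smooth \<eta> \<Longrightarrow> \<eta> differentiable (at p)"
  unfolding smooth_def by (metis empty_subsetI foldr.simps(1) id_apply list.set(1))

lemma smooth_isCont: "smooth \<eta> \<Longrightarrow> isCont \<eta> p"
  using smooth_differentiable differentiable_imp_continuous_within by blast

lemma smooth_continuous: "smooth \<eta> \<Longrightarrow> continuous_on S \<eta>"
  using smooth_isCont continuous_at_imp_continuous_on by blast

lemma smooth_measurable: "smooth \<eta> \<Longrightarrow> \<eta> \<in> borel_measurable borel"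
  using smooth_continuous borel_measurable_continuous_onI by blast

lemma pd_eqI:
  assumes "(f has_derivative D) (at p)"
  shows "pd e f p = D e"
proof -
  have D: "bounded_linear D" using assms has_derivative_bounded_linear by blast
  have "((\<lambda>\<tau>::real. p + \<tau> *\<^sub>R e) has_derivative (\<lambda>\<tau>. \<tau> *\<^sub>R e)) (at 0)"
    by (auto intro!: derivative_eq_intros)
  moreover have "(f has_derivative D) (at (p + (0::real) *\<^sub>R e))" using assms by simp
  ultimately have "((\<lambda>\<tau>. f (p + \<tau> *\<^sub>R e)) has_derivative (\<lambda>\<tau>. D (\<tau> *\<^sub>R e))) (at 0)"
    using has_derivative_compose by blast
  moreover have "(\<lambda>\<tau>. D (\<tau> *\<^sub>R e)) = (*) (D e)"
    using D by (auto simp: linear_simps(5) fun_eq_iff mult.commute)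
  ultimately have "DERIV (\<lambda>\<tau>. f (p + \<tau> *\<^sub>R e)) 0 :> D e"
    by (simp add: has_field_derivative_def)
  then show ?thesis unfolding pd_def by (rule DERIV_imp_deriv)
qed

lemma has_derivative_pd:
  assumes "f differentiable (at p)"
  shows "(f has_derivative (\<lambda>v. fst v * pd e_t f p + snd v * pd e_x f p)) (at p)"
proof -
  obtain D where D: "(f has_derivative D) (at p)" using assms unfolding differentiable_def by auto
  have bl: "bounded_linear D" using D has_derivative_bounded_linear by blast
  have "D v = fst v * pd e_t f p + snd v * pd e_x f p" for v
  proof -
    have "v = fst v *\<^sub>R e_t + snd v *\<^sub>R e_x" by (cases v) (simp add: e_t_def e_x_def)
    then have "D v = fst v *\<^sub>R D e_t + snd v *\<^sub>R D e_x" using bl by (metis linear_simps(1,5))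
    then show ?thesis using pd_eqI[OF D] by simp
  qed
  then have "D = (\<lambda>v. fst v * pd e_t f p + snd v * pd e_x f p)" by auto
  then show ?thesis using D by simp
qed

lemmas smooth_has_derivative = has_derivative_pd[OF smooth_differentiable]

lemma pd_add:
  assumes "f differentiable (at p)" "g differentiable (at p)"
  shows "pd e (\<lambda>p. f p + g p) p = pd e f p + pd e g p"
proof -
  obtain D E where "(f has_derivative D) (at p)" "(g has_derivative E) (at p)"
    using assms unfolding differentiable_def by auto
  then show ?thesis using pd_eqI[OF has_derivative_add] pd_eqI by metis
qed

lemma pd_mult:
  assumes "f differentiable (at p)" "g differentiable (at p)"
  shows "pd e (\<lambda>p. f p * g p) p = f p * pd e g p + pd e f p * g p"
proof -
  obtain D E where "(f has_derivative D) (at p)" "(g has_derivative E) (at p)"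
    using assms unfolding differentiable_def by auto
  then show ?thesis using pd_eqI[OF has_derivative_mult] pd_eqI by metis
qed

text \<open>The product rule turns a product into a sum of products, so products alone are not
  stable under \<open>pd\<close>. The closure under both operations is the invariant class that
  \<open>smooth_coinduct\<close> asks for.\<close>

inductive_set smooth_alg :: "(pt \<Rightarrow> real) set" where
  "smooth f \<Longrightarrow> f \<in> smooth_alg"
| "f \<in> smooth_alg \<Longrightarrow> g \<in> smooth_alg \<Longrightarrow> (\<lambda>p. f p + g p) \<in> smooth_alg"
| "f \<in> smooth_alg \<Longrightarrow> g \<in> smooth_alg \<Longrightarrow> (\<lambda>p. f p * g p) \<in> smooth_alg"

lemma smooth_alg_differentiable: "f \<in> smooth_alg \<Longrightarrow> f differentiable (at p)"
  by (induction rule: smooth_alg.induct) (auto simp: smooth_differentiable)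

lemma smooth_alg_smooth: "f \<in> smooth_alg \<Longrightarrow> smooth f"
proof (rule smooth_coinduct[where X = smooth_alg])
  fix f e assume "f \<in> smooth_alg" and e: "e \<in> {e_t, e_x}"
  then show "pd e f \<in> smooth_alg"
  proof (induction rule: smooth_alg.induct)
    case (2 f g)
    have "pd e (\<lambda>p. f p + g p) = (\<lambda>p. pd e f p + pd e g p)"
      using 2 by (auto simp: pd_add smooth_alg_differentiable)
    then show ?case using 2 by (simp add: smooth_alg.intros)
  next
    case (3 f g)
    have "pd e (\<lambda>p. f p * g p) = (\<lambda>p. f p * pd e g p + pd e f p * g p)"
      using 3 by (auto simp: pd_mult smooth_alg_differentiable)
    then show ?case using 3 by (simp add: smooth_alg.intros)
  qed (use smooth_pd smooth_alg.intros(1) in blast)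
qed (auto simp: smooth_alg_differentiable)

lemma smooth_add: "smooth f \<Longrightarrow> smooth g \<Longrightarrow> smooth (\<lambda>p. f p + g p)"
  and smooth_mult: "smooth f \<Longrightarrow> smooth g \<Longrightarrow> smooth (\<lambda>p. f p * g p)"
  by (simp_all add: smooth_alg_smooth smooth_alg.intros)

lemma smooth_const: "smooth (\<lambda>p. c)"
proof (rule smooth_coinduct[where X = "{\<eta>. \<exists>c. \<eta> = (\<lambda>p. c)}"])
  have *: "pd e (\<lambda>p. c) = (\<lambda>p. 0)" for e c by (simp add: pd_def fun_eq_iff)
  show "pd e \<eta> \<in> {\<eta>. \<exists>c. \<eta> = (\<lambda>p. c)}" if "\<eta> \<in> {\<eta>. \<exists>c. \<eta> = (\<lambda>p. c)}" for \<eta> e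
    using that * by blast
qed auto

lemma smooth_cmult: "smooth f \<Longrightarrow> smooth (\<lambda>p. c * f p)"
  using smooth_mult[OF smooth_const] by blast

lemma smooth_minus: "smooth f \<Longrightarrow> smooth (\<lambda>p. - f p)"
  using smooth_cmult[of f "-1"] by simp

lemma smooth_diff: "smooth f \<Longrightarrow> smooth g \<Longrightarrow> smooth (\<lambda>p. f p - g p)"
  using smooth_add[OF _ smooth_minus] by simp

lemmas smooth_intros = smooth_const smooth_add smooth_mult smooth_cmult smooth_minus smooth_diff
  smooth_pd_t smooth_pd_x

lemma pd_const: "pd e (\<lambda>p. c) p = 0"
  by (simp add: pd_def)

lemma smooth_pd_add: "smooth f \<Longrightarrow> smooth g \<Longrightarrow> pd e (\<lambda>p. f p + g p) p = pd e f p + pd e g p"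
  by (simp add: pd_add smooth_differentiable)

lemma smooth_pd_mult: "smooth f \<Longrightarrow> smooth g \<Longrightarrow>
    pd e (\<lambda>p. f p * g p) p = f p * pd e g p + pd e f p * g p"
  by (simp add: pd_mult smooth_differentiable)

lemma smooth_pd_cmult: "smooth f \<Longrightarrow> pd e (\<lambda>p. c * f p) p = c * pd e f p"
  by (simp add: smooth_pd_mult[OF smooth_const] pd_const)

lemma smooth_pd_minus: "smooth f \<Longrightarrow> pd e (\<lambda>p. - f p) p = - pd e f p"
  using smooth_pd_cmult[of f e "-1"] by simp

lemma smooth_pd_diff: "smooth f \<Longrightarrow> smooth g \<Longrightarrow> pd e (\<lambda>p. f p - g p) p = pd e f p - pd e g p"
  using smooth_pd_add[OF _ smooth_minus, of f g e] by (simp add: smooth_pd_minus)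

section \<open>Smooth functions of one variable, a smooth step, and its composition with affine
  maps\<close>

definition smooth1 :: "(real \<Rightarrow> real) \<Rightarrow> bool" where
  "smooth1 \<beta> \<longleftrightarrow> (\<forall>n x. (deriv ^^ n) \<beta> field_differentiable (at x))"

lemma smooth1_coinduct:
  assumes "\<beta> \<in> X" and "\<And>\<beta> x. \<beta> \<in> X \<Longrightarrow> \<exists>\<beta>'\<in>X. \<forall>x. DERIV \<beta> x :> \<beta>' x"
  shows "smooth1 \<beta>"
proof -
  have *: "deriv \<beta> \<in> X \<and> (\<forall>x. \<beta> field_differentiable (at x))" if "\<beta> \<in> X" for \<beta>
  proof -
    obtain \<beta>' where b: "\<beta>' \<in> X" "\<And>x. DERIV \<beta> x :> \<beta>' x" using assms(2)[OF \<open>\<beta> \<in> X\<close>] by blast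
    then have "deriv \<beta> = \<beta>'" using DERIV_imp_deriv by blast
    then show ?thesis using b field_differentiable_def by blast
  qed
  have "(deriv ^^ n) \<beta> \<in> X" for n by (induction n) (use assms(1) * in auto)
  then show ?thesis unfolding smooth1_def using * by blast
qed

lemma smooth1_deriv: "smooth1 \<beta> \<Longrightarrow> smooth1 (deriv \<beta>)"
  unfolding smooth1_def by (metis comp_apply funpow_Suc_right)

lemma smooth1_DERIV: "smooth1 \<beta> \<Longrightarrow> DERIV \<beta> x :> deriv \<beta> x"
  unfolding smooth1_def using field_differentiable_derivI by (metis funpow_0)

lemma smooth1_isCont: "smooth1 \<beta> \<Longrightarrow> isCont \<beta> x"
  using smooth1_DERIV DERIV_isCont by blast

lemma smooth1_DERIV_I: "smooth1 \<beta>' \<Longrightarrow> (\<And>x. DERIV \<beta> x :> \<beta>' x) \<Longrightarrow> smooth1 \<beta>"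
  by (rule smooth1_coinduct[where X = "insert \<beta> (Collect smooth1)"])
     (use smooth1_DERIV smooth1_deriv in blast)+

lemma smooth1_affine:
  assumes "smooth1 \<beta>" shows "smooth (\<lambda>p. \<beta> (p \<bullet> w + c))"
    and "pd e (\<lambda>p. \<beta> (p \<bullet> w + c)) p = (e \<bullet> w) * deriv \<beta> (p \<bullet> w + c)"
proof -
  have d: "((\<lambda>p. k * \<beta> (p \<bullet> w + c)) has_derivative (\<lambda>v. k * ((v \<bullet> w) * deriv \<beta> (p \<bullet> w + c)))) (at p)"
    if "smooth1 \<beta>" for \<beta> k p
  proof -
    have "((\<lambda>p. p \<bullet> w + c) has_derivative (\<lambda>v. v \<bullet> w)) (at p)"
      by (auto intro!: derivative_eq_intros)
    moreover have "(\<beta> has_derivative (\<lambda>v. deriv \<beta> (p \<bullet> w + c) * v)) (at (p \<bullet> w + c))"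
      using smooth1_DERIV[OF that] by (simp add: has_field_derivative_def)
    ultimately have "((\<lambda>p. \<beta> (p \<bullet> w + c)) has_derivative (\<lambda>v. deriv \<beta> (p \<bullet> w + c) * (v \<bullet> w))) (at p)"
      using has_derivative_compose by blast
    then show ?thesis by (auto intro!: derivative_eq_intros simp: algebra_simps)
  qed
  show "smooth (\<lambda>p. \<beta> (p \<bullet> w + c))"
  \<comment> \<open>The factor \<open>k\<close> absorbs the inner product
    \<open>e \<bullet> w\<close> that each differentiation produces.\<close>
  proof (rule smooth_coinduct[where X = "{\<lambda>p. k * \<beta> (p \<bullet> w + c) |k \<beta>. smooth1 \<beta>}"])
    show "(\<lambda>p. \<beta> (p \<bullet> w + c)) \<in> {\<lambda>p. k * \<beta> (p \<bullet> w + c) |k \<beta>. smooth1 \<beta>}"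
      using assms by (auto intro!: exI[of _ 1] exI[of _ \<beta>])
    fix \<eta> p e assume "\<eta> \<in> {\<lambda>p. k * \<beta> (p \<bullet> w + c) |k \<beta>. smooth1 \<beta>}"
    then obtain k \<beta> where \<eta>: "\<eta> = (\<lambda>p. k * \<beta> (p \<bullet> w + c))" and b: "smooth1 \<beta>" by auto
    show "\<eta> differentiable at p" unfolding \<eta> using d[OF b] differentiable_def by blast
    have "pd e \<eta> = (\<lambda>p. (k * (e \<bullet> w)) * deriv \<beta> (p \<bullet> w + c))"
      unfolding \<eta> using pd_eqI[OF d[OF b]] by (auto simp: fun_eq_iff)
    then show "pd e \<eta> \<in> {\<lambda>p. k * \<beta> (p \<bullet> w + c) |k \<beta>. smooth1 \<beta>}"
      using smooth1_deriv[OF b] by blast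
  qed
  show "pd e (\<lambda>p. \<beta> (p \<bullet> w + c)) p = (e \<bullet> w) * deriv \<beta> (p \<bullet> w + c)"
    using pd_eqI[OF d[OF assms, of 1]] by simp
qed

inductive_set smooth1_alg :: "(real \<Rightarrow> real) set" where
  "smooth1 f \<Longrightarrow> f \<in> smooth1_alg"
| "f \<in> smooth1_alg \<Longrightarrow> g \<in> smooth1_alg \<Longrightarrow> (\<lambda>p. f p + g p) \<in> smooth1_alg"
| "f \<in> smooth1_alg \<Longrightarrow> g \<in> smooth1_alg \<Longrightarrow> (\<lambda>p. f p * g p) \<in> smooth1_alg"

lemma smooth1_mult: 
  assumes "smooth1 f" "smooth1 g" shows "smooth1 (\<lambda>p. f p * g p)"
proof (rule smooth1_coinduct[where X = smooth1_alg])
  show "(\<lambda>p. f p * g p) \<in> smooth1_alg" using assms by (simp add: smooth1_alg.intros)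
  fix f assume "f \<in> smooth1_alg"
  then show "\<exists>f'\<in>smooth1_alg. \<forall>x. DERIV f x :> f' x"
  proof (induction rule: smooth1_alg.induct)
    case (1 f)
    then show ?case using smooth1_DERIV smooth1_deriv smooth1_alg.intros(1) by blast
  next
    case (2 f g)
    then obtain f' g' where "f' \<in> smooth1_alg" "g' \<in> smooth1_alg" "\<And>x. DERIV f x :> f' x" "\<And>x. DERIV g x :> g' x"
      by blast
    then show ?case by (intro bexI[of _ "\<lambda>x. f' x + g' x"]) (auto intro: smooth1_alg.intros derivative_intros)
  next
    case (3 f g)
    then obtain f' g' where fg: "f' \<in> smooth1_alg" "g' \<in> smooth1_alg" "\<And>x. DERIV f x :> f' x" "\<And>x. DERIV g x :> g' x"
      by blast
    show ?case
      by (rule bexI[of _ "\<lambda>x. f' x * g x + g' x * f x"])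
         (use 3 fg in \<open>auto intro: smooth1_alg.intros DERIV_mult\<close>)
  qed
qed

text \<open>Allowing every polynomial in \<open>1 / x\<close> in front of the classical
  \<open>exp (- 1 / x)\<close> makes the family stable under differentiation: in the variable
  \<open>y = 1 / x\<close> the derivative replaces \<open>P\<close> by
  \<open>y^2 (P - P')\<close>.\<close>

definition exp_cutoff :: "real poly \<Rightarrow> real \<Rightarrow> real" where
  "exp_cutoff P x = (if x > 0 then poly P (1 / x) * exp (- (1 / x)) else 0)"

lemma poly_exp_tendsto_0: "((\<lambda>y::real. poly P y * exp (- y)) \<longlongrightarrow> 0) at_top"
proof -
  have "((\<lambda>y. \<Sum>i\<le>degree P. coeff P i * (y ^ i / exp y)) \<longlongrightarrow> (\<Sum>i\<le>degree P. coeff P i * 0)) at_top"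
    by (intro tendsto_intros tendsto_power_div_exp_0)
  moreover have "(\<lambda>y. \<Sum>i\<le>degree P. coeff P i * (y ^ i / exp y)) = (\<lambda>y. poly P y * exp (- y))"
    by (simp add: poly_altdef exp_minus divide_inverse sum_distrib_right mult.assoc)
  ultimately show ?thesis by simp
qed

lemma exp_cutoff_DERIV:
  "DERIV (exp_cutoff P) x :> exp_cutoff ([:0, 0, 1:] * (P - pderiv P)) x"
proof (cases "x = 0")
  case False
  show ?thesis
  proof (cases "x > 0")
    case True
    have "DERIV (\<lambda>x. poly P (1 / x) * exp (- (1 / x))) x :> exp_cutoff ([:0, 0, 1:] * (P - pderiv P)) x"
      using True unfolding exp_cutoff_def
      by (auto intro!: derivative_eq_intros DERIV_chain2[OF poly_DERIV] simp: field_simps power2_eq_square)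
    then show ?thesis
      by (rule has_field_derivative_transform_within_open[where S = "{0<..}"]) (use True in \<open>auto simp: exp_cutoff_def\<close>)
  next
    case F: False
    have "DERIV (\<lambda>x. 0::real) x :> 0" by simp
    then have "DERIV (exp_cutoff P) x :> 0"
      by (rule has_field_derivative_transform_within_open[where S = "{..<0}"]) (use F False in \<open>auto simp: exp_cutoff_def\<close>)
    then show ?thesis using F by (simp add: exp_cutoff_def)
  qed
next
  case True
  have R: "((\<lambda>y. exp_cutoff P y / y) \<longlongrightarrow> 0) (at_right 0)"
  proof -
    \<comment> \<open>At the gluing point the right difference quotient is again of the same type:
      dividing by \<open>y\<close> multiplies by \<open>inverse y\<close>, which replaces
      \<open>P\<close> by \<open>pCons 0 P\<close>.\<close>
    have "((\<lambda>y. poly (pCons 0 P) (inverse y) * exp (- inverse y)) \<longlongrightarrow> 0) (at_right 0)"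
      using filterlim_compose[OF poly_exp_tendsto_0 filterlim_inverse_at_top_right] by blast
    then show ?thesis
      by (rule Lim_transform_eventually)
        (auto simp: exp_cutoff_def eventually_at_filter field_simps)
  qed
  have "((\<lambda>y. exp_cutoff P y / y) \<longlongrightarrow> 0) (at_left 0)"
    by (rule Lim_transform_eventually[OF tendsto_const]) (auto simp: exp_cutoff_def eventually_at_filter)
  with R have "((\<lambda>y. exp_cutoff P y / y) \<longlongrightarrow> 0) (at 0)"
    using filterlim_split_at by blast
  then show ?thesis using True by (simp add: DERIV_def exp_cutoff_def)
qed

lemma smooth1_exp_cutoff: "smooth1 (exp_cutoff P)"
  by (rule smooth1_coinduct[where X = "range exp_cutoff"]) (use exp_cutoff_DERIV in blast)+

lemma smooth1_comp_affine:
  assumes "smooth1 \<beta>" shows "smooth1 (\<lambda>x. \<beta> (k * x + c))"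
proof (rule smooth1_coinduct[where X = "{\<lambda>x. l * \<beta> (k * x + c) |l \<beta>. smooth1 \<beta>}"])
  show "(\<lambda>x. \<beta> (k * x + c)) \<in> {\<lambda>x. l * \<beta> (k * x + c) |l \<beta>. smooth1 \<beta>}"
    using assms by (auto intro!: exI[of _ 1] exI[of _ \<beta>])
  fix f assume "f \<in> {\<lambda>x. l * \<beta> (k * x + c) |l \<beta>. smooth1 \<beta>}"
  then obtain l \<beta> where f: "f = (\<lambda>x. l * \<beta> (k * x + c))" and b: "smooth1 \<beta>" by auto
  show "\<exists>f'\<in>{\<lambda>x. l * \<beta> (k * x + c) |l \<beta>. smooth1 \<beta>}. \<forall>x. DERIV f x :> f' x"
    by (rule bexI[of _ "\<lambda>x. (l * k) * deriv \<beta> (k * x + c)"])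
       (auto simp: f intro!: derivative_eq_intros DERIV_chain2[OF smooth1_DERIV[OF b]] exI[of _ "l * k"] exI[of _ "deriv \<beta>"] smooth1_deriv b)
qed

text \<open>The step is the primitive of a bump \<open>g\<close>, positive exactly between 1 and 2,
  divided by its total mass. Smoothness is inherited from \<open>g\<close> by
  \<open>smooth1_DERIV_I\<close>, the bound on the derivative from compactness of the
  interval.\<close>

lemma smooth_step_exists:
  obtains \<theta> :: "real \<Rightarrow> real" and B where "smooth1 \<theta>" "\<And>x. x \<le> 1 \<Longrightarrow> \<theta> x = 0" "\<And>x. x \<ge> 2 \<Longrightarrow> \<theta> x = 1"
    "\<And>x. 0 \<le> \<theta> x" "\<And>x. \<theta> x \<le> 1" "\<And>x. \<bar>deriv \<theta> x\<bar> \<le> B"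
proof -
  define g where "g = (\<lambda>x. exp_cutoff 1 (1 * x + (-1)) * exp_cutoff 1 ((-1) * x + 2))"
  have g: "smooth1 g" unfolding g_def by (intro smooth1_mult smooth1_comp_affine smooth1_exp_cutoff)
  have gc: "continuous_on S g" for S using smooth1_isCont[OF g] continuous_at_imp_continuous_on by blast
  have g0: "g x = 0" if "x \<le> 1 \<or> x \<ge> 2" for x using that by (auto simp: g_def exp_cutoff_def)
  have gpos: "g x > 0" if "1 < x" "x < 2" for x using that by (auto simp: g_def exp_cutoff_def)
  have gnn: "g x \<ge> 0" for x using g0[of x] gpos[of x] by linarith
  \<comment> \<open>The two branches match because \<open>g\<close> vanishes below 1, so that
    \<open>G\<close> is 0 on a whole neighbourhood of the origin.\<close>
  define G where "G = (\<lambda>x. if x < 0 then 0 else integral {0..x} g)"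
  have GD: "DERIV G x :> g x" for x
  proof (cases "x < 1")
    case True
    have z: "G y = 0" if "y < 1" for y
    proof (cases "y < 0")
      case False
      have "integral {0..y} g = integral {0..y} (\<lambda>x. 0)" by (rule integral_cong) (use that g0 in auto)
      then show ?thesis by (simp add: G_def)
    qed (simp add: G_def)
    have "DERIV (\<lambda>x. 0::real) x :> g x" using True g0 by simp
    then show ?thesis by (rule has_field_derivative_transform_within_open[where S = "{..<1}"]) (use True z in auto)
  next
    case False
    have "((\<lambda>y. integral {0..y} g) has_real_derivative g x) (at x within {0..x+1})"
      using integral_has_real_derivative[OF gc, of x 0 "x+1"] False by auto
    then have "((\<lambda>y. integral {0..y} g) has_real_derivative g x) (at x)"
      using at_within_Icc_at[of 0 x "x+1"] False by auto
    then show ?thesis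
      by (rule has_field_derivative_transform_within_open[where S = "{0<..}"]) (use False in \<open>auto simp: G_def\<close>)
  qed
  have mono: "G x \<le> G y" if "x \<le> y" for x y using DERIV_nonneg_imp_nondecreasing[OF that] GD gnn by blast
  have "G 1 < G 2"
    by (rule DERIV_pos_imp_increasing_open) (use GD gpos in \<open>auto intro: DERIV_isCont continuous_at_imp_continuous_on\<close>)
  have GD0: "DERIV G x :> 0" if "x \<le> 1 \<or> x \<ge> 2" for x using GD[of x] g0[OF that] by simp
  have GC: "continuous_on S G" for S using GD DERIV_isCont continuous_at_imp_continuous_on by blast
  have one: "G x = G 1" if "x \<le> 1" for x
  proof (cases "x = 1")
    case False
    show ?thesis
      by (rule DERIV_isconst_end[symmetric, OF _ GC]) (use that False GD0 in auto)
  qed simp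
  have two: "G x = G 2" if "x \<ge> 2" for x
  proof (cases "x = 2")
    case False
    show ?thesis
      by (rule DERIV_isconst_end[OF _ GC]) (use that False GD0 in auto)
  qed simp
  have G1: "G 1 = 0" using one[of "-1"] by (simp add: G_def)
  then have G2: "G 2 > 0" using \<open>G 1 < G 2\<close> by simp
  define \<theta> where "\<theta> = (\<lambda>x. G x / G 2)"
  have TD: "DERIV \<theta> x :> g x * (1 / G 2)" for x unfolding \<theta>_def using GD G2 by (auto intro!: derivative_eq_intros)
  have c1: "smooth1 (\<lambda>x. c)" for c
    by (rule smooth1_coinduct[where X = "{\<beta>. \<exists>c. \<beta> = (\<lambda>x. c)}"]) (blast, force intro: DERIV_const)
  have sm: "smooth1 \<theta>" by (rule smooth1_DERIV_I[OF _ TD]) (rule smooth1_mult[OF g c1])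
  have "bounded (g ` {1..2})" using gc compact_continuous_image compact_imp_bounded by blast
  then obtain B where B: "\<And>x. x \<in> {1..2} \<Longrightarrow> \<bar>g x\<bar> \<le> B" unfolding bounded_iff by (metis image_eqI real_norm_def)
  have Bb: "\<bar>g x\<bar> \<le> max B 0" for x using B[of x] g0[of x] by (cases "x \<in> {1..2}") auto
  have "\<bar>deriv \<theta> x\<bar> \<le> max B 0 * (1 / G 2)" for x
    unfolding DERIV_imp_deriv[OF TD] abs_mult using Bb[of x] G2 by (intro mult_mono) auto
  moreover have "0 \<le> \<theta> x" "\<theta> x \<le> 1" for x
    using mono[of "min x 1" x] mono[of x "max x 2"] one[of "min x 1"] two[of "max x 2"] G1 G2
    by (auto simp: \<theta>_def)
  moreover have "\<theta> x = 0" if "x \<le> 1" for x using one[OF that] G1 by (simp add: \<theta>_def)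
  moreover have "\<theta> x = 1" if "x \<ge> 2" for x using two[OF that] G2 by (simp add: \<theta>_def)
  ultimately show ?thesis using that[OF sm] by blast
qed

section \<open>The fundamental lemma of the calculus of variations\<close>

text \<open>One step is chosen once and for all, so that a single bound on its derivative gives
  gradients of order \<open>1 / \<epsilon>\<close> for all cutoffs of width
  \<open>\<epsilon>\<close>.\<close>

definition step :: "real \<Rightarrow> real" where
  "step = (SOME \<theta>. smooth1 \<theta> \<and> (\<forall>x\<le>1. \<theta> x = 0) \<and> (\<forall>x\<ge>2. \<theta> x = 1) \<and> (\<forall>x. 0 \<le> \<theta> x \<and> \<theta> x \<le> 1)
     \<and> (\<exists>B. \<forall>x. \<bar>deriv \<theta> x\<bar> \<le> B))"

lemma step_props: "smooth1 step \<and> (\<forall>x\<le>1. step x = 0) \<and> (\<forall>x\<ge>2. step x = 1) \<and> (\<forall>x. 0 \<le> step x \<and> step x \<le> 1)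
     \<and> (\<exists>B. \<forall>x. \<bar>deriv step x\<bar> \<le> B)"
proof -
  obtain \<theta> :: "real \<Rightarrow> real" and B where *: "smooth1 \<theta>" "\<And>x. x \<le> 1 \<Longrightarrow> \<theta> x = 0" "\<And>x. x \<ge> 2 \<Longrightarrow> \<theta> x = 1"
    "\<And>x. 0 \<le> \<theta> x" "\<And>x. \<theta> x \<le> 1" "\<And>x. \<bar>deriv \<theta> x\<bar> \<le> B"
    using smooth_step_exists by blast
  show ?thesis unfolding step_def by (rule someI[of _ \<theta>]) (use * in blast)
qed

lemma smooth1_step: "smooth1 step" and step_eq_0: "x \<le> 1 \<Longrightarrow> step x = 0" and step_eq_1: "x \<ge> 2 \<Longrightarrow> step x = 1"
  and step_nonneg: "0 \<le> step x" and step_le_1: "step x \<le> 1"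
  using step_props by auto

lemma step_deriv_bound: obtains B where "B > 0" "\<And>x. \<bar>deriv step x\<bar> \<le> B"
proof -
  obtain B where "\<And>x. \<bar>deriv step x\<bar> \<le> B" using step_props by blast
  then have "\<And>x. \<bar>deriv step x\<bar> \<le> max B 1" by (meson max.coboundedI1)
  then show ?thesis using that[of "max B 1"] by simp
qed

text \<open>A plateau around a line. It is a product of two one-sided steps so that the complement
  can be split by sides: with the steps \<open>sR\<close> and \<open>sL\<close>, the constant 1
  equals \<open>sR + (1 - sR) * sL + band\<close>.\<close>

definition band :: "pt \<Rightarrow> real \<Rightarrow> pt \<Rightarrow> real" where
  "band w c y = (1 - step (y \<bullet> w + c)) * (1 - step (y \<bullet> (- w) + (- c)))"

lemma smooth_band: "smooth (band w c)"
  unfolding band_def[abs_def] by (intro smooth_intros smooth1_affine(1)[OF smooth1_step])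

lemma band_eq_1: "\<bar>y \<bullet> w + c\<bar> \<le> 1 \<Longrightarrow> band w c y = 1"
  by (simp add: band_def step_eq_0)

lemma band_eq_0: "\<bar>y \<bullet> w + c\<bar> \<ge> 2 \<Longrightarrow> band w c y = 0"
proof -
  assume "\<bar>y \<bullet> w + c\<bar> \<ge> 2"
  then have "y \<bullet> w + c \<ge> 2 \<or> y \<bullet> (- w) + (- c) \<ge> 2" by (auto simp: abs_le_iff abs_if split: if_splits)
  then show ?thesis using step_eq_1 by (auto simp: band_def)
qed

lemma band_abs_le: "\<bar>band w c y\<bar> \<le> 1"
  unfolding band_def abs_mult using step_nonneg step_le_1 by (intro mult_le_one) (auto simp: abs_le_iff add_increasing)

lemma smooth_bump_exists:
  assumes "open W" "p \<in> W"
  obtains b V K where "smooth b" "open V" "p \<in> V" "\<And>y. y \<in> V \<Longrightarrow> b y = 1" "compact K" "K \<subseteq> W"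
    "\<And>y. b y \<noteq> 0 \<Longrightarrow> y \<in> K"
proof -
  obtain e where e: "e > 0" "cball p e \<subseteq> W" using assms open_contains_cball by blast
  \<comment> \<open>The product of the two bands vanishes once a coordinate is
    \<open>2 / k = e / 2\<close> away from \<open>p\<close>, which keeps the support within distance
    \<open>e\<close>.\<close>
  define k where "k = 4 / e"
  have k: "k > 0" using e by (simp add: k_def)
  define b where "b = (\<lambda>y. band (k *\<^sub>R e_t) (- k * fst p) y * band (k *\<^sub>R e_x) (- k * snd p) y)"
  have arg: "y \<bullet> (k *\<^sub>R e_t) + - k * fst p = k * (fst y - fst p)" "y \<bullet> (k *\<^sub>R e_x) + - k * snd p = k * (snd y - snd p)" for y
    by (simp_all add: e_t_def e_x_def inner_prod_def algebra_simps)
  show ?thesis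
  proof
    show "smooth b" unfolding b_def by (intro smooth_intros smooth_band)
    show "open (ball p (1 / k))" "p \<in> ball p (1 / k)" using k by auto
    show "compact (cball p e)" "cball p e \<subseteq> W" using e by auto
    show "b y = 1" if "y \<in> ball p (1 / k)" for y
    proof -
      have "\<bar>fst y - fst p\<bar> \<le> dist p y" "\<bar>snd y - snd p\<bar> \<le> dist p y"
        by (metis dist_commute dist_fst_le dist_real_def, metis dist_commute dist_snd_le dist_real_def)
      then have "k * \<bar>fst y - fst p\<bar> \<le> 1" "k * \<bar>snd y - snd p\<bar> \<le> 1"
        using that k by (auto simp: field_simps intro: order.trans[OF mult_left_mono])
      then show ?thesis unfolding b_def using k by (subst (1 2) band_eq_1) (auto simp only: arg abs_mult abs_of_pos mult_1)
    qed
    show "y \<in> cball p e" if "b y \<noteq> 0" for y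
    proof -
      have "k * \<bar>fst y - fst p\<bar> < 2" "k * \<bar>snd y - snd p\<bar> < 2"
        using that k band_eq_0[of y "k *\<^sub>R e_t" "- k * fst p"] band_eq_0[of y "k *\<^sub>R e_x" "- k * snd p"]
        unfolding b_def arg abs_mult abs_of_pos[OF k] by (metis linorder_not_le mult_zero_left, metis linorder_not_le mult_zero_right)
      then have "\<bar>fst y - fst p\<bar> < e / 2" "\<bar>snd y - snd p\<bar> < e / 2"
        using e by (auto simp: k_def field_simps)
      moreover have "dist p y \<le> \<bar>fst p - fst y\<bar> + \<bar>snd p - snd y\<bar>"
        by (simp add: dist_prod_def dist_real_def sqrt_sum_squares_le_sum_abs)
      ultimately show ?thesis by (auto simp: abs_minus_commute)
    qed
  qed
qed

text \<open>Boxes are an intersection-stable generator of the Borel sets, so the vanishing of the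
  integral spreads to all Borel sets by a Dynkin argument; the assumption on the whole space serves
  the complements. Then \<open>f\<close> and 0 are densities of the same set function.\<close>

lemma integral_boxes_zero_imp_AE:
  fixes f :: "'a::euclidean_space \<Rightarrow> real"
  assumes f: "integrable lborel f" and z: "\<And>a b. (\<integral>x\<in>box a b. f x \<partial>lborel) = 0"
    and u: "(\<integral>x. f x \<partial>lborel) = 0"
  shows "AE x in lborel. f x = 0"
proof -
  have si: "set_integrable lborel A f" if "A \<in> sets borel" for A
    using integrable_mult_indicator[OF _ f, of A] that by (simp add: set_integrable_def)
  have S: "sets borel = sigma_sets UNIV (range (\<lambda>(a, b). box a (b::'a)))"
    by (simp add: borel_eq_box)
  have "(\<integral>x\<in>A. f x \<partial>lborel) = 0" if "A \<in> sigma_sets UNIV (range (\<lambda>(a, b). box a (b::'a)))" for A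
  proof (rule sigma_sets_induct_disjoint[of "range (\<lambda>(a, b). box a (b::'a))" UNIV, OF _ _ that])
    show "Int_stable (range (\<lambda>(a, b). box a (b::'a)))"
    proof (rule Int_stableI, clarsimp)
      fix a b c d :: 'a
      show "box a b \<inter> box c d \<in> range (\<lambda>(a, b). box a b)"
        unfolding box_Int_box by blast
    qed
  next
    fix A assume "A \<in> range (\<lambda>(a, b). box a (b::'a))" then show "(\<integral>x\<in>A. f x \<partial>lborel) = 0" using z by auto
  next
    fix A assume A: "A \<in> sigma_sets UNIV (range (\<lambda>(a, b). box a (b::'a)))" "(\<integral>x\<in>A. f x \<partial>lborel) = 0"
    then have "A \<in> sets borel" using S by simp
    then have "(\<integral>x\<in>(A \<union> (UNIV - A)). f x \<partial>lborel) = (\<integral>x\<in>A. f x \<partial>lborel) + (\<integral>x\<in>(UNIV - A). f x \<partial>lborel)"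
      by (intro set_integral_Un si) auto
    then show "(\<integral>x\<in>UNIV - A. f x \<partial>lborel) = 0" using A u by (simp add: set_lebesgue_integral_def)
  next
    fix A :: "nat \<Rightarrow> 'a set" assume A: "disjoint_family A" "range A \<subseteq> sigma_sets UNIV (range (\<lambda>(a, b). box a (b::'a)))"
      "\<And>i. (\<integral>x\<in>A i. f x \<partial>lborel) = 0"
    have "A i \<in> sets borel" for i using A(2) S by auto
    then have "(\<integral>x\<in>(\<Union>i. A i). f x \<partial>lborel) = (\<Sum>i. (\<integral>x\<in>A i. f x \<partial>lborel))"
      using A(1) by (intro lebesgue_integral_countable_add si) (auto simp: disjoint_family_on_def)
    then show "(\<integral>x\<in>(\<Union>i. A i). f x \<partial>lborel) = 0" using A(3) by simp
  qed (auto simp: set_lebesgue_integral_def)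
  then have "AE x in lborel. f x = (\<lambda>_. 0) x"
    using f S by (intro density_unique_real) (auto simp: set_lebesgue_integral_def)
  then show ?thesis by simp
qed

lemma l2ip_real: "l2ip \<Omega> u w = (LINT p|lebesgue_on \<Omega>. u p * w p)" for u w :: "pt \<Rightarrow> real"
  by (simp add: l2ip_def)

lemma test_functionsI:
  assumes "smooth \<eta>" "compact K" "K \<subseteq> \<Omega>" "\<And>p. \<eta> p \<noteq> 0 \<Longrightarrow> p \<in> K"
  shows "\<eta> \<in> test_functions \<Omega>"
proof -
  have "closure {p. \<eta> p \<noteq> 0} \<subseteq> K"
    using assms(2,4) by (intro closure_minimal) (auto simp: compact_imp_closed)
  then show ?thesis unfolding test_functions_def
    using assms(1-3) compact_Int_closed[OF \<open>compact K\<close> closed_closure, of "{p. \<eta> p \<noteq> 0}"] by (simp add: inf.absorb2)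
qed

lemma box_prod: "box (a, b) (c, d) = box a c \<times> box b d" for a c b d :: real
  by (auto simp: box_def Basis_prod_def)

lemma step_scaled_tendsto: "(\<lambda>n. step (real n * y)) \<longlonglongrightarrow> indicator {0<..} y"
proof (cases "y > 0")
  case True
  obtain N where N: "2 / y < real N" using reals_Archimedean2 by blast
  have "eventually (\<lambda>n. step (real n * y) = 1) sequentially"
    unfolding eventually_sequentially
  proof (intro exI[of _ N] allI impI)
    fix n assume "N \<le> n"
    then have "2 / y < real n" using N by linarith
    then have "2 \<le> real n * y" using True by (simp add: field_simps)
    then show "step (real n * y) = 1" by (rule step_eq_1)
  qed
  then show ?thesis using True by (simp add: tendsto_eventually)
next
  case False
  then have "real n * y \<le> 0" for n by (simp add: mult_nonneg_nonpos)
  then have "step (real n * y) = 0" for n using step_eq_0 by (meson order.trans zero_le_one)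
  then show ?thesis using False by simp
qed

text \<open>The indicator of the open box is a bounded pointwise limit of test functions: products
  of four steps, one for each side, that steepen with \<open>n\<close>. All are supported in the
  closed box, on which \<open>w\<close> is integrable, so dominated convergence applies.\<close>

lemma integral_box_eq_0:
  assumes "open \<Omega>" and li: "locally_integrable \<Omega> w" and z: "\<And>\<eta>. \<eta> \<in> test_functions \<Omega> \<Longrightarrow> l2ip \<Omega> w \<eta> = 0"
    and sub: "cbox a b \<subseteq> \<Omega>"
  shows "(\<integral>x\<in>box a b. w x \<partial>lebesgue) = 0"
proof -
  obtain a1 a2 b1 b2 where ab: "a = (a1, a2)" "b = (b1, b2)" by (metis surj_pair)
  define \<eta> where "\<eta> = (\<lambda>n::nat. \<lambda>y::pt. step (y \<bullet> (real n *\<^sub>R e_t) + (- real n * a1)) * step (y \<bullet> (- real n *\<^sub>R e_t) + real n * b1)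
      * (step (y \<bullet> (real n *\<^sub>R e_x) + (- real n * a2)) * step (y \<bullet> (- real n *\<^sub>R e_x) + real n * b2)))"
  have \<eta>': "\<eta> n y = step (real n * (fst y - a1)) * step (real n * (b1 - fst y))
      * (step (real n * (snd y - a2)) * step (real n * (b2 - snd y)))" for n y
    unfolding \<eta>_def by (simp add: e_t_def e_x_def inner_prod_def algebra_simps)
  have sm: "smooth (\<eta> n)" for n unfolding \<eta>_def
    by (intro smooth_mult smooth1_affine(1)[OF smooth1_step])
  have pos: "c > 0" if "step (real n * c) \<noteq> 0" for n c
  proof (rule ccontr)
    assume "\<not> c > 0"
    then have "real n * c \<le> 1" by (simp add: mult_nonneg_nonpos order.trans[of _ 0])
    then show False using that step_eq_0 by blast
  qed
  have supp: "y \<in> box a b" if "\<eta> n y \<noteq> 0" for n y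
    using that pos[of n "fst y - a1"] pos[of n "b1 - fst y"] pos[of n "snd y - a2"] pos[of n "b2 - snd y"]
    unfolding \<eta>' ab box_prod by (cases y) auto
  have lim: "(\<lambda>n. \<eta> n y) \<longlonglongrightarrow> indicator (box a b) y" for y
  proof -
    have "(\<lambda>n. \<eta> n y) \<longlonglongrightarrow> (indicator {0<..} (fst y - a1) :: real) * indicator {0<..} (b1 - fst y) *
       (indicator {0<..} (snd y - a2) * indicator {0<..} (b2 - snd y))"
      unfolding \<eta>' by (intro tendsto_mult step_scaled_tendsto)
    moreover have "(indicator {0<..} (fst y - a1) :: real) * indicator {0<..} (b1 - fst y) *
       (indicator {0<..} (snd y - a2) * indicator {0<..} (b2 - snd y)) = indicator (box a b) y"
      unfolding ab box_prod by (cases y) (auto split: split_indicator)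
    ultimately show ?thesis by simp
  qed
  have bd: "\<bar>\<eta> n y\<bar> \<le> 1" for n y
    unfolding \<eta>' abs_mult using step_nonneg step_le_1
    by (intro mult_le_one) (auto simp: abs_le_iff order.trans[OF _ step_nonneg])
  have tf: "\<eta> n \<in> test_functions \<Omega>" for n
    by (rule test_functionsI[OF sm compact_cbox sub]) (use supp box_subset_cbox in blast)
  have iw: "integrable lebesgue (\<lambda>x. indicator (cbox a b) x * w x)"
    using li sub unfolding locally_integrable_def set_integrable_def by simp
  have zn: "(\<integral>x. \<eta> n x * (indicator (cbox a b) x * w x) \<partial>lebesgue) = 0" for n
  proof -
    have "(\<integral>x. \<eta> n x * (indicator (cbox a b) x * w x) \<partial>lebesgue) = (\<integral>x. indicator \<Omega> x *\<^sub>R (w x * \<eta> n x) \<partial>lebesgue)"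
    proof (rule Bochner_Integration.integral_cong[OF refl])
      fix x show "\<eta> n x * (indicator (cbox a b) x * w x) = indicator \<Omega> x *\<^sub>R (w x * \<eta> n x)"
      proof (cases "\<eta> n x = 0")
        case False
        then have "x \<in> cbox a b" using supp box_subset_cbox by blast
        then show ?thesis using sub by auto
      qed simp
    qed
    also have "\<dots> = l2ip \<Omega> w (\<eta> n)"
      unfolding l2ip_real using \<open>open \<Omega>\<close> by (subst integral_restrict_space) (auto simp: lmeasurable_iff_integrable)
    finally show ?thesis using z[OF tf] by simp
  qed
  have "(\<lambda>n. \<integral>x. \<eta> n x * (indicator (cbox a b) x * w x) \<partial>lebesgue) \<longlonglongrightarrow>
     (\<integral>x. indicator (box a b) x * (indicator (cbox a b) x * w x) \<partial>lebesgue)"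
  proof (rule integral_dominated_convergence[where w = "\<lambda>x. \<bar>indicator (cbox a b) x * w x\<bar>"])
    show "(\<lambda>x. \<eta> n x * (indicator (cbox a b) x * w x)) \<in> borel_measurable lebesgue" for n
      by (intro borel_measurable_times[OF _ borel_measurable_integrable[OF iw]])
        (use smooth_measurable[OF sm] in \<open>simp add: measurable_completion\<close>)
    show "AE x in lebesgue. (\<lambda>n. \<eta> n x * (indicator (cbox a b) x * w x)) \<longlonglongrightarrow> indicator (box a b) x * (indicator (cbox a b) x * w x)"
      by (intro AE_I2 tendsto_mult lim tendsto_const)
    show "AE x in lebesgue. norm (\<eta> n x * (indicator (cbox a b) x * w x)) \<le> \<bar>indicator (cbox a b) x * w x\<bar>" for n
      using bd by (auto simp: abs_mult intro!: AE_I2 mult_left_le_one_le)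
    show "(\<lambda>x. indicator (box a b) x * (indicator (cbox a b) x * w x)) \<in> borel_measurable lebesgue"
      by (intro borel_measurable_times[OF _ borel_measurable_integrable[OF iw]] borel_measurable_indicator) simp
  qed (use iw in auto)
  then have "(\<integral>x. indicator (box a b) x * (indicator (cbox a b) x * w x) \<partial>lebesgue) = 0"
    unfolding zn by (simp add: LIMSEQ_const_iff)
  moreover have "indicator (box a b) x * (indicator (cbox a b) x * w x) = indicator (box a b) x *\<^sub>R w x" for x
    using box_subset_cbox[of a b] by (auto simp: indicator_def)
  ultimately show ?thesis by (simp add: set_lebesgue_integral_def)
qed

text \<open>Cutting \<open>w\<close> off to a box makes it integrable on the plane, and a Borel
  representative brings it into the scope of \<open>integral_boxes_zero_imp_AE\<close>;
  intersections of boxes are boxes, so all its box integrals vanish. Countably many closed boxes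
  fill the domain, and their faces are negligible.\<close>

lemma fundamental_lemma:
  assumes "open \<Omega>" and li: "locally_integrable \<Omega> w" and z: "\<And>\<eta>. \<eta> \<in> test_functions \<Omega> \<Longrightarrow> l2ip \<Omega> w \<eta> = 0"
  shows "AE p in lebesgue_on \<Omega>. w p = 0"
proof -
  have loc: "AE x in lebesgue. x \<in> cbox a b \<longrightarrow> w x = 0" if sub: "cbox a b \<subseteq> \<Omega>" for a b
  proof -
    define f where "f = (\<lambda>x. indicator (box a b) x * w x)"
    have "set_integrable lebesgue (cbox a b) w" using li sub unfolding locally_integrable_def by simp
    then have "set_integrable lebesgue (box a b) w"
      by (rule set_integrable_subset) (auto simp: box_subset_cbox)
    then have f: "integrable lebesgue f" by (simp add: set_integrable_def f_def)
    obtain f' where f': "f' \<in> borel_measurable lborel" "AE x in lborel. f x = f' x"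
      using completion_ex_borel_measurable_real[of f lborel] f by auto
    have AE': "AE x in lebesgue. f x = f' x" using f'(2) by (rule AE_completion)
    have "integrable lebesgue f'" using integrable_cong_AE_imp[OF f _ AE'] f'(1) by (simp add: measurable_completion)
    then have fi: "integrable lborel f'" using f'(1) by (simp add: integrable_completion)
    have si: "(\<integral>x\<in>A. f' x \<partial>lborel) = (\<integral>x\<in>A. f x \<partial>lebesgue)" if "A \<in> sets borel" for A
    proof -
      have "(\<integral>x\<in>A. f' x \<partial>lborel) = (\<integral>x\<in>A. f' x \<partial>lebesgue)"
        unfolding set_lebesgue_integral_def using f'(1) that by (subst integral_completion) auto
      also have "\<dots> = (\<integral>x\<in>A. f x \<partial>lebesgue)"
        unfolding set_lebesgue_integral_def
        by (rule integral_cong_AE) (use AE' borel_measurable_integrable[OF f] f'(1) that in \<open>auto simp: measurable_completion intro!: borel_measurable_scaleR borel_measurable_indicator borel_measurable_times\<close>)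
      finally show ?thesis .
    qed
    have bx: "(\<integral>x\<in>box c d. f x \<partial>lebesgue) = 0" for c d
    proof -
      obtain l u where lu: "box c d \<inter> box a b = box l u" using box_Int_box[of c d a b] by blast
      have "(\<integral>x\<in>box c d. f x \<partial>lebesgue) = (\<integral>x\<in>box l u. w x \<partial>lebesgue)"
        unfolding set_lebesgue_integral_def f_def lu[symmetric] by (simp add: indicator_inter_arith mult.assoc)
      also have "\<dots> = 0"
      proof (cases "box l u = {}")
        case False
        have "closure (box l u) \<subseteq> closure (box a b)" by (rule closure_mono) (use lu in blast)
        also have "\<dots> \<subseteq> cbox a b" by (rule closure_minimal[OF box_subset_cbox closed_cbox])
        finally have "cbox l u \<subseteq> cbox a b" using closure_box[OF False] by simp
        from integral_box_eq_0[OF assms(1) li z order.trans[OF this sub]] show ?thesis by simp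
      qed (simp add: set_lebesgue_integral_def)
      finally show ?thesis .
    qed
    have "(\<integral>x. f' x \<partial>lborel) = (\<integral>x\<in>UNIV. f x \<partial>lebesgue)" using si[of UNIV] by (simp add: set_lebesgue_integral_def)
    also have "\<dots> = (\<integral>x\<in>box a b. f x \<partial>lebesgue)"
      unfolding set_lebesgue_integral_def f_def by (rule Bochner_Integration.integral_cong) (auto simp: indicator_def)
    finally have "(\<integral>x. f' x \<partial>lborel) = 0" using bx by simp
    then have "AE x in lborel. f' x = 0" using integral_boxes_zero_imp_AE[OF fi] si bx by auto
    then have "AE x in lebesgue. f' x = 0" by (rule AE_completion)
    moreover have "AE x in lebesgue. x \<notin> cbox a b - box a b"
      using negligible_frontier_interval[of a b] by (intro AE_not_in) (simp add: negligible_iff_null_sets)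
    ultimately show ?thesis using AE' by eventually_elim (auto simp: f_def)
  qed
  obtain D where D: "countable D" "D \<subseteq> Pow \<Omega>" "\<And>X. X \<in> D \<Longrightarrow> \<exists>a b. X = cbox a b" "\<Union>D = \<Omega>"
    using open_countable_Union_open_cbox[OF \<open>open \<Omega>\<close>] by metis
  have "AE x in lebesgue. \<forall>X\<in>D. x \<in> X \<longrightarrow> w x = 0"
    unfolding AE_ball_countable[OF D(1)] using D(2,3) loc by (metis PowD subsetD)
  then have "AE x in lebesgue. x \<in> \<Omega> \<longrightarrow> w x = 0" by eventually_elim (use D(4) in blast)
  then show ?thesis using \<open>open \<Omega>\<close> by (subst AE_restrict_space_iff) auto
qed

section \<open>Rotated coordinates\<close>

lemma nn_integral_plane:
  assumes [measurable]: "F \<in> borel_measurable (borel :: pt measure)"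
  shows "(\<integral>\<^sup>+z. F z \<partial>lborel) = (\<integral>\<^sup>+s. \<integral>\<^sup>+\<tau>. F (s, \<tau>) \<partial>lborel \<partial>lborel)"
    and "(\<integral>\<^sup>+z. F z \<partial>lborel) = (\<integral>\<^sup>+\<tau>. \<integral>\<^sup>+s. F (s, \<tau>) \<partial>lborel \<partial>lborel)"
proof -
  have m: "F \<in> borel_measurable (lborel \<Otimes>\<^sub>M lborel)" by (simp add: lborel_prod)
  show "(\<integral>\<^sup>+z. F z \<partial>lborel) = (\<integral>\<^sup>+s. \<integral>\<^sup>+\<tau>. F (s, \<tau>) \<partial>lborel \<partial>lborel)"
    using lborel.nn_integral_fst[OF m] by (simp add: lborel_prod)
  show "(\<integral>\<^sup>+z. F z \<partial>lborel) = (\<integral>\<^sup>+\<tau>. \<integral>\<^sup>+s. F (s, \<tau>) \<partial>lborel \<partial>lborel)"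
    using lborel_pair.nn_integral_snd[of F] m by (simp add: lborel_prod)
qed

text \<open>Coordinates of a boundary chart: the first runs along the direction
  \<open>(- b, a)\<close> over which the boundary is a graph, the second along
  \<open>(a, b)\<close>, which points out of the domain. For \<open>a^2 + b^2 = 1\<close> this is an
  isometry that takes the origin to \<open>p\<close>.\<close>

definition frame :: "pt \<Rightarrow> real \<Rightarrow> real \<Rightarrow> pt \<Rightarrow> pt" where
  "frame p a b z = p + fst z *\<^sub>R (- b, a) + snd z *\<^sub>R (a, b)"

lemma frame_pair: "frame p a b (s, \<tau>) = (fst p - b * s + a * \<tau>, snd p + a * s + b * \<tau>)"
  by (cases p) (simp add: frame_def algebra_simps)

lemma continuous_frame: "continuous_on S (frame p a b)"
  unfolding frame_def[abs_def] by (intro continuous_intros)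

lemma measurable_frame [measurable]: "frame p a b \<in> borel_measurable borel"
  using continuous_frame borel_measurable_continuous_onI by blast

text \<open>Rotation invariance by Fubini and one-dimensional substitutions. For
  \<open>b \<noteq> 0\<close> the first plane coordinate replaces \<open>s\<close> at fixed
  \<open>\<tau>\<close>, with factor \<open>\<bar>b\<bar>\<close>; then the second replaces
  \<open>\<tau>\<close> at fixed \<open>x\<close>, with factor \<open>1 / \<bar>b\<bar>\<close>
  because \<open>a^2 + b^2 = 1\<close>. For \<open>b = 0\<close> the axes are swapped, up to a
  common sign.\<close>

lemma nn_integral_frame:
  assumes ab: "a\<^sup>2 + b\<^sup>2 = 1" and F[measurable]: "F \<in> borel_measurable borel"
  shows "(\<integral>\<^sup>+z. F (frame p a b z) \<partial>lborel) = (\<integral>\<^sup>+z. F z \<partial>lborel)"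
proof (cases "b = 0")
  case True
  then have a: "\<bar>a\<bar> = 1" "a \<noteq> 0" using ab by (auto simp: power2_eq_1_iff)
  have "(\<integral>\<^sup>+z. F (frame p a b z) \<partial>lborel) = (\<integral>\<^sup>+s. \<integral>\<^sup>+\<tau>. F (fst p + a * \<tau>, snd p + a * s) \<partial>lborel \<partial>lborel)"
    by (subst nn_integral_plane(1)) (simp_all add: frame_pair True)
  also have "\<dots> = (\<integral>\<^sup>+s. \<integral>\<^sup>+x. F (x, snd p + a * s) \<partial>lborel \<partial>lborel)"
    using a by (subst nn_integral_real_affine[of "\<lambda>x. F (x, snd p + a * _)" a "fst p"]) auto
  also have "\<dots> = (\<integral>\<^sup>+y. \<integral>\<^sup>+x. F (x, y) \<partial>lborel \<partial>lborel)"
    using a by (subst nn_integral_real_affine[of "\<lambda>y. \<integral>\<^sup>+x. F (x, y) \<partial>lborel" a "snd p"]) auto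
  also have "\<dots> = (\<integral>\<^sup>+z. F z \<partial>lborel)" by (simp add: nn_integral_plane(2))
  finally show ?thesis .
next
  case False
  define G where "G = (\<lambda>x \<tau>. F (x, snd p + a * ((fst p + a * \<tau> - x) / b) + b * \<tau>))"
  have [measurable]: "case_prod G \<in> borel_measurable borel" 
    unfolding G_def case_prod_unfold by (intro measurable_compose[OF _ F] borel_measurable_continuous_onI continuous_intros) (use False in auto)
  have G1: "(\<lambda>x. G x \<tau>) \<in> borel_measurable borel" "G x \<in> borel_measurable borel" for x \<tau>
    unfolding G_def by measurable
  have Gf: "F (frame p a b (s, \<tau>)) = G ((fst p + a * \<tau>) + (-b) * s) \<tau>" for s \<tau>
    using False by (simp add: frame_pair G_def algebra_simps)
  have "\<bar>b\<bar> * (\<integral>\<^sup>+z. F (frame p a b z) \<partial>lborel) = \<bar>b\<bar> * (\<integral>\<^sup>+\<tau>. \<integral>\<^sup>+s. F (frame p a b (s, \<tau>)) \<partial>lborel \<partial>lborel)"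
    by (subst nn_integral_plane(2)) simp_all
  also have "\<dots> = (\<integral>\<^sup>+\<tau>. \<bar>-b\<bar> * (\<integral>\<^sup>+s. F (frame p a b (s, \<tau>)) \<partial>lborel) \<partial>lborel)"
    by (subst nn_integral_cmult) simp_all
  also have "\<dots> = (\<integral>\<^sup>+\<tau>. \<bar>-b\<bar> * (\<integral>\<^sup>+s. G ((fst p + a * \<tau>) + (-b) * s) \<tau> \<partial>lborel) \<partial>lborel)"
    unfolding Gf ..
  also have "\<dots> = (\<integral>\<^sup>+\<tau>. \<integral>\<^sup>+x. G x \<tau> \<partial>lborel \<partial>lborel)"
    by (subst nn_integral_real_affine[of "\<lambda>x. G x _" "-b", symmetric]) (use False G1 in auto)
  also have "\<dots> = (\<integral>\<^sup>+x. \<integral>\<^sup>+\<tau>. G x \<tau> \<partial>lborel \<partial>lborel)"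
    using nn_integral_plane[of "case_prod G"] by simp
  also have "\<dots> = (\<integral>\<^sup>+x. \<integral>\<^sup>+\<tau>. F (x, (snd p + a * (fst p - x) / b) + (1 / b) * \<tau>) \<partial>lborel \<partial>lborel)"
  proof -
    have "a * a + b * b = 1" using ab by (simp add: power2_eq_square)
    then have "\<tau> * (a * a) + \<tau> * (b * b) = \<tau>" for \<tau> by (metis distrib_left mult.right_neutral)
    then have "snd p + a * ((fst p + a * \<tau> - x) / b) + b * \<tau> = (snd p + a * (fst p - x) / b) + (1 / b) * \<tau>" for x \<tau>
      using False by (simp add: field_simps)
    then show ?thesis by (simp only: G_def)
  qed
  also have "\<dots> = (\<integral>\<^sup>+x. ennreal \<bar>b\<bar> * (\<bar>1 / b\<bar> * (\<integral>\<^sup>+\<tau>. F (x, (snd p + a * (fst p - x) / b) + (1 / b) * \<tau>) \<partial>lborel)) \<partial>lborel)"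
    using False by (simp add: mult.assoc[symmetric] ennreal_mult[symmetric])
  also have "\<dots> = (\<integral>\<^sup>+x. ennreal \<bar>b\<bar> * (\<integral>\<^sup>+y. F (x, y) \<partial>lborel) \<partial>lborel)"
    by (subst nn_integral_real_affine[of "\<lambda>y. F (_, y)" "1 / b", symmetric]) (use False in auto)
  also have "\<dots> = \<bar>b\<bar> * (\<integral>\<^sup>+z. F z \<partial>lborel)"
    by (subst nn_integral_cmult) (auto simp: nn_integral_plane(1))
  finally show ?thesis using False by (simp add: ennreal_mult_cancel_left)
qed

lemma integral_frame:
  fixes F :: "pt \<Rightarrow> real"
  assumes ab: "a\<^sup>2 + b\<^sup>2 = 1" and F[measurable]: "F \<in> borel_measurable borel"
  shows "(\<integral>z. F (frame p a b z) \<partial>lborel) = (\<integral>z. F z \<partial>lborel)"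
proof -
  have "distr lborel borel (frame p a b) = lborel"
  proof (rule measure_eqI)
    fix A assume "A \<in> sets (distr lborel borel (frame p a b))"
    then have [measurable]: "A \<in> sets borel" by simp
    have "emeasure (distr lborel borel (frame p a b)) A = (\<integral>\<^sup>+z. indicator A z \<partial>distr lborel borel (frame p a b))"
      by simp
    also have "\<dots> = (\<integral>\<^sup>+z. indicator A (frame p a b z) \<partial>lborel)" by (rule nn_integral_distr) auto
    also have "\<dots> = emeasure lborel A" by (subst nn_integral_frame[OF ab]) auto
    finally show "emeasure (distr lborel borel (frame p a b)) A = emeasure lborel A" .
  qed simp
  then have "(\<integral>z. F z \<partial>lborel) = (\<integral>z. F z \<partial>distr lborel borel (frame p a b))" by simp
  also have "\<dots> = (\<integral>z. F (frame p a b z) \<partial>lborel)" by (rule integral_distr) auto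
  finally show ?thesis by simp
qed

lemma has_derivative_comp_frame:
  assumes "smooth \<psi>"
  shows "((\<lambda>z. \<psi> (frame p a b z)) has_derivative
     (\<lambda>v. fst v * (- b * pd e_t \<psi> (frame p a b z) + a * pd e_x \<psi> (frame p a b z))
        + snd v * (a * pd e_t \<psi> (frame p a b z) + b * pd e_x \<psi> (frame p a b z)))) (at z)"
proof -
  have "(frame p a b has_derivative (\<lambda>v. fst v *\<^sub>R (- b, a) + snd v *\<^sub>R (a, b))) (at z)"
    unfolding frame_def[abs_def] by (auto intro!: derivative_eq_intros)
  from has_derivative_compose[OF this smooth_has_derivative[OF assms]]
  show ?thesis by (rule has_derivative_eq_rhs) (auto simp: algebra_simps)
qed

lemma pd_comp_frame:
  assumes "smooth \<psi>"
  shows "pd e_t (\<lambda>z. \<psi> (frame p a b z)) z = - b * pd e_t \<psi> (frame p a b z) + a * pd e_x \<psi> (frame p a b z)"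
    and "pd e_x (\<lambda>z. \<psi> (frame p a b z)) z = a * pd e_t \<psi> (frame p a b z) + b * pd e_x \<psi> (frame p a b z)"
  using pd_eqI[OF has_derivative_comp_frame[OF assms]] by (simp_all add: e_t_def e_x_def)

lemma smooth_comp_frame:
  assumes "smooth \<psi>" shows "smooth (\<lambda>z. \<psi> (frame p a b z))"
proof (rule smooth_coinduct[where X = "{\<lambda>z. \<psi> (frame p a b z) |\<psi>. smooth \<psi>}"])
  show "(\<lambda>z. \<psi> (frame p a b z)) \<in> {\<lambda>z. \<psi> (frame p a b z) |\<psi>. smooth \<psi>}" using assms by blast
  fix \<eta> e z assume "\<eta> \<in> {\<lambda>z. \<psi> (frame p a b z) |\<psi>. smooth \<psi>}"
  then obtain \<psi> where \<eta>: "\<eta> = (\<lambda>z. \<psi> (frame p a b z))" and s: "smooth \<psi>" by blast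
  show "\<eta> differentiable (at z)"
    unfolding \<eta> using has_derivative_comp_frame[OF s] differentiable_def by blast
  assume "e \<in> {e_t, e_x}"
  then show "pd e \<eta> \<in> {\<lambda>z. \<psi> (frame p a b z) |\<psi>. smooth \<psi>}"
  proof
    assume "e = e_t"
    then have "pd e \<eta> = (\<lambda>z. (\<lambda>y. - b * pd e_t \<psi> y + a * pd e_x \<psi> y) (frame p a b z))"
      unfolding \<eta> by (intro ext) (simp only: pd_comp_frame[OF s])
    moreover have "smooth (\<lambda>y. - b * pd e_t \<psi> y + a * pd e_x \<psi> y)" by (intro smooth_intros s)
    ultimately show ?thesis by (intro CollectI exI conjI)
  next
    assume "e \<in> {e_x}"
    then have "pd e \<eta> = (\<lambda>z. (\<lambda>y. a * pd e_t \<psi> y + b * pd e_x \<psi> y) (frame p a b z))"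
      unfolding \<eta> by (intro ext) (simp add: pd_comp_frame[OF s])
    moreover have "smooth (\<lambda>y. a * pd e_t \<psi> y + b * pd e_x \<psi> y)" by (intro smooth_intros s)
    ultimately show ?thesis by (intro CollectI exI conjI)
  qed
qed

lemma smooth_DERIV_snd: "smooth \<Psi> \<Longrightarrow> DERIV (\<lambda>\<tau>. \<Psi> (s, \<tau>)) \<tau> :> pd e_x \<Psi> (s, \<tau>)"
proof -
  assume "smooth \<Psi>"
  have "(Pair s has_derivative (\<lambda>v. (0, v))) (at \<tau>)" by (auto intro!: derivative_eq_intros)
  from has_derivative_compose[OF this smooth_has_derivative[OF \<open>smooth \<Psi>\<close>]]
  show ?thesis by (simp add: has_field_derivative_def mult_commute_abs)
qed

lemma smooth_DERIV_fst: "smooth \<Psi> \<Longrightarrow> DERIV (\<lambda>s. \<Psi> (s, \<tau>)) s :> pd e_t \<Psi> (s, \<tau>)"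
proof -
  assume "smooth \<Psi>"
  have "((\<lambda>s. (s, \<tau>)) has_derivative (\<lambda>v. (v, 0))) (at s)" by (auto intro!: derivative_eq_intros)
  from has_derivative_compose[OF this smooth_has_derivative[OF \<open>smooth \<Psi>\<close>]]
  show ?thesis by (simp add: has_field_derivative_def mult_commute_abs)
qed

lemma pd_eq_0_outside:
  assumes "closed K" "\<And>y. y \<notin> K \<Longrightarrow> \<psi> y = 0" "z \<notin> K"
  shows "pd e \<psi> z = 0"
proof -
  have "(\<psi> has_derivative (\<lambda>v. 0)) (at z)"
    by (rule has_derivative_transform_within_open[where s = "- K" and f = "\<lambda>y. 0"])
       (use assms in \<open>auto simp: open_Compl\<close>)
  then show ?thesis using pd_eqI by blast
qed

lemma compact_support_bounded:
  fixes f :: "pt \<Rightarrow> real"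
  assumes "continuous_on UNIV f" "compact K" "\<And>y. y \<notin> K \<Longrightarrow> f y = 0"
  obtains B where "B > 0" "\<And>y. \<bar>f y\<bar> \<le> B"
proof -
  have "bounded (f ` K)"
    using assms compact_continuous_image compact_imp_bounded continuous_on_subset by (metis subset_UNIV)
  then obtain B where "B > 0" "\<And>y. y \<in> K \<Longrightarrow> \<bar>f y\<bar> \<le> B" unfolding bounded_pos by auto
  then show ?thesis using assms(3) by (metis abs_zero less_imp_le that)
qed

lemma compact_support_integrable:
  fixes f :: "pt \<Rightarrow> real"
  assumes "continuous_on UNIV f" "compact K" "\<And>y. y \<notin> K \<Longrightarrow> f y = 0"
  shows "integrable lborel f"
proof -
  have "integrable lborel (\<lambda>x. indicator K x *\<^sub>R f x)"
    using borel_integrable_compact[OF assms(2) continuous_on_subset[OF assms(1)]] by simp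
  moreover have "(\<lambda>x. indicator K x *\<^sub>R f x) = f" using assms(3) by (auto split: split_indicator)
  ultimately show ?thesis by simp
qed

section \<open>Divergence theorem on a subgraph\<close>

lemma lipschitz_measurable:
  fixes \<gamma> :: "real \<Rightarrow> real"
  assumes "L-lipschitz_on UNIV \<gamma>" shows "\<gamma> \<in> borel_measurable borel"
  using lipschitz_on_continuous_on[OF assms] borel_measurable_continuous_onI by blast

lemma subgraph_borel:
  fixes \<gamma> :: "real \<Rightarrow> real"
  assumes [measurable]: "\<gamma> \<in> borel_measurable borel"
  shows "{z. snd z < \<gamma> (fst z)} \<in> sets (borel :: pt measure)"
proof -
  have "(\<lambda>z::pt. \<gamma> (fst z)) \<in> borel_measurable borel" "(snd :: pt \<Rightarrow> real) \<in> borel_measurable borel"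
    unfolding borel_prod[symmetric] by measurable
  from borel_measurable_less[OF this(2,1)] show ?thesis by simp
qed

text \<open>Fubini and the fundamental theorem of calculus on each vertical line: only the value on
  the graph survives.\<close>

lemma subgraph_integral_vertical:
  assumes \<Psi>: "smooth \<Psi>" and supp: "\<And>z. \<Psi> z \<noteq> 0 \<Longrightarrow> z \<in> cbox (-R, -R) (R, R)"
    and \<gamma>[measurable]: "\<gamma> \<in> borel_measurable borel"
  shows "ennreal \<bar>\<integral>z. indicator {z. snd z < \<gamma> (fst z)} z * pd e_x \<Psi> z \<partial>lborel\<bar> \<le> (\<integral>\<^sup>+s. ennreal \<bar>\<Psi> (s, \<gamma> s)\<bar> \<partial>lborel)"
proof -
  let ?D = "{z. snd z < \<gamma> (fst z)}"
  have [measurable]: "?D \<in> sets borel" by (rule subgraph_borel) fact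
  have supp': "\<And>z. z \<notin> cbox (-R, -R) (R, R) \<Longrightarrow> pd e_x \<Psi> z = 0"
    by (rule pd_eq_0_outside[OF closed_cbox]) (use supp in blast)+
  have int: "integrable lborel (pd e_x \<Psi>)"
    by (rule compact_support_integrable[OF smooth_continuous compact_cbox supp']) (intro smooth_intros \<Psi>)
  have i2: "integrable lborel (\<lambda>z. indicator ?D z * pd e_x \<Psi> z)"
    using integrable_mult_indicator[OF _ int, of ?D] by simp
  then have i3: "integrable (lborel \<Otimes>\<^sub>M lborel) (\<lambda>z. indicator ?D z * pd e_x \<Psi> z)" by (simp add: lborel_prod)
  have inner: "(\<integral>\<tau>. indicator ?D (s, \<tau>) * pd e_x \<Psi> (s, \<tau>) \<partial>lborel) = \<Psi> (s, \<gamma> s)" for s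
  proof -
    have out: "\<Psi> (s, \<tau>) = 0" "pd e_x \<Psi> (s, \<tau>) = 0" if "\<tau> < -R" for \<tau>
      using supp[of "(s, \<tau>)"] supp'[of "(s, \<tau>)"] that by (auto simp: cbox_Pair_eq)
    \<comment> \<open>Below the support and below the graph: the interval is nonempty and its lower
      end contributes 0.\<close>
    define l where "l = min (-R) (\<gamma> s) - 1"
    have "(\<integral>\<tau>. indicator ?D (s, \<tau>) * pd e_x \<Psi> (s, \<tau>) \<partial>lborel) = (\<integral>\<tau>. pd e_x \<Psi> (s, \<tau>) * indicator {l..\<gamma> s} \<tau> \<partial>lborel)"
    proof (rule integral_cong_AE)
      have c: "continuous_on UNIV (\<lambda>\<tau>. pd e_x \<Psi> (s, \<tau>))"
        by (rule continuous_on_compose2[OF smooth_continuous[of "pd e_x \<Psi>" UNIV]]) (auto intro!: continuous_intros smooth_intros \<Psi>)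
      have [measurable]: "(\<lambda>\<tau>. pd e_x \<Psi> (s, \<tau>)) \<in> borel_measurable borel" using borel_measurable_continuous_onI[OF c] .
      show "(\<lambda>\<tau>. indicator ?D (s, \<tau>) * pd e_x \<Psi> (s, \<tau>)) \<in> borel_measurable lborel"
        "(\<lambda>\<tau>. pd e_x \<Psi> (s, \<tau>) * indicator {l..\<gamma> s} \<tau>) \<in> borel_measurable lborel" by measurable
      show "AE \<tau> in lborel. indicator ?D (s, \<tau>) * pd e_x \<Psi> (s, \<tau>) = pd e_x \<Psi> (s, \<tau>) * indicator {l..\<gamma> s} \<tau>"
        using AE_lborel_singleton[of "\<gamma> s"] by eventually_elim (auto simp: indicator_def l_def out)
    qed
    also have "\<dots> = \<Psi> (s, \<gamma> s) - \<Psi> (s, l)"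
      by (rule integral_FTC_Icc_real) (auto simp: l_def intro!: smooth_DERIV_snd \<Psi> isCont_o2[OF _ smooth_isCont] smooth_intros)
    also have "\<Psi> (s, l) = 0" by (rule out) (simp add: l_def)
    finally show ?thesis by simp
  qed
  have "(\<integral>z. indicator ?D z * pd e_x \<Psi> z \<partial>lborel) = (\<integral>s. (\<integral>\<tau>. indicator ?D (s, \<tau>) * pd e_x \<Psi> (s, \<tau>) \<partial>lborel) \<partial>lborel)"
    using lborel_pair.integral_fst'[OF i3] by (simp add: lborel_prod)
  also have "\<dots> = (\<integral>s. \<Psi> (s, \<gamma> s) \<partial>lborel)" unfolding inner ..
  finally have eq: "(\<integral>z. indicator ?D z * pd e_x \<Psi> z \<partial>lborel) = (\<integral>s. \<Psi> (s, \<gamma> s) \<partial>lborel)" .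
  have "integrable lborel (\<lambda>s. \<Psi> (s, \<gamma> s))"
    using lborel_pair.integrable_fst'[OF i3] unfolding inner .
  then show ?thesis unfolding eq using integral_norm_bound_ennreal by fastforce
qed

lemma smooth_compact_lipschitz:
  assumes \<Psi>: "smooth \<Psi>" and supp: "\<And>z. \<Psi> z \<noteq> 0 \<Longrightarrow> z \<in> cbox (-R, -R) (R, R)"
  obtains M where "M > 0" "\<And>s s' \<tau>. \<bar>\<Psi> (s, \<tau>) - \<Psi> (s', \<tau>)\<bar> \<le> M * \<bar>s - s'\<bar>"
    "\<And>s \<tau> \<tau>'. \<bar>\<Psi> (s, \<tau>) - \<Psi> (s, \<tau>')\<bar> \<le> M * \<bar>\<tau> - \<tau>'\<bar>"
proof -
  have s0: "\<And>z e. z \<notin> cbox (-R, -R) (R, R) \<Longrightarrow> pd e \<Psi> z = 0"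
    by (rule pd_eq_0_outside[OF closed_cbox]) (use supp in blast)+
  obtain M1 where M1: "M1 > 0" "\<And>z. \<bar>pd e_t \<Psi> z\<bar> \<le> M1"
    using compact_support_bounded[OF smooth_continuous[OF smooth_pd_t[OF \<Psi>]] compact_cbox[of "(-R,-R)" "(R,R)"] s0] by blast
  obtain M2 where M2: "M2 > 0" "\<And>z. \<bar>pd e_x \<Psi> z\<bar> \<le> M2"
    using compact_support_bounded[OF smooth_continuous[OF smooth_pd_x[OF \<Psi>]] compact_cbox[of "(-R,-R)" "(R,R)"] s0] by blast
  show ?thesis
  proof (rule that[of "M1 + M2"])
    show "\<bar>\<Psi> (s, \<tau>) - \<Psi> (s', \<tau>)\<bar> \<le> (M1 + M2) * \<bar>s - s'\<bar>" for s s' \<tau>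
    proof -
      have "norm (\<Psi> (s, \<tau>) - \<Psi> (s', \<tau>)) \<le> M1 * norm (s - s')"
        by (rule field_differentiable_bound[where S = UNIV and f' = "\<lambda>s. pd e_t \<Psi> (s, \<tau>)"])
           (use smooth_DERIV_fst[OF \<Psi>] M1 in auto)
      also have "\<dots> \<le> (M1 + M2) * norm (s - s')" using M2(1) by (intro mult_right_mono) auto
      finally show ?thesis by simp
    qed
    show "\<bar>\<Psi> (s, \<tau>) - \<Psi> (s, \<tau>')\<bar> \<le> (M1 + M2) * \<bar>\<tau> - \<tau>'\<bar>" for s \<tau> \<tau>'
    proof -
      have "norm (\<Psi> (s, \<tau>) - \<Psi> (s, \<tau>')) \<le> M2 * norm (\<tau> - \<tau>')"
        by (rule field_differentiable_bound[where S = UNIV and f' = "\<lambda>\<tau>. pd e_x \<Psi> (s, \<tau>)"])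
           (use smooth_DERIV_snd[OF \<Psi>] M2 in auto)
      also have "\<dots> \<le> (M1 + M2) * norm (\<tau> - \<tau>')" using M1(1) by (intro mult_right_mono) auto
      finally show ?thesis by simp
    qed
  qed (use M1 M2 in auto)
qed

lemma nn_integral_layer:
  fixes \<gamma> :: "real \<Rightarrow> real"
  assumes [measurable]: "\<gamma> \<in> borel_measurable borel" "H \<in> borel_measurable borel" and "\<delta> \<ge> 0"
  shows "(\<integral>\<^sup>+z. H (fst z) * indicator {z. \<bar>snd z - \<gamma> (fst z)\<bar> \<le> \<delta>} z \<partial>lborel) = ennreal (2 * \<delta>) * (\<integral>\<^sup>+s. H s \<partial>lborel)"
proof -
  have "(\<integral>\<^sup>+z. H (fst z) * indicator {z. \<bar>snd z - \<gamma> (fst z)\<bar> \<le> \<delta>} z \<partial>lborel) =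
      (\<integral>\<^sup>+s. \<integral>\<^sup>+\<tau>. H s * indicator {\<gamma> s - \<delta>..\<gamma> s + \<delta>} \<tau> \<partial>lborel \<partial>lborel)"
  proof (subst nn_integral_plane(1))
    show "(\<lambda>z. H (fst z) * indicator {z. \<bar>snd z - \<gamma> (fst z)\<bar> \<le> \<delta>} z) \<in> borel_measurable (borel :: pt measure)"
      unfolding borel_prod[symmetric] by measurable
  qed (auto intro!: nn_integral_cong simp: indicator_def abs_le_iff)
  also have "\<dots> = (\<integral>\<^sup>+s. H s * ennreal (2 * \<delta>) \<partial>lborel)"
    using \<open>\<delta> \<ge> 0\<close> by (simp add: nn_integral_cmult_indicator)
  also have "\<dots> = ennreal (2 * \<delta>) * (\<integral>\<^sup>+s. H s \<partial>lborel)" by (subst nn_integral_multc) (auto simp: mult.commute)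
  finally show ?thesis .
qed

text \<open>Write the derivative along the graph direction as a limit of difference quotients: a translation
  moves the difference onto the indicator of the subgraph, which changes only in a layer of thickness
  \<open>L k\<close> about the graph.\<close>

lemma subgraph_integral_horizontal:
  assumes \<Psi>: "smooth \<Psi>" and supp: "\<And>z. \<Psi> z \<noteq> 0 \<Longrightarrow> z \<in> cbox (-R, -R) (R, R)"
    and \<gamma>: "L-lipschitz_on UNIV \<gamma>" and "R > 0"
  shows "ennreal \<bar>\<integral>z. indicator {z. snd z < \<gamma> (fst z)} z * pd e_t \<Psi> z \<partial>lborel\<bar>
    \<le> ennreal (2 * L) * (\<integral>\<^sup>+s. ennreal \<bar>\<Psi> (s, \<gamma> s)\<bar> \<partial>lborel)"
proof -
  let ?D = "{z. snd z < \<gamma> (fst z)}"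
  note [measurable] = lipschitz_measurable[OF \<gamma>]
  have [measurable]: "?D \<in> sets borel" by (rule subgraph_borel) measurable
  have L: "L \<ge> 0" using \<gamma> lipschitz_on_nonneg by blast
  have \<gamma>L: "\<bar>\<gamma> s - \<gamma> s'\<bar> \<le> L * \<bar>s - s'\<bar>" for s s' using lipschitz_onD[OF \<gamma>, of s s'] by (simp add: dist_real_def)
  obtain M where M: "M > 0" "\<And>s s' \<tau>. \<bar>\<Psi> (s, \<tau>) - \<Psi> (s', \<tau>)\<bar> \<le> M * \<bar>s - s'\<bar>"
    "\<And>s \<tau> \<tau>'. \<bar>\<Psi> (s, \<tau>) - \<Psi> (s, \<tau>')\<bar> \<le> M * \<bar>\<tau> - \<tau>'\<bar>" using smooth_compact_lipschitz[OF \<Psi> supp] by blast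
  note [measurable] = smooth_measurable[OF \<Psi>] smooth_measurable[OF smooth_pd_t[OF \<Psi>]]
  have i\<Psi>: "integrable lborel \<Psi>"
    by (rule compact_support_integrable[OF smooth_continuous[OF \<Psi>] compact_cbox[of "(-R,-R)" "(R,R)"]]) (use supp in blast)
  define k where "k = (\<lambda>n. 1 / real (Suc n))"
  have k: "k n > 0" "k n \<le> 1" for n by (auto simp: k_def)
  have k0: "k \<longlonglongrightarrow> 0" unfolding k_def using LIMSEQ_Suc[OF lim_1_over_n] by simp
  define Q where "Q = (\<lambda>n z. indicator ?D z * ((\<Psi> (z + (k n, 0)) - \<Psi> z) / k n))"
  have [measurable]: "Q n \<in> borel_measurable borel" for n unfolding Q_def by measurable
  \<comment> \<open>The shifts are at most 1, so a box enlarged by 1 holds the supports of all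
    difference quotients and carries the dominating function.\<close>
  have bigsupp: "\<Psi> (z + (k n, 0)) - \<Psi> z = 0" if "z \<notin> cbox (-R-1, -R-1) (R+1, R+1)" for n z
    using supp[of "z + (k n, 0)"] supp[of z] that k[of n] by (cases z) (force simp: cbox_Pair_eq)
  have lim: "(\<lambda>n. \<integral>z. Q n z \<partial>lborel) \<longlonglongrightarrow> (\<integral>z. indicator ?D z * pd e_t \<Psi> z \<partial>lborel)"
  proof (rule integral_dominated_convergence[where w = "\<lambda>z. indicator (cbox (-R-1, -R-1) (R+1, R+1)) z *\<^sub>R M"])
    show "integrable lborel (\<lambda>z. indicator (cbox (-R-1, -R-1) (R+1, R+1)) z *\<^sub>R M :: real)"
      by (rule borel_integrable_compact) auto
    show "AE z in lborel. (\<lambda>n. Q n z) \<longlonglongrightarrow> indicator ?D z * pd e_t \<Psi> z"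
    proof (intro AE_I2)
      fix z :: pt
      obtain s \<tau> where z: "z = (s, \<tau>)" by (cases z)
      have "((\<lambda>h. (\<Psi> (s + h, \<tau>) - \<Psi> (s, \<tau>)) / h) \<longlongrightarrow> pd e_t \<Psi> (s, \<tau>)) (at 0)"
        using smooth_DERIV_fst[OF \<Psi>] by (simp add: DERIV_def)
      moreover have "filterlim k (at 0) sequentially"
        using k0 k(1) by (auto simp: filterlim_at less_imp_neq[THEN not_sym] intro!: always_eventually)
      ultimately have "(\<lambda>n. (\<Psi> (s + k n, \<tau>) - \<Psi> (s, \<tau>)) / k n) \<longlonglongrightarrow> pd e_t \<Psi> (s, \<tau>)"
        by (rule filterlim_compose)
      then show "(\<lambda>n. Q n z) \<longlonglongrightarrow> indicator ?D z * pd e_t \<Psi> z"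
        unfolding Q_def z by (intro tendsto_mult tendsto_const) simp
    qed
    show "AE z in lborel. norm (Q n z) \<le> indicator (cbox (-R-1, -R-1) (R+1, R+1)) z *\<^sub>R M" for n
    proof (intro AE_I2)
      fix z :: pt
      have "\<bar>\<Psi> (z + (k n, 0)) - \<Psi> z\<bar> \<le> M * k n" using M(2)[of "fst z + k n" "snd z" "fst z"] k[of n] by (cases z) simp
      then have "\<bar>(\<Psi> (z + (k n, 0)) - \<Psi> z) / k n\<bar> \<le> M" using k[of n] by (simp add: field_simps)
      then show "norm (Q n z) \<le> indicator (cbox (-R-1, -R-1) (R+1, R+1)) z *\<^sub>R M"
        using bigsupp[of z n] M(1) by (auto simp: Q_def indicator_def)
    qed
  qed measurable
  have bound: "ennreal \<bar>\<integral>z. Q n z \<partial>lborel\<bar> \<le> ennreal (2 * L) * (\<integral>\<^sup>+s. ennreal \<bar>\<Psi> (s, \<gamma> s)\<bar> \<partial>lborel) + ennreal (4 * L * L * M * R * k n)" for n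
  proof -
    define h where "h = k n"
    have h: "h > 0" using k by (simp add: h_def)
    \<comment> \<open>After translating one of the two integrals, the difference acts on the
      indicator of the subgraph. \<open>E\<close> is nonzero only where the heights of the graph
      over \<open>s - h\<close> and \<open>s\<close> lie on different sides of
      \<open>\<tau>\<close>.\<close>
    define E where "E = (\<lambda>z. indicator ?D (z - (h, 0)) - indicator ?D z :: real)"
    have [measurable]: "E \<in> borel_measurable borel" unfolding E_def by measurable
    have i1: "integrable lborel (\<lambda>z. indicator ?D z * \<Psi> z)" using integrable_mult_indicator[OF _ i\<Psi>, of ?D] by simp
    have i2: "integrable lborel (\<lambda>z. indicator ?D (z - (h, 0)) * \<Psi> z)"
    proof (rule Bochner_Integration.integrable_bound[OF i\<Psi>])
      show "(\<lambda>z. indicator ?D (z - (h, 0)) * \<Psi> z) \<in> borel_measurable lborel" by measurable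
    qed (auto simp: indicator_def)
    have tr: "distr lborel borel (\<lambda>z. (h, 0) + z) = (lborel :: pt measure)" by (rule lborel_distr_plus)
    have "integrable (distr lborel borel (\<lambda>z. (h, 0) + z)) (\<lambda>z. indicator ?D (z - (h, 0)) * \<Psi> z)" using i2 tr by simp
    then have i3: "integrable lborel (\<lambda>z. indicator ?D z * \<Psi> (z + (h, 0)))"
      by (subst (asm) integrable_distr_eq) (auto simp: add.commute)
    have "(\<integral>z. indicator ?D (z - (h, 0)) * \<Psi> z \<partial>lborel) = (\<integral>z. indicator ?D (z - (h, 0)) * \<Psi> z \<partial>distr lborel borel (\<lambda>z. (h, 0) + z))"
      using tr by simp
    also have "\<dots> = (\<integral>z. indicator ?D z * \<Psi> (z + (h, 0)) \<partial>lborel)"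
      by (subst integral_distr) (auto simp: add.commute)
    finally have sh: "(\<integral>z. indicator ?D z * \<Psi> (z + (h, 0)) \<partial>lborel) = (\<integral>z. indicator ?D (z - (h, 0)) * \<Psi> z \<partial>lborel)" by simp
    have "(\<integral>z. Q n z \<partial>lborel) = (\<integral>z. (indicator ?D z * \<Psi> (z + (h, 0)) - indicator ?D z * \<Psi> z) / h \<partial>lborel)"
      by (simp add: Q_def h_def right_diff_distrib diff_divide_distrib)
    also have "\<dots> = ((\<integral>z. indicator ?D z * \<Psi> (z + (h, 0)) \<partial>lborel) - (\<integral>z. indicator ?D z * \<Psi> z \<partial>lborel)) / h"
      using i1 i3 by simp
    also have "\<dots> = (\<integral>z. E z * \<Psi> z / h \<partial>lborel)" unfolding sh using i1 i2 by (simp add: E_def left_diff_distrib)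
    finally have Qe: "(\<integral>z. Q n z \<partial>lborel) = (\<integral>z. E z * \<Psi> z / h \<partial>lborel)" .
    have ie: "integrable lborel (\<lambda>z. E z * \<Psi> z / h)" using i1 i2 by (simp add: E_def left_diff_distrib)
    \<comment> \<open>Bound for the integrand in the layer: the value on the graph divided by
      \<open>h\<close>, plus \<open>M * (L * h) / h\<close> for moving vertically to the graph, the
      latter only over the support.\<close>
    define H where "H = (\<lambda>s. ennreal (\<bar>\<Psi> (s, \<gamma> s)\<bar> / h + L * M * indicator {-R..R} s))"
    have [measurable]: "H \<in> borel_measurable borel" unfolding H_def by measurable
    have pt: "ennreal (norm (E z * \<Psi> z / h)) \<le> H (fst z) * indicator {z. \<bar>snd z - \<gamma> (fst z)\<bar> \<le> L * h} z" for z
    proof (cases "E z * \<Psi> z = 0")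
      case False
      obtain s \<tau> where z: "z = (s, \<tau>)" by (cases z)
      have sR: "s \<in> {-R..R}" using supp[of z] False z by (auto simp: cbox_Pair_eq)
      have E: "\<bar>E z\<bar> = 1" using False by (auto simp: E_def indicator_def split: if_splits)
      have "\<bar>\<gamma> (s - h) - \<gamma> s\<bar> \<le> L * h" using \<gamma>L[of "s - h" s] h by simp
      moreover have "(\<tau> < \<gamma> (s - h)) \<noteq> (\<tau> < \<gamma> s)" using False z by (auto simp: E_def indicator_def split: if_splits)
      ultimately have t: "\<bar>\<tau> - \<gamma> s\<bar> \<le> L * h" by linarith
      have "\<bar>\<Psi> z\<bar> \<le> \<bar>\<Psi> (s, \<gamma> s)\<bar> + M * \<bar>\<tau> - \<gamma> s\<bar>" using M(3)[of s \<tau> "\<gamma> s"] z by auto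
      also have "\<dots> \<le> \<bar>\<Psi> (s, \<gamma> s)\<bar> + M * (L * h)" using t M(1) by simp
      finally have "\<bar>\<Psi> z\<bar> / h \<le> \<bar>\<Psi> (s, \<gamma> s)\<bar> / h + L * M" using h by (simp add: field_simps)
      then show ?thesis using t sR h E by (simp add: z H_def abs_mult ennreal_leI)
    next
      case True
      show ?thesis unfolding True by simp
    qed
    have "ennreal \<bar>\<integral>z. Q n z \<partial>lborel\<bar> \<le> (\<integral>\<^sup>+z. ennreal (norm (E z * \<Psi> z / h)) \<partial>lborel)"
      unfolding Qe using integral_norm_bound_ennreal[OF ie] by simp
    also have "\<dots> \<le> (\<integral>\<^sup>+z. H (fst z) * indicator {z. \<bar>snd z - \<gamma> (fst z)\<bar> \<le> L * h} z \<partial>lborel)"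
      by (intro nn_integral_mono pt)
    also have "\<dots> = ennreal (2 * (L * h)) * (\<integral>\<^sup>+s. H s \<partial>lborel)"
      using L h by (intro nn_integral_layer) auto
    also have "(\<integral>\<^sup>+s. H s \<partial>lborel) = (\<integral>\<^sup>+s. ennreal (1 / h) * ennreal \<bar>\<Psi> (s, \<gamma> s)\<bar> + ennreal (L * M) * indicator {-R..R} s \<partial>lborel)"
      using h L M(1) by (intro nn_integral_cong) (auto simp: H_def ennreal_plus ennreal_mult'[symmetric] indicator_def)
    also have "\<dots> = ennreal (1 / h) * (\<integral>\<^sup>+s. ennreal \<bar>\<Psi> (s, \<gamma> s)\<bar> \<partial>lborel) + ennreal (L * M) * ennreal (2 * R)"
      using \<open>R > 0\<close> by (subst nn_integral_add) (auto simp: nn_integral_cmult)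
    \<comment> \<open>The thickness \<open>2 * L * h\<close> of the layer cancels
      \<open>1 / h\<close> in the main term and leaves the error term of order
      \<open>h\<close>.\<close>
    also have "ennreal (2 * (L * h)) * \<dots> = ennreal (2 * L) * (\<integral>\<^sup>+s. ennreal \<bar>\<Psi> (s, \<gamma> s)\<bar> \<partial>lborel) + ennreal (4 * L * L * M * R * h)"
    proof -
      have "ennreal (2 * (L * h)) * ennreal (1 / h) = ennreal (2 * L)"
        using h L by (subst ennreal_mult[symmetric]) auto
      moreover have "ennreal (2 * (L * h)) * (ennreal (L * M) * ennreal (2 * R)) = ennreal (4 * L * L * M * R * h)"
      proof -
        have "2 * (L * h) * (L * M * (2 * R)) = 4 * L * L * M * R * h" by simp
        then show ?thesis using h L M(1) \<open>R > 0\<close> by (simp add: ennreal_mult[symmetric])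
      qed
      ultimately show ?thesis by (simp only: distrib_left mult.assoc[symmetric])
    qed
    finally show ?thesis by (simp add: h_def)
  qed
  have "(\<lambda>n. ennreal (2 * L) * (\<integral>\<^sup>+s. ennreal \<bar>\<Psi> (s, \<gamma> s)\<bar> \<partial>lborel) + ennreal (4 * L * L * M * R * k n)) \<longlonglongrightarrow>
     ennreal (2 * L) * (\<integral>\<^sup>+s. ennreal \<bar>\<Psi> (s, \<gamma> s)\<bar> \<partial>lborel) + ennreal (4 * L * L * M * R * 0)"
    by (intro tendsto_intros tendsto_ennrealI k0)
  then have lb: "(\<lambda>n. ennreal (2 * L) * (\<integral>\<^sup>+s. ennreal \<bar>\<Psi> (s, \<gamma> s)\<bar> \<partial>lborel) + ennreal (4 * L * L * M * R * k n)) \<longlonglongrightarrow>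
     ennreal (2 * L) * (\<integral>\<^sup>+s. ennreal \<bar>\<Psi> (s, \<gamma> s)\<bar> \<partial>lborel)" by simp
  have la: "(\<lambda>n. ennreal \<bar>\<integral>z. Q n z \<partial>lborel\<bar>) \<longlonglongrightarrow> ennreal \<bar>\<integral>z. indicator ?D z * pd e_t \<Psi> z \<partial>lborel\<bar>"
    by (intro tendsto_ennrealI tendsto_rabs lim)
  show ?thesis by (rule LIMSEQ_le[OF la lb]) (use bound in blast)
qed

section \<open>A Poincare inequality on a subgraph\<close>

text \<open>Cauchy-Schwarz in variance form: expand the nonnegative integral of
  \<open>(g - m)^2\<close>, with \<open>m\<close> the mean slope. The right endpoint is left out so
  that the interval below a graph point lies in the strict subgraph.\<close>

lemma square_increment_le:
  fixes G g :: "real \<Rightarrow> real"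
  assumes "\<alpha> \<le> \<beta>" and D: "\<And>x. DERIV G x :> g x" and c: "\<And>x. isCont g x"
  shows "ennreal ((G \<beta> - G \<alpha>)\<^sup>2) \<le> ennreal (\<beta> - \<alpha>) * (\<integral>\<^sup>+x. indicator {\<alpha>..<\<beta>} x * ennreal ((g x)\<^sup>2) \<partial>lborel)"
proof (cases "\<alpha> = \<beta>")
  case False
  then have l: "\<beta> - \<alpha> > 0" using assms(1) by simp
  define m where "m = (G \<beta> - G \<alpha>) / (\<beta> - \<alpha>)"
  have c': "continuous_on S g" for S using c continuous_at_imp_continuous_on by blast
  have m1: "(\<lambda>x. (g x)\<^sup>2) \<in> borel_measurable borel"
    by (intro borel_measurable_continuous_onI continuous_intros c')
  have ig: "integrable lborel (\<lambda>x. g x * indicator {\<alpha>..\<beta>} x)"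
    using borel_integrable_compact[OF compact_Icc c', of \<alpha> \<beta>] by (simp add: mult.commute)
  have ig2: "integrable lborel (\<lambda>x. (g x)\<^sup>2 * indicator {\<alpha>..\<beta>} x)"
    using borel_integrable_compact[of "{\<alpha>..\<beta>}" "\<lambda>x. (g x)\<^sup>2"] c' by (simp add: mult.commute continuous_on_power)
  have i1: "integrable lborel (\<lambda>x. indicator {\<alpha>..\<beta>} x :: real)"
    by (intro integrable_real_indicator) (auto simp: emeasure_lborel_Icc_eq)
  have F: "(\<integral>x. g x * indicator {\<alpha>..\<beta>} x \<partial>lborel) = G \<beta> - G \<alpha>"
    by (rule integral_FTC_Icc_real) (use assms in auto)
  have "0 \<le> (\<integral>x. (g x - m)\<^sup>2 * indicator {\<alpha>..\<beta>} x \<partial>lborel)" by simp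
  also have "\<dots> = (\<integral>x. (g x)\<^sup>2 * indicator {\<alpha>..\<beta>} x - (2 * m) * (g x * indicator {\<alpha>..\<beta>} x) + m\<^sup>2 * indicator {\<alpha>..\<beta>} x \<partial>lborel)"
    by (rule Bochner_Integration.integral_cong) (auto simp: algebra_simps power2_eq_square)
  also have "\<dots> = (\<integral>x. (g x)\<^sup>2 * indicator {\<alpha>..\<beta>} x \<partial>lborel) - (2 * m) * (G \<beta> - G \<alpha>) + m\<^sup>2 * (\<beta> - \<alpha>)"
    using ig ig2 i1 assms(1) by (simp add: F)
  finally have "(2 * m) * (G \<beta> - G \<alpha>) - m\<^sup>2 * (\<beta> - \<alpha>) \<le> (\<integral>x. (g x)\<^sup>2 * indicator {\<alpha>..\<beta>} x \<partial>lborel)" by simp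
  moreover have ml: "m * (\<beta> - \<alpha>) = G \<beta> - G \<alpha>" using l by (simp add: m_def)
  moreover have "m\<^sup>2 * (\<beta> - \<alpha>) = m * (m * (\<beta> - \<alpha>))" by (simp add: power2_eq_square)
  ultimately have "m * (G \<beta> - G \<alpha>) \<le> (\<integral>x. (g x)\<^sup>2 * indicator {\<alpha>..\<beta>} x \<partial>lborel)" by simp
  then have "(\<beta> - \<alpha>) * (m * (G \<beta> - G \<alpha>)) \<le> (\<beta> - \<alpha>) * (\<integral>x. (g x)\<^sup>2 * indicator {\<alpha>..\<beta>} x \<partial>lborel)"
    using l by (intro mult_left_mono) auto
  moreover have "(\<beta> - \<alpha>) * (m * (G \<beta> - G \<alpha>)) = (m * (\<beta> - \<alpha>)) * (G \<beta> - G \<alpha>)" by (simp only: ac_simps)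
  ultimately have "(G \<beta> - G \<alpha>)\<^sup>2 \<le> (\<beta> - \<alpha>) * (\<integral>x. (g x)\<^sup>2 * indicator {\<alpha>..\<beta>} x \<partial>lborel)"
    unfolding ml power2_eq_square by linarith
  then have "ennreal ((G \<beta> - G \<alpha>)\<^sup>2) \<le> ennreal (\<beta> - \<alpha>) * ennreal (\<integral>x. (g x)\<^sup>2 * indicator {\<alpha>..\<beta>} x \<partial>lborel)"
    using l by (simp add: ennreal_mult'[symmetric] ennreal_leI)
  also have "ennreal (\<integral>x. (g x)\<^sup>2 * indicator {\<alpha>..\<beta>} x \<partial>lborel) = (\<integral>\<^sup>+x. ennreal ((g x)\<^sup>2 * indicator {\<alpha>..\<beta>} x) \<partial>lborel)"
    using ig2 by (subst nn_integral_eq_integral) auto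
  also have "\<dots> = (\<integral>\<^sup>+x. indicator {\<alpha>..<\<beta>} x * ennreal ((g x)\<^sup>2) \<partial>lborel)"
  proof (rule nn_integral_cong_AE)
    show "AE x in lborel. ennreal ((g x)\<^sup>2 * indicator {\<alpha>..\<beta>} x) = indicator {\<alpha>..<\<beta>} x * ennreal ((g x)\<^sup>2)"
      using AE_lborel_singleton[of \<beta>] by eventually_elim (auto simp: indicator_def)
  qed
  finally show ?thesis .
qed simp

text \<open>Before passing to \<open>ennreal\<close>, the right side minus the left side is
  \<open>(2 * y - x)^2\<close>.\<close>

lemma square_le_ennreal:
  fixes x y :: real
  shows "ennreal (x\<^sup>2) \<le> 2 * ennreal (y\<^sup>2) + 2 * ennreal ((y - x)\<^sup>2)"
proof -
  have "0 \<le> (2 * y - x)\<^sup>2" by simp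
  then have "x\<^sup>2 \<le> 2 * y\<^sup>2 + 2 * (y - x)\<^sup>2" by (simp add: power2_eq_square algebra_simps)
  then have "ennreal (x\<^sup>2) \<le> ennreal (2 * y\<^sup>2 + 2 * (y - x)\<^sup>2)" by (rule ennreal_leI)
  also have "\<dots> = 2 * ennreal (y\<^sup>2) + 2 * ennreal ((y - x)\<^sup>2)"
    by (simp add: ennreal_plus ennreal_mult')
  finally show ?thesis .
qed

definition grad_sq :: "(pt \<Rightarrow> real) \<Rightarrow> pt \<Rightarrow> real" where
  "grad_sq \<Psi> z = (pd e_t \<Psi> z)\<^sup>2 + (pd e_x \<Psi> z)\<^sup>2"

lemma grad_sq_nonneg [simp]: "0 \<le> grad_sq \<Psi> z"
  by (simp add: grad_sq_def)

lemma grad_sq_measurable: "smooth \<Psi> \<Longrightarrow> grad_sq \<Psi> \<in> borel_measurable borel"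
  unfolding grad_sq_def[abs_def]
  by (intro borel_measurable_add borel_measurable_power smooth_measurable smooth_pd_t smooth_pd_x)

lemma smooth_segment_bound:
  assumes \<Psi>: "smooth \<Psi>"
  shows "ennreal ((\<Psi> (z + v) - \<Psi> z)\<^sup>2) \<le> ennreal ((norm v)\<^sup>2) *
     (\<integral>\<^sup>+t. indicator {0..<1} t * ennreal (grad_sq \<Psi> (z + t *\<^sub>R v)) \<partial>lborel)"
proof -
  define g where "g = (\<lambda>t. fst v * pd e_t \<Psi> (z + t *\<^sub>R v) + snd v * pd e_x \<Psi> (z + t *\<^sub>R v))"
  have D: "DERIV (\<lambda>t. \<Psi> (z + t *\<^sub>R v)) t :> g t" for t
  proof -
    have "((\<lambda>t. z + t *\<^sub>R v) has_derivative (\<lambda>h. h *\<^sub>R v)) (at t)" by (auto intro!: derivative_eq_intros)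
    from has_derivative_compose[OF this smooth_has_derivative[OF \<Psi>]]
    show ?thesis unfolding has_field_derivative_def by (rule has_derivative_eq_rhs) (auto simp: g_def algebra_simps)
  qed
  have "isCont g t" for t unfolding g_def
    by (intro continuous_intros isCont_o2[OF _ smooth_isCont] smooth_intros \<Psi>)
  from square_increment_le[OF _ D this, of 0 1]
  have "ennreal ((\<Psi> (z + v) - \<Psi> z)\<^sup>2) \<le> (\<integral>\<^sup>+t. indicator {0..<1} t * ennreal ((g t)\<^sup>2) \<partial>lborel)" by simp
  also have "\<dots> \<le> (\<integral>\<^sup>+t. ennreal ((norm v)\<^sup>2) * (indicator {0..<1} t * ennreal (grad_sq \<Psi> (z + t *\<^sub>R v))) \<partial>lborel)"
  proof (rule nn_integral_mono)
    fix t :: real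
    define x y where "x = pd e_t \<Psi> (z + t *\<^sub>R v)" and "y = pd e_x \<Psi> (z + t *\<^sub>R v)"
    \<comment> \<open>Lagrange's identity, which gives Cauchy-Schwarz for the directional
      derivative.\<close>
    have "(fst v * x + snd v * y)\<^sup>2 + (fst v * y - snd v * x)\<^sup>2 = ((fst v)\<^sup>2 + (snd v)\<^sup>2) * (x\<^sup>2 + y\<^sup>2)"
      by (simp add: power2_eq_square algebra_simps)
    moreover have "(norm v)\<^sup>2 = (fst v)\<^sup>2 + (snd v)\<^sup>2" by (cases v) (simp add: norm_Pair)
    ultimately have "(g t)\<^sup>2 \<le> (norm v)\<^sup>2 * grad_sq \<Psi> (z + t *\<^sub>R v)"
      unfolding g_def grad_sq_def x_def[symmetric] y_def[symmetric] by (metis le_add_same_cancel1 zero_le_power2)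
    then have "ennreal ((g t)\<^sup>2) \<le> ennreal ((norm v)\<^sup>2) * ennreal (grad_sq \<Psi> (z + t *\<^sub>R v))"
      by (simp add: ennreal_mult'[symmetric] ennreal_leI)
    then show "indicator {0..<1} t * ennreal ((g t)\<^sup>2) \<le> ennreal ((norm v)\<^sup>2) * (indicator {0..<1} t * ennreal (grad_sq \<Psi> (z + t *\<^sub>R v)))"
      by (auto simp: indicator_def)
  qed
  also have "\<dots> = ennreal ((norm v)\<^sup>2) * (\<integral>\<^sup>+t. indicator {0..<1} t * ennreal (grad_sq \<Psi> (z + t *\<^sub>R v)) \<partial>lborel)"
  proof (rule nn_integral_cmult)
    have "(\<lambda>t. grad_sq \<Psi> (z + t *\<^sub>R v)) \<in> borel_measurable borel"
      by (rule measurable_compose[OF _ grad_sq_measurable[OF \<Psi>]]) (intro borel_measurable_continuous_onI continuous_intros)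
    then show "(\<lambda>t. indicator {0..<1} t * ennreal (grad_sq \<Psi> (z + t *\<^sub>R v))) \<in> borel_measurable lborel" by measurable
  qed
  finally show ?thesis .
qed

text \<open>A Poincare inequality for functions that vanish on the part of the graph to the right of the
  origin: from a point near the origin move down to the right along a slope steeper than the graph,
  which stays in the subgraph, and then straight up to the graph.\<close>

lemma subgraph_poincare:
  assumes \<Psi>: "smooth \<Psi>" and \<gamma>: "L-lipschitz_on UNIV \<gamma>" and \<gamma>0: "\<gamma> 0 = 0" and "e > 0" "K \<ge> 0"
    and Q: "Q = {z. \<bar>fst z\<bar> \<le> e \<and> - K * e \<le> snd z \<and> snd z < \<gamma> (fst z)}"
    and R: "R = {z. - e \<le> fst z \<and> fst z \<le> 3 * e \<and> - (K + 2 * L) * e \<le> snd z \<and> snd z < \<gamma> (fst z)}"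
  shows "(\<integral>\<^sup>+z. indicator Q z * ennreal ((\<Psi> z)\<^sup>2) \<partial>lborel)
    \<le> ennreal ((4 * (K + 5 * L)\<^sup>2 + 8 * (1 + L\<^sup>2)) * e\<^sup>2) * (\<integral>\<^sup>+z. indicator R z * ennreal (grad_sq \<Psi> z) \<partial>lborel)
      + ennreal (4 * (K + 5 * L) * e) * (\<integral>\<^sup>+s. indicator {e..3*e} s * ennreal ((\<Psi> (s, \<gamma> s))\<^sup>2) \<partial>lborel)"
proof -
  have L: "L \<ge> 0" using \<gamma> lipschitz_on_nonneg by blast
  have \<gamma>L: "\<bar>\<gamma> s - \<gamma> s'\<bar> \<le> L * \<bar>s - s'\<bar>" for s s' using lipschitz_onD[OF \<gamma>, of s s'] by (simp add: dist_real_def)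
  note [measurable] = lipschitz_measurable[OF \<gamma>] smooth_measurable[OF \<Psi>] grad_sq_measurable[OF \<Psi>]
     smooth_measurable[OF smooth_pd_x[OF \<Psi>]]
  have [measurable]: "(\<lambda>z::pt. \<gamma> (fst z)) \<in> borel_measurable borel" "(snd :: pt \<Rightarrow> real) \<in> borel_measurable borel"
    "(fst :: pt \<Rightarrow> real) \<in> borel_measurable borel"
    unfolding borel_prod[symmetric] by measurable
  have [measurable]: "Q \<in> sets borel" unfolding Q by measurable
  have [measurable]: "R \<in> sets borel" unfolding R by measurable
  define S where "S = R \<inter> {z. e \<le> fst z}"
  have [measurable]: "S \<in> sets borel" unfolding S_def by measurable
  \<comment> \<open>Over a horizontal distance \<open>2 * e\<close> the graph drops by at most
    \<open>2 * L * e\<close>, so a descent by that amount stays below it. From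
    \<open>\<bar>s\<bar> \<le> e\<close> the move ends over \<open>[e, 3 * e]\<close>, under the
    part of the graph whose values are known.\<close>
  define v :: pt where "v = (2 * e, - 2 * L * e)"
  have nv: "(norm v)\<^sup>2 = 4 * (1 + L\<^sup>2) * e\<^sup>2" unfolding v_def norm_Pair by (subst real_sqrt_pow2[OF sum_power2_ge_zero]) (simp add: power2_eq_square algebra_simps)
  have QR: "z + t *\<^sub>R v \<in> R" if "z \<in> Q" "0 \<le> t" "t \<le> 1" for z t
  proof -
    obtain s \<tau> where z: "z = (s, \<tau>)" by (cases z)
    have q: "- e \<le> s" "s \<le> e" "- K * e \<le> \<tau>" "\<tau> < \<gamma> s" using that z by (auto simp: Q)
    have te: "0 \<le> t * e" "t * e \<le> e" using that \<open>e > 0\<close> by (auto simp: mult_left_le_one_le)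
    have "\<gamma> s - \<gamma> (s + 2 * (t * e)) \<le> L * (2 * (t * e))" using \<gamma>L[of s "s + 2 * (t * e)"] te by simp
    moreover have "L * (t * e) \<le> L * e" using te L by (intro mult_left_mono) auto
    ultimately show ?thesis using q te by (simp add: R z v_def algebra_simps)
  qed
  have QS: "z + v \<in> S" if "z \<in> Q" for z
    using QR[OF that, of 1] that by (cases z) (auto simp: S_def Q v_def)
  have tr: "(\<integral>\<^sup>+z. F (z + w) \<partial>lborel) = (\<integral>\<^sup>+z. F z \<partial>lborel)" if [measurable]: "F \<in> borel_measurable borel" for F and w :: pt
  proof -
    have "(\<integral>\<^sup>+z. F z \<partial>lborel) = (\<integral>\<^sup>+z. F z \<partial>distr lborel borel ((+) w))" by (simp add: lborel_distr_plus)
    also have "\<dots> = (\<integral>\<^sup>+z. F (w + z) \<partial>lborel)" by (rule nn_integral_distr) auto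
    finally show ?thesis by (simp add: add.commute)
  qed
  let ?GR = "\<integral>\<^sup>+z. indicator R z * ennreal (grad_sq \<Psi> z) \<partial>lborel"
  let ?B = "\<integral>\<^sup>+s. indicator {e..3*e} s * ennreal ((\<Psi> (s, \<gamma> s))\<^sup>2) \<partial>lborel"
  \<comment> \<open>Bound for the height of \<open>S\<close>: there the graph is at most
    \<open>3 * L * e\<close>, as \<open>\<gamma> 0 = 0\<close>, and the floor is at
    \<open>- (K + 2 * L) * e\<close>.\<close>
  define ell where "ell = (K + 5 * L) * e"
  have ell: "ell \<ge> 0" using L \<open>e > 0\<close> \<open>K \<ge> 0\<close> by (simp add: ell_def)
  have leg1: "(\<integral>\<^sup>+z. indicator Q z * ennreal ((\<Psi> z)\<^sup>2) \<partial>lborel) \<le>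
     2 * (\<integral>\<^sup>+z. indicator S z * ennreal ((\<Psi> z)\<^sup>2) \<partial>lborel) + 2 * (ennreal ((norm v)\<^sup>2) * ?GR)"
  proof -
    have m1: "(\<lambda>x. indicator Q (fst x) * (indicator {0..<1} (snd x) * ennreal (grad_sq \<Psi> (fst x + snd x *\<^sub>R v)))) \<in> borel_measurable (lborel \<Otimes>\<^sub>M lborel)"
    proof -
      have "(\<lambda>x::pt\<times>real. fst x + snd x *\<^sub>R v) \<in> borel_measurable borel"
        by (intro borel_measurable_continuous_onI continuous_intros)
      then have "(\<lambda>x::pt\<times>real. fst x + snd x *\<^sub>R v) \<in> borel_measurable (lborel \<Otimes>\<^sub>M lborel)" by (simp add: lborel_prod)
      from measurable_compose[OF this grad_sq_measurable[OF \<Psi>]] show ?thesis by measurable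
    qed
    have inn: "(\<lambda>z. \<integral>\<^sup>+t. indicator {0..<1} t * ennreal (grad_sq \<Psi> (z + t *\<^sub>R v)) \<partial>lborel) \<in> borel_measurable borel"
    proof -
      have "(\<lambda>x::pt\<times>real. fst x + snd x *\<^sub>R v) \<in> borel_measurable borel"
        by (intro borel_measurable_continuous_onI continuous_intros)
      then have "(\<lambda>x::pt\<times>real. fst x + snd x *\<^sub>R v) \<in> borel_measurable (borel \<Otimes>\<^sub>M lborel)" by (simp add: borel_prod measurable_cong_sets[OF sets_pair_measure_cong[OF refl sets_lborel] refl])
      from measurable_compose[OF this grad_sq_measurable[OF \<Psi>]]
      have "(\<lambda>x. indicator {0..<1} (snd x) * ennreal (grad_sq \<Psi> (fst x + snd x *\<^sub>R v))) \<in> borel_measurable (borel \<Otimes>\<^sub>M lborel)" by measurable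
      from lborel.borel_measurable_nn_integral_fst[OF this] show ?thesis by simp
    qed
    have "(\<integral>\<^sup>+z. indicator Q z * ennreal ((\<Psi> z)\<^sup>2) \<partial>lborel) \<le> (\<integral>\<^sup>+z. 2 * (indicator Q z * ennreal ((\<Psi> (z + v))\<^sup>2)) +
        2 * (ennreal ((norm v)\<^sup>2) * (indicator Q z * (\<integral>\<^sup>+t. indicator {0..<1} t * ennreal (grad_sq \<Psi> (z + t *\<^sub>R v)) \<partial>lborel))) \<partial>lborel)"
    proof (rule nn_integral_mono)
      fix z :: pt
      have "ennreal ((\<Psi> z)\<^sup>2) \<le> 2 * ennreal ((\<Psi> (z + v))\<^sup>2) + 2 * ennreal ((\<Psi> (z + v) - \<Psi> z)\<^sup>2)" by (rule square_le_ennreal)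
      also have "\<dots> \<le> 2 * ennreal ((\<Psi> (z + v))\<^sup>2) + 2 * (ennreal ((norm v)\<^sup>2) * (\<integral>\<^sup>+t. indicator {0..<1} t * ennreal (grad_sq \<Psi> (z + t *\<^sub>R v)) \<partial>lborel))"
        by (intro add_mono mult_left_mono smooth_segment_bound \<Psi>) auto
      finally show "indicator Q z * ennreal ((\<Psi> z)\<^sup>2) \<le> 2 * (indicator Q z * ennreal ((\<Psi> (z + v))\<^sup>2)) +
        2 * (ennreal ((norm v)\<^sup>2) * (indicator Q z * (\<integral>\<^sup>+t. indicator {0..<1} t * ennreal (grad_sq \<Psi> (z + t *\<^sub>R v)) \<partial>lborel)))"
        by (auto simp: indicator_def)
    qed
    also have "\<dots> = 2 * (\<integral>\<^sup>+z. indicator Q z * ennreal ((\<Psi> (z + v))\<^sup>2) \<partial>lborel) + 2 * (ennreal ((norm v)\<^sup>2) *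
       (\<integral>\<^sup>+z. indicator Q z * (\<integral>\<^sup>+t. indicator {0..<1} t * ennreal (grad_sq \<Psi> (z + t *\<^sub>R v)) \<partial>lborel) \<partial>lborel))"
      using inn by (subst nn_integral_add) (simp_all add: nn_integral_cmult)
    also have "(\<integral>\<^sup>+z. indicator Q z * ennreal ((\<Psi> (z + v))\<^sup>2) \<partial>lborel) \<le> (\<integral>\<^sup>+z. indicator S (z + v) * ennreal ((\<Psi> (z + v))\<^sup>2) \<partial>lborel)"
      by (rule nn_integral_mono) (use QS in \<open>auto simp: indicator_def\<close>)
    also have "\<dots> = (\<integral>\<^sup>+z. indicator S z * ennreal ((\<Psi> z)\<^sup>2) \<partial>lborel)" by (rule tr) measurable
    also have "(\<integral>\<^sup>+z. indicator Q z * (\<integral>\<^sup>+t. indicator {0..<1} t * ennreal (grad_sq \<Psi> (z + t *\<^sub>R v)) \<partial>lborel) \<partial>lborel) =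
       (\<integral>\<^sup>+z. \<integral>\<^sup>+t. indicator Q z * (indicator {0..<1} t * ennreal (grad_sq \<Psi> (z + t *\<^sub>R v))) \<partial>lborel \<partial>lborel)"
      by (rule nn_integral_cong) (auto simp: indicator_def)
    \<comment> \<open>With the integrals exchanged, each slice in \<open>t\<close> is a translate of
      \<open>Q\<close> that stays inside \<open>R\<close>; as translations preserve measure, the
      average along the segments is bounded by the integral over \<open>R\<close>.\<close>
    also have "\<dots> = (\<integral>\<^sup>+t. \<integral>\<^sup>+z. indicator Q z * (indicator {0..<1} t * ennreal (grad_sq \<Psi> (z + t *\<^sub>R v))) \<partial>lborel \<partial>lborel)"
      using lborel_pair.Fubini[OF m1] by simp
    also have "\<dots> \<le> (\<integral>\<^sup>+t. indicator {0..<1} t * ?GR \<partial>(lborel :: real measure))"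
    proof (rule nn_integral_mono)
      fix t :: real
      have "(\<integral>\<^sup>+z. indicator Q z * (indicator {0..<1} t * ennreal (grad_sq \<Psi> (z + t *\<^sub>R v))) \<partial>lborel) \<le>
         (\<integral>\<^sup>+z. indicator {0..<1} t * (indicator R (z + t *\<^sub>R v) * ennreal (grad_sq \<Psi> (z + t *\<^sub>R v))) \<partial>lborel)"
        by (rule nn_integral_mono) (use QR in \<open>auto simp: indicator_def\<close>)
      also have "\<dots> = (\<integral>\<^sup>+z. indicator {0..<1} t * (indicator R z * ennreal (grad_sq \<Psi> z)) \<partial>lborel)" by (rule tr) measurable
      also have "\<dots> = indicator {0..<1} t * ?GR" by (rule nn_integral_cmult) measurable
      finally show "(\<integral>\<^sup>+z. indicator Q z * (indicator {0..<1} t * ennreal (grad_sq \<Psi> (z + t *\<^sub>R v))) \<partial>lborel) \<le> indicator {0..<1} t * ?GR" .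
    qed
    also have "\<dots> = ?GR" by (subst nn_integral_multc) auto
    finally show ?thesis by (simp add: add_mono mult_left_mono)
  qed
  have leg2: "(\<integral>\<^sup>+z. indicator S z * ennreal ((\<Psi> z)\<^sup>2) \<partial>lborel) \<le> ennreal (2 * ell) * ?B + ennreal (2 * ell\<^sup>2) * ?GR"
  \<comment> \<open>Straight up: for \<open>(s, \<tau>)\<close> in \<open>S\<close> the value
    differs from that on the graph by at most the gradient energy \<open>J s\<close> of the column
    over \<open>s\<close>, weighted with \<open>ell\<close>. Integrating over the column height
    yields the second factor \<open>ell\<close>.\<close>
  proof -
    define J where "J = (\<lambda>s. \<integral>\<^sup>+y. indicator R (s, y) * ennreal (grad_sq \<Psi> (s, y)) \<partial>lborel)"
    have [measurable]: "J \<in> borel_measurable borel"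
    proof -
      have "(\<lambda>z. indicator R z * ennreal (grad_sq \<Psi> z)) \<in> borel_measurable (borel \<Otimes>\<^sub>M borel :: pt measure)"
        unfolding borel_prod by measurable
      then have "(\<lambda>z. indicator R z * ennreal (grad_sq \<Psi> z)) \<in> borel_measurable (borel \<Otimes>\<^sub>M lborel :: pt measure)"
        by (simp add: measurable_cong_sets[OF sets_pair_measure_cong[OF refl sets_lborel] refl])
      from lborel.borel_measurable_nn_integral_fst[OF this] show ?thesis by (simp add: J_def)
    qed
    have bnd: "\<gamma> s + (K + 2 * L) * e \<le> ell" if "e \<le> s" "s \<le> 3 * e" for s
    proof -
      have "\<gamma> s \<le> L * s" using \<gamma>L[of s 0] \<gamma>0 that \<open>e > 0\<close> by simp
      also have "\<dots> \<le> L * (3 * e)" using that L by (intro mult_left_mono) auto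
      finally show ?thesis by (simp add: ell_def algebra_simps)
    qed
    have up: "ennreal ((\<Psi> (s, \<tau>))\<^sup>2) \<le> 2 * ennreal ((\<Psi> (s, \<gamma> s))\<^sup>2) + 2 * (ennreal ell * J s)" if "(s, \<tau>) \<in> S" for s \<tau>
    proof -
      have st: "e \<le> s" "s \<le> 3 * e" "- (K + 2 * L) * e \<le> \<tau>" "\<tau> < \<gamma> s" using that by (auto simp: S_def R)
      have len: "\<gamma> s - \<tau> \<le> ell" using bnd[OF st(1,2)] st(3) by (simp add: algebra_simps)
      have "ennreal ((\<Psi> (s, \<gamma> s) - \<Psi> (s, \<tau>))\<^sup>2) \<le> ennreal (\<gamma> s - \<tau>) * (\<integral>\<^sup>+y. indicator {\<tau>..<\<gamma> s} y * ennreal ((pd e_x \<Psi> (s, y))\<^sup>2) \<partial>lborel)"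
        by (rule square_increment_le) (use st in \<open>auto intro!: smooth_DERIV_snd \<Psi> isCont_o2[OF _ smooth_isCont] smooth_intros\<close>)
      also have "\<dots> \<le> ennreal ell * J s"
        unfolding J_def using len st \<open>e > 0\<close>
        by (intro mult_mono ennreal_leI nn_integral_mono) (auto simp: indicator_def R grad_sq_def intro!: ennreal_leI)
      finally have d: "ennreal ((\<Psi> (s, \<gamma> s) - \<Psi> (s, \<tau>))\<^sup>2) \<le> ennreal ell * J s" .
      show ?thesis
        by (rule order.trans[OF square_le_ennreal[of _ "\<Psi> (s, \<gamma> s)"]]) (intro add_left_mono mult_left_mono d zero_le)
    qed
    have "(\<integral>\<^sup>+z. indicator S z * ennreal ((\<Psi> z)\<^sup>2) \<partial>lborel) = (\<integral>\<^sup>+s. \<integral>\<^sup>+\<tau>. indicator S (s, \<tau>) * ennreal ((\<Psi> (s, \<tau>))\<^sup>2) \<partial>lborel \<partial>lborel)"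
      by (rule nn_integral_plane(1)) measurable
    also have "\<dots> \<le> (\<integral>\<^sup>+s. indicator {e..3*e} s * ((2 * ennreal ((\<Psi> (s, \<gamma> s))\<^sup>2) + 2 * (ennreal ell * J s)) * ennreal ell) \<partial>lborel)"
    proof (rule nn_integral_mono)
      fix s :: real
      show "(\<integral>\<^sup>+\<tau>. indicator S (s, \<tau>) * ennreal ((\<Psi> (s, \<tau>))\<^sup>2) \<partial>lborel) \<le> indicator {e..3*e} s * ((2 * ennreal ((\<Psi> (s, \<gamma> s))\<^sup>2) + 2 * (ennreal ell * J s)) * ennreal ell)"
      proof (cases "s \<in> {e..3*e}")
        case True
        let ?W = "2 * ennreal ((\<Psi> (s, \<gamma> s))\<^sup>2) + 2 * (ennreal ell * J s)"
        have "(\<integral>\<^sup>+\<tau>. indicator S (s, \<tau>) * ennreal ((\<Psi> (s, \<tau>))\<^sup>2) \<partial>lborel) \<le> (\<integral>\<^sup>+\<tau>. ?W * indicator {- (K + 2 * L) * e..\<gamma> s} \<tau> \<partial>lborel)"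
        proof (rule nn_integral_mono)
          fix \<tau> :: real
          show "indicator S (s, \<tau>) * ennreal ((\<Psi> (s, \<tau>))\<^sup>2) \<le> ?W * indicator {- (K + 2 * L) * e..\<gamma> s} \<tau>"
          proof (cases "(s, \<tau>) \<in> S")
            case True
            then have "\<tau> \<in> {- (K + 2 * L) * e..\<gamma> s}" by (auto simp: S_def R)
            then show ?thesis using up[OF True] True by simp
          qed simp
        qed
        also have "\<dots> = ?W * emeasure lborel {- (K + 2 * L) * e..\<gamma> s}"
          by (rule nn_integral_cmult_indicator) simp
        also have "\<dots> \<le> ?W * ennreal ell"
        proof (rule mult_left_mono)
          have "\<gamma> s - (- (K + 2 * L) * e) \<le> ell" using bnd[of s] True by (simp add: algebra_simps)
          then show "emeasure lborel {- (K + 2 * L) * e..\<gamma> s} \<le> ennreal ell"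
            unfolding emeasure_lborel_Icc_eq by (auto intro: ennreal_leI)
        qed simp
        finally show ?thesis using True by simp
      qed (auto simp: S_def R indicator_def)
    qed
    also have "\<dots> \<le> (\<integral>\<^sup>+s. ennreal (2 * ell) * (indicator {e..3*e} s * ennreal ((\<Psi> (s, \<gamma> s))\<^sup>2)) + ennreal (2 * ell\<^sup>2) * J s \<partial>lborel)"
    proof (rule nn_integral_mono)
      fix s :: real
      have "(2 * ennreal ((\<Psi> (s, \<gamma> s))\<^sup>2) + 2 * (ennreal ell * J s)) * ennreal ell = ennreal (2 * ell) * ennreal ((\<Psi> (s, \<gamma> s))\<^sup>2) + ennreal (2 * ell\<^sup>2) * J s"
        using ell by (simp add: ennreal_mult' power2_eq_square algebra_simps)
      then show "indicator {e..3*e} s * ((2 * ennreal ((\<Psi> (s, \<gamma> s))\<^sup>2) + 2 * (ennreal ell * J s)) * ennreal ell) \<le> ennreal (2 * ell) * (indicator {e..3*e} s * ennreal ((\<Psi> (s, \<gamma> s))\<^sup>2)) + ennreal (2 * ell\<^sup>2) * J s"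
        by (auto simp: indicator_def)
    qed
    also have "\<dots> = ennreal (2 * ell) * ?B + ennreal (2 * ell\<^sup>2) * (\<integral>\<^sup>+s. J s \<partial>lborel)"
    proof -
      have c: "(\<lambda>s. \<Psi> (s, \<gamma> s)) \<in> borel_measurable borel"
        by measurable
      show ?thesis using c by (subst nn_integral_add) (simp_all add: nn_integral_cmult)
    qed
    also have "(\<integral>\<^sup>+s. J s \<partial>lborel) = ?GR" unfolding J_def by (rule nn_integral_plane(1)[symmetric]) measurable
    finally show ?thesis .
  qed
  have "(\<integral>\<^sup>+z. indicator Q z * ennreal ((\<Psi> z)\<^sup>2) \<partial>lborel) \<le>
     2 * (ennreal (2 * ell) * ?B + ennreal (2 * ell\<^sup>2) * ?GR) + 2 * (ennreal ((norm v)\<^sup>2) * ?GR)"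
    using leg1 leg2 by (meson add_mono order.refl order.trans mult_left_mono zero_le)
  also have "\<dots> = ennreal (4 * ell\<^sup>2 + 2 * (norm v)\<^sup>2) * ?GR + ennreal (4 * ell) * ?B"
  proof -
    have "ennreal (4 * ell\<^sup>2 + 2 * (norm v)\<^sup>2) = 2 * ennreal (2 * ell\<^sup>2) + 2 * ennreal ((norm v)\<^sup>2)"
      "ennreal (4 * ell) = 2 * ennreal (2 * ell)"
      using ell by (simp_all add: ennreal_plus ennreal_mult' mult.assoc[symmetric])
    then show ?thesis by (simp add: algebra_simps)
  qed
  also have "4 * ell\<^sup>2 + 2 * (norm v)\<^sup>2 = (4 * (K + 5 * L)\<^sup>2 + 8 * (1 + L\<^sup>2)) * e\<^sup>2"
    by (simp only: nv ell_def power_mult_distrib) (simp add: algebra_simps)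
  also have "4 * ell = 4 * (K + 5 * L) * e" by (simp add: ell_def)
  finally show ?thesis .
qed

section \<open>Square-integrable functions and weak derivatives\<close>

lemma integral_lebesgue_on_borel:
  fixes F :: "pt \<Rightarrow> real"
  assumes "open \<Omega>" and [measurable]: "F \<in> borel_measurable borel"
  shows "(LINT p|lebesgue_on \<Omega>. F p) = (\<integral>p. indicator \<Omega> p * F p \<partial>lborel)"
proof -
  have [measurable]: "\<Omega> \<in> sets borel" using assms(1) by simp
  have "(LINT p|lebesgue_on \<Omega>. F p) = (\<integral>p. indicator \<Omega> p *\<^sub>R F p \<partial>lebesgue)"
    by (rule integral_restrict_space) simp
  also have "\<dots> = (\<integral>p. indicator \<Omega> p *\<^sub>R F p \<partial>lborel)"
    by (rule integral_completion) simp
  finally show ?thesis by simp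
qed

lemma nn_integral_lebesgue_on_borel:
  fixes F :: "pt \<Rightarrow> ennreal"
  assumes "open \<Omega>" and [measurable]: "F \<in> borel_measurable borel"
  shows "(\<integral>\<^sup>+p. F p \<partial>lebesgue_on \<Omega>) = (\<integral>\<^sup>+p. indicator \<Omega> p * F p \<partial>lborel)"
proof -
  have [measurable]: "\<Omega> \<in> sets borel" using assms(1) by simp
  have "(\<integral>\<^sup>+p. F p \<partial>lebesgue_on \<Omega>) = (\<integral>\<^sup>+p. F p * indicator \<Omega> p \<partial>lebesgue)"
    by (rule nn_integral_restrict_space) simp
  also have "\<dots> = (\<integral>\<^sup>+p. indicator \<Omega> p * F p \<partial>lborel)"
    by (simp add: nn_integral_completion mult.commute)
  finally show ?thesis .
qed

lemma borel_measurable_lebesgue_on: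
  "F \<in> borel_measurable borel \<Longrightarrow> F \<in> borel_measurable (lebesgue_on S)"
  for F :: "pt \<Rightarrow> 'b::topological_space"
  by (intro measurable_restrict_space1 measurable_completion) simp

section \<open>Square-integrable functions: Cauchy-Schwarz, weighted products, convergence\<close>

lemma L2_measurable: "u \<in> L2 M \<Longrightarrow> u \<in> borel_measurable M"
  and L2_integrable: "u \<in> L2 M \<Longrightarrow> integrable M (\<lambda>p. (u p)\<^sup>2)"
  by (auto simp: L2_def)

lemma L2_mult_integrable:
  assumes "u \<in> L2 M" "w \<in> L2 M" shows "integrable M (\<lambda>p. u p * w p)"
proof (rule Bochner_Integration.integrable_bound)
  show "integrable M (\<lambda>p. (u p)\<^sup>2 + (w p)\<^sup>2)" using assms by (simp add: L2_integrable)
  show "(\<lambda>p. u p * w p) \<in> borel_measurable M" using assms L2_measurable by (intro borel_measurable_times)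
  have "\<bar>x * y\<bar> \<le> x\<^sup>2 + y\<^sup>2" for x y :: real
  proof -
    have "0 \<le> (\<bar>x\<bar> - \<bar>y\<bar>)\<^sup>2" by simp
    then have "2 * \<bar>x * y\<bar> \<le> x\<^sup>2 + y\<^sup>2" by (simp add: power2_diff abs_mult)
    then show ?thesis using abs_ge_zero[of "x * y"] by linarith
  qed
  then show "AE p in M. norm (u p * w p) \<le> norm ((u p)\<^sup>2 + (w p)\<^sup>2)" by simp
qed

lemma L2_lincomb:
  assumes "u \<in> L2 M" "w \<in> L2 M" shows "(\<lambda>p. u p + c * w p) \<in> L2 M"
proof -
  have "integrable M (\<lambda>p. (u p)\<^sup>2 + 2 * c * (u p * w p) + c\<^sup>2 * (w p)\<^sup>2)"
    using assms by (simp add: L2_integrable L2_mult_integrable)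
  moreover have "(\<lambda>p. (u p)\<^sup>2 + 2 * c * (u p * w p) + c\<^sup>2 * (w p)\<^sup>2) = (\<lambda>p. (u p + c * w p)\<^sup>2)"
    by (simp add: power2_eq_square algebra_simps)
  ultimately show ?thesis using assms by (auto simp: L2_def)
qed

lemma L2_add: "u \<in> L2 M \<Longrightarrow> w \<in> L2 M \<Longrightarrow> (\<lambda>p. u p + w p) \<in> L2 M"
  using L2_lincomb[of u M w 1] by simp

lemma L2_diff: "u \<in> L2 M \<Longrightarrow> w \<in> L2 M \<Longrightarrow> (\<lambda>p. u p - w p) \<in> L2 M"
  using L2_lincomb[of u M w "-1"] by simp

lemma L2_zero: "(\<lambda>p. 0) \<in> L2 M"
  by (simp add: L2_def)

lemma L2_uminus: "u \<in> L2 M \<Longrightarrow> (\<lambda>p. - u p) \<in> L2 M"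
  by (simp add: L2_def)

lemma L2_abs: "u \<in> L2 M \<Longrightarrow> (\<lambda>p. \<bar>u p\<bar>) \<in> L2 M"
  by (auto simp: L2_def)

lemma L2_cong_AE:
  assumes "u \<in> L2 M" "w \<in> borel_measurable M" "AE p in M. u p = w p"
  shows "w \<in> L2 M"
proof -
  have "integrable M (\<lambda>p. (w p)\<^sup>2)"
    by (rule integrable_cong_AE_imp[OF L2_integrable[OF assms(1)]]) (use assms in \<open>auto elim: eventually_mono\<close>)
  then show ?thesis using assms(2) by (simp add: L2_def)
qed

lemma discriminant_le:
  fixes a b c :: real
  assumes "\<And>t. 0 \<le> a + 2 * t * b + t\<^sup>2 * c" "0 \<le> c"
  shows "b\<^sup>2 \<le> a * c"
proof (cases "c = 0")
  case True
  have "b = 0"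
  proof (rule ccontr)
    assume "b \<noteq> 0"
    \<comment> \<open>For \<open>c = 0\<close> the expression is affine in \<open>t\<close>, and
      this \<open>t\<close> makes it equal to -1.\<close>
    then show False using assms(1)[of "- (a + 1) / (2 * b)"] True by (simp add: field_simps)
  qed
  then show ?thesis using True by simp
next
  case False
  then have "c > 0" using assms(2) by simp
  then show ?thesis using assms(1)[of "- b / c"] by (simp add: field_simps power2_eq_square)
qed

definition n2 :: "'a measure \<Rightarrow> ('a \<Rightarrow> real) \<Rightarrow> real" where
  "n2 M u = sqrt (\<integral>p. (u p)\<^sup>2 \<partial>M)"

lemma n2_nonneg [simp]: "0 \<le> n2 M u"
  by (simp add: n2_def)

lemma n2_sq: "(n2 M u)\<^sup>2 = (\<integral>p. (u p)\<^sup>2 \<partial>M)"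
  by (simp add: n2_def)

lemma L2_Cauchy_Schwarz:
  assumes u: "u \<in> L2 M" and w: "w \<in> L2 M"
  shows "\<bar>\<integral>p. u p * w p \<partial>M\<bar> \<le> n2 M u * n2 M w"
proof -
  have "0 \<le> (\<integral>p. (u p)\<^sup>2 \<partial>M) + 2 * t * (\<integral>p. u p * w p \<partial>M) + t\<^sup>2 * (\<integral>p. (w p)\<^sup>2 \<partial>M)" for t
  proof -
    have "0 \<le> (\<integral>p. (u p + t * w p)\<^sup>2 \<partial>M)" by simp
    also have "\<dots> = (\<integral>p. (u p)\<^sup>2 + 2 * t * (u p * w p) + t\<^sup>2 * (w p)\<^sup>2 \<partial>M)"
      by (rule Bochner_Integration.integral_cong) (auto simp: power2_eq_square algebra_simps)
    also have "\<dots> = (\<integral>p. (u p)\<^sup>2 \<partial>M) + 2 * t * (\<integral>p. u p * w p \<partial>M) + t\<^sup>2 * (\<integral>p. (w p)\<^sup>2 \<partial>M)"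
      using u w by (simp add: L2_integrable L2_mult_integrable)
    finally show ?thesis .
  qed
  then have "(\<integral>p. u p * w p \<partial>M)\<^sup>2 \<le> (\<integral>p. (u p)\<^sup>2 \<partial>M) * (\<integral>p. (w p)\<^sup>2 \<partial>M)" by (rule discriminant_le) simp
  then have "sqrt ((\<integral>p. u p * w p \<partial>M)\<^sup>2) \<le> sqrt ((\<integral>p. (u p)\<^sup>2 \<partial>M) * (\<integral>p. (w p)\<^sup>2 \<partial>M))" by (rule real_sqrt_le_mono)
  then show ?thesis by (simp add: n2_def real_sqrt_mult)
qed

lemma L2_weighted_bound:
  assumes u: "u \<in> L2 M" and w: "w \<in> L2 M" and k: "k \<in> borel_measurable M" and B: "\<And>p. p \<in> space M \<Longrightarrow> \<bar>k p\<bar> \<le> B"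
  shows "integrable M (\<lambda>p. k p * u p * w p)"
    and "0 \<le> B \<Longrightarrow> \<bar>\<integral>p. k p * u p * w p \<partial>M\<bar> \<le> B * (n2 M u * n2 M w)"
proof -
  have b: "norm (k p * u p * w p) \<le> B * (\<bar>u p\<bar> * \<bar>w p\<bar>)" if "p \<in> space M" for p
    using B[OF that] by (simp add: abs_mult mult.assoc mult_right_mono)
  have i: "integrable M (\<lambda>p. B * (\<bar>u p\<bar> * \<bar>w p\<bar>))"
    using L2_mult_integrable[OF L2_abs[OF u] L2_abs[OF w]] by simp
  show i2: "integrable M (\<lambda>p. k p * u p * w p)"
  proof (rule Bochner_Integration.integrable_bound[OF i])
    show "(\<lambda>p. k p * u p * w p) \<in> borel_measurable M"
      using k L2_measurable[OF u] L2_measurable[OF w] by measurable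
    show "AE p in M. norm (k p * u p * w p) \<le> norm (B * (\<bar>u p\<bar> * \<bar>w p\<bar>))"
      using b by (intro AE_I2) fastforce
  qed
  assume "0 \<le> B"
  have "\<bar>\<integral>p. k p * u p * w p \<partial>M\<bar> \<le> (\<integral>p. B * (\<bar>u p\<bar> * \<bar>w p\<bar>) \<partial>M)"
  proof -
    have "\<bar>\<integral>p. k p * u p * w p \<partial>M\<bar> \<le> (\<integral>p. norm (k p * u p * w p) \<partial>M)"
      using integral_norm_bound[of M "\<lambda>p. k p * u p * w p"] by simp
    also have "\<dots> \<le> (\<integral>p. B * (\<bar>u p\<bar> * \<bar>w p\<bar>) \<partial>M)"
      by (rule integral_mono[OF integrable_norm[OF i2] i b])
    finally show ?thesis .
  qed
  also have "\<dots> = B * (\<integral>p. \<bar>u p\<bar> * \<bar>w p\<bar> \<partial>M)" by simp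
  also have "\<dots> \<le> B * (n2 M u * n2 M w)"
    using L2_Cauchy_Schwarz[OF L2_abs[OF u] L2_abs[OF w]] \<open>0 \<le> B\<close> by (intro mult_left_mono) (auto simp: n2_def)
  finally show "\<bar>\<integral>p. k p * u p * w p \<partial>M\<bar> \<le> B * (n2 M u * n2 M w)" .
qed

text \<open>Membership of the limit and of all terms is included because the Bochner integral of a
  non-integrable function is 0 by convention, so a small \<open>n2\<close> alone would mean
  nothing.\<close>

definition l2conv :: "'a measure \<Rightarrow> (nat \<Rightarrow> 'a \<Rightarrow> real) \<Rightarrow> ('a \<Rightarrow> real) \<Rightarrow> bool" where
  "l2conv M F f \<longleftrightarrow> f \<in> L2 M \<and> (\<forall>n. F n \<in> L2 M) \<and> (\<lambda>n. n2 M (\<lambda>p. F n p - f p)) \<longlonglongrightarrow> 0"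

lemma l2conv_const: "f \<in> L2 M \<Longrightarrow> l2conv M (\<lambda>n. f) f"
  by (simp add: l2conv_def n2_def)

text \<open>With \<open>dF = F n - f\<close> and \<open>dG = G n - g\<close>, the difference
  \<open>F n * G n - f * g\<close> is \<open>dF * dG + dF * g + f * dG\<close>; each summand has a
  factor tending to 0, and the bounded weight does no harm.\<close>

lemma l2conv_integral:
  assumes F: "l2conv M F f" and G: "l2conv M G g" and k: "k \<in> borel_measurable M" and B: "\<And>p. p \<in> space M \<Longrightarrow> \<bar>k p\<bar> \<le> B"
  shows "(\<lambda>n. \<integral>p. k p * F n p * G n p \<partial>M) \<longlonglongrightarrow> (\<integral>p. k p * f p * g p \<partial>M)"
proof -
  define B' where "B' = max B 0"
  have B': "\<bar>k p\<bar> \<le> B'" if "p \<in> space M" for p using B[OF that] by (simp add: B'_def)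
  have B0: "0 \<le> B'" by (simp add: B'_def)
  have f: "f \<in> L2 M" "\<And>n. F n \<in> L2 M" and g: "g \<in> L2 M" "\<And>n. G n \<in> L2 M" using F G by (auto simp: l2conv_def)
  define dF dG where "dF = (\<lambda>n p. F n p - f p)" and "dG = (\<lambda>n p. G n p - g p)"
  have d: "dF n \<in> L2 M" "dG n \<in> L2 M" for n unfolding dF_def dG_def using f g by (auto intro: L2_diff)
  note wb = L2_weighted_bound[OF _ _ k B']
  have bnd: "norm ((\<integral>p. k p * F n p * G n p \<partial>M) - (\<integral>p. k p * f p * g p \<partial>M)) \<le>
    B' * (n2 M (dF n) * n2 M (dG n)) + B' * (n2 M (dF n) * n2 M g) + B' * (n2 M f * n2 M (dG n))" for n
  proof -
    have "(\<integral>p. k p * F n p * G n p \<partial>M) - (\<integral>p. k p * f p * g p \<partial>M) = (\<integral>p. k p * F n p * G n p - k p * f p * g p \<partial>M)"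
      using wb(1) f g by simp
    also have "\<dots> = (\<integral>p. k p * dF n p * dG n p + k p * dF n p * g p + k p * f p * dG n p \<partial>M)"
      by (rule Bochner_Integration.integral_cong) (auto simp: dF_def dG_def algebra_simps)
    also have "\<dots> = (\<integral>p. k p * dF n p * dG n p \<partial>M) + (\<integral>p. k p * dF n p * g p \<partial>M) + (\<integral>p. k p * f p * dG n p \<partial>M)"
      using wb(1) f g d by simp
    finally show ?thesis
      using wb(2)[OF d(1)[of n] d(2)[of n]] wb(2)[OF d(1)[of n] g(1)] wb(2)[OF f(1) d(2)[of n]] B0 by simp
  qed
  have "(\<lambda>n. B' * (n2 M (dF n) * n2 M (dG n)) + B' * (n2 M (dF n) * n2 M g) + B' * (n2 M f * n2 M (dG n))) \<longlonglongrightarrow>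
     B' * (0 * 0) + B' * (0 * n2 M g) + B' * (n2 M f * 0)"
    using F G unfolding l2conv_def dF_def dG_def by (intro tendsto_intros) auto
  then have b0: "(\<lambda>n. B' * (n2 M (dF n) * n2 M (dG n)) + B' * (n2 M (dF n) * n2 M g) + B' * (n2 M f * n2 M (dG n))) \<longlonglongrightarrow> 0"
    by simp
  have "(\<lambda>n. (\<integral>p. k p * F n p * G n p \<partial>M) - (\<integral>p. k p * f p * g p \<partial>M)) \<longlonglongrightarrow> 0"
    by (rule Lim_null_comparison[OF always_eventually b0]) (use bnd in blast)
  then show ?thesis by (simp add: LIM_zero_iff)
qed

lemma smooth_bounded_on:
  assumes "smooth \<Phi>" "bounded \<Omega>"
  obtains B where "B > 0" "\<And>p. p \<in> \<Omega> \<Longrightarrow> \<bar>\<Phi> p\<bar> \<le> B"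
proof -
  have "bounded (\<Phi> ` closure \<Omega>)"
    using assms by (intro compact_imp_bounded compact_continuous_image smooth_continuous) (auto simp: compact_closure)
  then obtain B where "B > 0" "\<And>p. p \<in> closure \<Omega> \<Longrightarrow> \<bar>\<Phi> p\<bar> \<le> B" unfolding bounded_pos by auto
  then show ?thesis using that closure_subset by blast
qed

lemma finite_measure_lebesgue_on:
  assumes "open \<Omega>" "bounded \<Omega>" shows "finite_measure (lebesgue_on \<Omega>)"
proof (rule finite_measureI)
  have "\<Omega> \<in> lmeasurable" using assms by (simp add: lmeasurable_open)
  then show "emeasure (lebesgue_on \<Omega>) (space (lebesgue_on \<Omega>)) \<noteq> \<infinity>"
    by (auto simp: emeasure_restrict_space fmeasurable_def space_restrict_space top.not_eq_extremum simp del: emeasure_completion)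
qed

lemma smooth_L2:
  assumes "smooth \<Phi>" "open \<Omega>" "bounded \<Omega>" shows "\<Phi> \<in> L2 (lebesgue_on \<Omega>)"
proof -
  interpret finite_measure "lebesgue_on \<Omega>" by (rule finite_measure_lebesgue_on[OF assms(2,3)])
  have m: "\<Phi> \<in> borel_measurable (lebesgue_on \<Omega>)" by (rule borel_measurable_lebesgue_on[OF smooth_measurable[OF assms(1)]])
  obtain B where B: "B > 0" "\<And>p. p \<in> \<Omega> \<Longrightarrow> \<bar>\<Phi> p\<bar> \<le> B" using smooth_bounded_on assms by blast
  have "integrable (lebesgue_on \<Omega>) (\<lambda>p. (\<Phi> p)\<^sup>2)"
    by (rule integrable_const_bound[of _ "B\<^sup>2"]) (use B m in \<open>auto intro!: AE_I2 simp: abs_le_square_iff[symmetric]\<close>)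
  then show ?thesis using m by (simp add: L2_def)
qed

lemma L2_locally_integrable:
  assumes "u \<in> L2 (lebesgue_on \<Omega>)" "open \<Omega>" "bounded \<Omega>" shows "locally_integrable \<Omega> u"
proof -
  have "integrable (lebesgue_on \<Omega>) (\<lambda>p. 1 * u p)"
    using L2_mult_integrable[OF smooth_L2[OF smooth_const assms(2,3), of 1] assms(1)] .
  then have "set_integrable lebesgue \<Omega> u"
    using assms(2) by (simp add: set_integrable_def integrable_restrict_space)
  then show ?thesis unfolding locally_integrable_def
    using assms(2) by (auto intro!: set_integrable_subset[of lebesgue \<Omega>] simp: compact_imp_closed)
qed

text \<open>Integrability on a compact set includes measurability there; countably many closed boxes
  exhaust the domain.\<close>

lemma locally_integrable_measurable:
  assumes "locally_integrable \<Omega> u" "open \<Omega>" shows "u \<in> borel_measurable (lebesgue_on \<Omega>)"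
proof -
  obtain D where D: "countable D" "D \<subseteq> Pow \<Omega>" "\<And>X. X \<in> D \<Longrightarrow> \<exists>a b. X = cbox a b" "\<Union>D = \<Omega>"
    using open_countable_Union_open_cbox[OF \<open>open \<Omega>\<close>] by metis
  show ?thesis
  proof (rule measurable_piecewise_restrict[OF D(1)])
    fix X assume X: "X \<in> D"
    then obtain a b where ab: "X = cbox a b" using D by blast
    have sub: "X \<subseteq> \<Omega>" using X D by blast
    have "set_integrable lebesgue X u" using assms(1) sub ab by (auto simp: locally_integrable_def)
    then have "integrable (lebesgue_on X) u" using ab by (simp add: set_integrable_def integrable_restrict_space)
    then have "u \<in> borel_measurable (lebesgue_on X)" by (rule borel_measurable_integrable)
    moreover have "restrict_space (lebesgue_on \<Omega>) X = lebesgue_on X"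
      using sub \<open>open \<Omega>\<close> ab by (subst restrict_restrict_space) (auto simp: inf.absorb2)
    ultimately show "u \<in> borel_measurable (restrict_space (lebesgue_on \<Omega>) X)" by simp
    show "X \<inter> space (lebesgue_on \<Omega>) \<in> sets (lebesgue_on \<Omega>)"
      using sub \<open>open \<Omega>\<close> ab by (auto simp: sets_restrict_space_iff inf.absorb1)
  qed (use D in auto)
qed

section \<open>Weak derivatives: linearity, uniqueness, agreement with derivatives of smooth
  functions\<close>

lemma test_functionsD:
  assumes "\<eta> \<in> test_functions \<Omega>"
  shows "smooth \<eta> \<and> (\<exists>K. compact K \<and> K \<subseteq> \<Omega> \<and> (\<forall>p. p \<notin> K \<longrightarrow> \<eta> p = 0))"
proof -
  have "\<eta> p = 0" if "p \<notin> closure {p. \<eta> p \<noteq> 0}" for p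
    using subsetD[OF closure_subset, of p "{p. \<eta> p \<noteq> 0}"] that by auto
  then show ?thesis using assms unfolding test_functions_def by blast
qed

lemma test_functions_pd:
  assumes "\<eta> \<in> test_functions \<Omega>" "e \<in> {e_t, e_x}" shows "pd e \<eta> \<in> test_functions \<Omega>"
proof -
  obtain K where K: "smooth \<eta>" "compact K" "K \<subseteq> \<Omega>" "\<And>p. p \<notin> K \<Longrightarrow> \<eta> p = 0" using test_functionsD[OF assms(1)] by blast
  have "pd e \<eta> p = 0" if "p \<notin> K" for p
    by (rule pd_eq_0_outside[OF compact_imp_closed[OF K(2)] K(4) that])
  then show ?thesis
    by (intro test_functionsI[OF smooth_pd[OF K(1) assms(2)] K(2,3)]) blast
qed

lemma test_functions_iterated_pd:
  assumes "\<eta> \<in> test_functions \<Omega>" shows "(pd e_t ^^ i) ((pd e_x ^^ j) \<eta>) \<in> test_functions \<Omega>"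
proof -
  have "(pd e_x ^^ j) \<eta> \<in> test_functions \<Omega>" by (induction j) (use assms test_functions_pd in auto)
  then show ?thesis by (induction i) (use test_functions_pd in auto)
qed

lemma locally_integrable_mult_test:
  assumes "locally_integrable \<Omega> u" "open \<Omega>" "\<eta> \<in> test_functions \<Omega>"
  shows "integrable (lebesgue_on \<Omega>) (\<lambda>p. u p * \<eta> p)"
proof -
  obtain K where K: "smooth \<eta>" "compact K" "K \<subseteq> \<Omega>" "\<And>p. p \<notin> K \<Longrightarrow> \<eta> p = 0" using test_functionsD[OF assms(3)] by blast
  obtain B where B: "B > 0" "\<And>p. \<bar>\<eta> p\<bar> \<le> B"
    using compact_support_bounded[OF smooth_continuous[OF K(1)] K(2) K(4)] by blast
  have "set_integrable lebesgue K u" using assms(1) K by (auto simp: locally_integrable_def)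
  then have i: "integrable lebesgue (\<lambda>p. indicator K p * u p)" by (simp add: set_integrable_def)
  have "integrable lebesgue (\<lambda>p. (indicator K p * u p) * \<eta> p)"
  proof (rule Bochner_Integration.integrable_bound)
    show "integrable lebesgue (\<lambda>p. B * (indicator K p * u p))" using i by simp
    show "(\<lambda>p. (indicator K p * u p) * \<eta> p) \<in> borel_measurable lebesgue"
      by (intro borel_measurable_times[OF borel_measurable_integrable[OF i]]) (simp add: measurable_completion smooth_measurable[OF K(1)])
    show "AE p in lebesgue. norm ((indicator K p * u p) * \<eta> p) \<le> norm (B * (indicator K p * u p))"
      using B by (auto intro!: AE_I2 simp: abs_mult mult.commute[of _ "\<bar>\<eta> _\<bar>"] intro!: mult_right_mono)
  qed
  moreover have "(\<lambda>p. (indicator K p * u p) * \<eta> p) = (\<lambda>p. indicator \<Omega> p *\<^sub>R (u p * \<eta> p))"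
    using K(3,4) by (intro ext) (auto simp: indicator_def)
  ultimately show ?thesis using assms(2) by (simp add: integrable_restrict_space)
qed

lemma locally_integrable_lincomb:
  assumes "locally_integrable \<Omega> u" "locally_integrable \<Omega> w"
  shows "locally_integrable \<Omega> (\<lambda>p. u p + c * w p)"
  using assms unfolding locally_integrable_def by (auto intro!: set_integral_add set_integrable_mult_right)

lemma l2ip_lincomb_test:
  assumes "locally_integrable \<Omega> u" "locally_integrable \<Omega> w" "open \<Omega>" "\<eta> \<in> test_functions \<Omega>"
  shows "l2ip \<Omega> (\<lambda>p. u p + c * w p) \<eta> = l2ip \<Omega> u \<eta> + c * l2ip \<Omega> w \<eta>"
  using locally_integrable_mult_test[OF assms(1,3,4)] locally_integrable_mult_test[OF assms(2,3,4)]
  by (simp add: l2ip_real distrib_right mult.assoc)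

lemma weak_deriv_lincomb:
  assumes "weak_deriv \<Omega> i j u1 w1" "weak_deriv \<Omega> i j u2 w2" "open \<Omega>"
  shows "weak_deriv \<Omega> i j (\<lambda>p. u1 p + c * u2 p) (\<lambda>p. w1 p + c * w2 p)"
  using assms unfolding weak_deriv_def
  by (auto simp: locally_integrable_lincomb l2ip_lincomb_test test_functions_iterated_pd algebra_simps)

lemma weak_deriv_unique:
  assumes "weak_deriv \<Omega> i j u w1" "weak_deriv \<Omega> i j u w2" "open \<Omega>"
  shows "AE p in lebesgue_on \<Omega>. w1 p = w2 p"
proof -
  have l: "locally_integrable \<Omega> w1" "locally_integrable \<Omega> w2" using assms by (auto simp: weak_deriv_def)
  have "AE p in lebesgue_on \<Omega>. w1 p + (-1) * w2 p = 0"
  proof (rule fundamental_lemma[OF \<open>open \<Omega>\<close> locally_integrable_lincomb[OF l]])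
    fix \<eta> assume \<eta>: "\<eta> \<in> test_functions \<Omega>"
    have "(-1) ^ (i + j) * l2ip \<Omega> w1 \<eta> = (-1) ^ (i + j) * l2ip \<Omega> w2 \<eta>"
      using assms(1,2) \<eta> unfolding weak_deriv_def by metis
    then have "l2ip \<Omega> w1 \<eta> = l2ip \<Omega> w2 \<eta>" by simp
    then show "l2ip \<Omega> (\<lambda>p. w1 p + (-1) * w2 p) \<eta> = 0"
      unfolding l2ip_lincomb_test[OF l \<open>open \<Omega>\<close> \<eta>] by simp
  qed
  then show ?thesis by simp
qed

lemma wD_weak_deriv: "weak_deriv \<Omega> i j u w \<Longrightarrow> weak_deriv \<Omega> i j u (wD \<Omega> i j u)"
  unfolding wD_def by (rule someI[of "weak_deriv \<Omega> i j u" w])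

lemma wD_AE: "weak_deriv \<Omega> i j u w \<Longrightarrow> open \<Omega> \<Longrightarrow> AE p in lebesgue_on \<Omega>. wD \<Omega> i j u p = w p"
  using weak_deriv_unique wD_weak_deriv by blast

lemma wD_L2: "weak_deriv \<Omega> i j u w \<Longrightarrow> w \<in> L2 (lebesgue_on \<Omega>) \<Longrightarrow> open \<Omega> \<Longrightarrow> wD \<Omega> i j u \<in> L2 (lebesgue_on \<Omega>)"
proof (rule L2_cong_AE[of w])
  assume a: "weak_deriv \<Omega> i j u w" "open \<Omega>"
  show "AE p in lebesgue_on \<Omega>. w p = wD \<Omega> i j u p" using wD_AE[OF a] by (auto elim: eventually_mono)
  show "wD \<Omega> i j u \<in> borel_measurable (lebesgue_on \<Omega>)"
    using wD_weak_deriv[OF a(1)] a(2) by (auto simp: weak_deriv_def intro: locally_integrable_measurable)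
qed

text \<open>Under a horizontal graph placed above the support, the two subgraph estimates become
  statements about the whole plane with zero boundary term.\<close>

lemma integral_pd_compact_support:
  assumes \<psi>: "smooth \<psi>" and K: "compact K" "\<And>p. p \<notin> K \<Longrightarrow> \<psi> p = 0" and e: "e \<in> {e_t, e_x}"
  shows "(\<integral>z. pd e \<psi> z \<partial>lborel) = 0"
proof -
  obtain c where "K \<subseteq> cbox (- c) c" using bounded_subset_cbox_symmetric[OF compact_imp_bounded[OF K(1)]] by blast
  define R where "R = max 1 (max (fst c) (snd c))"
  have "cbox (- c) c \<subseteq> cbox (-R, -R) (R, R)" by (cases c) (auto simp: R_def cbox_Pair_eq)
  then have supp: "\<And>z. \<psi> z \<noteq> 0 \<Longrightarrow> z \<in> cbox (-R, -R) (R, R)" using K(2) \<open>K \<subseteq> cbox (- c) c\<close> by blast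
  have s0: "\<And>z e. z \<notin> cbox (-R, -R) (R, R) \<Longrightarrow> pd e \<psi> z = 0"
    by (rule pd_eq_0_outside[OF closed_cbox]) (use supp in blast)+
  have ind: "indicator {z. snd z < (\<lambda>_. R + 1) (fst z)} z * pd e \<psi> z = pd e \<psi> z" for z e
    using s0[of z e] by (cases z) (auto simp: indicator_def cbox_Pair_eq)
  have z: "\<psi> (s, R + 1) = 0" for s using supp[of "(s, R + 1)"] by (auto simp: cbox_Pair_eq)
  have "ennreal \<bar>\<integral>z. pd e_x \<psi> z \<partial>lborel\<bar> \<le> 0"
    using subgraph_integral_vertical[OF \<psi> supp, of "\<lambda>_. R + 1"] unfolding ind z by simp
  moreover have "ennreal \<bar>\<integral>z. pd e_t \<psi> z \<partial>lborel\<bar> \<le> 0"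
    using subgraph_integral_horizontal[OF \<psi> supp, of 0 "\<lambda>_. R + 1"] unfolding ind z
    by (simp add: lipschitz_on_def R_def)
  ultimately show ?thesis using e by auto
qed

lemma weak_deriv_smooth_0: "smooth \<Phi> \<Longrightarrow> open \<Omega> \<Longrightarrow> bounded \<Omega> \<Longrightarrow> weak_deriv \<Omega> 0 0 \<Phi> \<Phi>"
  by (simp add: weak_deriv_def L2_locally_integrable smooth_L2)

lemma l2ip_pd_smooth:
  assumes \<Phi>: "smooth \<Phi>" and \<Omega>: "open \<Omega>" "bounded \<Omega>" and \<eta>: "\<eta> \<in> test_functions \<Omega>" and e: "e \<in> {e_t, e_x}"
  shows "l2ip \<Omega> \<Phi> (pd e \<eta>) = - l2ip \<Omega> (pd e \<Phi>) \<eta>"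
proof -
  obtain K where K: "smooth \<eta>" "compact K" "K \<subseteq> \<Omega>" "\<And>p. p \<notin> K \<Longrightarrow> \<eta> p = 0" using test_functionsD[OF \<eta>] by blast
  have s: "smooth (\<lambda>p. \<Phi> p * \<eta> p)" by (intro smooth_intros \<Phi> K)
  have i: "integrable (lebesgue_on \<Omega>) (\<lambda>p. \<Phi> p * pd e \<eta> p)" "integrable (lebesgue_on \<Omega>) (\<lambda>p. pd e \<Phi> p * \<eta> p)"
    by (intro L2_mult_integrable smooth_L2 \<Phi> \<Omega> K smooth_pd e)+
  have "l2ip \<Omega> \<Phi> (pd e \<eta>) + l2ip \<Omega> (pd e \<Phi>) \<eta> = (LINT p|lebesgue_on \<Omega>. pd e (\<lambda>p. \<Phi> p * \<eta> p) p)"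
    using i by (simp add: l2ip_real smooth_pd_mult[OF \<Phi> K(1)])
  also have "\<dots> = (\<integral>p. indicator \<Omega> p * pd e (\<lambda>p. \<Phi> p * \<eta> p) p \<partial>lborel)"
    by (rule integral_lebesgue_on_borel[OF \<Omega>(1) smooth_measurable[OF smooth_pd[OF s e]]])
  also have "\<dots> = (\<integral>p. pd e (\<lambda>p. \<Phi> p * \<eta> p) p \<partial>lborel)"
  proof (rule Bochner_Integration.integral_cong[OF refl])
    fix p
    have "pd e (\<lambda>p. \<Phi> p * \<eta> p) p = 0" if "p \<notin> K"
      by (rule pd_eq_0_outside[OF compact_imp_closed[OF K(2)] _ that]) (simp add: K(4))
    then show "indicator \<Omega> p * pd e (\<lambda>p. \<Phi> p * \<eta> p) p = pd e (\<lambda>p. \<Phi> p * \<eta> p) p"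
      using K(3) by (auto simp: indicator_def)
  qed
  also have "\<dots> = 0" by (rule integral_pd_compact_support[OF s K(2) _ e]) (simp add: K(4))
  finally show ?thesis by simp
qed

lemma weak_deriv_smooth_t: "smooth \<Phi> \<Longrightarrow> open \<Omega> \<Longrightarrow> bounded \<Omega> \<Longrightarrow> weak_deriv \<Omega> 1 0 \<Phi> (pd e_t \<Phi>)"
  and weak_deriv_smooth_x: "smooth \<Phi> \<Longrightarrow> open \<Omega> \<Longrightarrow> bounded \<Omega> \<Longrightarrow> weak_deriv \<Omega> 0 1 \<Phi> (pd e_x \<Phi>)"
  by (simp_all add: weak_deriv_def L2_locally_integrable smooth_L2 smooth_pd_t smooth_pd_x l2ip_pd_smooth)

section \<open>Traces and arc length\<close>

lemma l2norm_real: "l2norm \<Omega> u = n2 (lebesgue_on \<Omega>) u" for u :: "pt \<Rightarrow> real"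
  by (simp add: l2norm_def l2ip_def n2_def power2_eq_square)

lemma n2_cong_AE:
  assumes "u \<in> borel_measurable M" "w \<in> borel_measurable M" "AE p in M. u p = w p"
  shows "n2 M u = n2 M w"
  unfolding n2_def by (rule arg_cong[where f = sqrt], rule integral_cong_AE) (use assms in \<open>auto elim: eventually_mono\<close>)

lemma n2_triangle:
  assumes u: "u \<in> L2 M" and w: "w \<in> L2 M"
  shows "n2 M (\<lambda>p. u p + c * w p) \<le> n2 M u + \<bar>c\<bar> * n2 M w"
proof -
  have "(n2 M (\<lambda>p. u p + c * w p))\<^sup>2 = (\<integral>p. (u p)\<^sup>2 + 2 * c * (u p * w p) + c\<^sup>2 * (w p)\<^sup>2 \<partial>M)"
    unfolding n2_sq by (rule Bochner_Integration.integral_cong) (auto simp: power2_eq_square algebra_simps)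
  also have "\<dots> = (n2 M u)\<^sup>2 + 2 * c * (\<integral>p. u p * w p \<partial>M) + c\<^sup>2 * (n2 M w)\<^sup>2"
    using u w by (simp add: L2_integrable L2_mult_integrable n2_sq)
  also have "\<dots> \<le> (n2 M u)\<^sup>2 + 2 * \<bar>c\<bar> * (n2 M u * n2 M w) + c\<^sup>2 * (n2 M w)\<^sup>2"
  proof -
    have "c * (\<integral>p. u p * w p \<partial>M) \<le> \<bar>c\<bar> * \<bar>\<integral>p. u p * w p \<partial>M\<bar>" by (metis abs_ge_self abs_mult)
    also have "\<dots> \<le> \<bar>c\<bar> * (n2 M u * n2 M w)" by (intro mult_left_mono L2_Cauchy_Schwarz u w) auto
    finally show ?thesis by simp
  qed
  also have "\<dots> = (n2 M u + \<bar>c\<bar> * n2 M w)\<^sup>2" by (simp add: power2_sum power_mult_distrib algebra_simps)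
  finally show ?thesis by (rule power2_le_imp_le) simp
qed

lemma l2conv_lincomb:
  assumes F: "l2conv M F f" and G: "l2conv M G g"
  shows "l2conv M (\<lambda>n p. F n p + c * G n p) (\<lambda>p. f p + c * g p)"
proof -
  have m: "f \<in> L2 M" "\<And>n. F n \<in> L2 M" "g \<in> L2 M" "\<And>n. G n \<in> L2 M" using F G by (auto simp: l2conv_def)
  have "(\<lambda>n. n2 M (\<lambda>p. F n p - f p) + \<bar>c\<bar> * n2 M (\<lambda>p. G n p - g p)) \<longlonglongrightarrow> 0 + \<bar>c\<bar> * 0"
    using F G unfolding l2conv_def by (intro tendsto_intros) auto
  then have l: "(\<lambda>n. n2 M (\<lambda>p. F n p - f p) + \<bar>c\<bar> * n2 M (\<lambda>p. G n p - g p)) \<longlonglongrightarrow> 0" by simp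
  have "norm (n2 M (\<lambda>p. F n p + c * G n p - (f p + c * g p))) \<le> n2 M (\<lambda>p. F n p - f p) + \<bar>c\<bar> * n2 M (\<lambda>p. G n p - g p)" for n
  proof -
    have "(\<lambda>p. F n p + c * G n p - (f p + c * g p)) = (\<lambda>p. (F n p - f p) + c * (G n p - g p))" by (simp add: algebra_simps)
    then show ?thesis using n2_triangle[of "\<lambda>p. F n p - f p" M "\<lambda>p. G n p - g p" c] m by (simp add: L2_diff)
  qed
  then have "(\<lambda>n. n2 M (\<lambda>p. F n p + c * G n p - (f p + c * g p))) \<longlonglongrightarrow> 0"
    by (intro Lim_null_comparison[OF always_eventually l]) blast
  then show ?thesis using m by (simp add: l2conv_def L2_lincomb)
qed

lemma l2conv_cong_AE:
  assumes "l2conv M F f" "g \<in> borel_measurable M" "AE p in M. f p = g p"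
  shows "l2conv M F g"
proof -
  have m: "f \<in> L2 M" "\<And>n. F n \<in> L2 M" using assms(1) by (auto simp: l2conv_def)
  have "n2 M (\<lambda>p. F n p - g p) = n2 M (\<lambda>p. F n p - f p)" for n
    by (rule n2_cong_AE[OF borel_measurable_diff[OF L2_measurable[OF m(2)] assms(2)] borel_measurable_diff[OF L2_measurable[OF m(2)] L2_measurable[OF m(1)]]])
       (use assms(3) in \<open>auto elim: eventually_mono\<close>)
  then show ?thesis using assms(1) L2_cong_AE[OF m(1) assms(2,3)] by (simp add: l2conv_def)
qed

lemma sobolev1_iff:
  assumes "open \<Omega>" "bounded \<Omega>"
  shows "\<phi> \<in> sobolev \<Omega> 1 \<longleftrightarrow> \<phi> \<in> L2 (lebesgue_on \<Omega>) \<and>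
    (\<exists>w \<in> L2 (lebesgue_on \<Omega>). weak_deriv \<Omega> 1 0 \<phi> w) \<and> (\<exists>w \<in> L2 (lebesgue_on \<Omega>). weak_deriv \<Omega> 0 1 \<phi> w)"
proof -
  have ij: "i + j \<le> nat \<lfloor>1::real\<rfloor> \<longleftrightarrow> (i, j) \<in> {(0, 0), (1, 0), (0, 1)}" for i j :: nat by auto
  have "weak_deriv \<Omega> 0 0 \<phi> \<phi>" if "\<phi> \<in> L2 (lebesgue_on \<Omega>)"
    using L2_locally_integrable[OF that assms] by (simp add: weak_deriv_def)
  then show ?thesis unfolding sobolev_def ij by auto
qed

lemma sobolev1D:
  assumes "open \<Omega>" "bounded \<Omega>" "\<phi> \<in> sobolev \<Omega> 1"
  shows "\<phi> \<in> L2 (lebesgue_on \<Omega>)" "weak_deriv \<Omega> 0 0 \<phi> \<phi>"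
    "weak_deriv \<Omega> 1 0 \<phi> (wD \<Omega> 1 0 \<phi>)" "weak_deriv \<Omega> 0 1 \<phi> (wD \<Omega> 0 1 \<phi>)"
    "wD \<Omega> 1 0 \<phi> \<in> L2 (lebesgue_on \<Omega>)" "wD \<Omega> 0 1 \<phi> \<in> L2 (lebesgue_on \<Omega>)"
proof -
  show l: "\<phi> \<in> L2 (lebesgue_on \<Omega>)" using assms(3) unfolding sobolev1_iff[OF assms(1,2)] by blast
  then show "weak_deriv \<Omega> 0 0 \<phi> \<phi>"
    using L2_locally_integrable[OF l assms(1,2)] by (simp add: weak_deriv_def)
  obtain a b where ab: "a \<in> L2 (lebesgue_on \<Omega>)" "weak_deriv \<Omega> 1 0 \<phi> a" "b \<in> L2 (lebesgue_on \<Omega>)" "weak_deriv \<Omega> 0 1 \<phi> b"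
    using assms(3) unfolding sobolev1_iff[OF assms(1,2)] by blast
  show "weak_deriv \<Omega> 1 0 \<phi> (wD \<Omega> 1 0 \<phi>)" "weak_deriv \<Omega> 0 1 \<phi> (wD \<Omega> 0 1 \<phi>)"
    "wD \<Omega> 1 0 \<phi> \<in> L2 (lebesgue_on \<Omega>)" "wD \<Omega> 0 1 \<phi> \<in> L2 (lebesgue_on \<Omega>)"
    using ab wD_weak_deriv wD_L2 assms(1) by blast+
qed

lemma sobolev_norm_1:
  assumes "open \<Omega>" and L: "w \<in> L2 (lebesgue_on \<Omega>)" "a \<in> L2 (lebesgue_on \<Omega>)" "b \<in> L2 (lebesgue_on \<Omega>)"
    and W: "weak_deriv \<Omega> 0 0 w w" "weak_deriv \<Omega> 1 0 w a" "weak_deriv \<Omega> 0 1 w b"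
  shows "sobolev_norm \<Omega> 1 w = sqrt ((n2 (lebesgue_on \<Omega>) w)\<^sup>2 + (n2 (lebesgue_on \<Omega>) a)\<^sup>2 + (n2 (lebesgue_on \<Omega>) b)\<^sup>2)"
proof -
  have n: "l2norm \<Omega> (wD \<Omega> i j w) = n2 (lebesgue_on \<Omega>) c" if "weak_deriv \<Omega> i j w c" "c \<in> L2 (lebesgue_on \<Omega>)" for i j c
    unfolding l2norm_real
    by (rule n2_cong_AE) (use wD_L2[OF that assms(1)] that(2) wD_AE[OF that(1) assms(1)] L2_measurable in auto)
  have ij: "{(i, j). i + j \<le> nat \<lfloor>1::real\<rfloor>} = {(0, 0), (1, 0), (0, 1)}" by auto
  show ?thesis unfolding sobolev_norm_def ij
    by (simp add: n[OF W(1) L(1)] n[OF W(2) L(2)] n[OF W(3) L(3)] n[OF W(2)[unfolded One_nat_def] L(2)] n[OF W(3)[unfolded One_nat_def] L(3)])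
qed

text \<open>Translates the norm of a difference, whose derivatives are choices made by
  \<open>wD\<close>, into convergence of the function and of its two first derivatives. Uniqueness
  almost everywhere makes the chosen derivative of the difference equal to the difference of
  derivatives.\<close>

lemma h1_tendsto_iff:
  assumes \<Omega>: "open \<Omega>" "bounded \<Omega>" and \<phi>: "\<phi> \<in> sobolev \<Omega> 1" and \<Phi>: "\<And>n. smooth (\<Phi> n)"
  shows "(\<lambda>n. sobolev_norm \<Omega> 1 (\<lambda>p. \<phi> p - \<Phi> n p)) \<longlonglongrightarrow> 0 \<longleftrightarrow>
    l2conv (lebesgue_on \<Omega>) \<Phi> \<phi> \<and> l2conv (lebesgue_on \<Omega>) (\<lambda>n. pd e_t (\<Phi> n)) (wD \<Omega> 1 0 \<phi>) \<and>
    l2conv (lebesgue_on \<Omega>) (\<lambda>n. pd e_x (\<Phi> n)) (wD \<Omega> 0 1 \<phi>)"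
proof -
  let ?M = "lebesgue_on \<Omega>"
  note s = sobolev1D[OF \<Omega> \<phi>]
  have sL: "\<Phi> n \<in> L2 ?M" "pd e_t (\<Phi> n) \<in> L2 ?M" "pd e_x (\<Phi> n) \<in> L2 ?M" for n
    using smooth_L2[OF _ \<Omega>] \<Phi> smooth_pd_t smooth_pd_x by auto
  define A B C where "A = (\<lambda>n. n2 ?M (\<lambda>p. \<Phi> n p - \<phi> p))" and "B = (\<lambda>n. n2 ?M (\<lambda>p. pd e_t (\<Phi> n) p - wD \<Omega> 1 0 \<phi> p))"
    and "C = (\<lambda>n. n2 ?M (\<lambda>p. pd e_x (\<Phi> n) p - wD \<Omega> 0 1 \<phi> p))"
  have nn: "A n \<ge> 0" "B n \<ge> 0" "C n \<ge> 0" for n by (auto simp: A_def B_def C_def)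
  have eq: "sobolev_norm \<Omega> 1 (\<lambda>p. \<phi> p - \<Phi> n p) = sqrt ((A n)\<^sup>2 + (B n)\<^sup>2 + (C n)\<^sup>2)" for n
  proof -
    have cm: "n2 ?M (\<lambda>p. u p + (-1) * w p) = n2 ?M (\<lambda>p. w p - u p)" for u w
      by (simp add: n2_def power2_commute)
    have "sobolev_norm \<Omega> 1 (\<lambda>p. \<phi> p + (-1) * \<Phi> n p) = sqrt ((A n)\<^sup>2 + (B n)\<^sup>2 + (C n)\<^sup>2)"
      unfolding A_def B_def C_def cm[symmetric]
      by (rule sobolev_norm_1[OF \<Omega>(1)])
         (intro L2_lincomb s sL weak_deriv_lincomb weak_deriv_smooth_0 weak_deriv_smooth_t weak_deriv_smooth_x \<Omega> \<Phi>)+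
    then show ?thesis by simp
  qed
  have "(\<lambda>n. sqrt ((A n)\<^sup>2 + (B n)\<^sup>2 + (C n)\<^sup>2)) \<longlonglongrightarrow> 0 \<longleftrightarrow> A \<longlonglongrightarrow> 0 \<and> B \<longlonglongrightarrow> 0 \<and> C \<longlonglongrightarrow> 0"
  proof (intro iffI conjI; (elim conjE)?)
    assume l: "(\<lambda>n. sqrt ((A n)\<^sup>2 + (B n)\<^sup>2 + (C n)\<^sup>2)) \<longlonglongrightarrow> 0"
    have c: "norm (A n) \<le> sqrt ((A n)\<^sup>2 + (B n)\<^sup>2 + (C n)\<^sup>2)" "norm (B n) \<le> sqrt ((A n)\<^sup>2 + (B n)\<^sup>2 + (C n)\<^sup>2)"
      "norm (C n) \<le> sqrt ((A n)\<^sup>2 + (B n)\<^sup>2 + (C n)\<^sup>2)" for n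
      by (auto intro!: real_le_rsqrt)
    show "A \<longlonglongrightarrow> 0" by (rule Lim_null_comparison[OF always_eventually l]) (use c in blast)
    show "B \<longlonglongrightarrow> 0" by (rule Lim_null_comparison[OF always_eventually l]) (use c in blast)
    show "C \<longlonglongrightarrow> 0" by (rule Lim_null_comparison[OF always_eventually l]) (use c in blast)
  next
    assume "A \<longlonglongrightarrow> 0" "B \<longlonglongrightarrow> 0" "C \<longlonglongrightarrow> 0"
    then have "(\<lambda>n. sqrt ((A n)\<^sup>2 + (B n)\<^sup>2 + (C n)\<^sup>2)) \<longlonglongrightarrow> sqrt (0\<^sup>2 + 0\<^sup>2 + 0\<^sup>2)" by (intro tendsto_intros)
    then show "(\<lambda>n. sqrt ((A n)\<^sup>2 + (B n)\<^sup>2 + (C n)\<^sup>2)) \<longlonglongrightarrow> 0" by simp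
  qed
  then show ?thesis unfolding eq l2conv_def using s sL by (simp add: A_def[abs_def] B_def[abs_def] C_def[abs_def])
qed

section \<open>Arc length measure, and smooth approximants of functions with zero trace\<close>

lemma space_hausdorff1 [simp]: "space hausdorff1 = UNIV"
  and sets_hausdorff1 [simp, measurable_cong]: "sets hausdorff1 = sets borel"
  unfolding hausdorff1_def by (simp_all add: space_measure_of_conv sets_measure_of_conv) (metis sets.sigma_sets_eq space_borel)

lemma nn_integral_surface:
  assumes "S \<in> sets borel"
  shows "(\<integral>\<^sup>+p. F p \<partial>surface S) = (\<integral>\<^sup>+p. indicator S p * F p \<partial>hausdorff1)"
  unfolding surface_def using assms by (subst nn_integral_restrict_space) (auto simp: mult.commute)

lemma measurable_surface: "\<Phi> \<in> borel_measurable borel \<Longrightarrow> \<Phi> \<in> borel_measurable (surface S)"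
  unfolding surface_def by (rule measurable_restrict_space1) (simp add: measurable_cong_sets[OF sets_hausdorff1 refl])

text \<open>All that is used about the trace. On \<open>S\<close> the approximants tend to 0 in mean
  square, since the trace is 0 there; on the whole boundary they stay bounded in mean square, since
  the trace is square integrable. The second fact controls the other factor when a product of
  boundary values is estimated.\<close>

lemma H1_0_approx:
  assumes \<Omega>: "open \<Omega>" "bounded \<Omega>" and S: "S \<in> sets borel" "S \<subseteq> frontier \<Omega>" and \<phi>: "\<phi> \<in> H1_0 \<Omega> S"
  obtains \<Phi> C where "\<And>n. smooth (\<Phi> n)" "l2conv (lebesgue_on \<Omega>) \<Phi> \<phi>"
    "l2conv (lebesgue_on \<Omega>) (\<lambda>n. pd e_t (\<Phi> n)) (wD \<Omega> 1 0 \<phi>)"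
    "l2conv (lebesgue_on \<Omega>) (\<lambda>n. pd e_x (\<Phi> n)) (wD \<Omega> 0 1 \<phi>)"
    "(\<lambda>n. \<integral>\<^sup>+p. indicator S p * ennreal ((\<Phi> n p)\<^sup>2) \<partial>hausdorff1) \<longlonglongrightarrow> 0"
    "C < \<infinity>" "\<forall>\<^sub>F n in sequentially. (\<integral>\<^sup>+p. indicator (frontier \<Omega>) p * ennreal ((\<Phi> n p)\<^sup>2) \<partial>hausdorff1) \<le> C"
proof -
  let ?\<Gamma> = "frontier \<Omega>"
  have F: "?\<Gamma> \<in> sets borel" by (simp add: borel_closed)
  obtain g \<Phi> where s1: "\<phi> \<in> sobolev \<Omega> 1" and g: "g \<in> L2 (surface ?\<Gamma>)" and ae: "AE p in surface S. g p = 0"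
    and \<Phi>: "\<And>n. smooth (\<Phi> n)" and h1: "(\<lambda>n. sobolev_norm \<Omega> 1 (\<lambda>p. \<phi> p - \<Phi> n p)) \<longlonglongrightarrow> 0"
    and tr: "(\<lambda>n. \<integral>\<^sup>+ p. ennreal ((g p - \<Phi> n p)\<^sup>2) \<partial>surface ?\<Gamma>) \<longlonglongrightarrow> 0"
    using \<phi> unfolding H1_0_def has_trace_def by blast
  have \<Phi>m: "\<Phi> n \<in> borel_measurable (surface T)" for n T by (rule measurable_surface[OF smooth_measurable[OF \<Phi>]])
  have ae': "AE p in hausdorff1. p \<in> S \<longrightarrow> g p = 0"
    using ae S unfolding surface_def by (subst (asm) AE_restrict_space_iff) auto
  have le: "(\<integral>\<^sup>+p. indicator S p * ennreal ((\<Phi> n p)\<^sup>2) \<partial>hausdorff1) \<le> (\<integral>\<^sup>+ p. ennreal ((g p - \<Phi> n p)\<^sup>2) \<partial>surface ?\<Gamma>)" for n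
  proof -
    have "(\<integral>\<^sup>+p. indicator S p * ennreal ((\<Phi> n p)\<^sup>2) \<partial>hausdorff1) \<le> (\<integral>\<^sup>+p. indicator ?\<Gamma> p * ennreal ((g p - \<Phi> n p)\<^sup>2) \<partial>hausdorff1)"
    proof (rule nn_integral_mono_AE)
      show "AE p in hausdorff1. indicator S p * ennreal ((\<Phi> n p)\<^sup>2) \<le> indicator ?\<Gamma> p * ennreal ((g p - \<Phi> n p)\<^sup>2)"
        using ae' by eventually_elim (use S(2) in \<open>auto simp: indicator_def\<close>)
    qed
    then show ?thesis by (simp add: nn_integral_surface[OF F])
  qed
  have z: "(\<lambda>n. \<integral>\<^sup>+p. indicator S p * ennreal ((\<Phi> n p)\<^sup>2) \<partial>hausdorff1) \<longlonglongrightarrow> 0"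
    by (rule tendsto_sandwich[OF _ _ tendsto_const tr]) (use le in auto)
  \<comment> \<open>The bound \<open>2 * I + 2\<close> is
    \<open>\<Phi>^2 \<le> 2 g^2 + 2 (g - \<Phi>)^2\<close>, integrated once the error integral is
    below 1.\<close>
  define I where "I = (\<integral>\<^sup>+ p. ennreal ((g p)\<^sup>2) \<partial>surface ?\<Gamma>)"
  have "I < \<infinity>" unfolding I_def using L2_integrable[OF g] by (simp add: integrable_iff_bounded)
  then have C: "2 * I + 2 < \<infinity>" by (simp add: ennreal_mult_less_top)
  have "\<forall>\<^sub>F n in sequentially. (\<integral>\<^sup>+ p. ennreal ((g p - \<Phi> n p)\<^sup>2) \<partial>surface ?\<Gamma>) < 1"
    using order_tendstoD(2)[OF tr] by simp
  then have ev: "\<forall>\<^sub>F n in sequentially. (\<integral>\<^sup>+p. indicator ?\<Gamma> p * ennreal ((\<Phi> n p)\<^sup>2) \<partial>hausdorff1) \<le> 2 * I + 2"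
  proof eventually_elim
    case (elim n)
    have "(\<integral>\<^sup>+p. ennreal ((\<Phi> n p)\<^sup>2) \<partial>surface ?\<Gamma>) \<le> (\<integral>\<^sup>+p. 2 * ennreal ((g p)\<^sup>2) + 2 * ennreal ((g p - \<Phi> n p)\<^sup>2) \<partial>surface ?\<Gamma>)"
      by (intro nn_integral_mono square_le_ennreal)
    also have "\<dots> = 2 * I + 2 * (\<integral>\<^sup>+ p. ennreal ((g p - \<Phi> n p)\<^sup>2) \<partial>surface ?\<Gamma>)"
      unfolding I_def using \<Phi>m L2_measurable[OF g] by (subst nn_integral_add) (simp_all add: nn_integral_cmult)
    also have "\<dots> \<le> 2 * I + 2 * 1" using elim by (intro add_left_mono mult_left_mono) auto
    finally show ?case by (simp add: nn_integral_surface[OF F])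
  qed
  show ?thesis
    by (rule that[of \<Phi>, OF \<Phi> _ _ _ z C ev]) (use h1_tendsto_iff[OF \<Omega> s1, of \<Phi>] \<Phi> h1 in blast)+
qed

lemma H1_0_sobolev: "\<phi> \<in> H1_0 \<Omega> S \<Longrightarrow> \<phi> \<in> sobolev \<Omega> 1"
  by (simp add: H1_0_def)

lemma wD_lincomb_AE:
  assumes \<Omega>: "open \<Omega>" "bounded \<Omega>" and 1: "\<phi>1 \<in> sobolev \<Omega> 1" and 2: "\<phi>2 \<in> sobolev \<Omega> 1"
  shows "AE p in lebesgue_on \<Omega>. wD \<Omega> 1 0 (\<lambda>p. \<phi>1 p + c * \<phi>2 p) p = wD \<Omega> 1 0 \<phi>1 p + c * wD \<Omega> 1 0 \<phi>2 p"
    and "AE p in lebesgue_on \<Omega>. wD \<Omega> 0 1 (\<lambda>p. \<phi>1 p + c * \<phi>2 p) p = wD \<Omega> 0 1 \<phi>1 p + c * wD \<Omega> 0 1 \<phi>2 p"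
  by (rule wD_AE[OF weak_deriv_lincomb \<Omega>(1)]; use sobolev1D[OF \<Omega> 1] sobolev1D[OF \<Omega> 2] \<Omega> in blast)+

lemma sobolev1_lincomb:
  assumes \<Omega>: "open \<Omega>" "bounded \<Omega>" and 1: "\<phi>1 \<in> sobolev \<Omega> 1" and 2: "\<phi>2 \<in> sobolev \<Omega> 1"
  shows "(\<lambda>p. \<phi>1 p + c * \<phi>2 p) \<in> sobolev \<Omega> 1"
  unfolding sobolev1_iff[OF \<Omega>]
  using sobolev1D[OF \<Omega> 1] sobolev1D[OF \<Omega> 2] \<Omega>(1) by (blast intro: L2_lincomb weak_deriv_lincomb)

text \<open>With \<open>c = - 1\<close> this admits \<open>qv - q\<close> as a test function, which
  is how the residual is bounded from below.\<close>

lemma H1_0_lincomb: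
  assumes \<Omega>: "open \<Omega>" "bounded \<Omega>" and 1: "\<phi>1 \<in> H1_0 \<Omega> S" and 2: "\<phi>2 \<in> H1_0 \<Omega> S"
  shows "(\<lambda>p. \<phi>1 p + c * \<phi>2 p) \<in> H1_0 \<Omega> S"
proof -
  let ?\<Gamma> = "surface (frontier \<Omega>)"
  let ?M = "lebesgue_on \<Omega>"
  note s = H1_0_sobolev[OF 1] H1_0_sobolev[OF 2]
  note sl = sobolev1_lincomb[OF \<Omega> s, of c]
  obtain g1 \<Phi>1 where g1: "g1 \<in> L2 ?\<Gamma>" and ae1: "AE p in surface S. g1 p = 0"
    and \<Phi>1: "\<And>n. smooth (\<Phi>1 n)" and h1: "(\<lambda>n. sobolev_norm \<Omega> 1 (\<lambda>p. \<phi>1 p - \<Phi>1 n p)) \<longlonglongrightarrow> 0"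
    and tr1: "(\<lambda>n. \<integral>\<^sup>+ p. ennreal ((g1 p - \<Phi>1 n p)\<^sup>2) \<partial>?\<Gamma>) \<longlonglongrightarrow> 0"
    using 1 unfolding H1_0_def has_trace_def by blast
  obtain g2 \<Phi>2 where g2: "g2 \<in> L2 ?\<Gamma>" and ae2: "AE p in surface S. g2 p = 0"
    and \<Phi>2: "\<And>n. smooth (\<Phi>2 n)" and h2: "(\<lambda>n. sobolev_norm \<Omega> 1 (\<lambda>p. \<phi>2 p - \<Phi>2 n p)) \<longlonglongrightarrow> 0"
    and tr2: "(\<lambda>n. \<integral>\<^sup>+ p. ennreal ((g2 p - \<Phi>2 n p)\<^sup>2) \<partial>?\<Gamma>) \<longlonglongrightarrow> 0"
    using 2 unfolding H1_0_def has_trace_def by blast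
  define \<Phi> where "\<Phi> = (\<lambda>n p. \<Phi>1 n p + c * \<Phi>2 n p)"
  have \<Phi>: "smooth (\<Phi> n)" for n unfolding \<Phi>_def by (intro smooth_intros \<Phi>1 \<Phi>2)
  have pd: "pd e (\<Phi> n) = (\<lambda>p. pd e (\<Phi>1 n) p + c * pd e (\<Phi>2 n) p)" for n e
    unfolding \<Phi>_def by (rule ext) (simp add: smooth_pd_add[OF \<Phi>1 smooth_cmult[OF \<Phi>2]] smooth_pd_cmult[OF \<Phi>2])
  note c1 = h1_tendsto_iff[OF \<Omega> s(1) \<Phi>1, THEN iffD1, OF h1]
  note c2 = h1_tendsto_iff[OF \<Omega> s(2) \<Phi>2, THEN iffD1, OF h2]
  have sn: "(\<lambda>n. sobolev_norm \<Omega> 1 (\<lambda>p. (\<phi>1 p + c * \<phi>2 p) - \<Phi> n p)) \<longlonglongrightarrow> 0"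
  proof (rule h1_tendsto_iff[OF \<Omega> sl \<Phi>, THEN iffD2], intro conjI)
    show "l2conv ?M \<Phi> (\<lambda>p. \<phi>1 p + c * \<phi>2 p)" unfolding \<Phi>_def using c1 c2 by (intro l2conv_lincomb) auto
    have "l2conv ?M (\<lambda>n. pd e_t (\<Phi> n)) (\<lambda>p. wD \<Omega> 1 0 \<phi>1 p + c * wD \<Omega> 1 0 \<phi>2 p)"
      unfolding pd using c1 c2 by (intro l2conv_lincomb) auto
    then show "l2conv ?M (\<lambda>n. pd e_t (\<Phi> n)) (wD \<Omega> 1 0 (\<lambda>p. \<phi>1 p + c * \<phi>2 p))"
      by (rule l2conv_cong_AE[OF _ L2_measurable[OF sobolev1D(5)[OF \<Omega> sl]] AE_symmetric[OF wD_lincomb_AE(1)[OF \<Omega> s]]])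
    have "l2conv ?M (\<lambda>n. pd e_x (\<Phi> n)) (\<lambda>p. wD \<Omega> 0 1 \<phi>1 p + c * wD \<Omega> 0 1 \<phi>2 p)"
      unfolding pd using c1 c2 by (intro l2conv_lincomb) auto
    then show "l2conv ?M (\<lambda>n. pd e_x (\<Phi> n)) (wD \<Omega> 0 1 (\<lambda>p. \<phi>1 p + c * \<phi>2 p))"
      by (rule l2conv_cong_AE[OF _ L2_measurable[OF sobolev1D(6)[OF \<Omega> sl]] AE_symmetric[OF wD_lincomb_AE(2)[OF \<Omega> s]]])
  qed
  have m: "(\<lambda>p. g1 p - \<Phi>1 n p) \<in> borel_measurable ?\<Gamma>" "(\<lambda>p. g2 p - \<Phi>2 n p) \<in> borel_measurable ?\<Gamma>" for n
    by (intro borel_measurable_diff L2_measurable[OF g1] L2_measurable[OF g2] measurable_surface smooth_measurable \<Phi>1 \<Phi>2)+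
  have le: "(\<integral>\<^sup>+ p. ennreal ((g1 p + c * g2 p - \<Phi> n p)\<^sup>2) \<partial>?\<Gamma>) \<le> 2 * (\<integral>\<^sup>+ p. ennreal ((g1 p - \<Phi>1 n p)\<^sup>2) \<partial>?\<Gamma>)
      + 2 * (ennreal (c\<^sup>2) * (\<integral>\<^sup>+ p. ennreal ((g2 p - \<Phi>2 n p)\<^sup>2) \<partial>?\<Gamma>))" for n
  proof -
    have "(\<integral>\<^sup>+ p. ennreal ((g1 p + c * g2 p - \<Phi> n p)\<^sup>2) \<partial>?\<Gamma>) \<le> (\<integral>\<^sup>+ p. 2 * ennreal ((g1 p - \<Phi>1 n p)\<^sup>2) + 2 * (ennreal (c\<^sup>2) * ennreal ((g2 p - \<Phi>2 n p)\<^sup>2)) \<partial>?\<Gamma>)"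
    proof (rule nn_integral_mono)
      fix p
      have "((g1 p - \<Phi>1 n p) - (g1 p + c * g2 p - \<Phi> n p))\<^sup>2 = c\<^sup>2 * (g2 p - \<Phi>2 n p)\<^sup>2"
        by (simp add: \<Phi>_def power2_eq_square algebra_simps)
      then show "ennreal ((g1 p + c * g2 p - \<Phi> n p)\<^sup>2) \<le> 2 * ennreal ((g1 p - \<Phi>1 n p)\<^sup>2) + 2 * (ennreal (c\<^sup>2) * ennreal ((g2 p - \<Phi>2 n p)\<^sup>2))"
        using square_le_ennreal[of "g1 p + c * g2 p - \<Phi> n p" "g1 p - \<Phi>1 n p"] by (simp add: ennreal_mult')
    qed
    also have "\<dots> = 2 * (\<integral>\<^sup>+ p. ennreal ((g1 p - \<Phi>1 n p)\<^sup>2) \<partial>?\<Gamma>)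
      + 2 * (ennreal (c\<^sup>2) * (\<integral>\<^sup>+ p. ennreal ((g2 p - \<Phi>2 n p)\<^sup>2) \<partial>?\<Gamma>))"
      using m[of n] by (subst nn_integral_add) (simp_all add: nn_integral_cmult)
    finally show ?thesis .
  qed
  have "(\<lambda>n. 2 * (\<integral>\<^sup>+ p. ennreal ((g1 p - \<Phi>1 n p)\<^sup>2) \<partial>?\<Gamma>)
      + 2 * (ennreal (c\<^sup>2) * (\<integral>\<^sup>+ p. ennreal ((g2 p - \<Phi>2 n p)\<^sup>2) \<partial>?\<Gamma>))) \<longlonglongrightarrow> 2 * 0 + 2 * (ennreal (c\<^sup>2) * 0)"
    by (intro tendsto_add tr1 tr2 ennreal_tendsto_cmult) auto
  then have l0: "(\<lambda>n. 2 * (\<integral>\<^sup>+ p. ennreal ((g1 p - \<Phi>1 n p)\<^sup>2) \<partial>?\<Gamma>)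
      + 2 * (ennreal (c\<^sup>2) * (\<integral>\<^sup>+ p. ennreal ((g2 p - \<Phi>2 n p)\<^sup>2) \<partial>?\<Gamma>))) \<longlonglongrightarrow> 0" by simp
  have tr: "(\<lambda>n. \<integral>\<^sup>+ p. ennreal ((g1 p + c * g2 p - \<Phi> n p)\<^sup>2) \<partial>?\<Gamma>) \<longlonglongrightarrow> 0"
    by (rule tendsto_sandwich[OF _ _ tendsto_const l0]) (use le in auto)
  have "has_trace \<Omega> (\<lambda>p. \<phi>1 p + c * \<phi>2 p) (\<lambda>p. g1 p + c * g2 p)"
    unfolding has_trace_def using L2_lincomb[OF g1 g2] \<Phi> sn tr by blast
  moreover have "AE p in surface S. g1 p + c * g2 p = 0" using ae1 ae2 by eventually_elim simp
  ultimately show ?thesis unfolding H1_0_def using sl by blast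
qed

text \<open>The constant sequence \<open>\<eta>\<close> approximates itself and vanishes on the
  boundary. This supplies nonzero elements, without which the supremum in \<open>dual_norm\<close>
  would be over the empty set.\<close>

lemma H1_0_test_functions:
  assumes \<Omega>: "open \<Omega>" "bounded \<Omega>" and \<eta>: "\<eta> \<in> test_functions \<Omega>"
  shows "\<eta> \<in> H1_0 \<Omega> S"
proof -
  obtain K where K: "smooth \<eta>" "K \<subseteq> \<Omega>" "\<And>p. p \<notin> K \<Longrightarrow> \<eta> p = 0" using test_functionsD[OF \<eta>] by blast
  have s1: "\<eta> \<in> sobolev \<Omega> 1"
    unfolding sobolev1_iff[OF \<Omega>] using smooth_L2[OF _ \<Omega>] K(1) smooth_pd_t smooth_pd_x weak_deriv_smooth_t weak_deriv_smooth_x \<Omega> by blast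
  have F: "frontier \<Omega> \<in> sets borel" by (simp add: borel_closed)
  have sn: "sobolev_norm \<Omega> 1 (\<lambda>p. \<eta> p - \<eta> p) = 0"
    using sobolev_norm_1[OF \<Omega>(1) L2_zero L2_zero L2_zero] weak_deriv_smooth_0[OF smooth_const[of 0] \<Omega>]
      weak_deriv_smooth_t[OF smooth_const[of 0] \<Omega>] weak_deriv_smooth_x[OF smooth_const[of 0] \<Omega>]
    by (simp add: n2_def pd_const[abs_def])
  have "\<eta> p = 0" if "p \<in> frontier \<Omega>" for p
    using that K(2,3) \<Omega>(1) by (metis frontier_disjoint_eq disjoint_iff subsetD)
  then have z0: "indicator (frontier \<Omega>) p * ennreal ((0 - \<eta> p)\<^sup>2) = 0" for p by (auto simp: indicator_def)
  then have z: "(\<integral>\<^sup>+ p. ennreal ((0 - \<eta> p)\<^sup>2) \<partial>surface (frontier \<Omega>)) = 0"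
    unfolding nn_integral_surface[OF F] z0 by simp
  have "has_trace \<Omega> \<eta> (\<lambda>p. 0)"
    unfolding has_trace_def using K(1) sn z by (intro conjI L2_zero exI[of _ "\<lambda>n. \<eta>"]) auto
  then show ?thesis unfolding H1_0_def using s1 by (auto intro!: exI[of _ "\<lambda>p. 0"])
qed

text \<open>\<open>measure_of\<close> falls back to the zero measure when the given set function is
  not a measure on the generated sigma-algebra; one set of nonzero measure excludes this
  case.\<close>

lemma emeasure_hausdorff1:
  assumes "emeasure hausdorff1 T \<noteq> 0" "Y \<in> sets borel"
  shows "emeasure hausdorff1 Y = hausdorff1_outer Y"
proof -
  have "measure_space UNIV (sigma_sets UNIV (sets (borel :: pt measure))) hausdorff1_outer"
    using assms(1) unfolding hausdorff1_def emeasure_measure_of_conv by (auto split: if_splits)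
  then show ?thesis using assms(2) unfolding hausdorff1_def emeasure_measure_of_conv
    by (auto simp: sigma_sets.Basic)
qed

text \<open>Contractions do not increase length: the image of a covering set lies in an interval no
  longer than the diameter of the set. Coverings at the single scale 1 suffice, since the outer
  measure is a supremum over all scales.\<close>

lemma emeasure_le_hausdorff1_outer:
  fixes \<pi> :: "pt \<Rightarrow> real"
  assumes lip: "\<And>x y. \<bar>\<pi> x - \<pi> y\<bar> \<le> dist x y" and A: "A \<in> sets borel" and sub: "A \<subseteq> \<pi> ` Y"
  shows "emeasure lborel A \<le> hausdorff1_outer Y"
proof -
  have "emeasure lborel A \<le> (\<Sum>n. ennreal (diameter (B n)))"
    if B: "Y \<subseteq> (\<Union>n. B n)" "\<And>n. bounded (B n) \<and> diameter (B n) \<le> 1" for B :: "nat \<Rightarrow> pt set"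
  proof -
    \<comment> \<open>The empty set is treated apart because \<open>Inf\<close> and
      \<open>Sup\<close> of the empty set of reals carry no information.\<close>
    define J where "J = (\<lambda>n. if B n = {} then {} else {Inf (\<pi> ` B n)..Sup (\<pi> ` B n)})"
    have d: "\<bar>\<pi> x - \<pi> y\<bar> \<le> diameter (B n)" if "x \<in> B n" "y \<in> B n" for x y n
      using order.trans[OF lip diameter_bounded_bound] that B(2) by blast
    have bd: "bdd_above (\<pi> ` B n)" "bdd_below (\<pi> ` B n)" for n
    proof -
      show "bdd_above (\<pi> ` B n)"
      proof (cases "B n = {}")
        case False
        then obtain y where "y \<in> B n" by blast
        then show ?thesis using d[of _ n y] by (intro bdd_aboveI[of _ "\<pi> y + diameter (B n)"]) force
      qed simp
      show "bdd_below (\<pi> ` B n)"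
      proof (cases "B n = {}")
        case False
        then obtain y where "y \<in> B n" by blast
        then show ?thesis using d[of _ n y] by (intro bdd_belowI[of _ "\<pi> y - diameter (B n)"]) force
      qed simp
    qed
    have AJ: "A \<subseteq> (\<Union>n. J n)"
    proof
      fix s assume "s \<in> A"
      then obtain y n where y: "y \<in> B n" "s = \<pi> y" using sub B(1) by blast
      then have "s \<in> J n" using bd[of n] by (auto simp: J_def intro: cInf_lower cSup_upper)
      then show "s \<in> (\<Union>n. J n)" by blast
    qed
    have eJ: "emeasure lborel (J n) \<le> ennreal (diameter (B n))" for n
    proof (cases "B n = {}")
      case False
      have "Sup (\<pi> ` B n) \<le> Inf (\<pi> ` B n) + diameter (B n)"
      proof (rule cSup_least)
        fix x assume "x \<in> \<pi> ` B n"
        then obtain x' where x': "x' \<in> B n" "x = \<pi> x'" by blast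
        have "x - diameter (B n) \<le> Inf (\<pi> ` B n)"
        proof (rule cInf_greatest)
          fix y assume "y \<in> \<pi> ` B n"
          then obtain y' where "y' \<in> B n" "y = \<pi> y'" by blast
          then show "x - diameter (B n) \<le> y" using d[of x' n y'] x' by simp
        qed (use False in auto)
        then show "x \<le> Inf (\<pi> ` B n) + diameter (B n)" by simp
      qed (use False in auto)
      then show ?thesis using False by (auto simp: J_def emeasure_lborel_Icc_eq intro: ennreal_leI)
    qed (simp add: J_def)
    have "emeasure lborel A \<le> emeasure lborel (\<Union>n. J n)"
      by (rule emeasure_mono[OF AJ]) (auto simp: J_def)
    also have "\<dots> \<le> (\<Sum>n. emeasure lborel (J n))"
      by (rule emeasure_subadditive_countably) (auto simp: J_def)
    also have "\<dots> \<le> (\<Sum>n. ennreal (diameter (B n)))" by (intro suminf_le eJ) auto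
    finally show ?thesis .
  qed
  then have "emeasure lborel A \<le> (INF B \<in> {B :: nat \<Rightarrow> pt set. Y \<subseteq> (\<Union>n. B n) \<and> (\<forall>n. bounded (B n) \<and> diameter (B n) \<le> (1::real))}.
        (\<Sum>n. ennreal (diameter (B n))))" by (intro INF_greatest) blast
  also have "\<dots> \<le> hausdorff1_outer Y"
    unfolding hausdorff1_outer_def by (rule SUP_upper) simp
  finally show ?thesis .
qed

definition graph :: "pt \<Rightarrow> real \<Rightarrow> real \<Rightarrow> (real \<Rightarrow> real) \<Rightarrow> real \<Rightarrow> pt" where
  "graph p a b \<gamma> s = frame p a b (s, \<gamma> s)"

text \<open>The projection \<open>\<pi>\<close> to the direction \<open>(- b, a)\<close> is a
  contraction that recovers the parameter from the graph point, so parameter length is at most arc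
  length. This carries information about traces from \<open>hausdorff1\<close> into a chart.\<close>

lemma nn_integral_graph_le:
  assumes nt: "emeasure hausdorff1 T \<noteq> 0" and ab: "a\<^sup>2 + b\<^sup>2 = 1" and \<gamma>[measurable]: "\<gamma> \<in> borel_measurable borel"
    and A[measurable]: "A \<in> sets borel" and S[measurable]: "S \<in> sets borel" and sub: "\<And>s. s \<in> A \<Longrightarrow> graph p a b \<gamma> s \<in> S"
    and F[measurable]: "F \<in> borel_measurable borel"
  shows "(\<integral>\<^sup>+s. indicator A s * F (graph p a b \<gamma> s) \<partial>lborel) \<le> (\<integral>\<^sup>+y. indicator S y * F y \<partial>hausdorff1)"
proof -
  define G where "G = graph p a b \<gamma>"
  have G[measurable]: "G \<in> borel_measurable borel"
    unfolding G_def graph_def[abs_def] by measurable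
  define \<pi> where "\<pi> = (\<lambda>y. (y - p) \<bullet> (- b, a))"
  have nb: "norm (- b, a) = 1" using ab by (simp add: norm_Pair add.commute)
  have lip: "\<bar>\<pi> x - \<pi> y\<bar> \<le> dist x y" for x y
  proof -
    have "\<pi> x - \<pi> y = (x - y) \<bullet> (- b, a)" by (simp add: \<pi>_def inner_diff_left)
    then show ?thesis using Cauchy_Schwarz_ineq2[of "x - y" "(- b, a)"] nb by (simp add: dist_norm)
  qed
  have \<pi>G: "\<pi> (G s) = s" for s
  proof -
    have "\<pi> (G s) = s * (a\<^sup>2 + b\<^sup>2)" by (simp add: \<pi>_def G_def graph_def frame_def power2_eq_square algebra_simps)
    then show ?thesis using ab by simp
  qed
  \<comment> \<open>The claim is an inequality between two Borel measures on the plane: parameter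
    length pushed to the graph, and arc length restricted to \<open>S\<close>. It is checked on
    Borel sets and then integrated.\<close>
  define \<nu> where "\<nu> = distr (density lborel (indicator A)) borel G"
  define \<mu> where "\<mu> = density hausdorff1 (indicator S)"
  have "(\<integral>\<^sup>+s. indicator A s * F (G s) \<partial>lborel) = (\<integral>\<^sup>+y. F y \<partial>\<nu>)"
    unfolding \<nu>_def by (subst nn_integral_distr) (auto simp: nn_integral_density)
  also have "\<dots> \<le> (\<integral>\<^sup>+y. F y \<partial>\<mu>)"
  proof (rule nn_integral_mono_measure)
    show "sets \<nu> = sets \<mu>" by (simp add: \<nu>_def \<mu>_def)
    show "\<nu> \<le> \<mu>"
    proof (subst le_measure)
      show "sets \<nu> = sets \<mu>" by (simp add: \<nu>_def \<mu>_def)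
      show "\<forall>X\<in>sets \<nu>. emeasure \<nu> X \<le> emeasure \<mu> X"
      proof
        fix X assume "X \<in> sets \<nu>"
        then have True: "X \<in> sets borel" by (simp add: \<nu>_def)
        show "emeasure \<nu> X \<le> emeasure \<mu> X"
        proof -
          note [measurable] = True
          have "G -` X \<in> sets borel" using measurable_sets_borel[OF G True] .
          then have AX: "A \<inter> G -` X \<in> sets borel" by auto
          have "emeasure \<nu> X = (\<integral>\<^sup>+s. indicator A s * indicator (G -` X) s \<partial>lborel)"
            unfolding \<nu>_def using \<open>G -` X \<in> sets borel\<close> by (subst emeasure_distr) (auto simp: emeasure_density)
          also have "\<dots> = emeasure lborel (A \<inter> G -` X)" using AX by (simp add: indicator_inter_arith[symmetric])
          also have "\<dots> \<le> hausdorff1_outer (S \<inter> X)"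
          proof (rule emeasure_le_hausdorff1_outer[OF lip AX])
            show "A \<inter> G -` X \<subseteq> \<pi> ` (S \<inter> X)"
            proof
              fix s assume "s \<in> A \<inter> G -` X"
              then have "G s \<in> S \<inter> X" using sub by (auto simp: G_def)
              then show "s \<in> \<pi> ` (S \<inter> X)" using \<pi>G[of s] by (metis imageI)
            qed
          qed
          also have "\<dots> = emeasure hausdorff1 (S \<inter> X)" using emeasure_hausdorff1[OF nt] S True by simp
          also have "\<dots> = emeasure \<mu> X"
            unfolding \<mu>_def by (subst emeasure_density) (auto simp: indicator_inter_arith[symmetric])
          finally show ?thesis .
        qed
      qed
    qed
  qed
  also have "\<dots> = (\<integral>\<^sup>+y. indicator S y * F y \<partial>hausdorff1)"
    unfolding \<mu>_def by (subst nn_integral_density) auto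
  finally show ?thesis by (simp add: G_def)
qed

section \<open>Boundary charts\<close>

text \<open>\<open>smooth\<close> asks only for differentiability of all iterated partial
  derivatives, so their symmetry has to be derived: two mean value theorems, applied in either order
  to the second difference over a square of side \<open>k n\<close>, give equal values at nearby
  points, and continuity closes the gap.\<close>

lemma smooth_mixed_pd:
  assumes M: "smooth M" shows "pd e_t (pd e_x M) z = pd e_x (pd e_t M) z"
proof -
  obtain s \<tau> where z: "z = (s, \<tau>)" by (cases z)
  define k where "k = (\<lambda>n. 1 / real (Suc n))"
  have k: "k n > 0" for n by (simp add: k_def)
  have k0: "k \<longlonglongrightarrow> 0" unfolding k_def using LIMSEQ_Suc[OF lim_1_over_n] by simp
  have "\<exists>x1 y1 x2 y2. \<bar>x1 - s\<bar> \<le> k n \<and> \<bar>y1 - \<tau>\<bar> \<le> k n \<and> \<bar>x2 - s\<bar> \<le> k n \<and> \<bar>y2 - \<tau>\<bar> \<le> k n \<and>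
      pd e_x (pd e_t M) (x1, y1) = pd e_t (pd e_x M) (x2, y2)" for n
  proof -
    let ?h = "k n"
    have "\<exists>x. s < x \<and> x < s + ?h \<and> (M (s + ?h, \<tau> + ?h) - M (s + ?h, \<tau>)) - (M (s, \<tau> + ?h) - M (s, \<tau>))
        = (s + ?h - s) * (pd e_t M (x, \<tau> + ?h) - pd e_t M (x, \<tau>))"
      by (rule MVT2) (use k in \<open>auto intro!: DERIV_diff smooth_DERIV_fst M\<close>)
    then obtain x1 where x1: "s < x1" "x1 < s + ?h" "(M (s + ?h, \<tau> + ?h) - M (s + ?h, \<tau>)) - (M (s, \<tau> + ?h) - M (s, \<tau>))
        = ?h * (pd e_t M (x1, \<tau> + ?h) - pd e_t M (x1, \<tau>))" by auto
    have "\<exists>y. \<tau> < y \<and> y < \<tau> + ?h \<and> pd e_t M (x1, \<tau> + ?h) - pd e_t M (x1, \<tau>) = (\<tau> + ?h - \<tau>) * pd e_x (pd e_t M) (x1, y)"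
      by (rule MVT2) (use k in \<open>auto intro!: smooth_DERIV_snd smooth_pd_t M\<close>)
    then obtain y1 where y1: "\<tau> < y1" "y1 < \<tau> + ?h" "pd e_t M (x1, \<tau> + ?h) - pd e_t M (x1, \<tau>) = ?h * pd e_x (pd e_t M) (x1, y1)" by auto
    have "\<exists>y. \<tau> < y \<and> y < \<tau> + ?h \<and> (M (s + ?h, \<tau> + ?h) - M (s, \<tau> + ?h)) - (M (s + ?h, \<tau>) - M (s, \<tau>))
        = (\<tau> + ?h - \<tau>) * (pd e_x M (s + ?h, y) - pd e_x M (s, y))"
      by (rule MVT2) (use k in \<open>auto intro!: DERIV_diff smooth_DERIV_snd M\<close>)
    then obtain y2 where y2: "\<tau> < y2" "y2 < \<tau> + ?h" "(M (s + ?h, \<tau> + ?h) - M (s, \<tau> + ?h)) - (M (s + ?h, \<tau>) - M (s, \<tau>))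
        = ?h * (pd e_x M (s + ?h, y2) - pd e_x M (s, y2))" by auto
    have "\<exists>x. s < x \<and> x < s + ?h \<and> pd e_x M (s + ?h, y2) - pd e_x M (s, y2) = (s + ?h - s) * pd e_t (pd e_x M) (x, y2)"
      by (rule MVT2) (use k in \<open>auto intro!: smooth_DERIV_fst smooth_pd_x M\<close>)
    then obtain x2 where x2: "s < x2" "x2 < s + ?h" "pd e_x M (s + ?h, y2) - pd e_x M (s, y2) = ?h * pd e_t (pd e_x M) (x2, y2)" by auto
    have "?h * (?h * pd e_x (pd e_t M) (x1, y1)) = ?h * (?h * pd e_t (pd e_x M) (x2, y2))"
      using x1(3)[unfolded y1(3)] y2(3)[unfolded x2(3)] by linarith
    then have "pd e_x (pd e_t M) (x1, y1) = pd e_t (pd e_x M) (x2, y2)" using k[of n] by simp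
    then show ?thesis using x1 y1 x2 y2 by (intro exI[of _ x1] exI[of _ y1] exI[of _ x2] exI[of _ y2]) auto
  qed
  then obtain x1 y1 x2 y2 where b: "\<And>n. \<bar>x1 n - s\<bar> \<le> k n" "\<And>n. \<bar>y1 n - \<tau>\<bar> \<le> k n" "\<And>n. \<bar>x2 n - s\<bar> \<le> k n" "\<And>n. \<bar>y2 n - \<tau>\<bar> \<le> k n"
     and eq: "\<And>n. pd e_x (pd e_t M) (x1 n, y1 n) = pd e_t (pd e_x M) (x2 n, y2 n)" by metis
  have lim: "c \<longlonglongrightarrow> l" if "\<And>n. \<bar>c n - l\<bar> \<le> k n" for c :: "nat \<Rightarrow> real" and l
    by (rule LIM_zero_cancel, rule Lim_null_comparison[OF always_eventually k0]) (use that in auto)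
  have "(\<lambda>n. pd e_x (pd e_t M) (x1 n, y1 n)) \<longlonglongrightarrow> pd e_x (pd e_t M) (s, \<tau>)"
    by (intro isCont_tendsto_compose[OF smooth_isCont] smooth_intros M tendsto_Pair lim b)
  moreover have "(\<lambda>n. pd e_x (pd e_t M) (x1 n, y1 n)) \<longlonglongrightarrow> pd e_t (pd e_x M) (s, \<tau>)"
    unfolding eq by (intro isCont_tendsto_compose[OF smooth_isCont] smooth_intros M tendsto_Pair lim b)
  ultimately show ?thesis using LIMSEQ_unique z by metis
qed

text \<open>The integral of \<open>d (\<zeta> f) \<and> d g\<close>, with the gradients \<open>(f1, f2)\<close> and \<open>(g1, g2)\<close> of \<open>f\<close> and \<open>g\<close>
  as separate arguments.\<close>

definition wedge :: "pt set \<Rightarrow> (pt \<Rightarrow> real) \<Rightarrow> (pt \<Rightarrow> real) \<Rightarrow> (pt \<Rightarrow> real) \<Rightarrow> (pt \<Rightarrow> real) \<Rightarrow>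
    (pt \<Rightarrow> real) \<Rightarrow> (pt \<Rightarrow> real) \<Rightarrow> real" where
  "wedge \<Omega> \<zeta> f f1 f2 g1 g2 = (LINT p|lebesgue_on \<Omega>.
     \<zeta> p * (f1 p * g2 p - f2 p * g1 p) + f p * (pd e_t \<zeta> p * g2 p - pd e_x \<zeta> p * g1 p))"

lemma wedge_eq:
  assumes \<zeta>: "smooth \<zeta>" and \<Omega>: "bounded \<Omega>" and
    L: "f \<in> L2 (lebesgue_on \<Omega>)" "f1 \<in> L2 (lebesgue_on \<Omega>)" "f2 \<in> L2 (lebesgue_on \<Omega>)" "g1 \<in> L2 (lebesgue_on \<Omega>)" "g2 \<in> L2 (lebesgue_on \<Omega>)"
  shows "integrable (lebesgue_on \<Omega>) (\<lambda>p. \<zeta> p * (f1 p * g2 p - f2 p * g1 p) + f p * (pd e_t \<zeta> p * g2 p - pd e_x \<zeta> p * g1 p))"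
    and "wedge \<Omega> \<zeta> f f1 f2 g1 g2 = (LINT p|lebesgue_on \<Omega>. \<zeta> p * f1 p * g2 p) - (LINT p|lebesgue_on \<Omega>. \<zeta> p * f2 p * g1 p)
    + (LINT p|lebesgue_on \<Omega>. pd e_t \<zeta> p * f p * g2 p) - (LINT p|lebesgue_on \<Omega>. pd e_x \<zeta> p * f p * g1 p)"
proof -
  have i: "integrable (lebesgue_on \<Omega>) (\<lambda>p. k p * u p * w p)" if k: "smooth k" and uw: "u \<in> L2 (lebesgue_on \<Omega>)" "w \<in> L2 (lebesgue_on \<Omega>)" for k u w
  proof -
    obtain B where "\<And>p. p \<in> \<Omega> \<Longrightarrow> \<bar>k p\<bar> \<le> B" using smooth_bounded_on[OF k \<Omega>] by blast
    then show ?thesis using L2_weighted_bound(1)[OF uw borel_measurable_lebesgue_on[OF smooth_measurable[OF k]]] by auto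
  qed
  note ii = i[OF \<zeta> L(2) L(5)] i[OF \<zeta> L(3) L(4)] i[OF smooth_pd_t[OF \<zeta>] L(1) L(5)] i[OF smooth_pd_x[OF \<zeta>] L(1) L(4)]
  have e: "(\<lambda>p. \<zeta> p * (f1 p * g2 p - f2 p * g1 p) + f p * (pd e_t \<zeta> p * g2 p - pd e_x \<zeta> p * g1 p)) =
    (\<lambda>p. \<zeta> p * f1 p * g2 p - \<zeta> p * f2 p * g1 p + pd e_t \<zeta> p * f p * g2 p - pd e_x \<zeta> p * f p * g1 p)"
    by (simp add: algebra_simps)
  show "integrable (lebesgue_on \<Omega>) (\<lambda>p. \<zeta> p * (f1 p * g2 p - f2 p * g1 p) + f p * (pd e_t \<zeta> p * g2 p - pd e_x \<zeta> p * g1 p))"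
    unfolding e using ii by simp
  show "wedge \<Omega> \<zeta> f f1 f2 g1 g2 = (LINT p|lebesgue_on \<Omega>. \<zeta> p * f1 p * g2 p) - (LINT p|lebesgue_on \<Omega>. \<zeta> p * f2 p * g1 p)
    + (LINT p|lebesgue_on \<Omega>. pd e_t \<zeta> p * f p * g2 p) - (LINT p|lebesgue_on \<Omega>. pd e_x \<zeta> p * f p * g1 p)"
    unfolding wedge_def e using ii by simp
qed

text \<open>As functions and gradients are separate arguments, a constant sequence may stand in any
  place; this gives the limit in one factor with the other fixed as well as the joint limit.\<close>

lemma wedge_tendsto:
  assumes \<zeta>: "smooth \<zeta>" and \<Omega>: "bounded \<Omega>" and
    c: "l2conv (lebesgue_on \<Omega>) F f" "l2conv (lebesgue_on \<Omega>) F1 f1" "l2conv (lebesgue_on \<Omega>) F2 f2"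
      "l2conv (lebesgue_on \<Omega>) G1 g1" "l2conv (lebesgue_on \<Omega>) G2 g2"
  shows "(\<lambda>n. wedge \<Omega> \<zeta> (F n) (F1 n) (F2 n) (G1 n) (G2 n)) \<longlonglongrightarrow> wedge \<Omega> \<zeta> f f1 f2 g1 g2"
proof -
  have L: "f \<in> L2 (lebesgue_on \<Omega>)" "f1 \<in> L2 (lebesgue_on \<Omega>)" "f2 \<in> L2 (lebesgue_on \<Omega>)" "g1 \<in> L2 (lebesgue_on \<Omega>)" "g2 \<in> L2 (lebesgue_on \<Omega>)"
    "\<And>n. F n \<in> L2 (lebesgue_on \<Omega>)" "\<And>n. F1 n \<in> L2 (lebesgue_on \<Omega>)" "\<And>n. F2 n \<in> L2 (lebesgue_on \<Omega>)" "\<And>n. G1 n \<in> L2 (lebesgue_on \<Omega>)" "\<And>n. G2 n \<in> L2 (lebesgue_on \<Omega>)"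
    using c by (auto simp: l2conv_def)
  have t: "(\<lambda>n. LINT p|lebesgue_on \<Omega>. k p * U n p * W n p) \<longlonglongrightarrow> (LINT p|lebesgue_on \<Omega>. k p * u p * w p)"
    if k: "smooth k" and uw: "l2conv (lebesgue_on \<Omega>) U u" "l2conv (lebesgue_on \<Omega>) W w" for k U u W w
  proof -
    obtain B where "\<And>p. p \<in> \<Omega> \<Longrightarrow> \<bar>k p\<bar> \<le> B" using smooth_bounded_on[OF k \<Omega>] by blast
    then show ?thesis
      by (intro l2conv_integral[where B = B] k uw borel_measurable_lebesgue_on smooth_measurable) auto
  qed
  show ?thesis
    unfolding wedge_eq(2)[OF \<zeta> \<Omega> L(1-5)] wedge_eq(2)[OF \<zeta> \<Omega> L(6) L(7) L(8) L(9) L(10)]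
    by (intro tendsto_add tendsto_diff t \<zeta> smooth_pd_t smooth_pd_x c)
qed

text \<open>\<open>\<gamma>\<close> is Lipschitz on the whole line so that integrals over all
  parameters make sense. As the graph may run outside the box, an interior point also has a chart,
  with the graph above the box.\<close>

definition chart :: "pt set \<Rightarrow> pt \<Rightarrow> real \<Rightarrow> real \<Rightarrow> real \<Rightarrow> real \<Rightarrow> real \<Rightarrow> (real \<Rightarrow> real) \<Rightarrow> bool" where
  "chart \<Omega> p a b r d L \<gamma> \<longleftrightarrow> a\<^sup>2 + b\<^sup>2 = 1 \<and> r > 0 \<and> d > 0 \<and> L-lipschitz_on UNIV \<gamma> \<and>
     (\<forall>s \<tau>. \<bar>s\<bar> < r \<longrightarrow> \<bar>\<tau>\<bar> < d \<longrightarrow> (frame p a b (s, \<tau>) \<in> \<Omega> \<longleftrightarrow> \<tau> < \<gamma> s))"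

text \<open>The strict inequalities leave a margin between the support and the sides of the box, and
  the smaller closed box is preserved by differentiation.\<close>

definition in_box :: "pt \<Rightarrow> real \<Rightarrow> real \<Rightarrow> real \<Rightarrow> real \<Rightarrow> (pt \<Rightarrow> real) \<Rightarrow> bool" where
  "in_box p a b r d \<psi> \<longleftrightarrow> (\<exists>r1 d1. r1 < r \<and> d1 < d \<and> (\<forall>z. \<psi> (frame p a b z) \<noteq> 0 \<longrightarrow> \<bar>fst z\<bar> \<le> r1 \<and> \<bar>snd z\<bar> \<le> d1))"

lemma in_box_mult: "in_box p a b r d \<psi> \<Longrightarrow> in_box p a b r d (\<lambda>y. \<psi> y * f y)"
  unfolding in_box_def by (metis mult_zero_left)

lemma frame_coordinates:
  assumes "a\<^sup>2 + b\<^sup>2 = 1"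
  shows "frame p a b (((y - p) \<bullet> (- b, a), (y - p) \<bullet> (a, b))) = y"
    and "((frame p a b z - p) \<bullet> (- b, a), (frame p a b z - p) \<bullet> (a, b)) = z"
proof -
  have e: "x * a\<^sup>2 + x * b\<^sup>2 = x" for x using assms by (metis distrib_left mult.right_neutral)
  show "frame p a b (((y - p) \<bullet> (- b, a), (y - p) \<bullet> (a, b))) = y"
    using e[of "fst y - fst p"] e[of "snd y - snd p"]
    by (cases y; cases p) (simp add: frame_def algebra_simps power2_eq_square)
  show "((frame p a b z - p) \<bullet> (- b, a), (frame p a b z - p) \<bullet> (a, b)) = z"
    using e[of "fst z"] e[of "snd z"]
    by (cases z) (simp add: frame_def algebra_simps power2_eq_square)
qed

lemma frame_inj: "a\<^sup>2 + b\<^sup>2 = 1 \<Longrightarrow> frame p a b z = frame p a b z' \<longleftrightarrow> z = z'"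
  using frame_coordinates(2) by metis

lemma compact_frame_box:
  assumes "a\<^sup>2 + b\<^sup>2 = 1"
  shows "compact (frame p a b ` (cbox (-r1, -d1) (r1, d1)))"
  by (intro compact_continuous_image continuous_frame) auto

lemma eq_0_outside_frame_box:
  assumes ab: "a\<^sup>2 + b\<^sup>2 = 1" and z: "\<And>z. \<psi> (frame p a b z) \<noteq> 0 \<Longrightarrow> \<bar>fst z\<bar> \<le> r \<and> \<bar>snd z\<bar> \<le> d"
    and y: "y \<notin> frame p a b ` (cbox (-r, -d) (r, d))"
  shows "\<psi> y = 0"
proof (rule ccontr)
  assume "\<psi> y \<noteq> 0"
  define z where "z = ((y - p) \<bullet> (- b, a), (y - p) \<bullet> (a, b))"
  have fz: "frame p a b z = y" unfolding z_def by (rule frame_coordinates(1)[OF ab])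
  then have "z \<in> cbox (-r, -d) (r, d)" using assms(2)[of z] \<open>\<psi> y \<noteq> 0\<close> by (cases z) (auto simp: cbox_Pair_eq)
  then show False using fz y by blast
qed

lemma in_box_pd:
  assumes ab: "a\<^sup>2 + b\<^sup>2 = 1" and s: "in_box p a b r d \<psi>" shows "in_box p a b r d (pd e \<psi>)"
proof -
  obtain r1 d1 where rd: "r1 < r" "d1 < d" and z: "\<And>z. \<psi> (frame p a b z) \<noteq> 0 \<Longrightarrow> \<bar>fst z\<bar> \<le> r1 \<and> \<bar>snd z\<bar> \<le> d1"
    using s unfolding in_box_def by blast
  let ?K = "frame p a b ` (cbox (-r1, -d1) (r1, d1))"
  have o: "pd e \<psi> y = 0" if "y \<notin> ?K" for y
    by (rule pd_eq_0_outside[OF compact_imp_closed[OF compact_frame_box[OF ab]] eq_0_outside_frame_box[OF ab z] that])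
  have "\<bar>fst z\<bar> \<le> r1 \<and> \<bar>snd z\<bar> \<le> d1" if "pd e \<psi> (frame p a b z) \<noteq> 0" for z
  proof -
    have "frame p a b z \<in> ?K" using that o by blast
    then obtain z' where "z' \<in> cbox (-r1, -d1) (r1, d1)" "frame p a b z = frame p a b z'" by blast
    then show ?thesis using frame_inj[OF ab] by (cases z) (auto simp: cbox_Pair_eq)
  qed
  then show ?thesis unfolding in_box_def using rd by blast
qed

text \<open>A partial derivative is a combination of the derivatives along the two frame directions,
  with coefficients \<open>a\<close> and \<open>b\<close> up to sign, of size at most 1. The
  vertical estimate contributes 1 and the horizontal one \<open>2 * L\<close>.\<close>

lemma chart_boundary_estimate:
  assumes ch: "chart \<Omega> p a b r d L \<gamma>" and \<Omega>: "open \<Omega>" and \<psi>: "smooth \<psi>" and box: "in_box p a b r d \<psi>" and e: "e \<in> {e_t, e_x}"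
  shows "ennreal \<bar>LINT y|lebesgue_on \<Omega>. pd e \<psi> y\<bar> \<le> ennreal (1 + 2 * L) * (\<integral>\<^sup>+s. ennreal \<bar>\<psi> (graph p a b \<gamma> s)\<bar> \<partial>lborel)"
proof -
  have ab: "a\<^sup>2 + b\<^sup>2 = 1" and \<gamma>: "L-lipschitz_on UNIV \<gamma>" and "r > 0"
    and iff: "\<And>s \<tau>. \<bar>s\<bar> < r \<Longrightarrow> \<bar>\<tau>\<bar> < d \<Longrightarrow> frame p a b (s, \<tau>) \<in> \<Omega> \<longleftrightarrow> \<tau> < \<gamma> s"
    using ch unfolding chart_def by auto
  have L: "L \<ge> 0" using \<gamma> lipschitz_on_nonneg by blast
  obtain r1 d1 where rd: "r1 < r" "d1 < d" and z: "\<And>z. \<psi> (frame p a b z) \<noteq> 0 \<Longrightarrow> \<bar>fst z\<bar> \<le> r1 \<and> \<bar>snd z\<bar> \<le> d1"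
    using box unfolding in_box_def by blast
  obtain r2 d2 where rd2: "r2 < r" "d2 < d" and z2: "\<And>z. pd e \<psi> (frame p a b z) \<noteq> 0 \<Longrightarrow> \<bar>fst z\<bar> \<le> r2 \<and> \<bar>snd z\<bar> \<le> d2"
    using in_box_pd[OF ab box, of e] unfolding in_box_def by blast
  define \<Psi> where "\<Psi> = (\<lambda>z. \<psi> (frame p a b z))"
  have \<Psi>: "smooth \<Psi>" unfolding \<Psi>_def by (rule smooth_comp_frame[OF \<psi>])
  define R where "R = max 1 (max r1 d1)"
  have R: "R > 0" by (simp add: R_def)
  have supp: "z \<in> cbox (-R, -R) (R, R)" if "\<Psi> z \<noteq> 0" for z
  proof -
    have "\<bar>fst z\<bar> \<le> R \<and> \<bar>snd z\<bar> \<le> R" using z[of z] that unfolding \<Psi>_def R_def by auto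
    then show ?thesis by (cases z) (auto simp: cbox_Pair_eq)
  qed
  let ?D = "{z. snd z < \<gamma> (fst z)}"
  have [measurable]: "\<gamma> \<in> borel_measurable borel" by (rule lipschitz_measurable[OF \<gamma>])
  have D[measurable]: "?D \<in> sets borel" by (rule subgraph_borel) measurable
  define I1 I2 where "I1 = (\<integral>z. indicator ?D z * pd e_t \<Psi> z \<partial>lborel)" and "I2 = (\<integral>z. indicator ?D z * pd e_x \<Psi> z \<partial>lborel)"
  have int: "integrable lborel (\<lambda>z. indicator ?D z * pd e \<Psi> z)" if "e \<in> {e_t, e_x}" for e
  proof -
    have o: "pd e \<Psi> z = 0" if "z \<notin> cbox (-R, -R) (R, R)" for z
      by (rule pd_eq_0_outside[OF closed_cbox _ that]) (use supp in blast)
    have "integrable lborel (pd e \<Psi>)"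
      by (rule compact_support_integrable[OF smooth_continuous[OF smooth_pd[OF \<Psi> that]] compact_cbox o])
    then show ?thesis using integrable_mult_indicator[of ?D lborel "pd e \<Psi>"] D by simp
  qed
  have b1: "ennreal \<bar>I1\<bar> \<le> ennreal (2 * L) * (\<integral>\<^sup>+s. ennreal \<bar>\<psi> (graph p a b \<gamma> s)\<bar> \<partial>lborel)"
    using subgraph_integral_horizontal[OF \<Psi> supp \<gamma> R] by (simp add: I1_def \<Psi>_def graph_def)
  have b2: "ennreal \<bar>I2\<bar> \<le> (\<integral>\<^sup>+s. ennreal \<bar>\<psi> (graph p a b \<gamma> s)\<bar> \<partial>lborel)"
    using subgraph_integral_vertical[OF \<Psi> supp, of \<gamma>] by (simp add: I2_def \<Psi>_def graph_def)
  have sp: "smooth (pd e \<psi>)" by (rule smooth_pd[OF \<psi> e])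
  have "(LINT y|lebesgue_on \<Omega>. pd e \<psi> y) = (\<integral>y. indicator \<Omega> y * pd e \<psi> y \<partial>lborel)"
    by (rule integral_lebesgue_on_borel[OF \<Omega> smooth_measurable[OF sp]])
  also have "\<dots> = (\<integral>z. indicator \<Omega> (frame p a b z) * pd e \<psi> (frame p a b z) \<partial>lborel)"
    using \<Omega> smooth_measurable[OF sp] by (subst integral_frame[OF ab, symmetric]) auto
  also have "\<dots> = (\<integral>z. indicator ?D z * pd e \<psi> (frame p a b z) \<partial>lborel)"
  proof (rule Bochner_Integration.integral_cong[OF refl])
    fix z :: pt
    show "indicator \<Omega> (frame p a b z) * pd e \<psi> (frame p a b z) = indicator ?D z * pd e \<psi> (frame p a b z)"
    proof (cases "pd e \<psi> (frame p a b z) = 0")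
      case False
      then have "\<bar>fst z\<bar> < r" "\<bar>snd z\<bar> < d" using z2[of z] rd2 by auto
      then have "frame p a b z \<in> \<Omega> \<longleftrightarrow> z \<in> ?D" using iff[of "fst z" "snd z"] by simp
      then show ?thesis by (simp add: indicator_def)
    qed simp
  qed
  also have "\<exists>c1 c2. \<bar>c1\<bar> \<le> 1 \<and> \<bar>c2\<bar> \<le> 1 \<and> (\<integral>z. indicator ?D z * pd e \<psi> (frame p a b z) \<partial>lborel) = c1 * I1 + c2 * I2"
  proof -
    have e1: "x * a\<^sup>2 + x * b\<^sup>2 = x" for x using ab by (metis distrib_left mult.right_neutral)
    have t: "pd e_t \<psi> (frame p a b z) = (- b) * pd e_t \<Psi> z + a * pd e_x \<Psi> z" for z
      unfolding \<Psi>_def pd_comp_frame[OF \<psi>] using e1[of "pd e_t \<psi> (frame p a b z)"] by (simp add: algebra_simps power2_eq_square)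
    have x: "pd e_x \<psi> (frame p a b z) = a * pd e_t \<Psi> z + b * pd e_x \<Psi> z" for z
      unfolding \<Psi>_def pd_comp_frame[OF \<psi>] using e1[of "pd e_x \<psi> (frame p a b z)"] by (simp add: algebra_simps power2_eq_square)
    have le1: "\<bar>a\<bar> \<le> 1" "\<bar>b\<bar> \<le> 1" using ab by (metis abs_square_le_1 le_add_same_cancel1 zero_le_power2, metis abs_square_le_1 le_add_same_cancel2 zero_le_power2)
    have "\<exists>c1 c2. \<bar>c1\<bar> \<le> 1 \<and> \<bar>c2\<bar> \<le> 1 \<and> (\<forall>z. pd e \<psi> (frame p a b z) = c1 * pd e_t \<Psi> z + c2 * pd e_x \<Psi> z)"
      using e
    proof
      assume "e = e_t" then show ?thesis using t le1 by (intro exI[of _ "-b"] exI[of _ a]) auto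
    next
      assume "e \<in> {e_x}" then show ?thesis using x le1 by (intro exI[of _ a] exI[of _ b]) auto
    qed
    then obtain c1 c2 where c: "\<bar>c1\<bar> \<le> 1" "\<bar>c2\<bar> \<le> 1" "\<And>z. pd e \<psi> (frame p a b z) = c1 * pd e_t \<Psi> z + c2 * pd e_x \<Psi> z" by blast
    have "(\<integral>z. indicator ?D z * pd e \<psi> (frame p a b z) \<partial>lborel) = (\<integral>z. c1 * (indicator ?D z * pd e_t \<Psi> z) + c2 * (indicator ?D z * pd e_x \<Psi> z) \<partial>lborel)"
      by (simp add: c(3) algebra_simps)
    also have "\<dots> = c1 * I1 + c2 * I2" using int by (simp add: I1_def I2_def)
    finally show ?thesis using c by blast
  qed
  finally obtain c1 c2 where c: "\<bar>c1\<bar> \<le> 1" "\<bar>c2\<bar> \<le> 1" "(LINT y|lebesgue_on \<Omega>. pd e \<psi> y) = c1 * I1 + c2 * I2" by blast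
  have "\<bar>c1 * I1 + c2 * I2\<bar> \<le> \<bar>c1 * I1\<bar> + \<bar>c2 * I2\<bar>" by (rule abs_triangle_ineq)
  also have "\<dots> \<le> \<bar>I1\<bar> + \<bar>I2\<bar>" unfolding abs_mult using c(1,2) by (intro add_mono mult_left_le_one_le) auto
  finally have "ennreal \<bar>LINT y|lebesgue_on \<Omega>. pd e \<psi> y\<bar> \<le> ennreal \<bar>I1\<bar> + ennreal \<bar>I2\<bar>"
    unfolding c(3) by (simp add: ennreal_leI flip: ennreal_plus)
  also have "\<dots> \<le> ennreal (2 * L) * (\<integral>\<^sup>+s. ennreal \<bar>\<psi> (graph p a b \<gamma> s)\<bar> \<partial>lborel) + (\<integral>\<^sup>+s. ennreal \<bar>\<psi> (graph p a b \<gamma> s)\<bar> \<partial>lborel)"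
    by (intro add_mono b1 b2)
  also have "\<dots> = ennreal (1 + 2 * L) * (\<integral>\<^sup>+s. ennreal \<bar>\<psi> (graph p a b \<gamma> s)\<bar> \<partial>lborel)"
    using L by (simp add: ennreal_plus distrib_right add.commute)
  finally show ?thesis .
qed

text \<open>Young's inequality \<open>\<bar>f g\<bar> \<le> k g^2 + f^2 / k\<close> takes the place
  of Cauchy-Schwarz, so that the argument stays within integrals in \<open>ennreal\<close>.\<close>

lemma nn_integral_product_tendsto_0:
  assumes f[measurable]: "\<And>n. f n \<in> borel_measurable N" and g[measurable]: "\<And>n. g n \<in> borel_measurable N"
    and f0: "(\<lambda>n. \<integral>\<^sup>+x. ennreal ((f n x)\<^sup>2) \<partial>N) \<longlonglongrightarrow> 0"
    and gC: "C < \<infinity>" "\<forall>\<^sub>F n in sequentially. (\<integral>\<^sup>+x. ennreal ((g n x)\<^sup>2) \<partial>N) \<le> C"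
  shows "(\<lambda>n. \<integral>\<^sup>+x. ennreal \<bar>f n x * g n x\<bar> \<partial>N) \<longlonglongrightarrow> 0"
proof (rule order_tendstoI)
  fix \<epsilon> :: ennreal assume "0 < \<epsilon>"
  then obtain x where x: "0 < x" "x < \<epsilon>" using dense by blast
  then have "x < top" by (meson order.strict_trans2 top_greatest)
  define e where "e = enn2real x"
  have e: "e > 0" "ennreal e < \<epsilon>" using x \<open>x < top\<close> by (simp_all add: e_def enn2real_positive_iff)
  define c where "c = enn2real C + 1"
  have "C = ennreal (enn2real C)" using gC(1) by simp
  also have "\<dots> \<le> ennreal c" by (rule ennreal_leI) (simp add: c_def)
  finally have c: "c > 0" "C \<le> ennreal c" using enn2real_nonneg[of C] by (auto simp: c_def simp del: enn2real_nonneg)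
  \<comment> \<open>This weight makes the bounded factor contribute \<open>k * c = e / 2\<close>.
    The integral of \<open>f^2\<close> is then required to fall below \<open>k * (e / 2)\<close>,
    for the other half.\<close>
  define k where "k = e / (2 * c)"
  have k: "k > 0" using e c by (simp add: k_def)
  have "\<forall>\<^sub>F n in sequentially. (\<integral>\<^sup>+x. ennreal ((f n x)\<^sup>2) \<partial>N) < ennreal (k * (e / 2))"
    using order_tendstoD(2)[OF f0] k e by simp
  then show "\<forall>\<^sub>F n in sequentially. (\<integral>\<^sup>+x. ennreal \<bar>f n x * g n x\<bar> \<partial>N) < \<epsilon>"
    using gC(2)
  proof eventually_elim
    case (elim n)
    have pt: "ennreal \<bar>f n x * g n x\<bar> \<le> ennreal k * ennreal ((g n x)\<^sup>2) + ennreal (1 / k) * ennreal ((f n x)\<^sup>2)" for x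
    proof -
      have "0 \<le> (k * \<bar>g n x\<bar> - \<bar>f n x\<bar>)\<^sup>2" by simp
      then have "2 * (k * \<bar>f n x * g n x\<bar>) \<le> k * (k * (g n x)\<^sup>2) + (f n x)\<^sup>2"
        by (simp add: power2_diff power_mult_distrib abs_mult power2_eq_square algebra_simps)
      moreover have "0 \<le> k * \<bar>f n x * g n x\<bar>" using k by simp
      ultimately have "k * \<bar>f n x * g n x\<bar> \<le> k * (k * (g n x)\<^sup>2) + (f n x)\<^sup>2" by linarith
      then have "\<bar>f n x * g n x\<bar> \<le> k * (g n x)\<^sup>2 + (1 / k) * (f n x)\<^sup>2" using k by (simp add: field_simps)
      then have "ennreal \<bar>f n x * g n x\<bar> \<le> ennreal (k * (g n x)\<^sup>2 + (1 / k) * (f n x)\<^sup>2)" by (rule ennreal_leI)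
      also have "\<dots> = ennreal k * ennreal ((g n x)\<^sup>2) + ennreal (1 / k) * ennreal ((f n x)\<^sup>2)"
      proof -
        have "ennreal ((1 / k) * (f n x)\<^sup>2) = ennreal (1 / k) * ennreal ((f n x)\<^sup>2)"
          by (rule ennreal_mult) (use k in auto)
        moreover have "ennreal (k * (g n x)\<^sup>2) = ennreal k * ennreal ((g n x)\<^sup>2)"
          by (rule ennreal_mult) (use k in auto)
        moreover have "ennreal (k * (g n x)\<^sup>2 + (1 / k) * (f n x)\<^sup>2) = ennreal (k * (g n x)\<^sup>2) + ennreal ((1 / k) * (f n x)\<^sup>2)"
          by (rule ennreal_plus) (use k in auto)
        ultimately show ?thesis by (simp only:)
      qed
      finally show ?thesis .
    qed
    have "(\<integral>\<^sup>+x. ennreal \<bar>f n x * g n x\<bar> \<partial>N) \<le> (\<integral>\<^sup>+x. ennreal k * ennreal ((g n x)\<^sup>2) + ennreal (1 / k) * ennreal ((f n x)\<^sup>2) \<partial>N)"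
      by (intro nn_integral_mono pt)
    also have "\<dots> = ennreal k * (\<integral>\<^sup>+x. ennreal ((g n x)\<^sup>2) \<partial>N) + ennreal (1 / k) * (\<integral>\<^sup>+x. ennreal ((f n x)\<^sup>2) \<partial>N)"
      by (subst nn_integral_add) (simp_all add: nn_integral_cmult)
    also have "\<dots> \<le> ennreal k * ennreal c + ennreal (1 / k) * ennreal (k * (e / 2))"
      using elim c(2) by (intro add_mono mult_left_mono) auto
    also have "\<dots> = ennreal e"
    proof -
      have "k * c + 1 / k * (k * (e / 2)) = e" using k c by (simp add: k_def)
      then show ?thesis using k c e by (simp add: ennreal_mult[symmetric] ennreal_plus[symmetric] del: ennreal_plus)
    qed
    also have "\<dots> < \<epsilon>" by (rule e(2))
    finally show ?case .
  qed
qed simp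

definition wedgeH :: "pt set \<Rightarrow> (pt \<Rightarrow> real) \<Rightarrow> (pt \<Rightarrow> real) \<Rightarrow> (pt \<Rightarrow> real) \<Rightarrow> real" where
  "wedgeH \<Omega> \<zeta> \<phi> \<mu> = wedge \<Omega> \<zeta> \<phi> (wD \<Omega> 1 0 \<phi>) (wD \<Omega> 0 1 \<phi>) (wD \<Omega> 1 0 \<mu>) (wD \<Omega> 0 1 \<mu>)"

abbreviation wedgeS :: "pt set \<Rightarrow> (pt \<Rightarrow> real) \<Rightarrow> (pt \<Rightarrow> real) \<Rightarrow> (pt \<Rightarrow> real) \<Rightarrow> real" where
  "wedgeS \<Omega> \<zeta> \<Phi> M \<equiv> wedge \<Omega> \<zeta> \<Phi> (pd e_t \<Phi>) (pd e_x \<Phi>) (pd e_t M) (pd e_x M)"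

lemma in_box_graphD: "in_box p a b r d \<psi> \<Longrightarrow> \<psi> (graph p a b \<gamma> s) \<noteq> 0 \<Longrightarrow> \<bar>s\<bar> < r \<and> \<bar>\<gamma> s\<bar> < d"
  unfolding in_box_def graph_def by fastforce

lemma in_box_compact:
  assumes ab: "a\<^sup>2 + b\<^sup>2 = 1" and s: "in_box p a b r d \<psi>"
  shows "\<exists>K. compact K \<and> (\<forall>y. y \<notin> K \<longrightarrow> \<psi> y = 0)"
proof -
  obtain r1 d1 where z: "\<And>z. \<psi> (frame p a b z) \<noteq> 0 \<Longrightarrow> \<bar>fst z\<bar> \<le> r1 \<and> \<bar>snd z\<bar> \<le> d1"
    using s unfolding in_box_def by blast
  have "\<forall>y. y \<notin> frame p a b ` (cbox (-r1, -d1) (r1, d1)) \<longrightarrow> \<psi> y = 0"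
    using eq_0_outside_frame_box[OF ab z] by blast
  then show ?thesis using compact_frame_box[OF ab] by blast
qed

lemma smooth_in_box_bounded:
  assumes "a\<^sup>2 + b\<^sup>2 = 1" "in_box p a b r d \<psi>" "smooth \<psi>"
  obtains B where "B > 0" "\<And>y. \<bar>\<psi> y\<bar> \<le> B"
proof -
  obtain K where "compact K" "\<And>y. y \<notin> K \<Longrightarrow> \<psi> y = 0" using in_box_compact[OF assms(1,2)] by blast
  then show ?thesis using compact_support_bounded[OF smooth_continuous[OF assms(3)]] that by blast
qed

lemma graph_measurable: "\<gamma> \<in> borel_measurable borel \<Longrightarrow> graph p a b \<gamma> \<in> borel_measurable borel"
  unfolding graph_def[abs_def] by measurable

text \<open>\<open>d (\<zeta> \<Phi>) \<and> d M\<close> is the differential of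
  \<open>\<zeta> \<Phi> d M\<close>, because the mixed derivatives of \<open>M\<close> agree. Its
  integral is thus controlled by boundary values of \<open>\<zeta> \<Phi>\<close> times derivatives
  of \<open>M\<close>.\<close>

lemma wedgeS_bound:
  assumes ch: "chart \<Omega> p a b r d L \<gamma>" and \<Omega>: "open \<Omega>" "bounded \<Omega>"
    and s: "smooth \<zeta>" "smooth \<Phi>" "smooth M" and box: "in_box p a b r d \<zeta>"
  shows "ennreal \<bar>wedgeS \<Omega> \<zeta> \<Phi> M\<bar> \<le> ennreal (1 + 2 * L) *
    ((\<integral>\<^sup>+s. ennreal \<bar>\<zeta> (graph p a b \<gamma> s) * \<Phi> (graph p a b \<gamma> s) * pd e_x M (graph p a b \<gamma> s)\<bar> \<partial>lborel) +
     (\<integral>\<^sup>+s. ennreal \<bar>\<zeta> (graph p a b \<gamma> s) * \<Phi> (graph p a b \<gamma> s) * pd e_t M (graph p a b \<gamma> s)\<bar> \<partial>lborel))"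
proof -
  define X Y where "X = (\<lambda>p. \<zeta> p * \<Phi> p * pd e_x M p)" and "Y = (\<lambda>p. \<zeta> p * \<Phi> p * pd e_t M p)"
  have sX: "smooth X" "smooth Y" unfolding X_def Y_def by (intro smooth_intros s)+
  have bX: "in_box p a b r d X" "in_box p a b r d Y"
    unfolding X_def Y_def using in_box_mult[OF in_box_mult[OF box]] by auto
  have z: "smooth (\<lambda>p. \<zeta> p * \<Phi> p)" by (intro smooth_intros s)
  have i: "integrable (lebesgue_on \<Omega>) (pd e F)" if "smooth F" "e \<in> {e_t, e_x}" for F e
    using L2_mult_integrable[OF smooth_L2[OF smooth_const \<Omega>, of 1] smooth_L2[OF smooth_pd[OF that] \<Omega>]] by simp
  have "wedgeS \<Omega> \<zeta> \<Phi> M = (LINT y|lebesgue_on \<Omega>. pd e_t X y - pd e_x Y y)"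
    unfolding wedge_def
  proof (rule Bochner_Integration.integral_cong[OF refl])
    fix y
    have "pd e_t X y = \<zeta> y * \<Phi> y * pd e_t (pd e_x M) y + (\<zeta> y * pd e_t \<Phi> y + pd e_t \<zeta> y * \<Phi> y) * pd e_x M y"
      unfolding X_def by (simp add: smooth_pd_mult[OF z smooth_pd_x[OF s(3)]] smooth_pd_mult[OF s(1,2)])
    moreover have "pd e_x Y y = \<zeta> y * \<Phi> y * pd e_x (pd e_t M) y + (\<zeta> y * pd e_x \<Phi> y + pd e_x \<zeta> y * \<Phi> y) * pd e_t M y"
      unfolding Y_def by (simp add: smooth_pd_mult[OF z smooth_pd_t[OF s(3)]] smooth_pd_mult[OF s(1,2)])
    ultimately show "\<zeta> y * (pd e_t \<Phi> y * pd e_x M y - pd e_x \<Phi> y * pd e_t M y) + \<Phi> y * (pd e_t \<zeta> y * pd e_x M y - pd e_x \<zeta> y * pd e_t M y)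
       = pd e_t X y - pd e_x Y y"
      by (simp add: smooth_mixed_pd[OF s(3)] algebra_simps)
  qed
  also have "\<dots> = (LINT y|lebesgue_on \<Omega>. pd e_t X y) - (LINT y|lebesgue_on \<Omega>. pd e_x Y y)"
    by (rule Bochner_Integration.integral_diff) (auto intro!: i sX)
  finally have "\<bar>wedgeS \<Omega> \<zeta> \<Phi> M\<bar> \<le> \<bar>LINT y|lebesgue_on \<Omega>. pd e_t X y\<bar> + \<bar>LINT y|lebesgue_on \<Omega>. pd e_x Y y\<bar>" by simp
  then have "ennreal \<bar>wedgeS \<Omega> \<zeta> \<Phi> M\<bar> \<le> ennreal \<bar>LINT y|lebesgue_on \<Omega>. pd e_t X y\<bar> + ennreal \<bar>LINT y|lebesgue_on \<Omega>. pd e_x Y y\<bar>"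
    by (simp add: ennreal_leI flip: ennreal_plus)
  also have "\<dots> \<le> ennreal (1 + 2 * L) * (\<integral>\<^sup>+s. ennreal \<bar>X (graph p a b \<gamma> s)\<bar> \<partial>lborel) + ennreal (1 + 2 * L) * (\<integral>\<^sup>+s. ennreal \<bar>Y (graph p a b \<gamma> s)\<bar> \<partial>lborel)"
    by (intro add_mono chart_boundary_estimate[OF ch \<Omega>(1)] sX bX) auto
  finally show ?thesis by (simp add: X_def Y_def distrib_left)
qed

text \<open>In the sum the terms with \<open>d \<Phi> \<and> d M\<close> cancel, and
  \<open>d \<zeta> \<and> d (\<Phi> M) = - d (\<Phi> M d \<zeta>)\<close> remains. On the boundary
  only the product \<open>\<Phi> * M\<close> is left, with derivatives falling on
  \<open>\<zeta>\<close> alone, so both approximations may pass to the limit together.\<close>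

lemma wedgeS_sym_bound:
  assumes ch: "chart \<Omega> p a b r d L \<gamma>" and \<Omega>: "open \<Omega>" "bounded \<Omega>"
    and s: "smooth \<zeta>" "smooth \<Phi>" "smooth M" and box: "in_box p a b r d \<zeta>"
  shows "ennreal \<bar>wedgeS \<Omega> \<zeta> \<Phi> M + wedgeS \<Omega> \<zeta> M \<Phi>\<bar> \<le> ennreal (1 + 2 * L) *
    ((\<integral>\<^sup>+s. ennreal \<bar>pd e_t \<zeta> (graph p a b \<gamma> s) * (\<Phi> (graph p a b \<gamma> s) * M (graph p a b \<gamma> s))\<bar> \<partial>lborel) +
     (\<integral>\<^sup>+s. ennreal \<bar>pd e_x \<zeta> (graph p a b \<gamma> s) * (\<Phi> (graph p a b \<gamma> s) * M (graph p a b \<gamma> s))\<bar> \<partial>lborel))"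
proof -
  have ab: "a\<^sup>2 + b\<^sup>2 = 1" using ch by (simp add: chart_def)
  define X Y where "X = (\<lambda>p. pd e_t \<zeta> p * (\<Phi> p * M p))" and "Y = (\<lambda>p. pd e_x \<zeta> p * (\<Phi> p * M p))"
  have sX: "smooth X" "smooth Y" unfolding X_def Y_def by (intro smooth_intros s)+
  have bX: "in_box p a b r d X" "in_box p a b r d Y"
    unfolding X_def Y_def using in_box_mult[OF in_box_pd[OF ab box]] by auto
  have z: "smooth (\<lambda>p. \<Phi> p * M p)" by (intro smooth_intros s)
  have i: "integrable (lebesgue_on \<Omega>) (pd e F)" if "smooth F" "e \<in> {e_t, e_x}" for F e
    using L2_mult_integrable[OF smooth_L2[OF smooth_const \<Omega>, of 1] smooth_L2[OF smooth_pd[OF that] \<Omega>]] by simp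
  note sl = smooth_L2[OF _ \<Omega>]
  have wi: "integrable (lebesgue_on \<Omega>) (\<lambda>y. \<zeta> y * (pd e_t \<Phi> y * pd e_x M y - pd e_x \<Phi> y * pd e_t M y) + \<Phi> y * (pd e_t \<zeta> y * pd e_x M y - pd e_x \<zeta> y * pd e_t M y))"
    if "smooth \<Phi>" "smooth M" for \<Phi> M
    by (rule wedge_eq(1)[OF s(1) \<Omega>(2)]) (intro sl smooth_intros that)+
  have "wedgeS \<Omega> \<zeta> \<Phi> M + wedgeS \<Omega> \<zeta> M \<Phi> = (LINT y|lebesgue_on \<Omega>. pd e_x X y - pd e_t Y y)"
    unfolding wedge_def Bochner_Integration.integral_add[OF wi[OF s(2,3)] wi[OF s(3,2)], symmetric]
  proof (rule Bochner_Integration.integral_cong[OF refl])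
    fix y
    have "pd e_x X y = pd e_t \<zeta> y * (\<Phi> y * pd e_x M y + pd e_x \<Phi> y * M y) + pd e_x (pd e_t \<zeta>) y * (\<Phi> y * M y)"
      unfolding X_def by (simp add: smooth_pd_mult[OF smooth_pd_t[OF s(1)] z] smooth_pd_mult[OF s(2,3)])
    moreover have "pd e_t Y y = pd e_x \<zeta> y * (\<Phi> y * pd e_t M y + pd e_t \<Phi> y * M y) + pd e_t (pd e_x \<zeta>) y * (\<Phi> y * M y)"
      unfolding Y_def by (simp add: smooth_pd_mult[OF smooth_pd_x[OF s(1)] z] smooth_pd_mult[OF s(2,3)])
    ultimately show "\<zeta> y * (pd e_t \<Phi> y * pd e_x M y - pd e_x \<Phi> y * pd e_t M y) + \<Phi> y * (pd e_t \<zeta> y * pd e_x M y - pd e_x \<zeta> y * pd e_t M y)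
       + (\<zeta> y * (pd e_t M y * pd e_x \<Phi> y - pd e_x M y * pd e_t \<Phi> y) + M y * (pd e_t \<zeta> y * pd e_x \<Phi> y - pd e_x \<zeta> y * pd e_t \<Phi> y))
       = pd e_x X y - pd e_t Y y"
      by (simp add: smooth_mixed_pd[OF s(1)] algebra_simps)
  qed
  also have "\<dots> = (LINT y|lebesgue_on \<Omega>. pd e_x X y) - (LINT y|lebesgue_on \<Omega>. pd e_t Y y)"
    by (rule Bochner_Integration.integral_diff) (auto intro!: i sX)
  finally have "\<bar>wedgeS \<Omega> \<zeta> \<Phi> M + wedgeS \<Omega> \<zeta> M \<Phi>\<bar> \<le> \<bar>LINT y|lebesgue_on \<Omega>. pd e_x X y\<bar> + \<bar>LINT y|lebesgue_on \<Omega>. pd e_t Y y\<bar>" by simp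
  then have "ennreal \<bar>wedgeS \<Omega> \<zeta> \<Phi> M + wedgeS \<Omega> \<zeta> M \<Phi>\<bar> \<le> ennreal \<bar>LINT y|lebesgue_on \<Omega>. pd e_x X y\<bar> + ennreal \<bar>LINT y|lebesgue_on \<Omega>. pd e_t Y y\<bar>"
    by (simp add: ennreal_leI flip: ennreal_plus)
  also have "\<dots> \<le> ennreal (1 + 2 * L) * (\<integral>\<^sup>+s. ennreal \<bar>X (graph p a b \<gamma> s)\<bar> \<partial>lborel) + ennreal (1 + 2 * L) * (\<integral>\<^sup>+s. ennreal \<bar>Y (graph p a b \<gamma> s)\<bar> \<partial>lborel)"
    by (intro add_mono chart_boundary_estimate[OF ch \<Omega>(1)] sX bX) auto
  finally show ?thesis by (simp add: X_def Y_def distrib_left)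
qed

lemma tendsto_0_ennreal_bound:
  fixes x :: "nat \<Rightarrow> real"
  assumes l: "x \<longlonglongrightarrow> l" and b: "\<And>n. ennreal \<bar>x n\<bar> \<le> ennreal c * (X n + Y n)" and "X \<longlonglongrightarrow> 0" "Y \<longlonglongrightarrow> 0"
  shows "l = 0"
proof -
  have "(\<lambda>n. ennreal c * (X n + Y n)) \<longlonglongrightarrow> ennreal c * (0 + 0)"
    by (intro ennreal_tendsto_cmult tendsto_add assms) auto
  then have l0: "(\<lambda>n. ennreal c * (X n + Y n)) \<longlonglongrightarrow> 0" by simp
  have "(\<lambda>n. ennreal \<bar>x n\<bar>) \<longlonglongrightarrow> 0"
    by (rule tendsto_sandwich[OF _ _ tendsto_const l0]) (use b in auto)
  moreover have "(\<lambda>n. ennreal \<bar>x n\<bar>) \<longlonglongrightarrow> ennreal \<bar>l\<bar>" by (intro tendsto_ennrealI tendsto_rabs l)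
  ultimately have "ennreal \<bar>l\<bar> = 0" using LIMSEQ_unique by blast
  then show ?thesis by simp
qed

text \<open>Order of limits: for fixed \<open>m\<close> the derivatives of \<open>M m\<close> are
  bounded on the support of \<open>\<zeta>\<close>, while \<open>\<Phi> n\<close> tends to 0 in mean
  square on the part of the boundary that \<open>\<zeta>\<close> sees. Once the form vanishes for
  each \<open>M m\<close>, convergence of the gradients inside the domain suffices for
  \<open>m\<close>.\<close>

lemma wedgeH_eq_0:
  assumes nt: "emeasure hausdorff1 T \<noteq> 0" and ch: "chart \<Omega> p a b r d L \<gamma>" and \<Omega>: "open \<Omega>" "bounded \<Omega>"
    and S: "S \<in> sets borel" "S \<subseteq> frontier \<Omega>" and \<phi>: "\<phi> \<in> H1_0 \<Omega> S"
    and S': "S' \<in> sets borel" "S' \<subseteq> frontier \<Omega>" and \<mu>: "\<mu> \<in> H1_0 \<Omega> S'"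
    and \<zeta>: "smooth \<zeta>" "in_box p a b r d \<zeta>" and g: "\<And>s. \<zeta> (graph p a b \<gamma> s) \<noteq> 0 \<Longrightarrow> graph p a b \<gamma> s \<in> S"
  shows "wedgeH \<Omega> \<zeta> \<phi> \<mu> = 0"
proof -
  let ?M = "lebesgue_on \<Omega>"
  let ?G = "graph p a b \<gamma>"
  have ab: "a\<^sup>2 + b\<^sup>2 = 1" and \<gamma>L: "L-lipschitz_on UNIV \<gamma>" and rd: "r > 0" "d > 0" using ch by (auto simp: chart_def)
  have \<gamma>[measurable]: "\<gamma> \<in> borel_measurable borel" by (rule lipschitz_measurable[OF \<gamma>L])
  have G[measurable]: "?G \<in> borel_measurable borel" by (rule graph_measurable[OF \<gamma>])
  obtain \<Phi> where \<Phi>: "\<And>n. smooth (\<Phi> n)" and c\<Phi>: "l2conv ?M \<Phi> \<phi>" "l2conv ?M (\<lambda>n. pd e_t (\<Phi> n)) (wD \<Omega> 1 0 \<phi>)"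
     "l2conv ?M (\<lambda>n. pd e_x (\<Phi> n)) (wD \<Omega> 0 1 \<phi>)" and tr: "(\<lambda>n. \<integral>\<^sup>+p. indicator S p * ennreal ((\<Phi> n p)\<^sup>2) \<partial>hausdorff1) \<longlonglongrightarrow> 0"
    using H1_0_approx[OF \<Omega> S \<phi>] by blast
  obtain M where M: "\<And>n. smooth (M n)" and cM: "l2conv ?M (\<lambda>n. pd e_t (M n)) (wD \<Omega> 1 0 \<mu>)"
     "l2conv ?M (\<lambda>n. pd e_x (M n)) (wD \<Omega> 0 1 \<mu>)"
    using H1_0_approx[OF \<Omega> S' \<mu>] by blast
  note [measurable] = smooth_measurable[OF \<zeta>(1)] smooth_measurable[OF \<Phi>]
  define A where "A = {s. \<zeta> (?G s) \<noteq> 0}"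
  have "A = {s \<in> space borel. \<zeta> (?G s) \<noteq> 0}" by (simp add: A_def)
  also have "\<dots> \<in> sets borel" by measurable
  finally have A[measurable]: "A \<in> sets borel" .
  have lim: "(\<lambda>n. \<integral>\<^sup>+s. ennreal \<bar>\<zeta> (?G s) * \<Phi> n (?G s) * k (?G s)\<bar> \<partial>lborel) \<longlonglongrightarrow> 0" if k: "smooth k" for k
  proof -
    note [measurable] = smooth_measurable[OF k]
    \<comment> \<open>\<open>F n\<close> is the factor that tends to 0, cut off to parameters whose
      graph points lie in \<open>S\<close>; \<open>H\<close> is the fixed bounded factor, supported
      in \<open>[- r, r]\<close>.\<close>
    define F where "F = (\<lambda>n s. indicator A s * \<Phi> n (?G s))"
    define H where "H = (\<lambda>s. \<zeta> (?G s) * k (?G s))"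
    have eq: "\<zeta> (?G s) * \<Phi> n (?G s) * k (?G s) = F n s * H s" for n s by (auto simp: F_def H_def A_def indicator_def)
    have zk: "smooth (\<lambda>y. \<zeta> y * k y)" "in_box p a b r d (\<lambda>y. \<zeta> y * k y)" by (intro smooth_intros \<zeta> k in_box_mult)+
    obtain B where B: "B > 0" "\<And>y. \<bar>\<zeta> y * k y\<bar> \<le> B" using smooth_in_box_bounded[OF ab zk(2,1)] by blast
    have HB: "(\<integral>\<^sup>+s. ennreal ((H s)\<^sup>2) \<partial>lborel) \<le> ennreal (B\<^sup>2) * ennreal (2 * r)"
    proof -
      have "(\<integral>\<^sup>+s. ennreal ((H s)\<^sup>2) \<partial>lborel) \<le> (\<integral>\<^sup>+s. ennreal (B\<^sup>2) * indicator {-r..r} s \<partial>lborel)"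
      proof (rule nn_integral_mono)
        fix s
        show "ennreal ((H s)\<^sup>2) \<le> ennreal (B\<^sup>2) * indicator {-r..r} s"
        proof (cases "H s = 0")
          case False
          then have "s \<in> {-r..r}" using in_box_graphD[OF zk(2), of \<gamma> s] by (auto simp: H_def)
          moreover have "(H s)\<^sup>2 \<le> B\<^sup>2" using B(2)[of "?G s"] B(1) by (simp add: H_def abs_le_square_iff[symmetric])
          ultimately show ?thesis by (simp add: ennreal_leI)
        qed simp
      qed
      also have "\<dots> = ennreal (B\<^sup>2) * ennreal (2 * r)" using rd by (simp add: nn_integral_cmult_indicator)
      finally show ?thesis .
    qed
    have F0: "(\<lambda>n. \<integral>\<^sup>+s. ennreal ((F n s)\<^sup>2) \<partial>lborel) \<longlonglongrightarrow> 0"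
    proof (rule tendsto_sandwich[OF _ _ tendsto_const tr])
      have "(\<integral>\<^sup>+s. ennreal ((F n s)\<^sup>2) \<partial>lborel) \<le> (\<integral>\<^sup>+p. indicator S p * ennreal ((\<Phi> n p)\<^sup>2) \<partial>hausdorff1)" for n
      proof -
        have "(\<integral>\<^sup>+s. ennreal ((F n s)\<^sup>2) \<partial>lborel) = (\<integral>\<^sup>+s. indicator A s * ennreal ((\<Phi> n (?G s))\<^sup>2) \<partial>lborel)"
          by (rule nn_integral_cong) (auto simp: F_def indicator_def)
        also have "\<dots> \<le> (\<integral>\<^sup>+p. indicator S p * ennreal ((\<Phi> n p)\<^sup>2) \<partial>hausdorff1)"
          by (rule nn_integral_graph_le[OF nt ab \<gamma> A S(1)]) (use g A_def in auto)
        finally show ?thesis .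
      qed
      then show "\<forall>\<^sub>F n in sequentially. (\<integral>\<^sup>+s. ennreal ((F n s)\<^sup>2) \<partial>lborel) \<le> (\<integral>\<^sup>+p. indicator S p * ennreal ((\<Phi> n p)\<^sup>2) \<partial>hausdorff1)" by simp
    qed simp
    have Fm: "F n \<in> borel_measurable lborel" for n unfolding F_def by measurable
    have Hm: "H \<in> borel_measurable lborel" unfolding H_def by measurable
    have "ennreal (B\<^sup>2) * ennreal (2 * r) < \<infinity>" by (simp add: ennreal_mult_less_top)
    then show ?thesis unfolding eq
      by (rule nn_integral_product_tendsto_0[OF Fm Hm F0]) (use HB in simp)
  qed
  have z: "wedge \<Omega> \<zeta> \<phi> (wD \<Omega> 1 0 \<phi>) (wD \<Omega> 0 1 \<phi>) (pd e_t (M m)) (pd e_x (M m)) = 0" for m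
  proof (rule tendsto_0_ennreal_bound)
    show "(\<lambda>n. wedgeS \<Omega> \<zeta> (\<Phi> n) (M m)) \<longlonglongrightarrow> wedge \<Omega> \<zeta> \<phi> (wD \<Omega> 1 0 \<phi>) (wD \<Omega> 0 1 \<phi>) (pd e_t (M m)) (pd e_x (M m))"
      by (intro wedge_tendsto \<zeta> \<Omega> c\<Phi> l2conv_const smooth_L2 smooth_pd_t smooth_pd_x M)
    show "ennreal \<bar>wedgeS \<Omega> \<zeta> (\<Phi> n) (M m)\<bar> \<le> ennreal (1 + 2 * L) * ((\<integral>\<^sup>+s. ennreal \<bar>\<zeta> (?G s) * \<Phi> n (?G s) * pd e_x (M m) (?G s)\<bar> \<partial>lborel)
       + (\<integral>\<^sup>+s. ennreal \<bar>\<zeta> (?G s) * \<Phi> n (?G s) * pd e_t (M m) (?G s)\<bar> \<partial>lborel))" for n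
      by (rule wedgeS_bound[OF ch \<Omega> \<zeta>(1) \<Phi> M \<zeta>(2)])
  qed (intro lim smooth_pd_t smooth_pd_x M)+
  have "(\<lambda>m. wedge \<Omega> \<zeta> \<phi> (wD \<Omega> 1 0 \<phi>) (wD \<Omega> 0 1 \<phi>) (pd e_t (M m)) (pd e_x (M m))) \<longlonglongrightarrow> wedgeH \<Omega> \<zeta> \<phi> \<mu>"
    unfolding wedgeH_def using c\<Phi> by (intro wedge_tendsto \<zeta> \<Omega> cM l2conv_const) (auto simp: l2conv_def)
  then show ?thesis unfolding z by (simp add: LIMSEQ_const_iff)
qed

text \<open>The boundary term contains the product \<open>\<Phi> n * M n\<close>. On
  \<open>S\<close> the first factor tends to 0 and the second is bounded in mean square, on
  \<open>S'\<close> the reverse, and the graph inside the box is covered by these two sets up to one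
  point.\<close>

lemma wedgeH_antisym:
  assumes nt: "emeasure hausdorff1 T \<noteq> 0" and ch: "chart \<Omega> p a b r d L \<gamma>" and \<Omega>: "open \<Omega>" "bounded \<Omega>"
    and S: "S \<in> sets borel" "S \<subseteq> frontier \<Omega>" and \<phi>: "\<phi> \<in> H1_0 \<Omega> S"
    and S': "S' \<in> sets borel" "S' \<subseteq> frontier \<Omega>" and \<mu>: "\<mu> \<in> H1_0 \<Omega> S'"
    and \<zeta>: "smooth \<zeta>" "in_box p a b r d \<zeta>"
    and g: "\<And>s. \<bar>s\<bar> < r \<Longrightarrow> \<bar>\<gamma> s\<bar> < d \<Longrightarrow> s \<noteq> 0 \<Longrightarrow> graph p a b \<gamma> s \<in> S \<union> S'"
  shows "wedgeH \<Omega> \<zeta> \<phi> \<mu> = - wedgeH \<Omega> \<zeta> \<mu> \<phi>"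
proof -
  let ?M = "lebesgue_on \<Omega>"
  let ?G = "graph p a b \<gamma>"
  let ?F = "frontier \<Omega>"
  have ab: "a\<^sup>2 + b\<^sup>2 = 1" and \<gamma>L: "L-lipschitz_on UNIV \<gamma>" and rd: "r > 0" "d > 0" using ch by (auto simp: chart_def)
  have \<gamma>[measurable]: "\<gamma> \<in> borel_measurable borel" by (rule lipschitz_measurable[OF \<gamma>L])
  have G[measurable]: "?G \<in> borel_measurable borel" by (rule graph_measurable[OF \<gamma>])
  note [measurable] = S(1) S'(1)
  have [measurable]: "?F \<in> sets borel" by (simp add: borel_closed)
  obtain \<Phi> C where \<Phi>: "\<And>n. smooth (\<Phi> n)" and c\<Phi>: "l2conv ?M \<Phi> \<phi>" "l2conv ?M (\<lambda>n. pd e_t (\<Phi> n)) (wD \<Omega> 1 0 \<phi>)"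
     "l2conv ?M (\<lambda>n. pd e_x (\<Phi> n)) (wD \<Omega> 0 1 \<phi>)" and tr: "(\<lambda>n. \<integral>\<^sup>+p. indicator S p * ennreal ((\<Phi> n p)\<^sup>2) \<partial>hausdorff1) \<longlonglongrightarrow> 0"
     and C: "C < \<infinity>" "\<forall>\<^sub>F n in sequentially. (\<integral>\<^sup>+p. indicator ?F p * ennreal ((\<Phi> n p)\<^sup>2) \<partial>hausdorff1) \<le> C"
    using H1_0_approx[OF \<Omega> S \<phi>] by blast
  obtain M C' where M: "\<And>n. smooth (M n)" and cM: "l2conv ?M M \<mu>" "l2conv ?M (\<lambda>n. pd e_t (M n)) (wD \<Omega> 1 0 \<mu>)"
     "l2conv ?M (\<lambda>n. pd e_x (M n)) (wD \<Omega> 0 1 \<mu>)" and tr': "(\<lambda>n. \<integral>\<^sup>+p. indicator S' p * ennreal ((M n p)\<^sup>2) \<partial>hausdorff1) \<longlonglongrightarrow> 0"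
     and C': "C' < \<infinity>" "\<forall>\<^sub>F n in sequentially. (\<integral>\<^sup>+p. indicator ?F p * ennreal ((M n p)\<^sup>2) \<partial>hausdorff1) \<le> C'"
    using H1_0_approx[OF \<Omega> S' \<mu>] by blast
  note [measurable] = smooth_measurable[OF \<Phi>] smooth_measurable[OF M]
  have sq: "ennreal ((indicator A y * (x::real))\<^sup>2) = indicator A y * ennreal (x\<^sup>2)" for A x and y :: pt by (simp add: indicator_def)
  have mh: "f \<in> borel_measurable hausdorff1" if "f \<in> borel_measurable borel" for f :: "pt \<Rightarrow> real"
    using that by (simp add: measurable_cong_sets[OF sets_hausdorff1 refl])
  have p1: "(\<lambda>n. \<integral>\<^sup>+y. ennreal \<bar>(indicator S y * \<Phi> n y) * (indicator ?F y * M n y)\<bar> \<partial>hausdorff1) \<longlonglongrightarrow> 0"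
    by (rule nn_integral_product_tendsto_0[OF mh mh _ C'(1)]) (use tr C'(2) in \<open>simp_all add: sq\<close>)
  have p2: "(\<lambda>n. \<integral>\<^sup>+y. ennreal \<bar>(indicator S' y * M n y) * (indicator ?F y * \<Phi> n y)\<bar> \<partial>hausdorff1) \<longlonglongrightarrow> 0"
    by (rule nn_integral_product_tendsto_0[OF mh mh _ C(1)]) (use tr' C(2) in \<open>simp_all add: sq\<close>)
  have lim: "(\<lambda>n. \<integral>\<^sup>+s. ennreal \<bar>\<psi> (?G s) * (\<Phi> n (?G s) * M n (?G s))\<bar> \<partial>lborel) \<longlonglongrightarrow> 0"
    if \<psi>: "smooth \<psi>" "in_box p a b r d \<psi>" for \<psi>
  proof -
    obtain B where B: "B > 0" "\<And>y. \<bar>\<psi> y\<bar> \<le> B" using smooth_in_box_bounded[OF ab \<psi>(2,1)] by blast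
    note [measurable] = smooth_measurable[OF \<psi>(1)]
    \<comment> \<open>The parameter 0, where neither boundary condition is guaranteed, is removed;
      as a single point it is negligible.\<close>
    define A where "A = {s. \<psi> (?G s) \<noteq> 0} - {0}"
    have "{s. \<psi> (?G s) \<noteq> 0} = {s \<in> space borel. \<psi> (?G s) \<noteq> 0}" by simp
    also have "\<dots> \<in> sets borel" by measurable
    finally have A[measurable]: "A \<in> sets borel" by (simp add: A_def)
    have AS: "?G s \<in> S \<union> S'" if "s \<in> A" for s
      using that in_box_graphD[OF \<psi>(2), of \<gamma> s] g[of s] by (auto simp: A_def)
    have le: "(\<integral>\<^sup>+s. ennreal \<bar>\<psi> (?G s) * (\<Phi> n (?G s) * M n (?G s))\<bar> \<partial>lborel) \<le>
      ennreal B * ((\<integral>\<^sup>+y. ennreal \<bar>(indicator S y * \<Phi> n y) * (indicator ?F y * M n y)\<bar> \<partial>hausdorff1) +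
       (\<integral>\<^sup>+y. ennreal \<bar>(indicator S' y * M n y) * (indicator ?F y * \<Phi> n y)\<bar> \<partial>hausdorff1))" for n
    proof -
      have "(\<integral>\<^sup>+s. ennreal \<bar>\<psi> (?G s) * (\<Phi> n (?G s) * M n (?G s))\<bar> \<partial>lborel) \<le>
          (\<integral>\<^sup>+s. ennreal B * (indicator A s * ennreal \<bar>\<Phi> n (?G s) * M n (?G s)\<bar>) \<partial>lborel)"
      proof (rule nn_integral_mono_AE)
        show "AE s in lborel. ennreal \<bar>\<psi> (?G s) * (\<Phi> n (?G s) * M n (?G s))\<bar> \<le> ennreal B * (indicator A s * ennreal \<bar>\<Phi> n (?G s) * M n (?G s)\<bar>)"
          using AE_lborel_singleton[of 0]
        proof eventually_elim
          case (elim s)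
          show ?case
          proof (cases "\<psi> (?G s) = 0")
            case False
            then have "s \<in> A" using elim by (simp add: A_def)
            moreover have "\<bar>\<psi> (?G s)\<bar> * \<bar>\<Phi> n (?G s) * M n (?G s)\<bar> \<le> B * \<bar>\<Phi> n (?G s) * M n (?G s)\<bar>"
              using B by (intro mult_right_mono) auto
            ultimately show ?thesis using B(1) by (simp add: abs_mult ennreal_leI flip: ennreal_mult)
          qed simp
        qed
      qed
      also have "\<dots> = ennreal B * (\<integral>\<^sup>+s. indicator A s * ennreal \<bar>\<Phi> n (?G s) * M n (?G s)\<bar> \<partial>lborel)"
        by (rule nn_integral_cmult) measurable
      also have "(\<integral>\<^sup>+s. indicator A s * ennreal \<bar>\<Phi> n (?G s) * M n (?G s)\<bar> \<partial>lborel) \<le>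
         (\<integral>\<^sup>+y. indicator (S \<union> S') y * ennreal \<bar>\<Phi> n y * M n y\<bar> \<partial>hausdorff1)"
        by (rule nn_integral_graph_le[OF nt ab \<gamma> A]) (use AS in auto)
      also have "\<dots> \<le> (\<integral>\<^sup>+y. ennreal \<bar>(indicator S y * \<Phi> n y) * (indicator ?F y * M n y)\<bar> + ennreal \<bar>(indicator S' y * M n y) * (indicator ?F y * \<Phi> n y)\<bar> \<partial>hausdorff1)"
        by (rule nn_integral_mono) (use S(2) S'(2) in \<open>auto simp: indicator_def mult.commute\<close>)
      also have "\<dots> = (\<integral>\<^sup>+y. ennreal \<bar>(indicator S y * \<Phi> n y) * (indicator ?F y * M n y)\<bar> \<partial>hausdorff1) +
       (\<integral>\<^sup>+y. ennreal \<bar>(indicator S' y * M n y) * (indicator ?F y * \<Phi> n y)\<bar> \<partial>hausdorff1)"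
        by (rule nn_integral_add) measurable
      finally show ?thesis by (simp add: mult_left_mono)
    qed
    have "(\<lambda>n. ennreal B * ((\<integral>\<^sup>+y. ennreal \<bar>(indicator S y * \<Phi> n y) * (indicator ?F y * M n y)\<bar> \<partial>hausdorff1) +
       (\<integral>\<^sup>+y. ennreal \<bar>(indicator S' y * M n y) * (indicator ?F y * \<Phi> n y)\<bar> \<partial>hausdorff1))) \<longlonglongrightarrow> ennreal B * (0 + 0)"
      by (intro ennreal_tendsto_cmult tendsto_add p1 p2) auto
    then have l0: "(\<lambda>n. ennreal B * ((\<integral>\<^sup>+y. ennreal \<bar>(indicator S y * \<Phi> n y) * (indicator ?F y * M n y)\<bar> \<partial>hausdorff1) +
       (\<integral>\<^sup>+y. ennreal \<bar>(indicator S' y * M n y) * (indicator ?F y * \<Phi> n y)\<bar> \<partial>hausdorff1))) \<longlonglongrightarrow> 0" by simp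
    show ?thesis by (rule tendsto_sandwich[OF _ _ tendsto_const l0]) (use le in auto)
  qed
  have "wedgeH \<Omega> \<zeta> \<phi> \<mu> + wedgeH \<Omega> \<zeta> \<mu> \<phi> = 0"
  proof (rule tendsto_0_ennreal_bound)
    show "(\<lambda>n. wedgeS \<Omega> \<zeta> (\<Phi> n) (M n) + wedgeS \<Omega> \<zeta> (M n) (\<Phi> n)) \<longlonglongrightarrow> wedgeH \<Omega> \<zeta> \<phi> \<mu> + wedgeH \<Omega> \<zeta> \<mu> \<phi>"
      unfolding wedgeH_def by (intro tendsto_add wedge_tendsto \<zeta> \<Omega> c\<Phi> cM)
    show "ennreal \<bar>wedgeS \<Omega> \<zeta> (\<Phi> n) (M n) + wedgeS \<Omega> \<zeta> (M n) (\<Phi> n)\<bar> \<le> ennreal (1 + 2 * L) *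
       ((\<integral>\<^sup>+s. ennreal \<bar>pd e_t \<zeta> (?G s) * (\<Phi> n (?G s) * M n (?G s))\<bar> \<partial>lborel) +
        (\<integral>\<^sup>+s. ennreal \<bar>pd e_x \<zeta> (?G s) * (\<Phi> n (?G s) * M n (?G s))\<bar> \<partial>lborel))" for n
      by (rule wedgeS_sym_bound[OF ch \<Omega> \<zeta>(1) \<Phi> M \<zeta>(2)])
  qed (intro lim smooth_pd_t smooth_pd_x \<zeta> in_box_pd[OF ab])+
  then show ?thesis by simp
qed

section \<open>Points where the boundary condition may change\<close>

definition corner_box :: "pt set \<Rightarrow> pt \<Rightarrow> real \<Rightarrow> real \<Rightarrow> real \<Rightarrow> real \<Rightarrow> pt set" where
  "corner_box \<Omega> p a b K e = {y \<in> \<Omega>. \<bar>(y - p) \<bullet> (- b, a)\<bar> \<le> e \<and> \<bar>(y - p) \<bullet> (a, b)\<bar> \<le> K * e}"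

lemma corner_box_borel: "open \<Omega> \<Longrightarrow> corner_box \<Omega> p a b K e \<in> sets borel"
proof -
  assume "open \<Omega>"
  have "closed {y. \<bar>(y - p) \<bullet> (- b, a)\<bar> \<le> e \<and> \<bar>(y - p) \<bullet> (a, b)\<bar> \<le> K * e}"
    by (intro closed_Collect_conj closed_Collect_le continuous_intros)
  moreover have "corner_box \<Omega> p a b K e = \<Omega> \<inter> {y. \<bar>(y - p) \<bullet> (- b, a)\<bar> \<le> e \<and> \<bar>(y - p) \<bullet> (a, b)\<bar> \<le> K * e}"
    by (auto simp: corner_box_def)
  ultimately show ?thesis using \<open>open \<Omega>\<close> by (auto intro!: sets.Int borel_closed)
qed

text \<open>\<open>subgraph_poincare\<close> carried over by the rotation. The bounds on
  \<open>e\<close> keep the region \<open>R\<close> swept by the paths inside the chart, where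
  subgraph and domain coincide, and keep the parameters \<open>[e, 3 * e]\<close> where the graph
  lies in \<open>S\<close>.\<close>

lemma corner_poincare_smooth:
  assumes nt: "emeasure hausdorff1 T \<noteq> 0" and ch: "chart \<Omega> p a b r d L \<gamma>" and \<gamma>0: "\<gamma> 0 = 0" and \<Omega>: "open \<Omega>"
    and S: "S \<in> sets borel" and right: "\<And>s. 0 < s \<Longrightarrow> s < r \<Longrightarrow> graph p a b \<gamma> s \<in> S"
    and e: "e > 0" "3 * e < r" "(K + 2 * L) * e < d" "3 * L * e < d" and K: "K \<ge> 0" and \<Phi>: "smooth \<Phi>"
  shows "(\<integral>\<^sup>+y. indicator (corner_box \<Omega> p a b K e) y * ennreal ((\<Phi> y)\<^sup>2) \<partial>lebesgue_on \<Omega>)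
    \<le> ennreal ((4 * (K + 5 * L)\<^sup>2 + 8 * (1 + L\<^sup>2)) * e\<^sup>2) * (\<integral>\<^sup>+y. ennreal (grad_sq \<Phi> y) \<partial>lebesgue_on \<Omega>)
      + ennreal (4 * (K + 5 * L) * e) * (\<integral>\<^sup>+y. indicator S y * ennreal ((\<Phi> y)\<^sup>2) \<partial>hausdorff1)"
proof -
  have ab: "a\<^sup>2 + b\<^sup>2 = 1" and \<gamma>L: "L-lipschitz_on UNIV \<gamma>" and rd: "r > 0" "d > 0"
    and iff: "\<And>s \<tau>. \<bar>s\<bar> < r \<Longrightarrow> \<bar>\<tau>\<bar> < d \<Longrightarrow> frame p a b (s, \<tau>) \<in> \<Omega> \<longleftrightarrow> \<tau> < \<gamma> s" using ch by (auto simp: chart_def)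
  have L: "L \<ge> 0" using \<gamma>L lipschitz_on_nonneg by blast
  have \<gamma>le: "\<bar>\<gamma> s\<bar> \<le> L * \<bar>s\<bar>" for s using lipschitz_onD[OF \<gamma>L, of s 0] \<gamma>0 by (simp add: dist_real_def)
  have \<gamma>[measurable]: "\<gamma> \<in> borel_measurable borel" by (rule lipschitz_measurable[OF \<gamma>L])
  define \<Psi> where "\<Psi> = (\<lambda>z. \<Phi> (frame p a b z))"
  have \<Psi>: "smooth \<Psi>" unfolding \<Psi>_def by (rule smooth_comp_frame[OF \<Phi>])
  define Q where "Q = {z. \<bar>fst z\<bar> \<le> e \<and> - K * e \<le> snd z \<and> snd z < \<gamma> (fst z)}"
  define R where "R = {z. - e \<le> fst z \<and> fst z \<le> 3 * e \<and> - (K + 2 * L) * e \<le> snd z \<and> snd z < \<gamma> (fst z)}"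
  note pc = subgraph_poincare[OF \<Psi> \<gamma>L \<gamma>0 e(1) K Q_def R_def]
  note [measurable] = smooth_measurable[OF \<Phi>] grad_sq_measurable[OF \<Phi>] corner_box_borel[OF \<Omega>]
  have O[measurable]: "\<Omega> \<in> sets borel" using \<Omega> by simp
  have Ke: "K * e < d" 
  proof -
    have "0 \<le> 2 * L * e" using e(1) L by simp
    then show ?thesis using e(3) by (simp only: distrib_right)
  qed
  have 1: "(\<integral>\<^sup>+y. indicator (corner_box \<Omega> p a b K e) y * ennreal ((\<Phi> y)\<^sup>2) \<partial>lebesgue_on \<Omega>) \<le> (\<integral>\<^sup>+z. indicator Q z * ennreal ((\<Psi> z)\<^sup>2) \<partial>lborel)"
  proof -
    have "(\<integral>\<^sup>+y. indicator (corner_box \<Omega> p a b K e) y * ennreal ((\<Phi> y)\<^sup>2) \<partial>lebesgue_on \<Omega>) =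
       (\<integral>\<^sup>+y. indicator \<Omega> y * (indicator (corner_box \<Omega> p a b K e) y * ennreal ((\<Phi> y)\<^sup>2)) \<partial>lborel)"
      by (rule nn_integral_lebesgue_on_borel[OF \<Omega>]) measurable
    also have "\<dots> = (\<integral>\<^sup>+z. indicator \<Omega> (frame p a b z) * (indicator (corner_box \<Omega> p a b K e) (frame p a b z) * ennreal ((\<Phi> (frame p a b z))\<^sup>2)) \<partial>lborel)"
      by (rule nn_integral_frame[OF ab, symmetric]) measurable
    also have "\<dots> \<le> (\<integral>\<^sup>+z. indicator Q z * ennreal ((\<Psi> z)\<^sup>2) \<partial>lborel)"
    proof (rule nn_integral_mono)
      fix z :: pt
      have "z \<in> Q" if "frame p a b z \<in> \<Omega>" "frame p a b z \<in> corner_box \<Omega> p a b K e"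
      proof -
        have z: "\<bar>fst z\<bar> \<le> e" "\<bar>snd z\<bar> \<le> K * e"
          using that frame_coordinates(2)[OF ab, of p z] by (auto simp: corner_box_def) (metis fst_conv, metis snd_conv)
        then show ?thesis using iff[of "fst z" "snd z"] e Ke that by (auto simp: Q_def)
      qed
      then show "indicator \<Omega> (frame p a b z) * (indicator (corner_box \<Omega> p a b K e) (frame p a b z) * ennreal ((\<Phi> (frame p a b z))\<^sup>2)) \<le> indicator Q z * ennreal ((\<Psi> z)\<^sup>2)"
        by (auto simp: indicator_def \<Psi>_def)
    qed
    finally show ?thesis .
  qed
  have 2: "(\<integral>\<^sup>+z. indicator R z * ennreal (grad_sq \<Psi> z) \<partial>lborel) \<le> (\<integral>\<^sup>+y. ennreal (grad_sq \<Phi> y) \<partial>lebesgue_on \<Omega>)"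
  proof -
    have gs: "grad_sq \<Psi> z = grad_sq \<Phi> (frame p a b z)" for z
    proof -
      have e1: "x * a\<^sup>2 + x * b\<^sup>2 = x" for x using ab by (metis distrib_left mult.right_neutral)
      show ?thesis unfolding grad_sq_def \<Psi>_def pd_comp_frame[OF \<Phi>]
        using e1[of "(pd e_t \<Phi> (frame p a b z))\<^sup>2"] e1[of "(pd e_x \<Phi> (frame p a b z))\<^sup>2"]
        by (simp add: power2_eq_square algebra_simps)
    qed
    have "(\<integral>\<^sup>+z. indicator R z * ennreal (grad_sq \<Psi> z) \<partial>lborel) \<le> (\<integral>\<^sup>+z. indicator \<Omega> (frame p a b z) * ennreal (grad_sq \<Phi> (frame p a b z)) \<partial>lborel)"
    proof (rule nn_integral_mono)
      fix z :: pt
      have "frame p a b z \<in> \<Omega>" if "z \<in> R"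
      proof -
        obtain s \<tau> where z: "z = (s, \<tau>)" by (cases z)
        have r: "- e \<le> s" "s \<le> 3 * e" "- (K + 2 * L) * e \<le> \<tau>" "\<tau> < \<gamma> s" using that z by (auto simp: R_def)
        have "\<bar>s\<bar> \<le> 3 * e" using r e(1) by auto
        then have "L * \<bar>s\<bar> \<le> 3 * L * e" using L by (metis mult.assoc mult.left_commute mult_left_mono)
        then have "\<gamma> s < d" using \<gamma>le[of s] e(4) by linarith
        moreover have "- d < \<tau>" using r(3) e(3) by (simp add: algebra_simps)
        ultimately show ?thesis using iff[of s \<tau>] r \<open>\<bar>s\<bar> \<le> 3 * e\<close> e(2) z by auto
      qed
      then show "indicator R z * ennreal (grad_sq \<Psi> z) \<le> indicator \<Omega> (frame p a b z) * ennreal (grad_sq \<Phi> (frame p a b z))"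
        by (auto simp: indicator_def gs)
    qed
    also have "\<dots> = (\<integral>\<^sup>+y. indicator \<Omega> y * ennreal (grad_sq \<Phi> y) \<partial>lborel)"
      by (rule nn_integral_frame[OF ab]) measurable
    also have "\<dots> = (\<integral>\<^sup>+y. ennreal (grad_sq \<Phi> y) \<partial>lebesgue_on \<Omega>)"
      by (rule nn_integral_lebesgue_on_borel[OF \<Omega>, symmetric]) measurable
    finally show ?thesis .
  qed
  have 3: "(\<integral>\<^sup>+s. indicator {e..3*e} s * ennreal ((\<Psi> (s, \<gamma> s))\<^sup>2) \<partial>lborel) \<le> (\<integral>\<^sup>+y. indicator S y * ennreal ((\<Phi> y)\<^sup>2) \<partial>hausdorff1)"
  proof -
    have "(\<integral>\<^sup>+s. indicator {e..3*e} s * ennreal ((\<Phi> (graph p a b \<gamma> s))\<^sup>2) \<partial>lborel) \<le> (\<integral>\<^sup>+y. indicator S y * ennreal ((\<Phi> y)\<^sup>2) \<partial>hausdorff1)"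
      by (rule nn_integral_graph_le[OF nt ab \<gamma> _ S]) (use right e in auto)
    then show ?thesis by (simp add: \<Psi>_def graph_def)
  qed
  show ?thesis
    by (rule order.trans[OF 1 order.trans[OF pc]]) (intro add_mono mult_left_mono 2 3 zero_le)
qed

text \<open>In the limit of smooth approximants the boundary integral over \<open>S\<close>
  disappears. What matters later is the factor \<open>e^2\<close>: the square norm on the box is
  small of second order in its size.\<close>

lemma corner_poincare:
  assumes nt: "emeasure hausdorff1 T \<noteq> 0" and ch: "chart \<Omega> p a b r d L \<gamma>" and \<gamma>0: "\<gamma> 0 = 0" and \<Omega>: "open \<Omega>" "bounded \<Omega>"
    and S: "S \<in> sets borel" "S \<subseteq> frontier \<Omega>" and \<phi>: "\<phi> \<in> H1_0 \<Omega> S" and right: "\<And>s. 0 < s \<Longrightarrow> s < r \<Longrightarrow> graph p a b \<gamma> s \<in> S"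
    and e: "e > 0" "3 * e < r" "(K + 2 * L) * e < d" "3 * L * e < d" and K: "K \<ge> 0"
  shows "(LINT y|lebesgue_on \<Omega>. indicator (corner_box \<Omega> p a b K e) y * \<phi> y * \<phi> y) \<le>
     ((4 * (K + 5 * L)\<^sup>2 + 8 * (1 + L\<^sup>2)) * e\<^sup>2) * ((n2 (lebesgue_on \<Omega>) (wD \<Omega> 1 0 \<phi>))\<^sup>2 + (n2 (lebesgue_on \<Omega>) (wD \<Omega> 0 1 \<phi>))\<^sup>2)"
proof -
  let ?M = "lebesgue_on \<Omega>"
  let ?Q = "corner_box \<Omega> p a b K e"
  let ?c = "(4 * (K + 5 * L)\<^sup>2 + 8 * (1 + L\<^sup>2)) * e\<^sup>2"
  obtain \<Phi> where \<Phi>: "\<And>n. smooth (\<Phi> n)" and c: "l2conv ?M \<Phi> \<phi>" "l2conv ?M (\<lambda>n. pd e_t (\<Phi> n)) (wD \<Omega> 1 0 \<phi>)"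
     "l2conv ?M (\<lambda>n. pd e_x (\<Phi> n)) (wD \<Omega> 0 1 \<phi>)" and tr: "(\<lambda>n. \<integral>\<^sup>+p. indicator S p * ennreal ((\<Phi> n p)\<^sup>2) \<partial>hausdorff1) \<longlonglongrightarrow> 0"
    using H1_0_approx[OF \<Omega> S \<phi>] by blast
  have Qm[measurable]: "?Q \<in> sets borel" by (rule corner_box_borel[OF \<Omega>(1)])
  have im: "(indicator ?Q :: pt \<Rightarrow> real) \<in> borel_measurable ?M" by (rule borel_measurable_lebesgue_on) simp
  define I where "I = (\<lambda>n. LINT y|?M. indicator ?Q y * \<Phi> n y * \<Phi> n y)"
  define J where "J = (\<lambda>n. (LINT y|?M. 1 * pd e_t (\<Phi> n) y * pd e_t (\<Phi> n) y) + (LINT y|?M. 1 * pd e_x (\<Phi> n) y * pd e_x (\<Phi> n) y))"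
  have lI: "I \<longlonglongrightarrow> (LINT y|?M. indicator ?Q y * \<phi> y * \<phi> y)"
    unfolding I_def by (rule l2conv_integral[OF c(1) c(1) im, of 1]) (simp add: indicator_def)
  have lJ: "J \<longlonglongrightarrow> (LINT y|?M. 1 * wD \<Omega> 1 0 \<phi> y * wD \<Omega> 1 0 \<phi> y) + (LINT y|?M. 1 * wD \<Omega> 0 1 \<phi> y * wD \<Omega> 0 1 \<phi> y)"
    unfolding J_def by (intro tendsto_add l2conv_integral[OF c(2) c(2), of _ 1] l2conv_integral[OF c(3) c(3), of _ 1]) auto
  have sl: "\<Phi> n \<in> L2 ?M" "pd e_t (\<Phi> n) \<in> L2 ?M" "pd e_x (\<Phi> n) \<in> L2 ?M" for n
    using c by (auto simp: l2conv_def)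
  have eI: "(\<integral>\<^sup>+y. indicator ?Q y * ennreal ((\<Phi> n y)\<^sup>2) \<partial>?M) = ennreal (I n)" for n
  proof -
    have "(\<integral>\<^sup>+y. indicator ?Q y * ennreal ((\<Phi> n y)\<^sup>2) \<partial>?M) = (\<integral>\<^sup>+y. ennreal (indicator ?Q y * \<Phi> n y * \<Phi> n y) \<partial>?M)"
      by (rule nn_integral_cong) (simp add: indicator_def power2_eq_square)
    also have "\<dots> = ennreal (I n)" unfolding I_def
      by (rule nn_integral_eq_integral[OF L2_weighted_bound(1)[OF sl(1) sl(1) im, of 1]]) (auto simp: indicator_def)
    finally show ?thesis .
  qed
  have eJ: "(\<integral>\<^sup>+y. ennreal (grad_sq (\<Phi> n) y) \<partial>?M) = ennreal (J n)" for n
  proof -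
    have "(\<integral>\<^sup>+y. ennreal (grad_sq (\<Phi> n) y) \<partial>?M) = ennreal (LINT y|?M. (pd e_t (\<Phi> n) y)\<^sup>2 + (pd e_x (\<Phi> n) y)\<^sup>2)"
      unfolding grad_sq_def by (rule nn_integral_eq_integral) (use L2_integrable[OF sl(2)] L2_integrable[OF sl(3)] in auto)
    also have "\<dots> = ennreal (J n)" using L2_integrable[OF sl(2)] L2_integrable[OF sl(3)] by (simp add: J_def power2_eq_square)
    finally show ?thesis .
  qed
  have "ennreal (I n) \<le> ennreal ?c * ennreal (J n) + ennreal (4 * (K + 5 * L) * e) * (\<integral>\<^sup>+y. indicator S y * ennreal ((\<Phi> n y)\<^sup>2) \<partial>hausdorff1)" for n
    unfolding eI[symmetric] eJ[symmetric] by (rule corner_poincare_smooth[OF nt ch \<gamma>0 \<Omega>(1) S(1) right e K \<Phi>])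
  moreover have "(\<lambda>n. ennreal ?c * ennreal (J n) + ennreal (4 * (K + 5 * L) * e) * (\<integral>\<^sup>+y. indicator S y * ennreal ((\<Phi> n y)\<^sup>2) \<partial>hausdorff1)) \<longlonglongrightarrow>
     ennreal ?c * ennreal ((LINT y|?M. 1 * wD \<Omega> 1 0 \<phi> y * wD \<Omega> 1 0 \<phi> y) + (LINT y|?M. 1 * wD \<Omega> 0 1 \<phi> y * wD \<Omega> 0 1 \<phi> y)) + ennreal (4 * (K + 5 * L) * e) * 0"
    by (intro tendsto_add ennreal_tendsto_cmult tendsto_ennrealI lJ tr) auto
  moreover have "(\<lambda>n. ennreal (I n)) \<longlonglongrightarrow> ennreal (LINT y|?M. indicator ?Q y * \<phi> y * \<phi> y)" by (intro tendsto_ennrealI lI)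
  ultimately have "ennreal (LINT y|?M. indicator ?Q y * \<phi> y * \<phi> y) \<le> ennreal ?c * ennreal ((LINT y|?M. 1 * wD \<Omega> 1 0 \<phi> y * wD \<Omega> 1 0 \<phi> y) + (LINT y|?M. 1 * wD \<Omega> 0 1 \<phi> y * wD \<Omega> 0 1 \<phi> y)) + ennreal (4 * (K + 5 * L) * e) * 0"
    by (intro LIMSEQ_le) auto
  also have "\<dots> = ennreal (?c * ((n2 ?M (wD \<Omega> 1 0 \<phi>))\<^sup>2 + (n2 ?M (wD \<Omega> 0 1 \<phi>))\<^sup>2))"
  proof -
    have sq: "(LINT y|?M. 1 * u y * u y) = (n2 ?M u)\<^sup>2" for u
      unfolding n2_sq by (simp add: power2_eq_square)
    show ?thesis unfolding sq by (subst ennreal_mult[symmetric]) auto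
  qed
  finally show ?thesis by (rule ennreal_le_iff[THEN iffD1, rotated]) simp
qed

lemma wedgeH_add:
  assumes \<Omega>: "open \<Omega>" "bounded \<Omega>" and z: "smooth \<zeta>1" "smooth \<zeta>2" and \<phi>: "\<phi> \<in> sobolev \<Omega> 1" and \<mu>: "\<mu> \<in> sobolev \<Omega> 1"
  shows "wedgeH \<Omega> (\<lambda>y. \<zeta>1 y + \<zeta>2 y) \<phi> \<mu> = wedgeH \<Omega> \<zeta>1 \<phi> \<mu> + wedgeH \<Omega> \<zeta>2 \<phi> \<mu>"
proof -
  note s = sobolev1D[OF \<Omega> \<phi>] sobolev1D[OF \<Omega> \<mu>]
  note i = wedge_eq(1)[OF _ \<Omega>(2) s(1) s(5) s(6) s(11) s(12)]
  show ?thesis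
    unfolding wedgeH_def wedge_def Bochner_Integration.integral_add[OF i[OF z(1)] i[OF z(2)], symmetric]
    by (rule Bochner_Integration.integral_cong) (simp_all add: smooth_pd_add[OF z] algebra_simps)
qed

lemma n2_indicator_tendsto_0:
  assumes u: "u \<in> L2 M" and Q: "\<And>n. Q n \<in> sets M" and z: "\<And>y. y \<in> space M \<Longrightarrow> \<forall>\<^sub>F n in sequentially. y \<notin> Q n"
  shows "(\<lambda>n. n2 M (\<lambda>y. indicator (Q n) y * u y)) \<longlonglongrightarrow> 0"
proof -
  have um[measurable]: "u \<in> borel_measurable M" by (rule L2_measurable[OF u])
  note [measurable] = Q
  have "(\<lambda>n. \<integral>y. (indicator (Q n) y * u y)\<^sup>2 \<partial>M) \<longlonglongrightarrow> (\<integral>y. 0 \<partial>M)"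
  proof (rule integral_dominated_convergence[where w = "\<lambda>y. (u y)\<^sup>2"])
    show "AE y in M. (\<lambda>n. (indicator (Q n) y * u y)\<^sup>2) \<longlonglongrightarrow> 0"
    proof (rule AE_I2)
      fix y assume "y \<in> space M"
      from z[OF this] have "\<forall>\<^sub>F n in sequentially. (indicator (Q n) y * u y)\<^sup>2 = 0" by eventually_elim simp
      then show "(\<lambda>n. (indicator (Q n) y * u y)\<^sup>2) \<longlonglongrightarrow> 0" by (rule tendsto_eventually)
    qed
    show "AE y in M. norm ((indicator (Q n) y * u y)\<^sup>2) \<le> (u y)\<^sup>2" for n by (auto simp: indicator_def)
  qed (use L2_integrable[OF u] in auto)
  then have "(\<lambda>n. sqrt (\<integral>y. (indicator (Q n) y * u y)\<^sup>2 \<partial>M)) \<longlonglongrightarrow> sqrt 0" by (intro tendsto_real_sqrt) simp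
  then show ?thesis by (simp add: n2_def)
qed

lemma band_pd_bound:
  assumes B: "\<And>x. \<bar>deriv step x\<bar> \<le> B" and e: "norm e \<le> 1"
  shows "\<bar>pd e (band w c) y\<bar> \<le> 2 * B * norm w"
proof -
  let ?X = "\<lambda>y. 1 - step (y \<bullet> w + c)" and ?Y = "\<lambda>y. 1 - step (y \<bullet> (- w) + (- c))"
  note st = smooth1_affine[OF smooth1_step]
  have sX: "smooth ?X" "smooth ?Y" by (intro smooth_diff smooth_const st(1))+
  have B0: "B \<ge> 0" using B[of 0] by linarith
  have pX: "pd e ?X y = - ((e \<bullet> w) * deriv step (y \<bullet> w + c))"
    by (simp add: smooth_pd_diff[OF smooth_const st(1)] pd_const st(2))
  have pY: "pd e ?Y y = - ((e \<bullet> (- w)) * deriv step (y \<bullet> (- w) + (- c)))"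
    by (simp only: smooth_pd_diff[OF smooth_const st(1)] pd_const st(2) diff_0)
  have ew: "\<bar>e \<bullet> w\<bar> \<le> norm w"
    using Cauchy_Schwarz_ineq2[of e w] mult_right_mono[OF e, of "norm w"] by simp
  have b1: "\<bar>pd e ?X y\<bar> \<le> norm w * B" "\<bar>pd e ?Y y\<bar> \<le> norm w * B"
    unfolding pX pY using ew B B0 by (auto intro!: mult_mono simp: abs_mult)
  have x1: "\<bar>?X y\<bar> \<le> 1" "\<bar>?Y y\<bar> \<le> 1" using step_nonneg step_le_1 by (auto simp: abs_le_iff add_increasing)
  have "pd e (band w c) y = ?X y * pd e ?Y y + pd e ?X y * ?Y y"
    unfolding band_def[abs_def] by (rule smooth_pd_mult[OF sX])
  also have "\<bar>\<dots>\<bar> \<le> \<bar>?X y\<bar> * \<bar>pd e ?Y y\<bar> + \<bar>pd e ?X y\<bar> * \<bar>?Y y\<bar>"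
    by (rule order.trans[OF abs_triangle_ineq]) (simp add: abs_mult)
  also have "\<dots> \<le> 1 * (norm w * B) + (norm w * B) * 1"
    using b1 x1 B0 by (intro add_mono mult_mono) auto
  finally show ?thesis by (simp add: ac_simps)
qed

lemma norm_e [simp]: "norm e_t = 1" "norm e_x = 1"
  by (simp_all add: e_t_def e_x_def norm_Pair)

text \<open>At a point where the boundary condition may change, \<open>\<zeta>\<close> splits into a part right of the
  point, a part left of it, a part away from the boundary, and a part \<open>\<zeta> \<eta>\<close> supported in a box of
  size \<open>\<epsilon>\<close>. There \<open>\<eta>\<close> has gradient of order \<open>1 / \<epsilon>\<close>, which the Poincare inequality compensates.\<close>

lemma corner_wedgeH_eq_0:
  assumes nt: "emeasure hausdorff1 T \<noteq> 0" and ch: "chart \<Omega> p a b r d L \<gamma>" and \<gamma>0: "\<gamma> 0 = 0" and \<Omega>: "open \<Omega>" "bounded \<Omega>"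
    and S: "S \<in> sets borel" "S \<subseteq> frontier \<Omega>" and \<phi>: "\<phi> \<in> H1_0 \<Omega> S"
    and S': "S' \<in> sets borel" "S' \<subseteq> frontier \<Omega>" and \<mu>: "\<mu> \<in> H1_0 \<Omega> S'"
    and right: "\<And>s. 0 < s \<Longrightarrow> s < r \<Longrightarrow> graph p a b \<gamma> s \<in> S"
    and left: "(\<forall>s. - r < s \<longrightarrow> s < 0 \<longrightarrow> graph p a b \<gamma> s \<in> S) \<or> (\<forall>s. - r < s \<longrightarrow> s < 0 \<longrightarrow> graph p a b \<gamma> s \<in> S')"
    and \<zeta>: "smooth \<zeta>" "in_box p a b r d \<zeta>"
  shows "wedgeH \<Omega> \<zeta> \<phi> \<mu> = 0"
proof -
  let ?M = "lebesgue_on \<Omega>"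
  let ?G = "graph p a b \<gamma>"
  have ab: "a\<^sup>2 + b\<^sup>2 = 1" and \<gamma>L: "L-lipschitz_on UNIV \<gamma>" and rd: "r > 0" "d > 0"
    and iff: "\<And>s \<tau>. \<bar>s\<bar> < r \<Longrightarrow> \<bar>\<tau>\<bar> < d \<Longrightarrow> frame p a b (s, \<tau>) \<in> \<Omega> \<longleftrightarrow> \<tau> < \<gamma> s" using ch by (auto simp: chart_def)
  have L: "L \<ge> 0" using \<gamma>L lipschitz_on_nonneg by blast
  have \<gamma>le: "\<bar>\<gamma> s\<bar> \<le> L * \<bar>s\<bar>" for s using lipschitz_onD[OF \<gamma>L, of s 0] \<gamma>0 by (simp add: dist_real_def)
  note s\<phi> = H1_0_sobolev[OF \<phi>] and s\<mu> = H1_0_sobolev[OF \<mu>]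
  note d\<phi> = sobolev1D[OF \<Omega> s\<phi>] and d\<mu> = sobolev1D[OF \<Omega> s\<mu>]
  define w v where "w = (- b, a)" and "v = (a, b)"
  have nw: "norm w = 1" "norm v = 1" using ab by (auto simp: w_def v_def norm_Pair add.commute)
  have coord: "(?G s - p) \<bullet> w = s" "(?G s - p) \<bullet> v = \<gamma> s" for s
    using frame_coordinates(2)[OF ab, of p "(s, \<gamma> s)"] by (auto simp: w_def v_def graph_def)
  \<comment> \<open>Where the horizontal cutoff \<open>B1 \<epsilon>\<close> is nonzero,
    \<open>\<bar>s\<bar> < 2 * \<epsilon>\<close> and hence \<open>\<bar>\<gamma> s\<bar> \<le> 2 *
    L * \<epsilon> < K * \<epsilon>\<close>: the graph stays on the plateau of
    \<open>B2 \<epsilon>\<close>.\<close>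
  define K where "K = 2 * L + 1"
  have K: "K \<ge> 1" using L by (simp add: K_def)
  define W where "W = (\<lambda>\<epsilon>. (1 / \<epsilon>) *\<^sub>R w)"
  define c where "c = (\<lambda>\<epsilon>. - (p \<bullet> w) / \<epsilon>)"
  define B1 where "B1 = (\<lambda>\<epsilon>. band (W \<epsilon>) (c \<epsilon>))"
  define B2 where "B2 = (\<lambda>\<epsilon>. band ((1 / (K * \<epsilon>)) *\<^sub>R v) (- (p \<bullet> v) / (K * \<epsilon>)))"
  define \<eta> where "\<eta> = (\<lambda>\<epsilon> y. B1 \<epsilon> y * B2 \<epsilon> y)"
  have arg1: "y \<bullet> W \<epsilon> + c \<epsilon> = ((y - p) \<bullet> w) / \<epsilon>" for y \<epsilon>
    by (simp add: W_def c_def inner_diff_left diff_divide_distrib)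
  have arg2: "y \<bullet> ((1 / (K * \<epsilon>)) *\<^sub>R v) + - (p \<bullet> v) / (K * \<epsilon>) = ((y - p) \<bullet> v) / (K * \<epsilon>)" for y \<epsilon>
    by (simp add: inner_diff_left diff_divide_distrib)
  have sB: "smooth (B1 \<epsilon>)" "smooth (B2 \<epsilon>)" for \<epsilon> unfolding B1_def B2_def by (rule smooth_band)+
  have s\<eta>: "smooth (\<eta> \<epsilon>)" for \<epsilon> unfolding \<eta>_def by (intro smooth_intros sB)
  \<comment> \<open>A weight that meets the graph only on one side of \<open>p\<close> sees only one
    boundary condition. If that side is in \<open>S'\<close>, antisymmetry exchanges the functions;
    it applies because the right side is in \<open>S\<close> and the left side in
    \<open>S'\<close>.\<close>
  have van: "wedgeH \<Omega> \<zeta>' \<phi> \<mu> = 0"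
    if z: "smooth \<zeta>'" "in_box p a b r d \<zeta>'" and g: "(\<forall>s. \<zeta>' (?G s) \<noteq> 0 \<longrightarrow> 0 < s) \<or> (\<forall>s. \<zeta>' (?G s) \<noteq> 0 \<longrightarrow> s < 0)" for \<zeta>'
  proof -
    have sr: "- r < s \<and> s < r" if "\<zeta>' (?G s) \<noteq> 0" for s using in_box_graphD[OF z(2) that] by auto
    consider "\<forall>s. \<zeta>' (?G s) \<noteq> 0 \<longrightarrow> ?G s \<in> S" | "\<forall>s. \<zeta>' (?G s) \<noteq> 0 \<longrightarrow> ?G s \<in> S'" "\<forall>s. - r < s \<longrightarrow> s < 0 \<longrightarrow> ?G s \<in> S'"
      using g left right sr by blast
    then show ?thesis
    proof cases
      case 1
      then show ?thesis using wedgeH_eq_0[OF nt ch \<Omega> S \<phi> S' \<mu> z] by blast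
    next
      case 2
      have "wedgeH \<Omega> \<zeta>' \<phi> \<mu> = - wedgeH \<Omega> \<zeta>' \<mu> \<phi>"
      proof (rule wedgeH_antisym[OF nt ch \<Omega> S \<phi> S' \<mu> z])
        fix s :: real assume "\<bar>s\<bar> < r" "s \<noteq> 0"
        then show "?G s \<in> S \<union> S'" using right[of s] 2(2) by (cases "s > 0") auto
      qed
      also have "wedgeH \<Omega> \<zeta>' \<mu> \<phi> = 0"
        using 2(1) wedgeH_eq_0[OF nt ch \<Omega> S' \<mu> S \<phi> z] by blast
      finally show ?thesis by simp
    qed
  qed
  have red: "wedgeH \<Omega> \<zeta> \<phi> \<mu> = wedgeH \<Omega> (\<lambda>y. \<zeta> y * \<eta> \<epsilon> y) \<phi> \<mu>" if \<epsilon>: "\<epsilon> > 0" for \<epsilon>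
  proof -
    define sR where "sR = (\<lambda>y. step (y \<bullet> W \<epsilon> + c \<epsilon>))"
    define sL where "sL = (\<lambda>y. step (y \<bullet> (- W \<epsilon>) + (- c \<epsilon>)))"
    have sm: "smooth sR" "smooth sL" unfolding sR_def sL_def by (intro smooth1_affine(1)[OF smooth1_step])+
    define z1 z2 z3 z4 where "z1 = (\<lambda>y. \<zeta> y * sR y)" and "z2 = (\<lambda>y. \<zeta> y * ((1 - sR y) * sL y))"
      and "z3 = (\<lambda>y. \<zeta> y * (B1 \<epsilon> y * (1 - B2 \<epsilon> y)))" and "z4 = (\<lambda>y. \<zeta> y * \<eta> \<epsilon> y)"
    have sz: "smooth z1" "smooth z2" "smooth z3" "smooth z4"
      unfolding z1_def z2_def z3_def z4_def by (intro smooth_intros \<zeta> sm sB s\<eta>)+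
    have bz: "in_box p a b r d z1" "in_box p a b r d z2" "in_box p a b r d z3"
      unfolding z1_def z2_def z3_def by (rule in_box_mult[OF \<zeta>(2)])+
    \<comment> \<open>This is \<open>1 = sR + (1 - sR) * sL + B1 * (1 - B2) + B1 * B2\<close>,
      multiplied by \<open>\<zeta>\<close>.\<close>
    have eq: "\<zeta> = (\<lambda>y. z1 y + (z2 y + (z3 y + z4 y)))"
      unfolding z1_def z2_def z3_def z4_def \<eta>_def B1_def band_def sR_def sL_def by (rule ext) (simp add: algebra_simps)
    have "wedgeH \<Omega> z1 \<phi> \<mu> = 0"
    proof (rule van[OF sz(1) bz(1)], intro disjI1 allI impI)
      fix s assume "z1 (?G s) \<noteq> 0"
      then have "step (s / \<epsilon>) \<noteq> 0" by (simp add: z1_def sR_def arg1 coord)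
      then have "s / \<epsilon> > 1" using step_eq_0[of "s / \<epsilon>"] by linarith
      then show "0 < s" using \<epsilon> by (simp add: field_simps)
    qed
    moreover have "wedgeH \<Omega> z2 \<phi> \<mu> = 0"
    proof (rule van[OF sz(2) bz(2)], intro disjI2 allI impI)
      fix s assume nz: "z2 (?G s) \<noteq> 0"
      have "?G s \<bullet> (- W \<epsilon>) + (- c \<epsilon>) = - (s / \<epsilon>)" using arg1[of "?G s" \<epsilon>] coord(1)[of s] by (simp add: algebra_simps)
      then have "step (- (s / \<epsilon>)) \<noteq> 0" using nz by (auto simp: z2_def sL_def)
      then have "- (s / \<epsilon>) > 1" using step_eq_0[of "- (s / \<epsilon>)"] by linarith
      then have "s / \<epsilon> < 0" by simp
      then show "s < 0" using \<epsilon> by (simp add: divide_less_0_iff)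
    qed
    \<comment> \<open>\<open>z3\<close> vanishes on the entire graph, so the condition on the side
      is satisfied vacuously.\<close>
    moreover have "wedgeH \<Omega> z3 \<phi> \<mu> = 0"
    proof (rule van[OF sz(3) bz(3)], intro disjI1 allI impI)
      fix s assume nz: "z3 (?G s) \<noteq> 0"
      then have "B1 \<epsilon> (?G s) \<noteq> 0" by (auto simp: z3_def)
      then have "\<bar>?G s \<bullet> W \<epsilon> + c \<epsilon>\<bar> < 2" unfolding B1_def using band_eq_0[of "?G s" "W \<epsilon>" "c \<epsilon>"] by linarith
      then have "\<bar>s\<bar> < 2 * \<epsilon>" unfolding arg1 coord using \<epsilon> by (simp add: abs_divide field_simps)
      then have "L * \<bar>s\<bar> \<le> L * (2 * \<epsilon>)" using L by (intro mult_left_mono) auto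
      then have "\<bar>\<gamma> s\<bar> \<le> K * \<epsilon>" using \<gamma>le[of s] \<epsilon> by (simp add: K_def algebra_simps)
      then have "\<bar>\<gamma> s / (K * \<epsilon>)\<bar> \<le> 1" using K \<epsilon> by (simp add: abs_divide abs_mult field_simps)
      then have "B2 \<epsilon> (?G s) = 1" unfolding B2_def by (intro band_eq_1) (simp only: arg2 coord)
      then show "0 < s" using nz by (simp add: z3_def)
    qed
    ultimately show ?thesis
      unfolding z4_def[symmetric]
      by (subst eq) (simp add: wedgeH_add[OF \<Omega> _ _ s\<phi> s\<mu>] sz smooth_add)
  qed
  obtain Bs where Bs: "Bs > 0" "\<And>x. \<bar>deriv step x\<bar> \<le> Bs" using step_deriv_bound by blast
  obtain C0 where C0: "C0 > 0" "\<And>y. \<bar>\<zeta> y\<bar> \<le> C0" using smooth_in_box_bounded[OF ab \<zeta>(2,1)] by blast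
  obtain C1 where C1: "C1 > 0" "\<And>y. \<bar>pd e_t \<zeta> y\<bar> \<le> C1" using smooth_in_box_bounded[OF ab in_box_pd[OF ab \<zeta>(2)] smooth_pd_t[OF \<zeta>(1)]] by blast
  obtain C2 where C2: "C2 > 0" "\<And>y. \<bar>pd e_x \<zeta> y\<bar> \<le> C2" using smooth_in_box_bounded[OF ab in_box_pd[OF ab \<zeta>(2)] smooth_pd_x[OF \<zeta>(1)]] by blast
  \<comment> \<open>\<open>D / \<epsilon>\<close> bounds the partial derivatives of
    \<open>\<zeta> \<eta>\<close> for \<open>\<epsilon> \<le> 1\<close>: each of the two bands
    contributes \<open>2 * Bs / \<epsilon>\<close>, multiplied by the bound \<open>C0\<close> of
    \<open>\<zeta>\<close>, and the derivatives of \<open>\<zeta>\<close> contribute at most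
    \<open>C1 + C2\<close>.\<close>
  define D where "D = 4 * C0 * Bs + C1 + C2"
  have D: "D > 0" using C0 C1 C2 Bs by (simp add: D_def add_pos_pos)
  define Cp where "Cp = 4 * (K + 5 * L)\<^sup>2 + 8 * (1 + L\<^sup>2)"
  define N where "N = sqrt (Cp * ((n2 ?M (wD \<Omega> 1 0 \<phi>))\<^sup>2 + (n2 ?M (wD \<Omega> 0 1 \<phi>))\<^sup>2))"
  \<comment> \<open>Twice the scale, because the bands vanish only from argument 2 on.\<close>
  define Q where "Q = (\<lambda>\<epsilon>. corner_box \<Omega> p a b K (2 * \<epsilon>))"
  define \<nu> where "\<nu> = (\<lambda>\<epsilon> u. n2 ?M (\<lambda>y. indicator (Q \<epsilon>) y * u y))"
  have Qm[measurable]: "Q \<epsilon> \<in> sets borel" for \<epsilon> unfolding Q_def by (rule corner_box_borel[OF \<Omega>(1)])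
  have QM: "Q \<epsilon> \<in> sets ?M" for \<epsilon>
    using Qm \<Omega>(1) by (auto simp: sets_restrict_space_iff Q_def corner_box_def)
  have QL: "(\<lambda>y. indicator (Q \<epsilon>) y * u y) \<in> L2 ?M" if "u \<in> L2 ?M" for \<epsilon> u
  proof -
    have "integrable ?M (\<lambda>y. indicator (Q \<epsilon>) y *\<^sub>R (u y)\<^sup>2)"
      by (rule integrable_mult_indicator[OF QM L2_integrable[OF that]])
    moreover have "(\<lambda>y. indicator (Q \<epsilon>) y *\<^sub>R (u y)\<^sup>2) = (\<lambda>y. (indicator (Q \<epsilon>) y * u y)\<^sup>2)" by (auto simp: indicator_def)
    moreover have "(\<lambda>y. indicator (Q \<epsilon>) y * u y) \<in> borel_measurable ?M"
      by (intro borel_measurable_times borel_measurable_indicator QM L2_measurable[OF that])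
    ultimately show ?thesis by (simp add: L2_def)
  qed
  define C' where "C' = (C0 * n2 ?M (wD \<Omega> 1 0 \<phi>) + C0 * n2 ?M (wD \<Omega> 0 1 \<phi>) + 2 * D * N)"
  \<comment> \<open>The left side does not depend on \<open>\<epsilon>\<close>, and
    \<open>C'\<close> is fixed. The remaining factor is the norm of the gradient of
    \<open>\<mu>\<close> on a shrinking box.\<close>
  have bound: "\<bar>wedgeH \<Omega> \<zeta> \<phi> \<mu>\<bar> \<le> C' * (\<nu> \<epsilon> (wD \<Omega> 1 0 \<mu>) + \<nu> \<epsilon> (wD \<Omega> 0 1 \<mu>))"
    if \<epsilon>: "\<epsilon> > 0" "\<epsilon> \<le> 1" "6 * \<epsilon> < r" "(K + 2 * L) * (2 * \<epsilon>) < d" "3 * L * (2 * \<epsilon>) < d" for \<epsilon>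
  proof -
    define k where "k = (\<lambda>y. \<zeta> y * \<eta> \<epsilon> y)"
    have sk: "smooth k" unfolding k_def by (intro smooth_intros \<zeta> s\<eta>)
    let ?Z = "{y. \<bar>(y - p) \<bullet> w\<bar> \<le> 2 * \<epsilon> \<and> \<bar>(y - p) \<bullet> v\<bar> \<le> K * (2 * \<epsilon>)}"
    have clZ: "closed ?Z" by (intro closed_Collect_conj closed_Collect_le continuous_intros)
    have \<eta>0: "\<eta> \<epsilon> y = 0" if "y \<notin> ?Z" for y
    proof -
      have "\<bar>((y - p) \<bullet> w) / \<epsilon>\<bar> \<ge> 2 \<or> \<bar>((y - p) \<bullet> v) / (K * \<epsilon>)\<bar> \<ge> 2"
        using that \<epsilon>(1) K by (auto simp: abs_divide abs_mult field_simps)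
      then show ?thesis unfolding \<eta>_def B1_def B2_def using band_eq_0[of y "W \<epsilon>" "c \<epsilon>"]
          band_eq_0[of y "(1 / (K * \<epsilon>)) *\<^sub>R v" "- (p \<bullet> v) / (K * \<epsilon>)"] unfolding arg1 arg2 by auto
    qed
    have k0: "k y = 0" if "y \<notin> ?Z" for y using \<eta>0[OF that] by (simp add: k_def)
    have pk0: "pd e k y = 0" if "y \<notin> ?Z" for y e
      by (rule pd_eq_0_outside[OF clZ k0 that])
    have QZ: "y \<in> Q \<epsilon> \<longleftrightarrow> y \<in> ?Z" if "y \<in> \<Omega>" for y
      using that by (auto simp: Q_def corner_box_def w_def v_def)
    have \<eta>1: "\<bar>\<eta> \<epsilon> y\<bar> \<le> 1" for y
      unfolding \<eta>_def abs_mult B1_def B2_def using band_abs_le by (intro mult_le_one) auto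
    have kb: "\<bar>k y\<bar> \<le> C0" for y
      unfolding k_def abs_mult using mult_mono[OF C0(2)[of y] \<eta>1[of y]] C0(1) by simp
    have p\<eta>: "\<bar>pd e (\<eta> \<epsilon>) y\<bar> \<le> 4 * Bs / \<epsilon>" if e: "norm e \<le> 1" for e y
    proof -
      have n1: "norm (W \<epsilon>) = 1 / \<epsilon>" using \<epsilon> nw by (simp add: W_def)
      have n2: "norm ((1 / (K * \<epsilon>)) *\<^sub>R v) \<le> 1 / \<epsilon>" using \<epsilon> nw K by (simp add: field_simps)
      have b1: "\<bar>pd e (B1 \<epsilon>) y\<bar> \<le> 2 * Bs * (1 / \<epsilon>)" unfolding B1_def n1[symmetric] by (rule band_pd_bound[OF Bs(2) e])
      have "\<bar>pd e (B2 \<epsilon>) y\<bar> \<le> 2 * Bs * norm ((1 / (K * \<epsilon>)) *\<^sub>R v)" unfolding B2_def by (rule band_pd_bound[OF Bs(2) e])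
      also have "\<dots> \<le> 2 * Bs * (1 / \<epsilon>)" using n2 Bs(1) by (intro mult_left_mono) auto
      finally have b2: "\<bar>pd e (B2 \<epsilon>) y\<bar> \<le> 2 * Bs * (1 / \<epsilon>)" .
      have "pd e (\<eta> \<epsilon>) y = B1 \<epsilon> y * pd e (B2 \<epsilon>) y + pd e (B1 \<epsilon>) y * B2 \<epsilon> y"
        unfolding \<eta>_def by (rule smooth_pd_mult[OF sB])
      also have "\<bar>\<dots>\<bar> \<le> \<bar>B1 \<epsilon> y\<bar> * \<bar>pd e (B2 \<epsilon>) y\<bar> + \<bar>pd e (B1 \<epsilon>) y\<bar> * \<bar>B2 \<epsilon> y\<bar>"
        by (rule order.trans[OF abs_triangle_ineq]) (simp add: abs_mult)
      also have "\<dots> \<le> 1 * (2 * Bs * (1 / \<epsilon>)) + (2 * Bs * (1 / \<epsilon>)) * 1"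
        using b1 b2 Bs(1) \<epsilon>(1) unfolding B1_def B2_def by (intro add_mono mult_mono band_abs_le) auto
      finally show ?thesis by simp
    qed
    have pk: "\<bar>pd e k y\<bar> \<le> D / \<epsilon>" if e: "e \<in> {e_t, e_x}" for e y
    proof -
      have c: "\<bar>pd e \<zeta> y\<bar> \<le> C1 + C2" using e C1(1) C2(1) C1(2)[of y] C2(2)[of y] by auto
      have ne: "norm e \<le> 1" using e by auto
      have "pd e k y = \<zeta> y * pd e (\<eta> \<epsilon>) y + pd e \<zeta> y * \<eta> \<epsilon> y"
        unfolding k_def by (rule smooth_pd_mult[OF \<zeta>(1) s\<eta>])
      also have "\<bar>\<dots>\<bar> \<le> \<bar>\<zeta> y\<bar> * \<bar>pd e (\<eta> \<epsilon>) y\<bar> + \<bar>pd e \<zeta> y\<bar> * \<bar>\<eta> \<epsilon> y\<bar>"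
        by (rule order.trans[OF abs_triangle_ineq]) (simp add: abs_mult)
      also have "\<dots> \<le> C0 * (4 * Bs / \<epsilon>) + (C1 + C2) * 1"
        using C0 C1 C2 c p\<eta>[OF ne] \<eta>1 \<epsilon>(1) by (intro add_mono mult_mono) auto
      also have "\<dots> \<le> C0 * (4 * Bs / \<epsilon>) + (C1 + C2) * (1 / \<epsilon>)"
        using C1 C2 \<epsilon> by (intro add_left_mono mult_left_mono) auto
      also have "\<dots> = D / \<epsilon>" by (simp add: D_def add_divide_distrib)
      finally show ?thesis .
    qed
    have n\<phi>: "\<nu> \<epsilon> \<phi> \<le> 2 * \<epsilon> * N"
    proof -
      have "(\<nu> \<epsilon> \<phi>)\<^sup>2 = (LINT y|?M. indicator (Q \<epsilon>) y * \<phi> y * \<phi> y)"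
        unfolding \<nu>_def n2_sq by (rule Bochner_Integration.integral_cong) (auto simp: indicator_def power2_eq_square)
      also have "\<dots> \<le> (Cp * (2 * \<epsilon>)\<^sup>2) * ((n2 ?M (wD \<Omega> 1 0 \<phi>))\<^sup>2 + (n2 ?M (wD \<Omega> 0 1 \<phi>))\<^sup>2)"
        unfolding Q_def Cp_def
        by (rule corner_poincare[OF nt ch \<gamma>0 \<Omega> S \<phi> right]) (use \<epsilon> K in auto)
      also have "\<dots> = (2 * \<epsilon>)\<^sup>2 * (Cp * ((n2 ?M (wD \<Omega> 1 0 \<phi>))\<^sup>2 + (n2 ?M (wD \<Omega> 0 1 \<phi>))\<^sup>2))" by simp
      also have "\<dots> = (2 * \<epsilon> * N)\<^sup>2" by (simp add: N_def power_mult_distrib Cp_def)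
      finally show ?thesis by (rule power2_le_imp_le) (use \<epsilon> in \<open>simp add: N_def Cp_def\<close>)
    qed
    have km: "k \<in> borel_measurable ?M" "pd e_t k \<in> borel_measurable ?M" "pd e_x k \<in> borel_measurable ?M"
      using borel_measurable_lebesgue_on smooth_measurable sk smooth_pd_t smooth_pd_x by blast+
    have T1: "\<bar>LINT y|?M. k y * f y * g y\<bar> \<le> C0 * n2 ?M f * \<nu> \<epsilon> g" if "f \<in> L2 ?M" "g \<in> L2 ?M" for f g
    proof -
      have "(LINT y|?M. k y * f y * g y) = (LINT y|?M. k y * f y * (indicator (Q \<epsilon>) y * g y))"
        by (rule Bochner_Integration.integral_cong) (use k0 QZ in \<open>auto simp: indicator_def\<close>)
      then show ?thesis using L2_weighted_bound(2)[OF that(1) QL[OF that(2)] km(1), of C0] kb C0(1)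
        by (simp add: \<nu>_def mult.assoc)
    qed
    have T2: "\<bar>LINT y|?M. pd e k y * \<phi> y * g y\<bar> \<le> 2 * D * N * \<nu> \<epsilon> g" if g: "g \<in> L2 ?M" and e: "e \<in> {e_t, e_x}" for g e
    proof -
      have "(LINT y|?M. pd e k y * \<phi> y * g y) = (LINT y|?M. pd e k y * (indicator (Q \<epsilon>) y * \<phi> y) * (indicator (Q \<epsilon>) y * g y))"
        by (rule Bochner_Integration.integral_cong) (use pk0 QZ in \<open>auto simp: indicator_def\<close>)
      moreover have "pd e k \<in> borel_measurable ?M" using e km by auto
      ultimately have "\<bar>LINT y|?M. pd e k y * \<phi> y * g y\<bar> \<le> (D / \<epsilon>) * (\<nu> \<epsilon> \<phi> * \<nu> \<epsilon> g)"
        using L2_weighted_bound(2)[OF QL[OF d\<phi>(1)] QL[OF g], of "pd e k" "D / \<epsilon>"] pk[OF e] D \<epsilon>(1) by (simp add: \<nu>_def)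
      \<comment> \<open>The decisive cancellation: the gradient of the cutoff costs
        \<open>D / \<epsilon>\<close>, and the Poincare inequality returns
        \<open>2 * \<epsilon> * N\<close> for \<open>\<phi>\<close> on the box.\<close>
      also have "\<dots> \<le> (D / \<epsilon>) * ((2 * \<epsilon> * N) * \<nu> \<epsilon> g)"
        using D \<epsilon>(1) n\<phi> by (intro mult_left_mono mult_right_mono) (auto simp: \<nu>_def)
      also have "\<dots> = 2 * D * N * \<nu> \<epsilon> g" using \<epsilon>(1) by simp
      finally show ?thesis .
    qed
    have "wedgeH \<Omega> \<zeta> \<phi> \<mu> = wedgeH \<Omega> k \<phi> \<mu>" using red[OF \<epsilon>(1)] by (simp add: k_def)
    also have "\<dots> = (LINT y|?M. k y * wD \<Omega> 1 0 \<phi> y * wD \<Omega> 0 1 \<mu> y) - (LINT y|?M. k y * wD \<Omega> 0 1 \<phi> y * wD \<Omega> 1 0 \<mu> y)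
      + (LINT y|?M. pd e_t k y * \<phi> y * wD \<Omega> 0 1 \<mu> y) - (LINT y|?M. pd e_x k y * \<phi> y * wD \<Omega> 1 0 \<mu> y)"
      unfolding wedgeH_def by (rule wedge_eq(2)[OF sk \<Omega>(2)]) (use d\<phi> d\<mu> in auto)
    finally have "\<bar>wedgeH \<Omega> \<zeta> \<phi> \<mu>\<bar> \<le> C0 * n2 ?M (wD \<Omega> 1 0 \<phi>) * \<nu> \<epsilon> (wD \<Omega> 0 1 \<mu>) + C0 * n2 ?M (wD \<Omega> 0 1 \<phi>) * \<nu> \<epsilon> (wD \<Omega> 1 0 \<mu>)
       + 2 * D * N * \<nu> \<epsilon> (wD \<Omega> 0 1 \<mu>) + 2 * D * N * \<nu> \<epsilon> (wD \<Omega> 1 0 \<mu>)"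
      using T1[OF d\<phi>(5) d\<mu>(6)] T1[OF d\<phi>(6) d\<mu>(5)] T2[OF d\<mu>(6), of e_t] T2[OF d\<mu>(5), of e_x] by simp
    also have "\<dots> \<le> C' * (\<nu> \<epsilon> (wD \<Omega> 1 0 \<mu>) + \<nu> \<epsilon> (wD \<Omega> 0 1 \<mu>))"
    proof -
      have "0 \<le> C0 * n2 ?M (wD \<Omega> 1 0 \<phi>) * \<nu> \<epsilon> (wD \<Omega> 1 0 \<mu>)" "0 \<le> C0 * n2 ?M (wD \<Omega> 0 1 \<phi>) * \<nu> \<epsilon> (wD \<Omega> 0 1 \<mu>)"
        using C0(1) by (auto simp: \<nu>_def)
      then show ?thesis by (simp add: C'_def algebra_simps)
    qed
    finally show ?thesis .
  qed
  define \<epsilon> where "\<epsilon> = (\<lambda>n. 1 / real (Suc n))"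
  have \<epsilon>0: "\<epsilon> \<longlonglongrightarrow> 0" unfolding \<epsilon>_def using LIMSEQ_Suc[OF lim_1_over_n] by simp
  have pos: "\<epsilon> n > 0" "\<epsilon> n \<le> 1" for n by (auto simp: \<epsilon>_def)
  have small: "\<forall>\<^sub>F n in sequentially. m * \<epsilon> n < t" if "t > 0" for m t :: real
    using order_tendstoD(2)[OF tendsto_mult_right_zero[OF \<epsilon>0, of m] that] .
  \<comment> \<open>The boxes shrink to \<open>p\<close>, which is outside the domain, so each point
    of the domain eventually leaves them and dominated convergence applies.\<close>
  have pn: "p \<notin> \<Omega>" using iff[of 0 0] rd \<gamma>0 by (simp add: frame_def zero_prod_def[symmetric])
  have out: "\<forall>\<^sub>F n in sequentially. y \<notin> Q (\<epsilon> n)" if "y \<in> space ?M" for y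
  proof -
    have "y \<noteq> p" using that pn \<Omega>(1) by auto
    have "(y - p) \<bullet> w \<noteq> 0 \<or> (y - p) \<bullet> v \<noteq> 0"
    proof (rule ccontr)
      assume "\<not> ?thesis"
      then have "frame p a b (0, 0) = y" using frame_coordinates(1)[OF ab, of p y] by (simp add: w_def v_def)
      then show False using \<open>y \<noteq> p\<close> by (simp add: frame_def zero_prod_def[symmetric])
    qed
    then show ?thesis
    proof
      assume "(y - p) \<bullet> w \<noteq> 0"
      then have "\<forall>\<^sub>F n in sequentially. 2 * \<epsilon> n < \<bar>(y - p) \<bullet> w\<bar>" by (intro small) simp
      then show ?thesis by eventually_elim (auto simp: Q_def corner_box_def w_def)
    next
      assume "(y - p) \<bullet> v \<noteq> 0"
      then have "\<forall>\<^sub>F n in sequentially. (K * 2) * \<epsilon> n < \<bar>(y - p) \<bullet> v\<bar>" by (intro small) simp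
      then show ?thesis by eventually_elim (auto simp: Q_def corner_box_def v_def mult.assoc)
    qed
  qed
  have "(\<lambda>n. C' * (\<nu> (\<epsilon> n) (wD \<Omega> 1 0 \<mu>) + \<nu> (\<epsilon> n) (wD \<Omega> 0 1 \<mu>))) \<longlonglongrightarrow> C' * (0 + 0)"
    unfolding \<nu>_def by (intro tendsto_intros n2_indicator_tendsto_0 d\<mu> QM out)
  moreover have "\<forall>\<^sub>F n in sequentially. \<bar>wedgeH \<Omega> \<zeta> \<phi> \<mu>\<bar> \<le> C' * (\<nu> (\<epsilon> n) (wD \<Omega> 1 0 \<mu>) + \<nu> (\<epsilon> n) (wD \<Omega> 0 1 \<mu>))"
    using small[OF rd(1), of 6] small[OF rd(2), of "(K + 2 * L) * 2"] small[OF rd(2), of "3 * L * 2"]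
    by eventually_elim (rule bound, use pos in \<open>auto simp: algebra_simps\<close>)
  ultimately have "\<bar>wedgeH \<Omega> \<zeta> \<phi> \<mu>\<bar> \<le> C' * (0 + 0)"
    by (rule tendsto_lowerbound) simp
  then show ?thesis by simp
qed

section \<open>Orthogonality of gradients and rotated gradients\<close>

lemma chart_restrict:
  "chart \<Omega> p a b r d L \<gamma> \<Longrightarrow> 0 < r' \<Longrightarrow> r' \<le> r \<Longrightarrow> chart \<Omega> p a b r' d L \<gamma>"
  unfolding chart_def by auto

lemma open_frame_image:
  assumes ab: "a\<^sup>2 + b\<^sup>2 = 1" and "open U"
  shows "open (frame p a b ` U)"
proof -
  have "frame p a b ` U = (\<lambda>y. ((y - p) \<bullet> (- b, a), (y - p) \<bullet> (a, b))) -` U"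
  proof (intro set_eqI iffI)
    fix y assume "y \<in> frame p a b ` U"
    then obtain u where u: "u \<in> U" "y = frame p a b u" by blast
    show "y \<in> (\<lambda>y. ((y - p) \<bullet> (- b, a), (y - p) \<bullet> (a, b))) -` U"
      unfolding vimage_eq u(2) frame_coordinates(2)[OF ab] by (rule u(1))
  next
    fix y assume "y \<in> (\<lambda>y. ((y - p) \<bullet> (- b, a), (y - p) \<bullet> (a, b))) -` U"
    then show "y \<in> frame p a b ` U"
      by (intro image_eqI[of _ _ "((y - p) \<bullet> (- b, a), (y - p) \<bullet> (a, b))"]) (simp_all add: frame_coordinates(1)[OF ab])
  qed
  also have "open \<dots>" by (rule open_vimage[OF \<open>open U\<close>]) (intro continuous_intros)
  finally show ?thesis .
qed

section \<open>The boundary near one of its points: a graph, each side of which lies in one boundary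
  part\<close>

lemma continuous_graph:
  assumes "L-lipschitz_on UNIV \<gamma>" shows "continuous_on A (graph p a b \<gamma>)"
proof -
  have "continuous_on A \<gamma>" using continuous_on_subset[OF lipschitz_on_continuous_on[OF assms]] by blast
  then show ?thesis unfolding graph_def[abs_def] frame_def by (intro continuous_intros)
qed

lemma graph_in_frontier:
  assumes ch: "chart \<Omega> p a b r d L \<gamma>" and \<Omega>: "open \<Omega>" and s: "\<bar>s\<bar> < r" "\<bar>\<gamma> s\<bar> < d"
  shows "graph p a b \<gamma> s \<in> frontier \<Omega>"
proof -
  have iff: "\<And>s \<tau>. \<bar>s\<bar> < r \<Longrightarrow> \<bar>\<tau>\<bar> < d \<Longrightarrow> frame p a b (s, \<tau>) \<in> \<Omega> \<longleftrightarrow> \<tau> < \<gamma> s" using ch by (auto simp: chart_def)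
  have n: "graph p a b \<gamma> s \<notin> \<Omega>" using iff[OF s] by (simp add: graph_def)
  \<comment> \<open>Downward steps from the graph point; the denominators start at 2 so that the
    points stay strictly within height \<open>d\<close>.\<close>
  define k where "k = (\<lambda>n. (d - \<bar>\<gamma> s\<bar>) / real (Suc (Suc n)))"
  have k: "0 < k n" "k n < d - \<bar>\<gamma> s\<bar>" for n
    using s(2) mult_left_mono[of "\<bar>\<gamma> s\<bar>" d "real n"] by (auto simp: k_def field_simps)
  have k0: "k \<longlonglongrightarrow> 0"
    unfolding k_def using LIMSEQ_Suc[OF LIMSEQ_Suc[OF lim_const_over_n[of "d - \<bar>\<gamma> s\<bar>"]]] by simp
  have "frame p a b (s, \<gamma> s - k n) \<in> \<Omega>" for n
    by (subst iff) (use s k[of n] in auto)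
  moreover have "(\<lambda>n. frame p a b (s, \<gamma> s - k n)) \<longlonglongrightarrow> frame p a b (s, \<gamma> s - 0)"
    unfolding frame_def fst_conv snd_conv by (intro tendsto_intros k0)
  ultimately have "graph p a b \<gamma> s \<in> closure \<Omega>"
    unfolding closure_sequential graph_def by (intro exI[of _ "\<lambda>n. frame p a b (s, \<gamma> s - k n)"]) simp
  then show ?thesis using n \<Omega> by (simp add: frontier_def interior_open)
qed

text \<open>The region above the graph inside the box is open and disjoint from the domain, hence
  disjoint from its closure; points below the graph belong to the open domain itself.\<close>

lemma frontier_in_graph:
  assumes ch: "chart \<Omega> p a b r d L \<gamma>" and \<Omega>: "open \<Omega>" and st: "\<bar>s\<bar> < r" "\<bar>\<tau>\<bar> < d" and f: "frame p a b (s, \<tau>) \<in> frontier \<Omega>"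
  shows "\<tau> = \<gamma> s"
proof -
  have ab: "a\<^sup>2 + b\<^sup>2 = 1" and \<gamma>L: "L-lipschitz_on UNIV \<gamma>"
    and iff: "\<And>s \<tau>. \<bar>s\<bar> < r \<Longrightarrow> \<bar>\<tau>\<bar> < d \<Longrightarrow> frame p a b (s, \<tau>) \<in> \<Omega> \<longleftrightarrow> \<tau> < \<gamma> s" using ch by (auto simp: chart_def)
  have c: "continuous_on UNIV (\<lambda>z::pt. \<gamma> (fst z))"
    using lipschitz_on_continuous_on[OF \<gamma>L] by (rule continuous_on_compose2) (auto intro!: continuous_intros)
  have nO: "frame p a b (s, \<tau>) \<notin> \<Omega>" using f \<Omega> by (simp add: frontier_def interior_open)
  have "\<not> \<gamma> s < \<tau>"
  proof
    assume "\<gamma> s < \<tau>"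
    let ?U = "{z. \<bar>fst z\<bar> < r \<and> \<bar>snd z\<bar> < d \<and> \<gamma> (fst z) < snd z}"
    have "open ?U" by (intro open_Collect_conj open_Collect_less continuous_intros c)
    then have "open (frame p a b ` ?U)" by (rule open_frame_image[OF ab])
    moreover have "frame p a b (s, \<tau>) \<in> frame p a b ` ?U" using st \<open>\<gamma> s < \<tau>\<close> by auto
    moreover have "frame p a b (s, \<tau>) \<in> closure \<Omega>" using f by (simp add: frontier_def)
    ultimately have "frame p a b ` ?U \<inter> \<Omega> \<noteq> {}"
      using open_Int_closure_eq_empty[of "frame p a b ` ?U" \<Omega>] by blast
    then obtain z where "z \<in> ?U" "frame p a b z \<in> \<Omega>" by blast
    then show False using iff[of "fst z" "snd z"] by auto
  qed
  then show ?thesis using iff[OF st] nO by linarith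
qed

lemma frame_0 [simp]: "frame p a b (0, 0) = p"
  by (simp add: frame_def zero_prod_def[symmetric])

lemma boundary_chart:
  assumes \<Omega>: "open \<Omega>" and lip: "lipschitz_boundary \<Omega>" and p: "p \<in> frontier \<Omega>"
  obtains a b r d L \<gamma> where "chart \<Omega> p a b r d L \<gamma>" "\<gamma> 0 = 0" "\<And>s. \<bar>\<gamma> s\<bar> < d"
proof -
  from lip p have "\<exists>a b r d L. \<exists>\<gamma> :: real \<Rightarrow> real.
        a\<^sup>2 + b\<^sup>2 = 1 \<and> r > 0 \<and> d > 0 \<and> L-lipschitz_on {-r<..<r} \<gamma> \<and>
        (\<forall>s. \<bar>s\<bar> < r \<longrightarrow> \<bar>\<gamma> s\<bar> < d) \<and>
        (\<forall>s \<tau>. \<bar>s\<bar> < r \<longrightarrow> \<bar>\<tau>\<bar> < d \<longrightarrow>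
           (p + s *\<^sub>R (-b, a) + \<tau> *\<^sub>R (a, b) \<in> \<Omega> \<longleftrightarrow> \<tau> < \<gamma> s))"
    unfolding lipschitz_boundary_def by blast
  then obtain a b r d L and \<gamma> :: "real \<Rightarrow> real" where
        ab: "a\<^sup>2 + b\<^sup>2 = 1" and r: "r > 0" and d: "d > 0" and \<gamma>L: "L-lipschitz_on {-r<..<r} \<gamma>" and
        \<gamma>d: "\<And>s. \<bar>s\<bar> < r \<Longrightarrow> \<bar>\<gamma> s\<bar> < d" and
        iff: "\<And>s \<tau>. \<bar>s\<bar> < r \<Longrightarrow> \<bar>\<tau>\<bar> < d \<Longrightarrow> (p + s *\<^sub>R (-b, a) + \<tau> *\<^sub>R (a, b) \<in> \<Omega> \<longleftrightarrow> \<tau> < \<gamma> s)"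
    by blast
  \<comment> \<open>Clamping the parameter to half the interval extends the local graph function to
    the line with the same Lipschitz constant and the same height bound.\<close>
  define cl where "cl = (\<lambda>s. max (- r / 2) (min (r / 2) s))"
  define \<gamma>' where "\<gamma>' = (\<lambda>s. \<gamma> (cl s))"
  have cl: "\<bar>cl s\<bar> < r" for s using r by (auto simp: cl_def abs_less_iff min_def max_def)
  have cl_lip: "\<bar>cl s - cl s'\<bar> \<le> \<bar>s - s'\<bar>" for s s' using r by (auto simp: cl_def min_def max_def)
  have cl_id: "cl s = s" if "\<bar>s\<bar> < r / 2" for s using that by (auto simp: cl_def min_def max_def abs_less_iff)
  have L: "L \<ge> 0" using \<gamma>L lipschitz_on_nonneg by blast
  have lip': "L-lipschitz_on UNIV \<gamma>'"
  proof (rule lipschitz_onI[OF _ L])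
    fix s s'
    have "dist (\<gamma>' s) (\<gamma>' s') \<le> L * dist (cl s) (cl s')"
      unfolding \<gamma>'_def by (rule lipschitz_onD[OF \<gamma>L]) (use cl in \<open>auto simp: abs_less_iff minus_less_iff\<close>)
    also have "\<dots> \<le> L * dist s s'" using cl_lip L by (intro mult_left_mono) (auto simp: dist_real_def)
    finally show "dist (\<gamma>' s) (\<gamma>' s') \<le> L * dist s s'" .
  qed
  have ch: "chart \<Omega> p a b (r / 2) d L \<gamma>'"
    unfolding chart_def using ab r d lip' iff cl_id by (auto simp: frame_def \<gamma>'_def)
  have g: "\<bar>\<gamma>' s\<bar> < d" for s using \<gamma>d cl by (simp add: \<gamma>'_def)
  have "frame p a b (0, 0) \<in> frontier \<Omega>" using p by simp
  then have "\<gamma>' 0 = 0" using frontier_in_graph[OF ch \<Omega>, of 0 0] r d by simp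
  then show ?thesis using that ch g by blast
qed

text \<open>If membership in \<open>K\<close> kept alternating towards the point, there would be
  parameters \<open>m2 < n < m < n'\<close> with \<open>m2\<close>, \<open>m\<close> inside and
  \<open>n\<close>, \<open>n'\<close> outside. The open arc between \<open>n\<close> and
  \<open>n'\<close> would then be separated from the rest of \<open>K\<close>. The sign
  \<open>\<sigma>\<close> selects the side.\<close>

lemma connected_one_sided:
  assumes ch: "chart \<Omega> p a b r d L \<gamma>" and \<gamma>d: "\<And>s. \<bar>\<gamma> s\<bar> < d" and \<Omega>: "open \<Omega>"
    and K: "connected K" "K \<subseteq> frontier \<Omega>" and \<sigma>: "\<sigma> = 1 \<or> \<sigma> = - 1"
  shows "\<exists>\<delta>>0. (\<forall>s. 0 < s \<and> s < \<delta> \<longrightarrow> graph p a b \<gamma> (\<sigma> * s) \<notin> K) \<or> (\<forall>s. 0 < s \<and> s < \<delta> \<longrightarrow> graph p a b \<gamma> (\<sigma> * s) \<in> K)"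
proof (rule ccontr)
  let ?G = "\<lambda>s. graph p a b \<gamma> (\<sigma> * s)"
  assume "\<not> ?thesis"
  then have no: "\<And>\<delta>. \<delta> > 0 \<Longrightarrow> (\<exists>s. 0 < s \<and> s < \<delta> \<and> ?G s \<in> K) \<and> (\<exists>s. 0 < s \<and> s < \<delta> \<and> ?G s \<notin> K)" by blast
  have ab: "a\<^sup>2 + b\<^sup>2 = 1" and \<gamma>L: "L-lipschitz_on UNIV \<gamma>" and r: "r > 0" using ch by (auto simp: chart_def)
  obtain n' where n': "0 < n'" "n' < r" "?G n' \<notin> K" using no[OF r] by blast
  obtain m where m: "0 < m" "m < n'" "?G m \<in> K" using no[OF n'(1)] by blast
  obtain n where n: "0 < n" "n < m" "?G n \<notin> K" using no[OF m(1)] by blast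
  obtain m2 where m2: "0 < m2" "m2 < n" "?G m2 \<in> K" using no[OF n(1)] by blast
  have inj: "?G s = ?G t \<longleftrightarrow> s = t" for s t using \<sigma> frame_inj[OF ab] by (auto simp: graph_def)
  \<comment> \<open>The separating open sets: \<open>A\<close> meets the boundary exactly in the
    open arc from \<open>n\<close> to \<open>n'\<close>, and \<open>B\<close> is the complement of
    the closed arc. They cover \<open>K\<close> because the two ends of the arc are not in
    \<open>K\<close>.\<close>
  define A where "A = frame p a b ` {z. n < \<sigma> * fst z \<and> \<sigma> * fst z < n' \<and> \<bar>snd z\<bar> < d}"
  define B where "B = - (?G ` {n..n'})"
  have oA: "open A" unfolding A_def
    by (intro open_frame_image[OF ab] open_Collect_conj open_Collect_less continuous_intros)
  have "compact (?G ` {n..n'})"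
    by (intro compact_continuous_image continuous_on_compose2[OF continuous_graph[OF \<gamma>L, of UNIV]] continuous_intros) auto
  then have oB: "open B" unfolding B_def by (simp add: compact_imp_closed open_Compl)
  have AG: "k \<in> A \<longleftrightarrow> (\<exists>t. n < t \<and> t < n' \<and> k = ?G t)" if "k \<in> frontier \<Omega>" for k
  proof
    assume "k \<in> A"
    then obtain s \<tau> where st: "k = frame p a b (s, \<tau>)" "n < \<sigma> * s" "\<sigma> * s < n'" "\<bar>\<tau>\<bar> < d" by (auto simp: A_def)
    then have "\<bar>s\<bar> < r" using \<sigma> n n' by auto
    then have "\<tau> = \<gamma> s" using frontier_in_graph[OF ch \<Omega>, of s \<tau>] st that by simp
    then show "\<exists>t. n < t \<and> t < n' \<and> k = ?G t" using st \<sigma> by (intro exI[of _ "\<sigma> * s"]) (auto simp: graph_def)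
  next
    assume "\<exists>t. n < t \<and> t < n' \<and> k = ?G t"
    then obtain t where t: "n < t" "t < n'" "k = ?G t" by blast
    show "k \<in> A" unfolding A_def t(3) graph_def by (intro imageI) (use t(1,2) \<gamma>d \<sigma> in auto)
  qed
  have "K \<subseteq> A \<union> B"
  proof
    fix k assume k: "k \<in> K"
    show "k \<in> A \<union> B"
    proof (cases "k \<in> B")
      case False
      then obtain t where t: "n \<le> t" "t \<le> n'" "k = ?G t" by (auto simp: B_def)
      then have "t \<noteq> n" "t \<noteq> n'" using k n(3) n'(3) by auto
      then show ?thesis using AG[of k] k K(2) t by force
    qed simp
  qed
  moreover have "A \<inter> B \<inter> K = {}"
  proof (rule ccontr)
    assume "A \<inter> B \<inter> K \<noteq> {}"
    then obtain k where k: "k \<in> A" "k \<in> B" "k \<in> K" by blast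
    then obtain t where t: "n < t" "t < n'" "k = ?G t" using AG[of k] K(2) by blast
    then have "k \<in> ?G ` {n..n'}" by (intro image_eqI[of _ _ t]) auto
    then show False using k(2) by (simp add: B_def)
  qed
  moreover have "A \<inter> K \<noteq> {}" using AG[of "?G m"] m n K(2) by blast
  moreover have "B \<inter> K \<noteq> {}"
  proof -
    have "?G m2 \<in> B" using m2 inj by (auto simp: B_def)
    then show ?thesis using m2 by blast
  qed
  ultimately show False using K(1) oA oB unfolding connected_def by blast
qed

text \<open>Either some component contains a one-sided arc at the point, or each component misses
  one; finiteness of their number then gives a common length.\<close>

lemma finite_components_one_sided:
  assumes ch: "chart \<Omega> p a b r d L \<gamma>" and \<gamma>d: "\<And>s. \<bar>\<gamma> s\<bar> < d" and \<Omega>: "open \<Omega>"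
    and S: "finite (components S)" "S \<subseteq> frontier \<Omega>" and \<sigma>: "\<sigma> = 1 \<or> \<sigma> = - 1"
  shows "\<exists>\<delta>>0. (\<forall>s. 0 < s \<and> s < \<delta> \<longrightarrow> graph p a b \<gamma> (\<sigma> * s) \<notin> S) \<or> (\<forall>s. 0 < s \<and> s < \<delta> \<longrightarrow> graph p a b \<gamma> (\<sigma> * s) \<in> S)"
proof (cases "\<exists>K\<in>components S. \<exists>\<delta>>0. \<forall>s. 0 < s \<and> s < \<delta> \<longrightarrow> graph p a b \<gamma> (\<sigma> * s) \<in> K")
  case True
  then show ?thesis using in_components_subset by blast
next
  case False
  have "\<forall>K\<in>components S. \<exists>\<delta>>0. \<forall>s. 0 < s \<and> s < \<delta> \<longrightarrow> graph p a b \<gamma> (\<sigma> * s) \<notin> K"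
  proof
    fix K assume K: "K \<in> components S"
    have "connected K" "K \<subseteq> frontier \<Omega>" using K S(2) in_components_connected in_components_subset by blast+
    from connected_one_sided[OF ch \<gamma>d \<Omega> this \<sigma>] False K
    show "\<exists>\<delta>>0. \<forall>s. 0 < s \<and> s < \<delta> \<longrightarrow> graph p a b \<gamma> (\<sigma> * s) \<notin> K" by blast
  qed
  then obtain \<delta> where \<delta>: "\<And>K. K \<in> components S \<Longrightarrow> \<delta> K > 0" "\<And>K s. K \<in> components S \<Longrightarrow> 0 < s \<Longrightarrow> s < \<delta> K \<Longrightarrow> graph p a b \<gamma> (\<sigma> * s) \<notin> K"
    by metis
  \<comment> \<open>The element 1 keeps \<open>Min\<close> meaningful when there are no
    components.\<close>
  define \<delta>0 where "\<delta>0 = Min (insert 1 (\<delta> ` components S))"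
  have "\<delta>0 > 0" unfolding \<delta>0_def using S(1) \<delta>(1) by (subst Min_gr_iff) auto
  moreover have "graph p a b \<gamma> (\<sigma> * s) \<notin> S" if "0 < s" "s < \<delta>0" for s
  proof
    assume "graph p a b \<gamma> (\<sigma> * s) \<in> S"
    then obtain K where K: "K \<in> components S" "graph p a b \<gamma> (\<sigma> * s) \<in> K" using Union_components by blast
    then have "\<delta>0 \<le> \<delta> K" unfolding \<delta>0_def using S(1) by (intro Min_le) auto
    then show False using \<delta>(2)[OF K(1) that(1)] that K(2) by simp
  qed
  ultimately show ?thesis by blast
qed

text \<open>An arc missed by both parts would have an open neighbourhood, over the same parameters,
  missed by both and therefore by their closures; but these closures cover the boundary.\<close>

lemma boundary_one_sided:
  assumes ch: "chart \<Omega> p a b r d L \<gamma>" and \<gamma>d: "\<And>s. \<bar>\<gamma> s\<bar> < d" and \<Omega>: "open \<Omega>"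
    and I: "finite (components \<Gamma>I)" "\<Gamma>I \<subseteq> frontier \<Omega>" and C: "finite (components \<Gamma>C)" "\<Gamma>C \<subseteq> frontier \<Omega>"
    and F: "frontier \<Omega> = closure \<Gamma>I \<union> closure \<Gamma>C" and \<sigma>: "\<sigma> = 1 \<or> \<sigma> = - 1"
  shows "\<exists>\<delta>>0. (\<forall>s. 0 < s \<and> s < \<delta> \<longrightarrow> graph p a b \<gamma> (\<sigma> * s) \<in> \<Gamma>I) \<or> (\<forall>s. 0 < s \<and> s < \<delta> \<longrightarrow> graph p a b \<gamma> (\<sigma> * s) \<in> \<Gamma>C)"
proof -
  have ab: "a\<^sup>2 + b\<^sup>2 = 1" and r: "r > 0" using ch by (auto simp: chart_def)
  obtain \<delta>1 where \<delta>1: "\<delta>1 > 0" "(\<forall>s. 0 < s \<and> s < \<delta>1 \<longrightarrow> graph p a b \<gamma> (\<sigma> * s) \<notin> \<Gamma>I) \<or> (\<forall>s. 0 < s \<and> s < \<delta>1 \<longrightarrow> graph p a b \<gamma> (\<sigma> * s) \<in> \<Gamma>I)"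
    using finite_components_one_sided[OF ch \<gamma>d \<Omega> I \<sigma>] by blast
  obtain \<delta>2 where \<delta>2: "\<delta>2 > 0" "(\<forall>s. 0 < s \<and> s < \<delta>2 \<longrightarrow> graph p a b \<gamma> (\<sigma> * s) \<notin> \<Gamma>C) \<or> (\<forall>s. 0 < s \<and> s < \<delta>2 \<longrightarrow> graph p a b \<gamma> (\<sigma> * s) \<in> \<Gamma>C)"
    using finite_components_one_sided[OF ch \<gamma>d \<Omega> C \<sigma>] by blast
  have "\<not> ((\<forall>s. 0 < s \<and> s < \<delta>1 \<longrightarrow> graph p a b \<gamma> (\<sigma> * s) \<notin> \<Gamma>I) \<and> (\<forall>s. 0 < s \<and> s < \<delta>2 \<longrightarrow> graph p a b \<gamma> (\<sigma> * s) \<notin> \<Gamma>C))"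
  proof
    assume no: "(\<forall>s. 0 < s \<and> s < \<delta>1 \<longrightarrow> graph p a b \<gamma> (\<sigma> * s) \<notin> \<Gamma>I) \<and> (\<forall>s. 0 < s \<and> s < \<delta>2 \<longrightarrow> graph p a b \<gamma> (\<sigma> * s) \<notin> \<Gamma>C)"
    define m where "m = min r (min \<delta>1 \<delta>2)"
    have m: "0 < m" "m \<le> r" "m \<le> \<delta>1" "m \<le> \<delta>2" using r \<delta>1 \<delta>2 by (auto simp: m_def)
    define A where "A = frame p a b ` {z. 0 < \<sigma> * fst z \<and> \<sigma> * fst z < m \<and> \<bar>snd z\<bar> < d}"
    have oA: "open A" unfolding A_def
      by (intro open_frame_image[OF ab] open_Collect_conj open_Collect_less continuous_intros)
    have ss: "\<sigma> * (\<sigma> * t) = t" for t using \<sigma> by auto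
    have "graph p a b \<gamma> (\<sigma> * (m / 2)) \<in> A" unfolding A_def graph_def by (intro imageI) (use m \<gamma>d \<sigma> in auto)
    moreover have "\<bar>\<sigma> * (m / 2)\<bar> < r" using m \<sigma> by auto
    then have "graph p a b \<gamma> (\<sigma> * (m / 2)) \<in> frontier \<Omega>" by (intro graph_in_frontier[OF ch \<Omega>] \<gamma>d)
    ultimately have "A \<inter> closure \<Gamma>I \<noteq> {} \<or> A \<inter> closure \<Gamma>C \<noteq> {}" using F by blast
    then have "A \<inter> \<Gamma>I \<noteq> {} \<or> A \<inter> \<Gamma>C \<noteq> {}" using open_Int_closure_eq_empty[OF oA] by blast
    then obtain k where k: "k \<in> A" "k \<in> \<Gamma>I \<union> \<Gamma>C" by blast
    then obtain s \<tau> where st: "k = frame p a b (s, \<tau>)" "0 < \<sigma> * s" "\<sigma> * s < m" "\<bar>\<tau>\<bar> < d" by (auto simp: A_def)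
    then have "\<bar>s\<bar> < r" using \<sigma> m by auto
    moreover have "k \<in> frontier \<Omega>" using k(2) I(2) C(2) by blast
    ultimately have "\<tau> = \<gamma> s" using frontier_in_graph[OF ch \<Omega>, of s \<tau>] st by simp
    then have "k = graph p a b \<gamma> (\<sigma> * (\<sigma> * s))" using st \<sigma> by (auto simp: graph_def)
    then show False using no k(2) st m by fastforce
  qed
  then show ?thesis using \<delta>1 \<delta>2 by blast
qed

text \<open>At an interior point the weight does not reach the boundary. At a boundary point each
  side of a short arc lies in one part, and \<open>corner_wedgeH_eq_0\<close> is applied to the
  function that vanishes on the right side, after an exchange if that function is
  \<open>\<mu>\<close>.\<close>

lemma wedgeH_local:
  assumes nt: "emeasure hausdorff1 T \<noteq> 0" and \<Omega>: "open \<Omega>" "bounded \<Omega>" and lip: "lipschitz_boundary \<Omega>"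
    and I: "finite (components \<Gamma>I)" "\<Gamma>I \<subseteq> frontier \<Omega>" "\<Gamma>I \<in> sets borel" and C: "finite (components \<Gamma>C)" "\<Gamma>C \<subseteq> frontier \<Omega>" "\<Gamma>C \<in> sets borel"
    and F: "frontier \<Omega> = closure \<Gamma>I \<union> closure \<Gamma>C" and \<phi>: "\<phi> \<in> H1_0 \<Omega> \<Gamma>C" and \<mu>: "\<mu> \<in> H1_0 \<Omega> \<Gamma>I" and p: "p \<in> closure \<Omega>"
  shows "\<exists>W. open W \<and> p \<in> W \<and> (\<forall>\<zeta>. smooth \<zeta> \<and> {y. \<zeta> y \<noteq> 0} \<subseteq> W \<longrightarrow> wedgeH \<Omega> \<zeta> \<phi> \<mu> = 0)"
proof -
  have W: "\<exists>W. open W \<and> p \<in> W \<and> (\<forall>\<zeta>. smooth \<zeta> \<and> {y. \<zeta> y \<noteq> 0} \<subseteq> W \<longrightarrow> wedgeH \<Omega> \<zeta> \<phi> \<mu> = 0)"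
    if ab: "a\<^sup>2 + b\<^sup>2 = 1" and rd: "r > 0" "d > 0" and van: "\<And>\<zeta>. smooth \<zeta> \<Longrightarrow> in_box p a b r d \<zeta> \<Longrightarrow> wedgeH \<Omega> \<zeta> \<phi> \<mu> = 0" for a b r d
  proof (intro exI conjI allI impI)
    let ?U = "{z :: pt. \<bar>fst z\<bar> < r / 2 \<and> \<bar>snd z\<bar> < d / 2}"
    show "open (frame p a b ` ?U)" by (intro open_frame_image[OF ab] open_Collect_conj open_Collect_less continuous_intros)
    show "p \<in> frame p a b ` ?U" using rd by (intro image_eqI[of _ _ "(0, 0)"]) auto
    fix \<zeta> assume \<zeta>: "smooth \<zeta> \<and> {y. \<zeta> y \<noteq> 0} \<subseteq> frame p a b ` ?U"
    have "\<bar>fst z\<bar> \<le> r / 2 \<and> \<bar>snd z\<bar> \<le> d / 2" if "\<zeta> (frame p a b z) \<noteq> 0" for z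
    proof -
      have "frame p a b z \<in> frame p a b ` ?U" using \<zeta> that by blast
      then obtain z' where "z' \<in> ?U" "frame p a b z = frame p a b z'" by blast
      then show ?thesis using frame_inj[OF ab, of p z z'] by auto
    qed
    then have "in_box p a b r d \<zeta>" unfolding in_box_def using rd by (intro exI[of _ "r / 2"] exI[of _ "d / 2"]) auto
    then show "wedgeH \<Omega> \<zeta> \<phi> \<mu> = 0" using van \<zeta> by blast
  qed
  show ?thesis
  proof (cases "p \<in> \<Omega>")
    case True
    then obtain e where e: "e > 0" "ball p e \<subseteq> \<Omega>" using \<Omega>(1) open_contains_ball by blast
    define r where "r = e / 2"
    have r: "r > 0" using e by (simp add: r_def)
    \<comment> \<open>A degenerate chart: the constant graph runs along the top edge of a box
      contained in the domain, so a weight supported inside the box vanishes on it.\<close>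
    have ch: "chart \<Omega> p 0 1 r r 0 (\<lambda>_. r)"
    proof -
      have "frame p 0 1 (s, \<tau>) \<in> \<Omega>" if "\<bar>s\<bar> < r" "\<bar>\<tau>\<bar> < r" for s \<tau>
      proof -
        have "frame p 0 1 (s, \<tau>) - p = (- s, \<tau>)" by (simp add: frame_def)
        then have "dist p (frame p 0 1 (s, \<tau>)) = norm (- s, \<tau>)" by (metis dist_commute dist_norm)
        also have "\<dots> \<le> \<bar>s\<bar> + \<bar>\<tau>\<bar>" using norm_Pair_le[of "- s" \<tau>] by simp
        also have "\<dots> < e" using that by (simp add: r_def)
        finally show ?thesis using e by auto
      qed
      then show ?thesis unfolding chart_def using r by (auto simp: lipschitz_on_def)
    qed
    show ?thesis
    proof (rule W[of 0 1 r r])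
      fix \<zeta> assume \<zeta>: "smooth \<zeta>" "in_box p 0 1 r r \<zeta>"
      show "wedgeH \<Omega> \<zeta> \<phi> \<mu> = 0"
        by (rule wedgeH_eq_0[OF nt ch \<Omega> C(3,2) \<phi> I(3,2) \<mu> \<zeta>]) (use in_box_graphD[OF \<zeta>(2)] in fastforce)
    qed (use r in auto)
  next
    case False
    then have "p \<in> frontier \<Omega>" using p \<Omega> by (simp add: frontier_def interior_open)
    then obtain a b r d L \<gamma> where ch: "chart \<Omega> p a b r d L \<gamma>" and \<gamma>0: "\<gamma> 0 = 0" and \<gamma>d: "\<And>s. \<bar>\<gamma> s\<bar> < d"
      using boundary_chart[OF \<Omega>(1) lip] by blast
    have ab: "a\<^sup>2 + b\<^sup>2 = 1" and rd: "r > 0" "d > 0" using ch by (auto simp: chart_def)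
    note os = boundary_one_sided[OF ch \<gamma>d \<Omega>(1) I(1,2) C(1,2) F]
    obtain \<delta>1 where \<delta>1: "\<delta>1 > 0" "(\<forall>s. 0 < s \<and> s < \<delta>1 \<longrightarrow> graph p a b \<gamma> s \<in> \<Gamma>I) \<or> (\<forall>s. 0 < s \<and> s < \<delta>1 \<longrightarrow> graph p a b \<gamma> s \<in> \<Gamma>C)"
      using os[of 1] by auto
    obtain \<delta>2 where \<delta>2: "\<delta>2 > 0" "(\<forall>s. 0 < s \<and> s < \<delta>2 \<longrightarrow> graph p a b \<gamma> (- s) \<in> \<Gamma>I) \<or> (\<forall>s. 0 < s \<and> s < \<delta>2 \<longrightarrow> graph p a b \<gamma> (- s) \<in> \<Gamma>C)"
      using os[of "-1"] by auto
    define m where "m = min r (min \<delta>1 \<delta>2)"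
    have m: "0 < m" "m \<le> r" "m \<le> \<delta>1" "m \<le> \<delta>2" using rd \<delta>1 \<delta>2 by (auto simp: m_def)
    have chm: "chart \<Omega> p a b m d L \<gamma>" by (rule chart_restrict[OF ch m(1,2)])
    have right: "(\<forall>s. 0 < s \<longrightarrow> s < m \<longrightarrow> graph p a b \<gamma> s \<in> \<Gamma>I) \<or> (\<forall>s. 0 < s \<longrightarrow> s < m \<longrightarrow> graph p a b \<gamma> s \<in> \<Gamma>C)"
      using \<delta>1(2) m(3) by (meson order.strict_trans2)
    have left: "(\<forall>s. - m < s \<longrightarrow> s < 0 \<longrightarrow> graph p a b \<gamma> s \<in> \<Gamma>I) \<or> (\<forall>s. - m < s \<longrightarrow> s < 0 \<longrightarrow> graph p a b \<gamma> s \<in> \<Gamma>C)"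
    proof -
      have conv: "\<forall>s. - m < s \<longrightarrow> s < 0 \<longrightarrow> graph p a b \<gamma> s \<in> X" if "\<forall>s. 0 < s \<and> s < \<delta>2 \<longrightarrow> graph p a b \<gamma> (- s) \<in> X" for X
      proof (intro allI impI)
        fix s :: real assume "- m < s" "s < 0"
        then show "graph p a b \<gamma> s \<in> X" using that[rule_format, of "- s"] m(4) by simp
      qed
      show ?thesis using \<delta>2(2) conv by blast
    qed
    show ?thesis
    proof (rule W[OF ab m(1) rd(2)])
      fix \<zeta> assume \<zeta>: "smooth \<zeta>" "in_box p a b m d \<zeta>"
      show "wedgeH \<Omega> \<zeta> \<phi> \<mu> = 0"
      proof (cases "\<forall>s. 0 < s \<longrightarrow> s < m \<longrightarrow> graph p a b \<gamma> s \<in> \<Gamma>C")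
        case True
        show ?thesis
          by (rule corner_wedgeH_eq_0[OF nt chm \<gamma>0 \<Omega> C(3,2) \<phi> I(3,2) \<mu> _ _ \<zeta>]) (use True left in blast)+
      next
        case False
        then have r: "\<forall>s. 0 < s \<longrightarrow> s < m \<longrightarrow> graph p a b \<gamma> s \<in> \<Gamma>I" using right by blast
        \<comment> \<open>Here \<open>\<mu>\<close> is the function that vanishes to the right of
          the point, so the roles are exchanged before the corner argument.\<close>
        have "wedgeH \<Omega> \<zeta> \<phi> \<mu> = - wedgeH \<Omega> \<zeta> \<mu> \<phi>"
        proof (rule wedgeH_antisym[OF nt chm \<Omega> C(3,2) \<phi> I(3,2) \<mu> \<zeta>])
          fix s :: real assume "\<bar>s\<bar> < m" "s \<noteq> 0"
          then have "0 < s \<and> s < m \<or> - m < s \<and> s < 0" by auto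
          then show "graph p a b \<gamma> s \<in> \<Gamma>C \<union> \<Gamma>I" using right left by blast
        qed
        also have "wedgeH \<Omega> \<zeta> \<mu> \<phi> = 0"
          by (rule corner_wedgeH_eq_0[OF nt chm \<gamma>0 \<Omega> I(3,2) \<mu> C(3,2) \<phi> _ _ \<zeta>]) (use r left in blast)+
        finally show ?thesis by simp
      qed
    qed
  qed
qed

text \<open>Linearity in the weight: multiplying it by \<open>1 - b\<close>, with a local bump
  \<open>b\<close>, leaves the form unchanged, since the part with factor \<open>b\<close>
  contributes 0. After finitely many such steps the weight vanishes on an open set containing the
  closed domain.\<close>

lemma wedgeH_global:
  assumes \<Omega>: "open \<Omega>" "bounded \<Omega>" and \<phi>: "\<phi> \<in> sobolev \<Omega> 1" and \<mu>: "\<mu> \<in> sobolev \<Omega> 1"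
    and loc: "\<And>p. p \<in> closure \<Omega> \<Longrightarrow> \<exists>W. open W \<and> p \<in> W \<and> (\<forall>\<zeta>. smooth \<zeta> \<and> {y. \<zeta> y \<noteq> 0} \<subseteq> W \<longrightarrow> wedgeH \<Omega> \<zeta> \<phi> \<mu> = 0)"
    and \<zeta>: "smooth \<zeta>"
  shows "wedgeH \<Omega> \<zeta> \<phi> \<mu> = 0"
proof -
  \<comment> \<open>Open sets on which some bump is identically 1, where this bump makes the form
    vanish for every further smooth factor. The arbitrary factor is what allows the bumps to be
    applied one after another.\<close>
  define \<V> where "\<V> = {V. open V \<and> (\<exists>b. smooth b \<and> (\<forall>y\<in>V. b y = 1) \<and> (\<forall>\<zeta>. smooth \<zeta> \<longrightarrow> wedgeH \<Omega> (\<lambda>y. \<zeta> y * b y) \<phi> \<mu> = 0))}"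
  have "\<exists>b V. smooth b \<and> open V \<and> p \<in> V \<and> (\<forall>y\<in>V. b y = 1) \<and> (\<forall>\<zeta>. smooth \<zeta> \<longrightarrow> wedgeH \<Omega> (\<lambda>y. \<zeta> y * b y) \<phi> \<mu> = 0)" if p: "p \<in> closure \<Omega>" for p
  proof -
    obtain W where W: "open W" "p \<in> W" "\<And>\<zeta>. smooth \<zeta> \<Longrightarrow> {y. \<zeta> y \<noteq> 0} \<subseteq> W \<Longrightarrow> wedgeH \<Omega> \<zeta> \<phi> \<mu> = 0" using loc[OF p] by blast
    obtain b V K where b: "smooth b" "open V" "p \<in> V" "\<And>y. y \<in> V \<Longrightarrow> b y = 1" "K \<subseteq> W" "\<And>y. b y \<noteq> 0 \<Longrightarrow> y \<in> K"
      using smooth_bump_exists[OF W(1,2)] by metis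
    have "wedgeH \<Omega> (\<lambda>y. \<zeta> y * b y) \<phi> \<mu> = 0" if "smooth \<zeta>" for \<zeta>
      by (rule W(3)[OF smooth_mult[OF that b(1)]]) (use b(5,6) in auto)
    then show ?thesis using b by blast
  qed
  then have cov: "closure \<Omega> \<subseteq> \<Union>\<V>" and oV: "\<And>V. V \<in> \<V> \<Longrightarrow> open V" unfolding \<V>_def by blast+
  have "compact (closure \<Omega>)" using \<Omega> by (simp add: compact_closure)
  then obtain P where P: "P \<subseteq> \<V>" "finite P" "closure \<Omega> \<subseteq> \<Union>P"
    using compactE[of "closure \<Omega>" \<V>] cov oV by blast
  have "\<exists>\<zeta>'. smooth \<zeta>' \<and> wedgeH \<Omega> \<zeta> \<phi> \<mu> = wedgeH \<Omega> \<zeta>' \<phi> \<mu> \<and> (\<forall>y\<in>\<Union>P. \<zeta>' y = 0)"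
    using P(2,1)
  proof (induction P rule: finite_induct)
    case empty
    then show ?case using \<zeta> by blast
  next
    case (insert V P)
    then obtain \<zeta>' where z: "smooth \<zeta>'" "wedgeH \<Omega> \<zeta> \<phi> \<mu> = wedgeH \<Omega> \<zeta>' \<phi> \<mu>" "\<forall>y\<in>\<Union>P. \<zeta>' y = 0" by blast
    have "V \<in> \<V>" using insert.prems by blast
    then obtain b where b: "smooth b" "\<forall>y\<in>V. b y = 1" "\<forall>\<zeta>. smooth \<zeta> \<longrightarrow> wedgeH \<Omega> (\<lambda>y. \<zeta> y * b y) \<phi> \<mu> = 0"
      unfolding \<V>_def by blast
    define \<zeta>2 where "\<zeta>2 = (\<lambda>y. \<zeta>' y * (1 - b y))"
    have s2: "smooth \<zeta>2" unfolding \<zeta>2_def by (intro smooth_intros z b)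
    have "wedgeH \<Omega> \<zeta>' \<phi> \<mu> = wedgeH \<Omega> (\<lambda>y. \<zeta>' y * b y + \<zeta>2 y) \<phi> \<mu>"
      by (rule arg_cong[where f = "\<lambda>z. wedgeH \<Omega> z \<phi> \<mu>"]) (auto simp: \<zeta>2_def algebra_simps)
    also have "\<dots> = wedgeH \<Omega> (\<lambda>y. \<zeta>' y * b y) \<phi> \<mu> + wedgeH \<Omega> \<zeta>2 \<phi> \<mu>"
      by (rule wedgeH_add[OF \<Omega> smooth_mult[OF z(1) b(1)] s2 \<phi> \<mu>])
    also have "\<dots> = wedgeH \<Omega> \<zeta>2 \<phi> \<mu>" using b(3) z(1) by simp
    finally have "wedgeH \<Omega> \<zeta> \<phi> \<mu> = wedgeH \<Omega> \<zeta>2 \<phi> \<mu>" using z(2) by simp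
    moreover have "\<forall>y\<in>\<Union>(insert V P). \<zeta>2 y = 0" using z(3) b(2) by (auto simp: \<zeta>2_def)
    ultimately show ?case using s2 by blast
  qed
  then obtain \<zeta>' where z: "smooth \<zeta>'" "wedgeH \<Omega> \<zeta> \<phi> \<mu> = wedgeH \<Omega> \<zeta>' \<phi> \<mu>" "\<And>y. y \<in> \<Union>P \<Longrightarrow> \<zeta>' y = 0" by blast
  have cl: "closed (- \<Union>P)" using oV P(1) by (auto intro!: open_Union)
  have \<Omega>P: "y \<in> \<Union>P" if "y \<in> \<Omega>" for y using that P(3) closure_subset by blast
  have pd0: "pd e \<zeta>' y = 0" if "y \<in> \<Omega>" for e y
    by (rule pd_eq_0_outside[OF cl]) (use z(3) \<Omega>P[OF that] in auto)
  have z0: "\<zeta>' y = 0" if "y \<in> \<Omega>" for y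
    by (rule z(3)[OF \<Omega>P[OF that]])
  have "wedgeH \<Omega> \<zeta>' \<phi> \<mu> = (LINT y|lebesgue_on \<Omega>. 0)"
    unfolding wedgeH_def wedge_def by (rule Bochner_Integration.integral_cong) (auto simp: pd0 z0)
  then show ?thesis using z by simp
qed

text \<open>The constant weight 1 has zero gradient, so the form reduces to the inner
  product.\<close>

lemma grad_perp_orthogonal:
  assumes nt: "emeasure hausdorff1 T \<noteq> 0" and \<Omega>: "open \<Omega>" "bounded \<Omega>" and lip: "lipschitz_boundary \<Omega>"
    and I: "finite (components \<Gamma>I)" "openin (top_of_set (frontier \<Omega>)) \<Gamma>I" and C: "finite (components \<Gamma>C)" "openin (top_of_set (frontier \<Omega>)) \<Gamma>C"
    and F: "frontier \<Omega> = closure \<Gamma>I \<union> closure \<Gamma>C" and \<phi>: "\<phi> \<in> H1_0 \<Omega> \<Gamma>C" and \<mu>: "\<mu> \<in> H1_0 \<Omega> \<Gamma>I"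
  shows "l2ip \<Omega> (grad_perp \<Omega> \<mu>) (grad \<Omega> \<phi>) = 0"
proof -
  have b: "S \<subseteq> frontier \<Omega> \<and> S \<in> sets borel" if op: "openin (top_of_set (frontier \<Omega>)) S" for S
  proof -
    obtain U where "open U" "S = frontier \<Omega> \<inter> U" using op unfolding openin_open by blast
    then show ?thesis by (auto intro!: sets.Int borel_closed)
  qed
  note bI = b[OF I(2)] and bC = b[OF C(2)]
  have "wedgeH \<Omega> (\<lambda>_. 1) \<phi> \<mu> = 0"
    by (rule wedgeH_global[OF \<Omega> H1_0_sobolev[OF \<phi>] H1_0_sobolev[OF \<mu>] _ smooth_const],
        rule wedgeH_local[OF nt \<Omega> lip I(1) _ _ C(1) _ _ F \<phi> \<mu>]) (use bI bC in auto)
  moreover have "wedgeH \<Omega> (\<lambda>_. 1) \<phi> \<mu> = l2ip \<Omega> (grad_perp \<Omega> \<mu>) (grad \<Omega> \<phi>)"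
    unfolding wedgeH_def wedge_def l2ip_def
    by (rule Bochner_Integration.integral_cong) (simp_all add: grad_def grad_perp_def pd_const algebra_simps)
  ultimately show ?thesis by simp
qed

section \<open>The least-squares estimates\<close>

definition L2v :: "pt set \<Rightarrow> (pt \<Rightarrow> pt) set" where
  "L2v \<Omega> = {v. (\<lambda>p. fst (v p)) \<in> L2 (lebesgue_on \<Omega>) \<and> (\<lambda>p. snd (v p)) \<in> L2 (lebesgue_on \<Omega>)}"

lemma L2_cmult: "u \<in> L2 M \<Longrightarrow> (\<lambda>p. c * u p) \<in> L2 M"
  by (auto simp: L2_def power_mult_distrib)

lemma L2v_add: "v \<in> L2v \<Omega> \<Longrightarrow> w \<in> L2v \<Omega> \<Longrightarrow> (\<lambda>p. v p + w p) \<in> L2v \<Omega>"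
  and L2v_diff: "v \<in> L2v \<Omega> \<Longrightarrow> w \<in> L2v \<Omega> \<Longrightarrow> (\<lambda>p. v p - w p) \<in> L2v \<Omega>"
  and L2v_scaleR: "v \<in> L2v \<Omega> \<Longrightarrow> (\<lambda>p. c *\<^sub>R v p) \<in> L2v \<Omega>"
  by (auto simp: L2v_def intro: L2_add L2_diff L2_cmult)

lemma L2v_inner_integrable:
  assumes "v \<in> L2v \<Omega>" "w \<in> L2v \<Omega>" shows "integrable (lebesgue_on \<Omega>) (\<lambda>p. v p \<bullet> w p)"
  using assms by (auto simp: L2v_def inner_prod_def intro!: Bochner_Integration.integrable_add L2_mult_integrable)

lemma l2ip_commute: "l2ip \<Omega> v w = l2ip \<Omega> w v"
  by (simp add: l2ip_def inner_commute)

lemma l2ip_add_left: "v \<in> L2v \<Omega> \<Longrightarrow> w \<in> L2v \<Omega> \<Longrightarrow> z \<in> L2v \<Omega> \<Longrightarrow> l2ip \<Omega> (\<lambda>p. v p + w p) z = l2ip \<Omega> v z + l2ip \<Omega> w z"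
  by (simp add: l2ip_def inner_add_left L2v_inner_integrable)

lemma l2ip_add_right: "v \<in> L2v \<Omega> \<Longrightarrow> w \<in> L2v \<Omega> \<Longrightarrow> z \<in> L2v \<Omega> \<Longrightarrow> l2ip \<Omega> z (\<lambda>p. v p + w p) = l2ip \<Omega> z v + l2ip \<Omega> z w"
  by (simp add: l2ip_def inner_add_right L2v_inner_integrable)

lemma l2ip_diff_left: "v \<in> L2v \<Omega> \<Longrightarrow> w \<in> L2v \<Omega> \<Longrightarrow> z \<in> L2v \<Omega> \<Longrightarrow> l2ip \<Omega> (\<lambda>p. v p - w p) z = l2ip \<Omega> v z - l2ip \<Omega> w z"
  by (simp add: l2ip_def inner_diff_left L2v_inner_integrable)

lemma l2ip_diff_right: "v \<in> L2v \<Omega> \<Longrightarrow> w \<in> L2v \<Omega> \<Longrightarrow> z \<in> L2v \<Omega> \<Longrightarrow> l2ip \<Omega> z (\<lambda>p. v p - w p) = l2ip \<Omega> z v - l2ip \<Omega> z w"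
  by (simp add: l2ip_def inner_diff_right L2v_inner_integrable)

lemma l2ip_scaleR_left: "l2ip \<Omega> (\<lambda>p. c *\<^sub>R v p) z = c * l2ip \<Omega> v z" for v z :: "pt \<Rightarrow> pt"
  by (simp add: l2ip_def)

lemma l2ip_scaleR_right: "l2ip \<Omega> z (\<lambda>p. c *\<^sub>R v p) = c * l2ip \<Omega> z v" for v z :: "pt \<Rightarrow> pt"
  by (simp add: l2ip_def)

lemma l2norm_nonneg [simp]: "0 \<le> l2norm \<Omega> v"
  by (simp add: l2norm_def l2ip_def)

lemma l2norm_sq: "(l2norm \<Omega> v)\<^sup>2 = l2ip \<Omega> v v"
  by (simp add: l2norm_def l2ip_def)

lemma l2norm_add_sq:
  assumes "v \<in> L2v \<Omega>" "w \<in> L2v \<Omega>"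
  shows "(l2norm \<Omega> (\<lambda>p. v p + w p))\<^sup>2 = (l2norm \<Omega> v)\<^sup>2 + 2 * l2ip \<Omega> v w + (l2norm \<Omega> w)\<^sup>2"
  using assms l2ip_commute[of \<Omega> v w] unfolding l2norm_sq
  by (simp add: l2ip_add_left l2ip_add_right L2v_add)

lemma l2ip_Cauchy_Schwarz:
  assumes v: "v \<in> L2v \<Omega>" and w: "w \<in> L2v \<Omega>"
  shows "\<bar>l2ip \<Omega> v w\<bar> \<le> l2norm \<Omega> v * l2norm \<Omega> w"
proof -
  have "0 \<le> l2ip \<Omega> v v + 2 * t * l2ip \<Omega> v w + t\<^sup>2 * l2ip \<Omega> w w" for t
  proof -
    have "(l2norm \<Omega> (\<lambda>p. v p + t *\<^sub>R w p))\<^sup>2 = l2ip \<Omega> v v + 2 * t * l2ip \<Omega> v w + t\<^sup>2 * l2ip \<Omega> w w"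
      unfolding l2norm_add_sq[OF v L2v_scaleR[OF w]]
      unfolding l2norm_sq l2ip_scaleR_left l2ip_scaleR_right by (simp add: power2_eq_square)
    then show ?thesis using zero_le_power2[of "l2norm \<Omega> (\<lambda>p. v p + t *\<^sub>R w p)"] by simp
  qed
  then have "(l2ip \<Omega> v w)\<^sup>2 \<le> l2ip \<Omega> v v * l2ip \<Omega> w w" by (rule discriminant_le) (simp add: l2ip_def)
  then have "(l2ip \<Omega> v w)\<^sup>2 \<le> (l2norm \<Omega> v * l2norm \<Omega> w)\<^sup>2" by (simp add: power_mult_distrib l2norm_sq)
  then show ?thesis by (simp add: abs_le_square_iff[symmetric])
qed

lemma l2norm_add_sq_le:
  assumes v: "v \<in> L2v \<Omega>" and w: "w \<in> L2v \<Omega>"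
  shows "(l2norm \<Omega> (\<lambda>p. v p + w p))\<^sup>2 \<le> 2 * (l2norm \<Omega> v)\<^sup>2 + 2 * (l2norm \<Omega> w)\<^sup>2"
proof -
  have "l2ip \<Omega> v w \<le> l2norm \<Omega> v * l2norm \<Omega> w" using l2ip_Cauchy_Schwarz[OF v w] by simp
  moreover have "0 \<le> (l2norm \<Omega> v - l2norm \<Omega> w)\<^sup>2" by simp
  ultimately show ?thesis unfolding l2norm_add_sq[OF v w] by (simp add: power2_diff)
qed

lemma l2norm_minus_commute: "l2norm \<Omega> (\<lambda>p. v p - w p) = l2norm \<Omega> (\<lambda>p. w p - v p)"
proof -
  have "(v p - w p) \<bullet> (v p - w p) = (w p - v p) \<bullet> (w p - v p)" for p
    by (metis inner_minus_left inner_minus_right minus_diff_eq)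
  then show ?thesis by (simp add: l2norm_def l2ip_def)
qed

lemma l2ip_cong_AE:
  assumes "v \<in> L2v \<Omega>" "v' \<in> L2v \<Omega>" "w \<in> L2v \<Omega>" "w' \<in> L2v \<Omega>"
    "AE p in lebesgue_on \<Omega>. v p = v' p" "AE p in lebesgue_on \<Omega>. w p = w' p"
  shows "l2ip \<Omega> v w = l2ip \<Omega> v' w'"
  unfolding l2ip_def
proof (rule integral_cong_AE)
  show "AE p in lebesgue_on \<Omega>. v p \<bullet> w p = v' p \<bullet> w' p" using assms(5,6) by eventually_elim simp
qed (use L2v_inner_integrable assms(1-4) in blast)+

lemma l2norm_cong_AE:
  assumes "v \<in> L2v \<Omega>" "v' \<in> L2v \<Omega>" "AE p in lebesgue_on \<Omega>. v p = v' p"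
  shows "l2norm \<Omega> v = l2norm \<Omega> v'"
  unfolding l2norm_def using l2ip_cong_AE[OF assms(1,2,1,2,3,3)] by simp

lemma grad_L2v:
  assumes "open \<Omega>" "bounded \<Omega>" "\<phi> \<in> sobolev \<Omega> 1"
  shows "grad \<Omega> \<phi> \<in> L2v \<Omega>" "grad_perp \<Omega> \<phi> \<in> L2v \<Omega>"
  using sobolev1D[OF assms] L2_uminus[of "wD \<Omega> 1 0 \<phi>"] by (auto simp: L2v_def grad_def grad_perp_def)

lemma l2norm_grad_diff:
  assumes \<Omega>: "open \<Omega>" "bounded \<Omega>" and 1: "\<phi>1 \<in> sobolev \<Omega> 1" and 2: "\<phi>2 \<in> sobolev \<Omega> 1"
  shows "AE p in lebesgue_on \<Omega>. grad \<Omega> (\<lambda>p. \<phi>1 p - \<phi>2 p) p = grad \<Omega> \<phi>1 p - grad \<Omega> \<phi>2 p"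
    and "l2norm \<Omega> (grad \<Omega> (\<lambda>p. \<phi>1 p - \<phi>2 p)) = l2norm \<Omega> (\<lambda>p. grad \<Omega> \<phi>1 p - grad \<Omega> \<phi>2 p)"
    and "l2norm \<Omega> (\<lambda>p. grad_perp \<Omega> \<phi>1 p - grad_perp \<Omega> \<phi>2 p) = l2norm \<Omega> (\<lambda>p. grad \<Omega> \<phi>1 p - grad \<Omega> \<phi>2 p)"
proof -
  have s: "(\<lambda>p. \<phi>1 p - \<phi>2 p) \<in> sobolev \<Omega> 1" using sobolev1_lincomb[OF \<Omega> 1 2, of "-1"] by simp
  show ae: "AE p in lebesgue_on \<Omega>. grad \<Omega> (\<lambda>p. \<phi>1 p - \<phi>2 p) p = grad \<Omega> \<phi>1 p - grad \<Omega> \<phi>2 p"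
    using wD_lincomb_AE(1)[OF \<Omega> 1 2, of "-1"] wD_lincomb_AE(2)[OF \<Omega> 1 2, of "-1"]
    by eventually_elim (simp add: grad_def)
  show "l2norm \<Omega> (grad \<Omega> (\<lambda>p. \<phi>1 p - \<phi>2 p)) = l2norm \<Omega> (\<lambda>p. grad \<Omega> \<phi>1 p - grad \<Omega> \<phi>2 p)"
    by (rule l2norm_cong_AE[OF grad_L2v(1)[OF \<Omega> s] L2v_diff[OF grad_L2v(1)[OF \<Omega> 1] grad_L2v(1)[OF \<Omega> 2]] ae])
  show "l2norm \<Omega> (\<lambda>p. grad_perp \<Omega> \<phi>1 p - grad_perp \<Omega> \<phi>2 p) = l2norm \<Omega> (\<lambda>p. grad \<Omega> \<phi>1 p - grad \<Omega> \<phi>2 p)"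
  proof -
    have "(grad_perp \<Omega> \<phi>1 p - grad_perp \<Omega> \<phi>2 p) \<bullet> (grad_perp \<Omega> \<phi>1 p - grad_perp \<Omega> \<phi>2 p) =
        (grad \<Omega> \<phi>1 p - grad \<Omega> \<phi>2 p) \<bullet> (grad \<Omega> \<phi>1 p - grad \<Omega> \<phi>2 p)" for p
      by (simp add: grad_def grad_perp_def algebra_simps)
    then show ?thesis by (simp add: l2norm_def l2ip_def)
  qed
qed

text \<open>\<open>dual_norm\<close> excludes functions that vanish almost everywhere but divides by
  the norm of the gradient; this links the two conditions.\<close>

lemma l2norm_grad_AE_0:
  assumes \<Omega>: "open \<Omega>" "bounded \<Omega>" and \<phi>: "\<phi> \<in> sobolev \<Omega> 1" and 0: "AE p in lebesgue_on \<Omega>. \<phi> p = 0"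
  shows "l2norm \<Omega> (grad \<Omega> \<phi>) = 0"
proof -
  have z: "weak_deriv \<Omega> i j \<phi> (\<lambda>p. 0)" for i j
  proof -
    have "l2ip \<Omega> \<phi> \<eta> = 0" for \<eta> :: "pt \<Rightarrow> real"
    proof -
      have "AE p in lebesgue_on \<Omega>. \<phi> p \<bullet> \<eta> p = 0" using 0 by eventually_elim simp
      then show ?thesis unfolding l2ip_def by (rule integral_eq_zero_AE)
    qed
    moreover have "l2ip \<Omega> (\<lambda>p. 0) \<eta> = 0" for \<eta> :: "pt \<Rightarrow> real" by (simp add: l2ip_def)
    ultimately show ?thesis unfolding weak_deriv_def
      using L2_locally_integrable[OF sobolev1D(1)[OF \<Omega> \<phi>] \<Omega>] L2_locally_integrable[OF L2_zero \<Omega>] by simp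
  qed
  have "AE p in lebesgue_on \<Omega>. grad \<Omega> \<phi> p \<bullet> grad \<Omega> \<phi> p = 0"
    using wD_AE[OF z \<Omega>(1), of 1 0] wD_AE[OF z \<Omega>(1), of 0 1] by eventually_elim (simp add: grad_def)
  then show ?thesis unfolding l2norm_def l2ip_def by (simp add: integral_eq_zero_AE)
qed

text \<open>The flux is continuous, hence bounded on the compact interval in which \<open>v\<close>
  takes almost all its values, and the domain has finite measure.\<close>

lemma flux_L2v:
  assumes \<Omega>: "open \<Omega>" "bounded \<Omega>" and f: "locally_lipschitz_flux f" and v: "v \<in> Linf (lebesgue_on \<Omega>)"
  shows "(\<lambda>p. f (v p)) \<in> L2v \<Omega>"
proof -
  interpret finite_measure "lebesgue_on \<Omega>" by (rule finite_measure_lebesgue_on[OF \<Omega>])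
  obtain B where B: "AE p in lebesgue_on \<Omega>. \<bar>v p\<bar> \<le> B" and vm: "v \<in> borel_measurable (lebesgue_on \<Omega>)" using v by (auto simp: Linf_def)
  have L: "(\<lambda>p. g (v p)) \<in> L2 (lebesgue_on \<Omega>)"
    if g: "\<And>J. compact J \<Longrightarrow> \<exists>K. \<forall>a\<in>J. \<forall>b\<in>J. \<bar>g a - g b\<bar> \<le> K * \<bar>a - b\<bar>" for g :: "real \<Rightarrow> real"
  proof -
    have "isCont g x" for x
    proof -
      obtain K where K: "\<And>a b. a \<in> {x - 1..x + 1} \<Longrightarrow> b \<in> {x - 1..x + 1} \<Longrightarrow> \<bar>g a - g b\<bar> \<le> K * \<bar>a - b\<bar>"
        using g[OF compact_Icc, of "x - 1" "x + 1"] by blast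
      have "((\<lambda>y. K * \<bar>y - x\<bar>) \<longlongrightarrow> K * \<bar>x - x\<bar>) (at x)" by (intro tendsto_intros)
      then have "((\<lambda>y. K * \<bar>y - x\<bar>) \<longlongrightarrow> 0) (at x)" by simp
      moreover have "\<forall>\<^sub>F y in at x. norm (g y - g x) \<le> K * \<bar>y - x\<bar>"
        unfolding eventually_at by (intro exI[of _ 1] conjI ballI impI) (auto intro!: K simp: dist_real_def)
      ultimately have "((\<lambda>y. g y - g x) \<longlongrightarrow> 0) (at x)" by (rule Lim_null_comparison[rotated])
      then show ?thesis by (simp add: isCont_def LIM_zero_iff)
    qed
    then have gc: "continuous_on S g" for S using continuous_at_imp_continuous_on by blast
    have gm: "(\<lambda>p. g (v p)) \<in> borel_measurable (lebesgue_on \<Omega>)"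
      by (rule measurable_compose[OF vm borel_measurable_continuous_onI[OF gc]])
    have "bounded (g ` {-B..B})" using gc compact_continuous_image compact_imp_bounded compact_Icc by blast
    then obtain M where M: "\<forall>y\<in>g ` {-B..B}. norm y \<le> M" unfolding bounded_iff by blast
    have ae: "AE p in lebesgue_on \<Omega>. norm ((g (v p))\<^sup>2) \<le> M\<^sup>2"
      using B
    proof eventually_elim
      case (elim p)
      then have "\<bar>g (v p)\<bar> \<le> M" using M by (auto simp: abs_le_iff)
      then show ?case using power_mono[of "\<bar>g (v p)\<bar>" M 2] by simp
    qed
    have "integrable (lebesgue_on \<Omega>) (\<lambda>p. (g (v p))\<^sup>2)"
      by (rule integrable_const_bound[OF ae]) (use gm in simp)
    then show ?thesis using gm by (simp add: L2_def)
  qed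
  have "\<exists>K. \<forall>a\<in>J. \<forall>b\<in>J. \<bar>fst (f a) - fst (f b)\<bar> \<le> K * \<bar>a - b\<bar>" "\<exists>K. \<forall>a\<in>J. \<forall>b\<in>J. \<bar>snd (f a) - snd (f b)\<bar> \<le> K * \<bar>a - b\<bar>"
    if "compact J" for J
    using f that unfolding locally_lipschitz_flux_def by meson+
  then show ?thesis unfolding L2v_def using L[of "\<lambda>x. fst (f x)"] L[of "\<lambda>x. snd (f x)"] by simp
qed

text \<open>The real \<open>Sup\<close> is meaningful only for a nonempty set that is bounded above:
  the bound \<open>c\<close> gives the latter, a bump inside the domain the former. Where the
  gradient vanishes the quotient is 0 by convention, and \<open>l\<close> vanishes by its bound, so
  the norm inequality holds there too.\<close>

lemma dual_norm_bounds:
  assumes \<Omega>: "open \<Omega>" "bounded \<Omega>" "\<Omega> \<noteq> {}"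
    and c: "0 \<le> c" "\<And>\<phi>. \<phi> \<in> H1_0 \<Omega> S \<Longrightarrow> \<bar>l \<phi>\<bar> \<le> c * l2norm \<Omega> (grad \<Omega> \<phi>)"
  shows "0 \<le> dual_norm \<Omega> S l" "dual_norm \<Omega> S l \<le> c"
    and "\<phi> \<in> H1_0 \<Omega> S \<Longrightarrow> \<bar>l \<phi>\<bar> \<le> dual_norm \<Omega> S l * l2norm \<Omega> (grad \<Omega> \<phi>)"
proof -
  define X where "X = {\<bar>l \<phi>\<bar> / l2norm \<Omega> (grad \<Omega> \<phi>) |\<phi>. \<phi> \<in> H1_0 \<Omega> S \<and> \<not> (AE p in lebesgue_on \<Omega>. \<phi> p = 0)}"
  have dn: "dual_norm \<Omega> S l = Sup X" by (simp add: dual_norm_def X_def)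
  have le: "x \<le> c" if "x \<in> X" for x
  proof -
    obtain \<phi> where x: "x = \<bar>l \<phi>\<bar> / l2norm \<Omega> (grad \<Omega> \<phi>)" "\<phi> \<in> H1_0 \<Omega> S" using \<open>x \<in> X\<close> by (auto simp: X_def)
    show ?thesis
    proof (cases "l2norm \<Omega> (grad \<Omega> \<phi>) = 0")
      case False
      then have "0 < l2norm \<Omega> (grad \<Omega> \<phi>)" using l2norm_nonneg[of \<Omega> "grad \<Omega> \<phi>"] by linarith
      then show ?thesis using c(2)[OF x(2)] by (simp add: x(1) pos_divide_le_eq)
    qed (simp add: x c)
  qed
  have bdd: "bdd_above X" using le by (rule bdd_aboveI)
  have nn: "0 \<le> x" if "x \<in> X" for x using that by (auto simp: X_def)
  obtain x0 where x0: "x0 \<in> \<Omega>" using \<Omega>(3) by blast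
  obtain b V K where b: "smooth b" "open V" "x0 \<in> V" "\<And>y. y \<in> V \<Longrightarrow> b y = 1" "compact K" "K \<subseteq> \<Omega>" "\<And>y. b y \<noteq> 0 \<Longrightarrow> y \<in> K"
    using smooth_bump_exists[OF \<Omega>(1) x0] by metis
  have "b \<in> test_functions \<Omega>" by (rule test_functionsI[OF b(1,5,6,7)])
  then have bH: "b \<in> H1_0 \<Omega> S" by (rule H1_0_test_functions[OF \<Omega>(1,2)])
  have "\<not> (AE p in lebesgue_on \<Omega>. b p = 0)"
  proof
    assume "AE p in lebesgue_on \<Omega>. b p = 0"
    then have "AE p in lebesgue. p \<in> \<Omega> \<longrightarrow> b p = 0" using \<Omega>(1) by (subst (asm) AE_restrict_space_iff) auto
    then have "AE p in lebesgue. p \<notin> V \<inter> \<Omega>" by eventually_elim (use b(4) in force)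
    then have "V \<inter> \<Omega> \<in> null_sets lebesgue" using b(2) \<Omega>(1) by (subst (asm) AE_iff_null_sets[symmetric]) auto
    then have "negligible (V \<inter> \<Omega>)" by (simp add: negligible_iff_null_sets)
    then show False using open_not_negligible[of "V \<inter> \<Omega>"] b(2,3) \<Omega>(1) x0 by blast
  qed
  then have "\<bar>l b\<bar> / l2norm \<Omega> (grad \<Omega> b) \<in> X" using bH by (auto simp: X_def)
  then have ne: "X \<noteq> {}" by blast
  show "0 \<le> dual_norm \<Omega> S l" unfolding dn using ne nn bdd by (meson all_not_in_conv cSup_upper order.trans)
  show "dual_norm \<Omega> S l \<le> c" unfolding dn using cSup_least[OF ne le] .
  assume \<phi>: "\<phi> \<in> H1_0 \<Omega> S"
  show "\<bar>l \<phi>\<bar> \<le> dual_norm \<Omega> S l * l2norm \<Omega> (grad \<Omega> \<phi>)"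
  proof (cases "l2norm \<Omega> (grad \<Omega> \<phi>) = 0")
    case True
    then show ?thesis using c(2)[OF \<phi>] by simp
  next
    case False
    then have "\<not> (AE p in lebesgue_on \<Omega>. \<phi> p = 0)" using l2norm_grad_AE_0[OF \<Omega>(1,2) H1_0_sobolev[OF \<phi>]] by blast
    then have "\<bar>l \<phi>\<bar> / l2norm \<Omega> (grad \<Omega> \<phi>) \<in> X" using \<phi> by (auto simp: X_def)
    then have "\<bar>l \<phi>\<bar> / l2norm \<Omega> (grad \<Omega> \<phi>) \<le> dual_norm \<Omega> S l" unfolding dn using bdd by (rule cSup_upper)
    moreover have "0 < l2norm \<Omega> (grad \<Omega> \<phi>)" using False l2norm_nonneg[of \<Omega> "grad \<Omega> \<phi>"] by linarith
    ultimately show ?thesis by (simp add: pos_divide_le_eq)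
  qed
qed

lemma fin_dim_space_nonempty: "fin_dim_space V \<Longrightarrow> V \<noteq> {}"
  unfolding fin_dim_space_def by auto

lemma F_functional_nonneg: "0 \<le> F_functional \<Omega> f v p \<mu> q"
  by (simp add: F_functional_def)

lemma G_functional_le:
  assumes "p \<in> VC" "\<mu> \<in> VI" shows "G_functional \<Omega> f VC VI v q \<le> F_functional \<Omega> f v p \<mu> q"
proof -
  have "bdd_below ((\<lambda>(p, \<mu>). F_functional \<Omega> f v p \<mu> q) ` (VC \<times> VI))"
    by (rule bdd_belowI[of _ 0]) (auto simp: F_functional_nonneg)
  from cINF_lower[OF this, of "(p, \<mu>)"] show ?thesis using assms by (simp add: G_functional_def)
qed

lemma le_G_functional:
  assumes "VC \<noteq> {}" "VI \<noteq> {}" "\<And>p \<mu>. p \<in> VC \<Longrightarrow> \<mu> \<in> VI \<Longrightarrow> c \<le> F_functional \<Omega> f v p \<mu> q"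
  shows "c \<le> G_functional \<Omega> f VC VI v q"
  unfolding G_functional_def by (rule cINF_greatest) (use assms in auto)

lemma approximation_error_sq:
  fixes b C0 h \<beta> s :: real
  assumes "0 \<le> b" "b \<le> C0 * h powr \<beta> * s"
  shows "b\<^sup>2 \<le> C0\<^sup>2 * (h powr (2 * \<beta>) * s\<^sup>2)"
proof -
  have "b\<^sup>2 \<le> (C0 * h powr \<beta> * s)\<^sup>2" using assms by (intro power_mono) auto
  also have "\<dots> = C0\<^sup>2 * (h powr (2 * \<beta>) * s\<^sup>2)"
    by (simp add: power_mult_distrib power2_eq_square powr_add[symmetric])
  finally show ?thesis .
qed

theorem theorem5p1:
  fixes \<Omega> \<Gamma>I \<Gamma>C :: "pt set"
    and f :: "real \<Rightarrow> pt"
    and r g u q \<psi> :: "pt \<Rightarrow> real"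
    and h :: "nat \<Rightarrow> real"
    and U VC VI :: "nat \<Rightarrow> (pt \<Rightarrow> real) set"
  assumes "open \<Omega>" and "bounded \<Omega>" and "simply_connected \<Omega>" and "lipschitz_boundary \<Omega>"
    and "openin (top_of_set (frontier \<Omega>)) \<Gamma>I" and "openin (top_of_set (frontier \<Omega>)) \<Gamma>C"
    and "\<Gamma>I \<inter> \<Gamma>C = {}" and "frontier \<Omega> = closure \<Gamma>I \<union> closure \<Gamma>C"
    and "emeasure hausdorff1 \<Gamma>I \<noteq> 0" and "emeasure hausdorff1 \<Gamma>C \<noteq> 0"
    and "finite (components \<Gamma>I)" and "finite (components \<Gamma>C)"
    and "r \<in> L2 (lebesgue_on \<Omega>)" and "g \<in> Linf (surface \<Gamma>I)"
    and "locally_lipschitz_flux f"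
    and "\<And>n. h n > 0" and "h \<longlonglongrightarrow> 0"
    and "\<And>n. fin_dim_space (U n)" and "\<And>n. U n \<subseteq> Linf (lebesgue_on \<Omega>)"
    and "\<And>n. fin_dim_space (VC n)" and "\<And>n. VC n \<subseteq> H1_0 \<Omega> \<Gamma>C"
    and "\<And>n. fin_dim_space (VI n)" and "\<And>n. VI n \<subseteq> H1_0 \<Omega> \<Gamma>I"
    and "weak_solution \<Omega> \<Gamma>I \<Gamma>C f r g u"
    and "helmholtz \<Omega> \<Gamma>I \<Gamma>C (\<lambda>p. f (u p)) q \<psi>"
  shows "(\<forall>n. \<forall>v \<in> U n.
            1 / 2 * (residual_norm \<Omega> \<Gamma>I \<Gamma>C f r g v)\<^sup>2 \<le> G_functional \<Omega> f (VC n) (VI n) v q)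
    \<and> (\<forall>C0 \<beta>q \<beta>\<psi> :: real. C0 > 0 \<and> \<beta>q > 0 \<and> \<beta>\<psi> > 0 \<and>
          q \<in> sobolev \<Omega> (\<beta>q + 1) \<and> \<psi> \<in> sobolev \<Omega> (\<beta>\<psi> + 1) \<and>
          (\<forall>n. (\<exists>qh \<in> VC n. l2norm \<Omega> (grad \<Omega> (\<lambda>p. qh p - q p))
                    \<le> C0 * h n powr \<beta>q * sobolev_norm \<Omega> (\<beta>q + 1) q) \<and>
               (\<exists>\<psi>h \<in> VI n. l2norm \<Omega> (grad \<Omega> (\<lambda>p. \<psi>h p - \<psi> p))
                    \<le> C0 * h n powr \<beta>\<psi> * sobolev_norm \<Omega> (\<beta>\<psi> + 1) \<psi>))
        \<longrightarrow> (\<exists>C>0. \<forall>n. \<forall>v \<in> U n.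
              (\<forall>qv \<psi>v. helmholtz \<Omega> \<Gamma>I \<Gamma>C (\<lambda>p. f (v p)) qv \<psi>v \<longrightarrow>
                 G_functional \<Omega> f (VC n) (VI n) v q
                   \<le> 2 * (residual_norm \<Omega> \<Gamma>I \<Gamma>C f r g v)\<^sup>2
                     + C * h n powr (2 * \<beta>q) * (sobolev_norm \<Omega> (\<beta>q + 1) q)\<^sup>2
                     + (INF \<mu> \<in> VI n. (l2norm \<Omega> (grad \<Omega> (\<lambda>p. \<mu> p - \<psi>v p)))\<^sup>2)
                 \<and>
                 (\<forall>\<beta>h>0. \<psi>v \<in> sobolev \<Omega> (\<beta>h + 1) \<and>
                    (\<exists>\<mu> \<in> VI n. l2norm \<Omega> (grad \<Omega> (\<lambda>p. \<mu> p - \<psi>v p))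
                        \<le> C0 * h n powr \<beta>h * sobolev_norm \<Omega> (\<beta>h + 1) \<psi>v) \<longrightarrow>
                    G_functional \<Omega> f (VC n) (VI n) v q
                      \<le> 2 * (residual_norm \<Omega> \<Gamma>I \<Gamma>C f r g v)\<^sup>2
                        + C * h n powr (2 * \<beta>q) * (sobolev_norm \<Omega> (\<beta>q + 1) q)\<^sup>2
                        + C * h n powr (2 * \<beta>h) * (sobolev_norm \<Omega> (\<beta>h + 1) \<psi>v)\<^sup>2))
              \<and>
              G_functional \<Omega> f (VC n) (VI n) v q
                \<le> 2 * (l2norm \<Omega> (\<lambda>p. f (v p) - f (u p)))\<^sup>2
                  + C * h n powr (2 * \<beta>q) * (sobolev_norm \<Omega> (\<beta>q + 1) q)\<^sup>2
                  + C * h n powr (2 * \<beta>\<psi>) * (sobolev_norm \<Omega> (\<beta>\<psi> + 1) \<psi>)\<^sup>2))"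
proof -
  note \<Omega> = assms(1,2) and nt = assms(10)
  note VC = assms(20,21) and VI = assms(22,23)
  have hd: "q \<in> H1_0 \<Omega> \<Gamma>C" "\<psi> \<in> H1_0 \<Omega> \<Gamma>I" "AE p in lebesgue_on \<Omega>. f (u p) = grad \<Omega> q p + grad_perp \<Omega> \<psi> p"
    using assms(25) by (auto simp: helmholtz_def)
  have uL: "u \<in> Linf (lebesgue_on \<Omega>)" using assms(24) by (simp add: weak_solution_def)
  note fL = flux_L2v[OF \<Omega> assms(15)]
  have gL: "grad \<Omega> \<phi> \<in> L2v \<Omega>" "grad_perp \<Omega> \<phi> \<in> L2v \<Omega>" if "\<phi> \<in> H1_0 \<Omega> S" for \<phi> S
    using grad_L2v[OF \<Omega> H1_0_sobolev[OF that]] by auto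
  have orth: "l2ip \<Omega> (grad_perp \<Omega> \<mu>) (grad \<Omega> \<phi>) = 0" if "\<phi> \<in> H1_0 \<Omega> \<Gamma>C" "\<mu> \<in> H1_0 \<Omega> \<Gamma>I" for \<phi> \<mu>
    by (rule grad_perp_orthogonal[OF nt \<Omega> assms(4) assms(11,5) assms(12,6,8) that])
  \<comment> \<open>An empty domain has empty boundary, which contradicts the nonzero measure of
    \<open>\<Gamma>C\<close>.\<close>
  have ne: "\<Omega> \<noteq> {}"
  proof
    assume "\<Omega> = {}"
    then have "\<Gamma>C = {}" using openin_imp_subset[OF assms(6)] by simp
    then show False using nt by simp
  qed
  \<comment> \<open>The rotated gradient of \<open>\<psi>\<close> is not subtracted: test gradients
    do not see it.\<close>
  define A where "A = (\<lambda>v p. f (v p) - grad \<Omega> q p)"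
  have AL: "A v \<in> L2v \<Omega>" if "v \<in> Linf (lebesgue_on \<Omega>)" for v
    unfolding A_def by (intro L2v_diff fL that gL(1)[OF hd(1)])
  define R where "R = (\<lambda>v \<phi>. dual_div \<Omega> (\<lambda>p. f (v p)) \<phi> - data_functional \<Omega> \<Gamma>I f r g \<phi>)"
  have res: "residual_norm \<Omega> \<Gamma>I \<Gamma>C f r g v = dual_norm \<Omega> \<Gamma>C (R v)" for v
    by (simp add: residual_norm_def R_def)
  \<comment> \<open>The weak formulation for \<open>u\<close> replaces the data functional by
    \<open>- (f(u), \<nabla>\<phi>)\<close>, and orthogonality reduces this to
    \<open>- (\<nabla>q, \<nabla>\<phi>)\<close>.\<close>
  have R: "R v \<phi> = - l2ip \<Omega> (A v) (grad \<Omega> \<phi>)" if v: "v \<in> Linf (lebesgue_on \<Omega>)" and \<phi>: "\<phi> \<in> H1_0 \<Omega> \<Gamma>C" for v \<phi>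
  proof -
    have "l2ip \<Omega> (\<lambda>p. f (u p)) (grad \<Omega> \<phi>) = l2ip \<Omega> (\<lambda>p. grad \<Omega> q p + grad_perp \<Omega> \<psi> p) (grad \<Omega> \<phi>)"
      by (rule l2ip_cong_AE) (use fL[OF uL] gL(1)[OF hd(1)] gL(2)[OF hd(2)] gL(1)[OF \<phi>] hd(3) in \<open>auto intro: L2v_add\<close>)
    also have "\<dots> = l2ip \<Omega> (grad \<Omega> q) (grad \<Omega> \<phi>)"
      using orth[OF \<phi> hd(2)] gL(1)[OF hd(1)] gL(2)[OF hd(2)] gL(1)[OF \<phi>] by (simp add: l2ip_add_left)
    moreover have "- l2ip \<Omega> (\<lambda>p. f (u p)) (grad \<Omega> \<phi>) = data_functional \<Omega> \<Gamma>I f r g \<phi>"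
      using assms(24) \<phi> by (simp add: weak_solution_def)
    ultimately show ?thesis unfolding R_def dual_div_def A_def
      using fL[OF v] gL(1)[OF hd(1)] gL(1)[OF \<phi>] by (simp add: l2ip_diff_left)
  qed
  have Rb: "\<bar>R v \<phi>\<bar> \<le> l2norm \<Omega> (A v) * l2norm \<Omega> (grad \<Omega> \<phi>)" if "v \<in> Linf (lebesgue_on \<Omega>)" "\<phi> \<in> H1_0 \<Omega> \<Gamma>C" for v \<phi>
    using R[OF that] l2ip_Cauchy_Schwarz[OF AL[OF that(1)] gL(1)[OF that(2)]] by simp
  have res_nonneg: "0 \<le> residual_norm \<Omega> \<Gamma>I \<Gamma>C f r g v" if "v \<in> Linf (lebesgue_on \<Omega>)" for v
    unfolding res by (rule dual_norm_bounds(1)[OF \<Omega> ne _ Rb[OF that]]) auto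
  have lower: "1 / 2 * (residual_norm \<Omega> \<Gamma>I \<Gamma>C f r g v)\<^sup>2 \<le> F_functional \<Omega> f v p \<mu> q"
    if v: "v \<in> Linf (lebesgue_on \<Omega>)" and p: "p \<in> H1_0 \<Omega> \<Gamma>C" and \<mu>: "\<mu> \<in> H1_0 \<Omega> \<Gamma>I" for v p \<mu>
  proof -
    \<comment> \<open>\<open>X\<close> and \<open>Y\<close> are the fields in the two terms of the
      functional. \<open>A v\<close> is \<open>X + Y\<close> plus the rotated gradient of
      \<open>\<mu>\<close>, which is orthogonal to test gradients.\<close>
    define X where "X = (\<lambda>y. f (v y) - grad \<Omega> p y - grad_perp \<Omega> \<mu> y)"
    define Y where "Y = (\<lambda>y. grad \<Omega> p y - grad \<Omega> q y)"
    have XY: "X \<in> L2v \<Omega>" "Y \<in> L2v \<Omega>"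
      unfolding X_def Y_def by (intro L2v_diff fL v gL(1)[OF p] gL(2)[OF \<mu>] gL(1)[OF hd(1)])+
    have "\<bar>R v \<phi>\<bar> \<le> (l2norm \<Omega> X + l2norm \<Omega> Y) * l2norm \<Omega> (grad \<Omega> \<phi>)" if \<phi>: "\<phi> \<in> H1_0 \<Omega> \<Gamma>C" for \<phi>
    proof -
      have eq: "A v = (\<lambda>y. (X y + Y y) + grad_perp \<Omega> \<mu> y)" by (simp add: A_def X_def Y_def)
      have "R v \<phi> = - (l2ip \<Omega> X (grad \<Omega> \<phi>) + l2ip \<Omega> Y (grad \<Omega> \<phi>))"
        unfolding R[OF v \<phi>] eq using XY gL(1)[OF \<phi>] gL(2)[OF \<mu>] orth[OF \<phi> \<mu>]
        by (simp add: l2ip_add_left L2v_add)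
      then show ?thesis
        using l2ip_Cauchy_Schwarz[OF XY(1) gL(1)[OF \<phi>]] l2ip_Cauchy_Schwarz[OF XY(2) gL(1)[OF \<phi>]]
        by (simp add: distrib_right)
    qed
    then have "dual_norm \<Omega> \<Gamma>C (R v) \<le> l2norm \<Omega> X + l2norm \<Omega> Y"
      by (intro dual_norm_bounds(2)[OF \<Omega> ne]) auto
    then have "(residual_norm \<Omega> \<Gamma>I \<Gamma>C f r g v)\<^sup>2 \<le> (l2norm \<Omega> X + l2norm \<Omega> Y)\<^sup>2"
      using res_nonneg[OF v] unfolding res by (intro power_mono)
    also have "\<dots> \<le> 2 * ((l2norm \<Omega> X)\<^sup>2 + (l2norm \<Omega> Y)\<^sup>2)"
      using zero_le_power2[of "l2norm \<Omega> X - l2norm \<Omega> Y"] by (simp add: power2_sum power2_diff)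
    finally show ?thesis by (simp add: F_functional_def X_def Y_def)
  qed
  have Ui: "v \<in> Linf (lebesgue_on \<Omega>)" if "v \<in> U n" for v n using assms(19) that by blast
  have part1: "1 / 2 * (residual_norm \<Omega> \<Gamma>I \<Gamma>C f r g v)\<^sup>2 \<le> G_functional \<Omega> f (VC n) (VI n) v q" if "v \<in> U n" for n v
    by (rule le_G_functional[OF fin_dim_space_nonempty[OF VC(1)] fin_dim_space_nonempty[OF VI(1)]])
       (use lower[OF Ui[OF that]] VC(2) VI(2) in blast)
  have orth_diff: "l2ip \<Omega> (\<lambda>y. grad \<Omega> a y - grad \<Omega> b y) (\<lambda>y. grad_perp \<Omega> c y - grad_perp \<Omega> d y) = 0"
    if "a \<in> H1_0 \<Omega> \<Gamma>C" "b \<in> H1_0 \<Omega> \<Gamma>C" "c \<in> H1_0 \<Omega> \<Gamma>I" "d \<in> H1_0 \<Omega> \<Gamma>I" for a b c d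
    using orth[OF that(1,3)] orth[OF that(1,4)] orth[OF that(2,3)] orth[OF that(2,4)]
      gL[OF that(1)] gL[OF that(2)] gL[OF that(3)] gL[OF that(4)]
    unfolding l2ip_commute[of \<Omega> "grad_perp \<Omega> c"] l2ip_commute[of \<Omega> "grad_perp \<Omega> d"]
    by (simp add: l2ip_diff_left l2ip_diff_right L2v_diff)
  have upper: "F_functional \<Omega> f v p \<mu> q \<le> 2 * (residual_norm \<Omega> \<Gamma>I \<Gamma>C f r g v)\<^sup>2
      + 3 * (l2norm \<Omega> (grad \<Omega> (\<lambda>y. p y - q y)))\<^sup>2 + (l2norm \<Omega> (grad \<Omega> (\<lambda>y. \<mu> y - \<psi>v y)))\<^sup>2"
    if v: "v \<in> Linf (lebesgue_on \<Omega>)" and h: "helmholtz \<Omega> \<Gamma>I \<Gamma>C (\<lambda>p. f (v p)) qv \<psi>v"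
      and p: "p \<in> H1_0 \<Omega> \<Gamma>C" and \<mu>: "\<mu> \<in> H1_0 \<Omega> \<Gamma>I" for v qv \<psi>v p \<mu>
  proof -
    have hv: "qv \<in> H1_0 \<Omega> \<Gamma>C" "\<psi>v \<in> H1_0 \<Omega> \<Gamma>I" "AE p in lebesgue_on \<Omega>. f (v p) = grad \<Omega> qv p + grad_perp \<Omega> \<psi>v p"
      using h by (auto simp: helmholtz_def)
    \<comment> \<open>The first field of the functional is \<open>D + P + M\<close>, where
      \<open>M\<close> is orthogonal to \<open>D + P\<close>. So only \<open>D + P\<close> has to be
      split with a factor 2, and \<open>M\<close> keeps the factor 1; \<open>P\<close> occurs once
      more in the second term, which makes 3.\<close>
    define D where "D = (\<lambda>y. grad \<Omega> qv y - grad \<Omega> q y)"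
    define P where "P = (\<lambda>y. grad \<Omega> q y - grad \<Omega> p y)"
    define M where "M = (\<lambda>y. grad_perp \<Omega> \<psi>v y - grad_perp \<Omega> \<mu> y)"
    have L: "D \<in> L2v \<Omega>" "P \<in> L2v \<Omega>" "M \<in> L2v \<Omega>"
      unfolding D_def P_def M_def by (intro L2v_diff gL(1)[OF hv(1)] gL(1)[OF hd(1)] gL(1)[OF p] gL(2)[OF hv(2)] gL(2)[OF \<mu>])+
    have Dres: "l2norm \<Omega> D \<le> residual_norm \<Omega> \<Gamma>I \<Gamma>C f r g v"
    proof -
      \<comment> \<open>This test function has gradient \<open>D\<close>, the gradient part of
        \<open>A v\<close>, so evaluating the residual at it shows that the dual norm is at least
        the norm of \<open>D\<close>.\<close>
      define \<phi> where "\<phi> = (\<lambda>y. qv y - q y)"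
      have \<phi>: "\<phi> \<in> H1_0 \<Omega> \<Gamma>C" using H1_0_lincomb[OF \<Omega> hv(1) hd(1), of "-1"] by (simp add: \<phi>_def)
      have gae: "AE y in lebesgue_on \<Omega>. grad \<Omega> \<phi> y = D y" and gn: "l2norm \<Omega> (grad \<Omega> \<phi>) = l2norm \<Omega> D"
        unfolding \<phi>_def D_def using l2norm_grad_diff[OF \<Omega> H1_0_sobolev[OF hv(1)] H1_0_sobolev[OF hd(1)]] by auto
      have "l2ip \<Omega> (A v) (grad \<Omega> \<phi>) = l2ip \<Omega> (\<lambda>y. D y + grad_perp \<Omega> \<psi>v y) (grad \<Omega> \<phi>)"
      proof (rule l2ip_cong_AE)
        show "AE y in lebesgue_on \<Omega>. A v y = D y + grad_perp \<Omega> \<psi>v y"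
          using hv(3) by eventually_elim (simp add: A_def D_def)
      qed (use AL[OF v] L gL(2)[OF hv(2)] gL(1)[OF \<phi>] in \<open>auto intro: L2v_add\<close>)
      also have "\<dots> = l2ip \<Omega> D (grad \<Omega> \<phi>)"
        using L gL(2)[OF hv(2)] gL(1)[OF \<phi>] orth[OF \<phi> hv(2)] by (simp add: l2ip_add_left)
      also have "\<dots> = l2ip \<Omega> D D"
        by (rule l2ip_cong_AE) (use L gL(1)[OF \<phi>] gae in auto)
      finally have "\<bar>R v \<phi>\<bar> = (l2norm \<Omega> D)\<^sup>2" unfolding R[OF v \<phi>] by (simp add: l2norm_sq[symmetric])
      moreover have "\<bar>R v \<phi>\<bar> \<le> residual_norm \<Omega> \<Gamma>I \<Gamma>C f r g v * l2norm \<Omega> (grad \<Omega> \<phi>)"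
        unfolding res by (rule dual_norm_bounds(3)[OF \<Omega> ne _ Rb[OF v] \<phi>]) auto
      ultimately have "l2norm \<Omega> D * l2norm \<Omega> D \<le> residual_norm \<Omega> \<Gamma>I \<Gamma>C f r g v * l2norm \<Omega> D"
        by (simp add: gn power2_eq_square)
      then show ?thesis
        using res_nonneg[OF v] l2norm_nonneg[of \<Omega> D] mult_right_le_imp_le[of "l2norm \<Omega> D" "l2norm \<Omega> D"]
        by (cases "l2norm \<Omega> D = 0") auto
    qed
    have "l2norm \<Omega> (\<lambda>y. f (v y) - grad \<Omega> p y - grad_perp \<Omega> \<mu> y) = l2norm \<Omega> (\<lambda>y. (D y + P y) + M y)"
    proof (rule l2norm_cong_AE)
      show "AE y in lebesgue_on \<Omega>. f (v y) - grad \<Omega> p y - grad_perp \<Omega> \<mu> y = (D y + P y) + M y"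
        using hv(3) by eventually_elim (simp add: D_def P_def M_def)
      show "(\<lambda>y. f (v y) - grad \<Omega> p y - grad_perp \<Omega> \<mu> y) \<in> L2v \<Omega>"
        by (intro L2v_diff fL v gL(1)[OF p] gL(2)[OF \<mu>])
    qed (intro L2v_add L)
    moreover have "l2ip \<Omega> (\<lambda>y. D y + P y) M = 0"
      using orth_diff[OF hv(1) p hv(2) \<mu>] by (simp add: D_def P_def M_def)
    ultimately have "(l2norm \<Omega> (\<lambda>y. f (v y) - grad \<Omega> p y - grad_perp \<Omega> \<mu> y))\<^sup>2 = (l2norm \<Omega> (\<lambda>y. D y + P y))\<^sup>2 + (l2norm \<Omega> M)\<^sup>2"
      using l2norm_add_sq[OF L2v_add[OF L(1,2)] L(3)] by simp
    moreover have "(l2norm \<Omega> (\<lambda>y. D y + P y))\<^sup>2 \<le> 2 * (l2norm \<Omega> D)\<^sup>2 + 2 * (l2norm \<Omega> P)\<^sup>2"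
      by (rule l2norm_add_sq_le[OF L(1,2)])
    moreover have "(l2norm \<Omega> D)\<^sup>2 \<le> (residual_norm \<Omega> \<Gamma>I \<Gamma>C f r g v)\<^sup>2" using Dres by (intro power_mono) auto
    moreover have "l2norm \<Omega> (\<lambda>y. grad \<Omega> p y - grad \<Omega> q y) = l2norm \<Omega> P" unfolding P_def by (rule l2norm_minus_commute)
    moreover have "l2norm \<Omega> (grad \<Omega> (\<lambda>y. p y - q y)) = l2norm \<Omega> P"
      unfolding l2norm_grad_diff(2)[OF \<Omega> H1_0_sobolev[OF p] H1_0_sobolev[OF hd(1)]] P_def by (rule l2norm_minus_commute)
    moreover have "l2norm \<Omega> (grad \<Omega> (\<lambda>y. \<mu> y - \<psi>v y)) = l2norm \<Omega> M"
      unfolding l2norm_grad_diff(2)[OF \<Omega> H1_0_sobolev[OF \<mu>] H1_0_sobolev[OF hv(2)]] M_def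
        l2norm_grad_diff(3)[OF \<Omega> H1_0_sobolev[OF hv(2)] H1_0_sobolev[OF \<mu>]] by (rule l2norm_minus_commute)
    ultimately show ?thesis unfolding F_functional_def by simp
  qed
  have upper2: "F_functional \<Omega> f v p \<mu> q \<le> 2 * (l2norm \<Omega> (\<lambda>p. f (v p) - f (u p)))\<^sup>2
      + 3 * (l2norm \<Omega> (grad \<Omega> (\<lambda>y. p y - q y)))\<^sup>2 + 2 * (l2norm \<Omega> (grad \<Omega> (\<lambda>y. \<mu> y - \<psi> y)))\<^sup>2"
    if v: "v \<in> Linf (lebesgue_on \<Omega>)" and p: "p \<in> H1_0 \<Omega> \<Gamma>C" and \<mu>: "\<mu> \<in> H1_0 \<Omega> \<Gamma>I" for v p \<mu>
  proof -
    \<comment> \<open>Now \<open>D\<close> is the full flux difference and need not be orthogonal to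
      \<open>M\<close>, so it is split off first with a factor 2. \<open>P\<close> and
      \<open>M\<close> are orthogonal to each other, which gives the factors 2 + 1 for
      \<open>P\<close> and 2 for \<open>M\<close>.\<close>
    define D where "D = (\<lambda>y. f (v y) - f (u y))"
    define P where "P = (\<lambda>y. grad \<Omega> q y - grad \<Omega> p y)"
    define M where "M = (\<lambda>y. grad_perp \<Omega> \<psi> y - grad_perp \<Omega> \<mu> y)"
    have L: "D \<in> L2v \<Omega>" "P \<in> L2v \<Omega>" "M \<in> L2v \<Omega>"
      unfolding D_def P_def M_def by (intro L2v_diff fL v uL gL(1)[OF hd(1)] gL(1)[OF p] gL(2)[OF hd(2)] gL(2)[OF \<mu>])+
    have "l2norm \<Omega> (\<lambda>y. f (v y) - grad \<Omega> p y - grad_perp \<Omega> \<mu> y) = l2norm \<Omega> (\<lambda>y. D y + (P y + M y))"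
    proof (rule l2norm_cong_AE)
      show "AE y in lebesgue_on \<Omega>. f (v y) - grad \<Omega> p y - grad_perp \<Omega> \<mu> y = D y + (P y + M y)"
        using hd(3) by eventually_elim (simp add: D_def P_def M_def)
      show "(\<lambda>y. f (v y) - grad \<Omega> p y - grad_perp \<Omega> \<mu> y) \<in> L2v \<Omega>"
        by (intro L2v_diff fL v gL(1)[OF p] gL(2)[OF \<mu>])
    qed (intro L2v_add L)
    moreover have "(l2norm \<Omega> (\<lambda>y. D y + (P y + M y)))\<^sup>2 \<le> 2 * (l2norm \<Omega> D)\<^sup>2 + 2 * (l2norm \<Omega> (\<lambda>y. P y + M y))\<^sup>2"
      by (rule l2norm_add_sq_le[OF L(1) L2v_add[OF L(2,3)]])
    moreover have "(l2norm \<Omega> (\<lambda>y. P y + M y))\<^sup>2 = (l2norm \<Omega> P)\<^sup>2 + (l2norm \<Omega> M)\<^sup>2"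
      using l2norm_add_sq[OF L(2,3)] orth_diff[OF hd(1) p hd(2) \<mu>] by (simp add: P_def M_def)
    moreover have "l2norm \<Omega> (\<lambda>y. grad \<Omega> p y - grad \<Omega> q y) = l2norm \<Omega> P" unfolding P_def by (rule l2norm_minus_commute)
    moreover have "l2norm \<Omega> (grad \<Omega> (\<lambda>y. p y - q y)) = l2norm \<Omega> P"
      unfolding l2norm_grad_diff(2)[OF \<Omega> H1_0_sobolev[OF p] H1_0_sobolev[OF hd(1)]] P_def by (rule l2norm_minus_commute)
    moreover have "l2norm \<Omega> (grad \<Omega> (\<lambda>y. \<mu> y - \<psi> y)) = l2norm \<Omega> M"
      unfolding l2norm_grad_diff(2)[OF \<Omega> H1_0_sobolev[OF \<mu>] H1_0_sobolev[OF hd(2)]] M_def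
        l2norm_grad_diff(3)[OF \<Omega> H1_0_sobolev[OF hd(2)] H1_0_sobolev[OF \<mu>]] by (rule l2norm_minus_commute)
    ultimately show ?thesis unfolding F_functional_def D_def[symmetric] by simp
  qed
  show ?thesis
  proof (intro conjI allI ballI impI)
    fix n v assume "v \<in> U n"
    then show "1 / 2 * (residual_norm \<Omega> \<Gamma>I \<Gamma>C f r g v)\<^sup>2 \<le> G_functional \<Omega> f (VC n) (VI n) v q" by (rule part1)
  next
    fix C0 \<beta>q \<beta>\<psi> :: real
    assume H: "C0 > 0 \<and> \<beta>q > 0 \<and> \<beta>\<psi> > 0 \<and> q \<in> sobolev \<Omega> (\<beta>q + 1) \<and> \<psi> \<in> sobolev \<Omega> (\<beta>\<psi> + 1) \<and>
          (\<forall>n. (\<exists>qh \<in> VC n. l2norm \<Omega> (grad \<Omega> (\<lambda>p. qh p - q p))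
                    \<le> C0 * h n powr \<beta>q * sobolev_norm \<Omega> (\<beta>q + 1) q) \<and>
               (\<exists>\<psi>h \<in> VI n. l2norm \<Omega> (grad \<Omega> (\<lambda>p. \<psi>h p - \<psi> p))
                    \<le> C0 * h n powr \<beta>\<psi> * sobolev_norm \<Omega> (\<beta>\<psi> + 1) \<psi>))"
    \<comment> \<open>3 is the largest factor in front of an approximation error in
      \<open>upper\<close> and \<open>upper2\<close>, attained by the error of
      \<open>q\<close>.\<close>
    define C where "C = 3 * C0\<^sup>2"
    define E where "E = (\<lambda>n \<beta> w. h n powr (2 * \<beta>) * (sobolev_norm \<Omega> (\<beta> + 1) w)\<^sup>2)"
    have C: "C > 0" using H by (simp add: C_def)
    have E0: "0 \<le> E n \<beta> w" for n \<beta> w by (simp add: E_def)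
    have goalE: "C * h n powr (2 * \<beta>) * (sobolev_norm \<Omega> (\<beta> + 1) w)\<^sup>2 = C * E n \<beta> w" for n \<beta> w by (simp add: E_def)
    have err: "(l2norm \<Omega> z)\<^sup>2 \<le> C0\<^sup>2 * E n \<beta> w" if "l2norm \<Omega> z \<le> C0 * h n powr \<beta> * sobolev_norm \<Omega> (\<beta> + 1) w"
      for z :: "pt \<Rightarrow> pt" and n \<beta> w
      unfolding E_def by (rule approximation_error_sq[OF l2norm_nonneg that])
    show "\<exists>C>0. \<forall>n. \<forall>v \<in> U n.
              (\<forall>qv \<psi>v. helmholtz \<Omega> \<Gamma>I \<Gamma>C (\<lambda>p. f (v p)) qv \<psi>v \<longrightarrow>
                 G_functional \<Omega> f (VC n) (VI n) v q
                   \<le> 2 * (residual_norm \<Omega> \<Gamma>I \<Gamma>C f r g v)\<^sup>2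
                     + C * h n powr (2 * \<beta>q) * (sobolev_norm \<Omega> (\<beta>q + 1) q)\<^sup>2
                     + (INF \<mu> \<in> VI n. (l2norm \<Omega> (grad \<Omega> (\<lambda>p. \<mu> p - \<psi>v p)))\<^sup>2)
                 \<and>
                 (\<forall>\<beta>h>0. \<psi>v \<in> sobolev \<Omega> (\<beta>h + 1) \<and>
                    (\<exists>\<mu> \<in> VI n. l2norm \<Omega> (grad \<Omega> (\<lambda>p. \<mu> p - \<psi>v p))
                        \<le> C0 * h n powr \<beta>h * sobolev_norm \<Omega> (\<beta>h + 1) \<psi>v) \<longrightarrow>
                    G_functional \<Omega> f (VC n) (VI n) v q
                      \<le> 2 * (residual_norm \<Omega> \<Gamma>I \<Gamma>C f r g v)\<^sup>2
                        + C * h n powr (2 * \<beta>q) * (sobolev_norm \<Omega> (\<beta>q + 1) q)\<^sup>2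
                        + C * h n powr (2 * \<beta>h) * (sobolev_norm \<Omega> (\<beta>h + 1) \<psi>v)\<^sup>2))
              \<and>
              G_functional \<Omega> f (VC n) (VI n) v q
                \<le> 2 * (l2norm \<Omega> (\<lambda>p. f (v p) - f (u p)))\<^sup>2
                  + C * h n powr (2 * \<beta>q) * (sobolev_norm \<Omega> (\<beta>q + 1) q)\<^sup>2
                  + C * h n powr (2 * \<beta>\<psi>) * (sobolev_norm \<Omega> (\<beta>\<psi> + 1) \<psi>)\<^sup>2"
    proof (rule exI[of _ C], intro conjI C allI ballI impI; (elim conjE)?)
      fix n v qv \<psi>v assume v: "v \<in> U n" and h: "helmholtz \<Omega> \<Gamma>I \<Gamma>C (\<lambda>p. f (v p)) qv \<psi>v"
      obtain qh where qh: "qh \<in> VC n" "l2norm \<Omega> (grad \<Omega> (\<lambda>p. qh p - q p)) \<le> C0 * h n powr \<beta>q * sobolev_norm \<Omega> (\<beta>q + 1) q"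
        using H by blast
      have G: "G_functional \<Omega> f (VC n) (VI n) v q \<le> 2 * (residual_norm \<Omega> \<Gamma>I \<Gamma>C f r g v)\<^sup>2 + C * E n \<beta>q q
          + (l2norm \<Omega> (grad \<Omega> (\<lambda>p. \<mu> p - \<psi>v p)))\<^sup>2" if \<mu>: "\<mu> \<in> VI n" for \<mu>
      proof -
        have "qh \<in> H1_0 \<Omega> \<Gamma>C" "\<mu> \<in> H1_0 \<Omega> \<Gamma>I" using qh(1) \<mu> VC(2) VI(2) by blast+
        from upper[OF Ui[OF v] h this] G_functional_le[OF qh(1) \<mu>, of \<Omega> f v q] err[OF qh(2)]
        show ?thesis unfolding C_def by linarith
      qed
      \<comment> \<open>The terms without \<open>\<mu>\<close> are moved to the left so that the
        bound, valid for every \<open>\<mu>\<close>, passes to the infimum.\<close>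
      have "G_functional \<Omega> f (VC n) (VI n) v q - 2 * (residual_norm \<Omega> \<Gamma>I \<Gamma>C f r g v)\<^sup>2 - C * E n \<beta>q q
         \<le> (INF \<mu> \<in> VI n. (l2norm \<Omega> (grad \<Omega> (\<lambda>p. \<mu> p - \<psi>v p)))\<^sup>2)"
        by (rule cINF_greatest[OF fin_dim_space_nonempty[OF VI(1)]]) (use G in force)
      then show "G_functional \<Omega> f (VC n) (VI n) v q \<le> 2 * (residual_norm \<Omega> \<Gamma>I \<Gamma>C f r g v)\<^sup>2
                     + C * h n powr (2 * \<beta>q) * (sobolev_norm \<Omega> (\<beta>q + 1) q)\<^sup>2
                     + (INF \<mu> \<in> VI n. (l2norm \<Omega> (grad \<Omega> (\<lambda>p. \<mu> p - \<psi>v p)))\<^sup>2)"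
        unfolding goalE by linarith
      fix \<beta>h :: real
      assume "\<exists>\<mu> \<in> VI n. l2norm \<Omega> (grad \<Omega> (\<lambda>p. \<mu> p - \<psi>v p)) \<le> C0 * h n powr \<beta>h * sobolev_norm \<Omega> (\<beta>h + 1) \<psi>v"
      then obtain \<mu> where \<mu>: "\<mu> \<in> VI n" "l2norm \<Omega> (grad \<Omega> (\<lambda>p. \<mu> p - \<psi>v p)) \<le> C0 * h n powr \<beta>h * sobolev_norm \<Omega> (\<beta>h + 1) \<psi>v"
        by blast
      have "C0\<^sup>2 * E n \<beta>h \<psi>v \<le> C * E n \<beta>h \<psi>v" using E0 by (intro mult_right_mono) (simp_all add: C_def)
      then show "G_functional \<Omega> f (VC n) (VI n) v q \<le> 2 * (residual_norm \<Omega> \<Gamma>I \<Gamma>C f r g v)\<^sup>2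
                        + C * h n powr (2 * \<beta>q) * (sobolev_norm \<Omega> (\<beta>q + 1) q)\<^sup>2
                        + C * h n powr (2 * \<beta>h) * (sobolev_norm \<Omega> (\<beta>h + 1) \<psi>v)\<^sup>2"
        unfolding goalE using G[OF \<mu>(1)] err[OF \<mu>(2)] by linarith
    next
      fix n v assume v: "v \<in> U n"
      obtain qh where qh: "qh \<in> VC n" "l2norm \<Omega> (grad \<Omega> (\<lambda>p. qh p - q p)) \<le> C0 * h n powr \<beta>q * sobolev_norm \<Omega> (\<beta>q + 1) q"
        using H by blast
      obtain \<psi>h where ph: "\<psi>h \<in> VI n" "l2norm \<Omega> (grad \<Omega> (\<lambda>p. \<psi>h p - \<psi> p)) \<le> C0 * h n powr \<beta>\<psi> * sobolev_norm \<Omega> (\<beta>\<psi> + 1) \<psi>"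
        using H by blast
      have m: "qh \<in> H1_0 \<Omega> \<Gamma>C" "\<psi>h \<in> H1_0 \<Omega> \<Gamma>I" using qh(1) ph(1) VC(2) VI(2) by blast+
      have "2 * (C0\<^sup>2 * E n \<beta>\<psi> \<psi>) \<le> C * E n \<beta>\<psi> \<psi>" using E0[of n \<beta>\<psi> \<psi>] by (simp add: C_def mult_right_mono)
      then show "G_functional \<Omega> f (VC n) (VI n) v q \<le> 2 * (l2norm \<Omega> (\<lambda>p. f (v p) - f (u p)))\<^sup>2
                  + C * h n powr (2 * \<beta>q) * (sobolev_norm \<Omega> (\<beta>q + 1) q)\<^sup>2
                  + C * h n powr (2 * \<beta>\<psi>) * (sobolev_norm \<Omega> (\<beta>\<psi> + 1) \<psi>)\<^sup>2"
        using upper2[OF Ui[OF v] m] G_functional_le[OF qh(1) ph(1), of \<Omega> f v q] err[OF qh(2)] err[OF ph(2)]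
        unfolding goalE unfolding C_def by linarith
    qed
  qed
qed

end
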